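(* Let $\mathbf{X}$ be a locally small restriction category and let $\mathcal{E}$ be a locally small, cocomplete restriction category. Put $\mathbf{C}=\mathcal{M}\mathsf{Total}(\mathsf{K}_r(\mathbf{X}))$ and let $$\Lambda\colon \mathbf{X} \xrightarrow{J} \mathsf{K}_r(\mathbf{X}) \xrightarrow{\Phi} \mathsf{Par}(\mathbf{C}) \xrightarrow{\mathsf{Par}(\mathbf{y})} \mathsf{Par}(\mathcal{P}_{\mathcal{M}}(\mathbf{C}))$$ be the Cockett--Lack embedding. Then precomposition with $\Lambda$, $$(-)\circ\Lambda\colon\mathbf{rCocomp}\big(\mathsf{Par}(\mathcal{P}_{\mathcal{M}}(\mathcal{M}\mathsf{Total}(\mathsf{K}_r(\mathbf{X})))),\mathcal{E}\big)\to\mathbf{rCAT}(\mathbf{X},\mathcal{E}),$$ is an equivalence of categories.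
   Context: A restriction category is a category $\mathbf{X}$ with an assignment $f\mapsto\bar f$, $\mathbf{X}(A,B)\to\mathbf{X}(A,A)$, such that (R1) $f\bar f=f$; (R2) $\bar g\bar f=\bar f\bar g$ for $f\colon A\to B$, $g\colon A\to C$; (R3) $\overline{g\bar f}=\bar g\bar f$ for $f\colon A\to B$, $g\colon A\to C$; (R4) $\bar h f=f\,\overline{hf}$ for $f\colon A\to B$, $h\colon B\to C$. It is locally small if its underlying category is. A map $f$ is a restriction idempotent if $f=\bar f$, and total if $\bar f=1$; objects and total maps form a subcategory $\mathsf{Total}(\mathbf{X})$. A restriction functor is a functor $F$ with $F(\bar f)=\overline{F(f)}$; a restriction transformation is a natural transformation with total components. $\mathbf{rCAT}$ is the 2-category of locally small restriction categories, restriction functors and restriction transformations. A restriction category is split if every restriction idempotent $e$ splits ($e=mr$ with $rm=1$); such maps $m$ are called restriction monics. $\mathsf{K}_r(\mathbf{X})$ is the split restriction category with objects pairs $(A,e)$, $e$ a restriction idempotent on $A$; morphisms $(A,e)\to(A',e')$ are maps $f\colon A\to A'$ in $\mathbf{X}$ with $e'fe=f$; the restriction of $f$ is $\bar f$. $J\colon\mathbf{X}\to\mathsf{K}_r(\mathbf{X})$ sends $A$ to $(A,1_A)$ and $f$ to $f$. A stable system of monics $\mathcal{M}_{\mathbf{C}}$ in a category $\mathbf{C}$ is a collection of monics containing all isomorphisms, closed under composition, and such that the pullback of any $m\in\mathcal{M}_{\mathbf{C}}$ along any map exists and lies in $\mathcal{M}_{\mathbf{C}}$. An $\mathcal{M}$-category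 is a category with a stable system of monics. An $\mathcal{M}$-functor is a functor preserving the chosen monics and pullbacks of chosen monics. For a split restriction category $\mathbf{Y}$, $\mathcal{M}\mathsf{Total}(\mathbf{Y})$ is the $\mathcal{M}$-category $\mathsf{Total}(\mathbf{Y})$ whose chosen monics are the restriction monics of $\mathbf{Y}$. For an $\mathcal{M}$-category $\mathbf{C}$, $\mathsf{Par}(\mathbf{C})$ is the split restriction category with the objects of $\mathbf{C}$, whose morphisms $X\to Y$ are isomorphism classes $(m,f)$ of spans $X\xleftarrow{m}Z\xrightarrow{f}Y$ with $m\in\mathcal{M}_{\mathbf{C}}$; composition is by pullback, identities are $(1,1)$, and $\overline{(m,f)}=(m,m)$. For an $\mathcal{M}$-functor $F$, $\mathsf{Par}(F)$ sends $A\mapsto FA$ and $(m,f)\mapsto(Fm,Ff)$. For a split restriction category $\mathbf{Y}$, $\Phi\colon\mathbf{Y}\to\mathsf{Par}(\mathcal{M}\mathsf{Total}(\mathbf{Y}))$ is the isomorphism with $\Phi(A)=A$ and $\Phi(f)=(m,fm)$, where $\bar f=mr$, $rm=1$; above, $\Phi$ is taken for $\mathbf{Y}=\mathsf{K}_r(\mathbf{X})$. A presheaf on $\mathbf{C}$ is small if it is a small colimit of representables; $\mathcal{P}(\mathbf{C})$ is the category of small presheaves. $\mathcal{P}_{\mathcal{M}}(\mathbf{C})$ is the $\mathcal{M}$-category $\mathcal{P}(\mathbf{C})$ in which $\mu\colon P\Rightarrow Q$ is a chosen monic iff for every $\gamma\colon\mathbf{y}D\Rightarrow Q$ there is $m\colon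 C\to D$ in $\mathcal{M}_{\mathbf{C}}$ such that $\mathbf{y}m$ is a pullback of $\mu$ along $\gamma$; the Yoneda embedding is an $\mathcal{M}$-functor $\mathbf{y}\colon\mathbf{C}\to\mathcal{P}_{\mathcal{M}}(\mathbf{C})$. A restriction category $\mathbf{Y}$ is cocomplete if it is split, $\mathsf{Total}(\mathbf{Y})$ has all small colimits, and the inclusion $\mathsf{Total}(\mathbf{Y})\hookrightarrow\mathbf{Y}$ preserves small colimits. A restriction functor $F\colon\mathbf{Y}\to\mathbf{Z}$ is cocontinuous if the induced functor $\mathsf{Total}(\mathbf{Y})\to\mathsf{Total}(\mathbf{Z})$ preserves small colimits. $\mathbf{rCocomp}$ is the 2-category of cocomplete restriction categories, cocontinuous restriction functors and restriction transformations. The restriction category $\mathsf{Par}(\mathcal{P}_{\mathcal{M}}(\mathbf{C}))$ above is cocomplete. *)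

theory Defs
  imports "HOL-Library.FuncSet" "HOL-Library.Equipollence"
begin

section \<open>Smallness\<close>

text \<open>
  Size is measured by a type \<open>'u\<close>, passed around as a term of type \<open>'u itself\<close>: a set (over
  any type) is small if its cardinality is strictly less than that of \<open>'u\<close>. The closure conditions
  say that the cardinality of \<open>'u\<close> is an infinite regular strong limit, so that the small subsets
  of \<open>'u\<close> model the sets of a Grothendieck universe, up to bijection (for countable \<open>'u\<close>:
  the finite sets). Large collections are sets over arbitrary types.
\<close>

definition small :: "'u itself \<Rightarrow> 'x set \<Rightarrow> bool" where
  "small U A \<longleftrightarrow> A \<prec> (UNIV :: 'u set)"

definition universe :: "'u itself \<Rightarrow> bool" where
  "universe U \<longleftrightarrow>
     infinite (UNIV :: 'u set) \<and>
     (\<forall>A :: 'u set. small U A \<longrightarrow> small U (Pow A)) \<and>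
     (\<forall>(I :: 'u set) (A :: 'u \<Rightarrow> 'u set).
        small U I \<longrightarrow> (\<forall>i\<in>I. small U (A i)) \<longrightarrow> small U (\<Union>i\<in>I. A i))"


section \<open>Categories, functors, natural transformations\<close>

text \<open>
  Categories are given by families of hom-sets, which need not be disjoint; operations on arrows
  therefore take the objects involved as arguments. \<open>Comp C A B D g f\<close> is the composite
  \<open>g f\<close> of \<open>f : A \<rightarrow> B\<close> and \<open>g : B \<rightarrow> D\<close>.
\<close>

record ('o, 'a) cat =
  Ob :: "'o set"
  Hom :: "'o \<Rightarrow> 'o \<Rightarrow> 'a set"
  Comp :: "'o \<Rightarrow> 'o \<Rightarrow> 'o \<Rightarrow> 'a \<Rightarrow> 'a \<Rightarrow> 'a"
  Idt :: "'o \<Rightarrow> 'a"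

locale category =
  fixes C :: "('o, 'a, 'z) cat_scheme"
  assumes Idt_in: "A \<in> Ob C \<Longrightarrow> Idt C A \<in> Hom C A A"
    and Comp_in: "\<lbrakk>A \<in> Ob C; B \<in> Ob C; D \<in> Ob C; f \<in> Hom C A B; g \<in> Hom C B D\<rbrakk>
        \<Longrightarrow> Comp C A B D g f \<in> Hom C A D"
    and Idt_left: "\<lbrakk>A \<in> Ob C; B \<in> Ob C; f \<in> Hom C A B\<rbrakk> \<Longrightarrow> Comp C A B B (Idt C B) f = f"
    and Idt_right: "\<lbrakk>A \<in> Ob C; B \<in> Ob C; f \<in> Hom C A B\<rbrakk> \<Longrightarrow> Comp C A A B f (Idt C A) = f"
    and Comp_assoc: "\<lbrakk>A \<in> Ob C; B \<in> Ob C; D \<in> Ob C; E \<in> Ob C;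
          f \<in> Hom C A B; g \<in> Hom C B D; h \<in> Hom C D E\<rbrakk>
        \<Longrightarrow> Comp C A D E h (Comp C A B D g f) = Comp C A B E (Comp C B D E h g) f"

definition locally_small :: "'u itself \<Rightarrow> ('o, 'a, 'z) cat_scheme \<Rightarrow> bool" where
  "locally_small U C \<longleftrightarrow> (\<forall>A\<in>Ob C. \<forall>B\<in>Ob C. small U (Hom C A B))"

text \<open>Every small category is isomorphic to one whose objects and arrows are elements of \<open>'u\<close>.\<close>

definition small_category :: "'u itself \<Rightarrow> ('u, 'u) cat \<Rightarrow> bool" where
  "small_category U J \<longleftrightarrow> category J \<and> small U (Ob J) \<and> locally_small U J"

definition is_iso :: "('o, 'a, 'z) cat_scheme \<Rightarrow> 'o \<Rightarrow> 'o \<Rightarrow> 'a \<Rightarrow> bool" where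
  "is_iso C A B f \<longleftrightarrow> f \<in> Hom C A B \<and>
     (\<exists>g\<in>Hom C B A. Comp C A B A g f = Idt C A \<and> Comp C B A B f g = Idt C B)"

definition opposite :: "('o, 'a, 'z) cat_scheme \<Rightarrow> ('o, 'a) cat" where
  "opposite C = \<lparr>Ob = Ob C, Hom = (\<lambda>A B. Hom C B A),
     Comp = (\<lambda>A B D g f. Comp C D B A f g), Idt = Idt C\<rparr>"

definition full_subcategory :: "('o, 'a, 'z) cat_scheme \<Rightarrow> 'o set \<Rightarrow> ('o, 'a) cat" where
  "full_subcategory C S = \<lparr>Ob = Ob C \<inter> S, Hom = Hom C, Comp = Comp C, Idt = Idt C\<rparr>"

text \<open>
  Functors and transformations are required to be \<open>undefined\<close> outside their domains, so that
  equality of the representing functions is equality of functors and transformations.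
\<close>

record ('o, 'a, 'p, 'b) ftor =
  FO :: "'o \<Rightarrow> 'p"
  FA :: "'o \<Rightarrow> 'o \<Rightarrow> 'a \<Rightarrow> 'b"

definition mk_ftor :: "('o, 'a, 'z) cat_scheme \<Rightarrow> ('o \<Rightarrow> 'p) \<Rightarrow> ('o \<Rightarrow> 'o \<Rightarrow> 'a \<Rightarrow> 'b)
    \<Rightarrow> ('o, 'a, 'p, 'b) ftor" where
  "mk_ftor C F0 F1 = \<lparr>FO = restrict F0 (Ob C),
     FA = (\<lambda>A B f. if A \<in> Ob C \<and> B \<in> Ob C \<and> f \<in> Hom C A B then F1 A B f else undefined)\<rparr>"

definition is_functor :: "('o, 'a, 'z) cat_scheme \<Rightarrow> ('p, 'b, 'y) cat_scheme
    \<Rightarrow> ('o, 'a, 'p, 'b) ftor \<Rightarrow> bool" where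
  "is_functor C D F \<longleftrightarrow>
     F = mk_ftor C (FO F) (FA F) \<and>
     (\<forall>A\<in>Ob C. FO F A \<in> Ob D) \<and>
     (\<forall>A\<in>Ob C. \<forall>B\<in>Ob C. \<forall>f\<in>Hom C A B. FA F A B f \<in> Hom D (FO F A) (FO F B)) \<and>
     (\<forall>A\<in>Ob C. FA F A A (Idt C A) = Idt D (FO F A)) \<and>
     (\<forall>A\<in>Ob C. \<forall>B\<in>Ob C. \<forall>E\<in>Ob C. \<forall>f\<in>Hom C A B. \<forall>g\<in>Hom C B E.
        FA F A E (Comp C A B E g f)
          = Comp D (FO F A) (FO F B) (FO F E) (FA F B E g) (FA F A B f))"

definition id_ftor :: "('o, 'a, 'z) cat_scheme \<Rightarrow> ('o, 'a, 'o, 'a) ftor" where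
  "id_ftor C = mk_ftor C (\<lambda>A. A) (\<lambda>A B f. f)"

text \<open>\<open>comp_ftor C G F\<close> is \<open>G \<circ> F\<close>, where \<open>C\<close> is the domain of \<open>F\<close>.\<close>

definition comp_ftor :: "('o, 'a, 'z) cat_scheme \<Rightarrow> ('p, 'b, 'q, 'c) ftor
    \<Rightarrow> ('o, 'a, 'p, 'b) ftor \<Rightarrow> ('o, 'a, 'q, 'c) ftor" where
  "comp_ftor C G F = mk_ftor C (\<lambda>A. FO G (FO F A)) (\<lambda>A B f. FA G (FO F A) (FO F B) (FA F A B f))"

definition is_nat_trans :: "('o, 'a, 'z) cat_scheme \<Rightarrow> ('p, 'b, 'y) cat_scheme
    \<Rightarrow> ('o, 'a, 'p, 'b) ftor \<Rightarrow> ('o, 'a, 'p, 'b) ftor \<Rightarrow> ('o \<Rightarrow> 'b) \<Rightarrow> bool" where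
  "is_nat_trans C D F G \<alpha> \<longleftrightarrow>
     \<alpha> \<in> extensional (Ob C) \<and>
     (\<forall>A\<in>Ob C. \<alpha> A \<in> Hom D (FO F A) (FO G A)) \<and>
     (\<forall>A\<in>Ob C. \<forall>B\<in>Ob C. \<forall>f\<in>Hom C A B.
        Comp D (FO F A) (FO F B) (FO G B) (\<alpha> B) (FA F A B f)
          = Comp D (FO F A) (FO G A) (FO G B) (FA G A B f) (\<alpha> A))"

definition functor_category :: "('o, 'a, 'z) cat_scheme \<Rightarrow> ('p, 'b, 'y) cat_scheme
    \<Rightarrow> (('o, 'a, 'p, 'b) ftor, 'o \<Rightarrow> 'b) cat" where
  "functor_category C D =
     \<lparr>Ob = {F. is_functor C D F},
      Hom = (\<lambda>F G. {\<alpha>. is_nat_trans C D F G \<alpha>}),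
      Comp = (\<lambda>F G H \<beta> \<alpha>. \<lambda>A\<in>Ob C. Comp D (FO F A) (FO G A) (FO H A) (\<beta> A) (\<alpha> A)),
      Idt = (\<lambda>F. \<lambda>A\<in>Ob C. Idt D (FO F A))\<rparr>"

definition naturally_isomorphic :: "('o, 'a, 'z) cat_scheme \<Rightarrow> ('p, 'b, 'y) cat_scheme
    \<Rightarrow> ('o, 'a, 'p, 'b) ftor \<Rightarrow> ('o, 'a, 'p, 'b) ftor \<Rightarrow> bool" where
  "naturally_isomorphic C D F G \<longleftrightarrow>
     (\<exists>\<alpha>. is_nat_trans C D F G \<alpha> \<and> (\<forall>A\<in>Ob C. is_iso D (FO F A) (FO G A) (\<alpha> A)))"

definition is_equivalence :: "('o, 'a, 'z) cat_scheme \<Rightarrow> ('p, 'b, 'y) cat_scheme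
    \<Rightarrow> ('o, 'a, 'p, 'b) ftor \<Rightarrow> bool" where
  "is_equivalence C D F \<longleftrightarrow>
     category C \<and> category D \<and> is_functor C D F \<and>
     (\<exists>G. is_functor D C G \<and>
        naturally_isomorphic C C (comp_ftor C G F) (id_ftor C) \<and>
        naturally_isomorphic D D (comp_ftor D F G) (id_ftor D))"


section \<open>Limits and colimits\<close>

definition is_pullback :: "('o, 'a, 'z) cat_scheme \<Rightarrow> 'o \<Rightarrow> 'o \<Rightarrow> 'o \<Rightarrow> 'a \<Rightarrow> 'a
    \<Rightarrow> 'o \<Rightarrow> 'a \<Rightarrow> 'a \<Rightarrow> bool" where
  "is_pullback C A B D f g W p q \<longleftrightarrow>
     W \<in> Ob C \<and> p \<in> Hom C W A \<and> q \<in> Hom C W B \<and> Comp C W A D f p = Comp C W B D g q \<and>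
     (\<forall>V\<in>Ob C. \<forall>s\<in>Hom C V A. \<forall>t\<in>Hom C V B. Comp C V A D f s = Comp C V B D g t \<longrightarrow>
        (\<exists>!h. h \<in> Hom C V W \<and> Comp C V W A p h = s \<and> Comp C V W B q h = t))"

definition is_cocone :: "('i, 'j, 'z) cat_scheme \<Rightarrow> ('o, 'a, 'y) cat_scheme
    \<Rightarrow> ('i, 'j, 'o, 'a) ftor \<Rightarrow> 'o \<Rightarrow> ('i \<Rightarrow> 'a) \<Rightarrow> bool" where
  "is_cocone J C D V c \<longleftrightarrow>
     V \<in> Ob C \<and> (\<forall>i\<in>Ob J. c i \<in> Hom C (FO D i) V) \<and>
     (\<forall>i\<in>Ob J. \<forall>j\<in>Ob J. \<forall>u\<in>Hom J i j. Comp C (FO D i) (FO D j) V (c j) (FA D i j u) = c i)"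

definition is_colimit :: "('i, 'j, 'z) cat_scheme \<Rightarrow> ('o, 'a, 'y) cat_scheme
    \<Rightarrow> ('i, 'j, 'o, 'a) ftor \<Rightarrow> 'o \<Rightarrow> ('i \<Rightarrow> 'a) \<Rightarrow> bool" where
  "is_colimit J C D V c \<longleftrightarrow>
     is_cocone J C D V c \<and>
     (\<forall>W d. is_cocone J C D W d \<longrightarrow>
        (\<exists>!h. h \<in> Hom C V W \<and> (\<forall>i\<in>Ob J. Comp C (FO D i) V W h (c i) = d i)))"

definition has_small_colimits :: "'u itself \<Rightarrow> ('o, 'a, 'z) cat_scheme \<Rightarrow> bool" where
  "has_small_colimits U C \<longleftrightarrow>
     (\<forall>(J :: ('u, 'u) cat) D. small_category U J \<and> is_functor J C D \<longrightarrow>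
        (\<exists>V c. is_colimit J C D V c))"

definition preserves_small_colimits :: "'u itself \<Rightarrow> ('o, 'a, 'z) cat_scheme
    \<Rightarrow> ('p, 'b, 'y) cat_scheme \<Rightarrow> ('o, 'a, 'p, 'b) ftor \<Rightarrow> bool" where
  "preserves_small_colimits U C D F \<longleftrightarrow>
     (\<forall>(J :: ('u, 'u) cat) T V c.
        small_category U J \<and> is_functor J C T \<and> is_colimit J C T V c \<longrightarrow>
        is_colimit J D (comp_ftor J F T) (FO F V) (\<lambda>i. FA F (FO T i) V (c i)))"


section \<open>Restriction categories\<close>

text \<open>\<open>Rst X A B f\<close> is the restriction of \<open>f : A \<rightarrow> B\<close>.\<close>

record ('o, 'a) rcat = "('o, 'a) cat" +
  Rst :: "'o \<Rightarrow> 'o \<Rightarrow> 'a \<Rightarrow> 'a"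

locale restriction_category = category X
  for X :: "('o, 'a, 'z) rcat_scheme" +
  assumes Rst_in: "\<lbrakk>A \<in> Ob X; B \<in> Ob X; f \<in> Hom X A B\<rbrakk> \<Longrightarrow> Rst X A B f \<in> Hom X A A"
    and R1: "\<lbrakk>A \<in> Ob X; B \<in> Ob X; f \<in> Hom X A B\<rbrakk> \<Longrightarrow> Comp X A A B f (Rst X A B f) = f"
    and R2: "\<lbrakk>A \<in> Ob X; B \<in> Ob X; D \<in> Ob X; f \<in> Hom X A B; g \<in> Hom X A D\<rbrakk>
        \<Longrightarrow> Comp X A A A (Rst X A D g) (Rst X A B f) = Comp X A A A (Rst X A B f) (Rst X A D g)"
    and R3: "\<lbrakk>A \<in> Ob X; B \<in> Ob X; D \<in> Ob X; f \<in> Hom X A B; g \<in> Hom X A D\<rbrakk>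
        \<Longrightarrow> Rst X A D (Comp X A A D g (Rst X A B f)) = Comp X A A A (Rst X A D g) (Rst X A B f)"
    and R4: "\<lbrakk>A \<in> Ob X; B \<in> Ob X; D \<in> Ob X; f \<in> Hom X A B; h \<in> Hom X B D\<rbrakk>
        \<Longrightarrow> Comp X A B B (Rst X B D h) f = Comp X A A B f (Rst X A D (Comp X A B D h f))"

definition restriction_idempotent :: "('o, 'a, 'z) rcat_scheme \<Rightarrow> 'o \<Rightarrow> 'a \<Rightarrow> bool" where
  "restriction_idempotent X A e \<longleftrightarrow> e \<in> Hom X A A \<and> Rst X A A e = e"

definition is_total :: "('o, 'a, 'z) rcat_scheme \<Rightarrow> 'o \<Rightarrow> 'o \<Rightarrow> 'a \<Rightarrow> bool" where
  "is_total X A B f \<longleftrightarrow> f \<in> Hom X A B \<and> Rst X A B f = Idt X A"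

definition Total :: "('o, 'a, 'z) rcat_scheme \<Rightarrow> ('o, 'a) cat" where
  "Total X = \<lparr>Ob = Ob X, Hom = (\<lambda>A B. {f. is_total X A B f}), Comp = Comp X, Idt = Idt X\<rparr>"

definition Total_inclusion :: "('o, 'a, 'z) rcat_scheme \<Rightarrow> ('o, 'a, 'o, 'a) ftor" where
  "Total_inclusion X = mk_ftor (Total X) (\<lambda>A. A) (\<lambda>A B f. f)"

definition Total_ftor :: "('o, 'a, 'z) rcat_scheme \<Rightarrow> ('o, 'a, 'p, 'b) ftor
    \<Rightarrow> ('o, 'a, 'p, 'b) ftor" where
  "Total_ftor X F = mk_ftor (Total X) (FO F) (FA F)"

definition is_restriction_functor :: "('o, 'a, 'z) rcat_scheme \<Rightarrow> ('p, 'b, 'y) rcat_scheme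
    \<Rightarrow> ('o, 'a, 'p, 'b) ftor \<Rightarrow> bool" where
  "is_restriction_functor X Y F \<longleftrightarrow>
     is_functor X Y F \<and>
     (\<forall>A\<in>Ob X. \<forall>B\<in>Ob X. \<forall>f\<in>Hom X A B.
        FA F A A (Rst X A B f) = Rst Y (FO F A) (FO F B) (FA F A B f))"

definition is_restriction_trans :: "('o, 'a, 'z) rcat_scheme \<Rightarrow> ('p, 'b, 'y) rcat_scheme
    \<Rightarrow> ('o, 'a, 'p, 'b) ftor \<Rightarrow> ('o, 'a, 'p, 'b) ftor \<Rightarrow> ('o \<Rightarrow> 'b) \<Rightarrow> bool" where
  "is_restriction_trans X Y F G \<alpha> \<longleftrightarrow>
     is_nat_trans X Y F G \<alpha> \<and> (\<forall>A\<in>Ob X. is_total Y (FO F A) (FO G A) (\<alpha> A))"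

text \<open>The splitting \<open>e = m r\<close>, \<open>r m = 1\<close> of an arrow \<open>e : A \<rightarrow> A\<close> through \<open>Z\<close>.\<close>

definition splits_as :: "('o, 'a, 'z) cat_scheme \<Rightarrow> 'o \<Rightarrow> 'a \<Rightarrow> 'o \<Rightarrow> 'a \<Rightarrow> 'a \<Rightarrow> bool" where
  "splits_as X A e Z m r \<longleftrightarrow>
     Z \<in> Ob X \<and> m \<in> Hom X Z A \<and> r \<in> Hom X A Z \<and>
     e = Comp X A Z A m r \<and> Comp X Z A Z r m = Idt X Z"

definition split :: "('o, 'a, 'z) rcat_scheme \<Rightarrow> bool" where
  "split X \<longleftrightarrow> (\<forall>A\<in>Ob X. \<forall>e. restriction_idempotent X A e \<longrightarrow> (\<exists>Z m r. splits_as X A e Z m r))"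

definition restriction_monic :: "('o, 'a, 'z) rcat_scheme \<Rightarrow> 'o \<Rightarrow> 'o \<Rightarrow> 'a \<Rightarrow> bool" where
  "restriction_monic X Z A m \<longleftrightarrow>
     (\<exists>e r. restriction_idempotent X A e \<and> splits_as X A e Z m r)"

definition cocomplete :: "'u itself \<Rightarrow> ('o, 'a, 'z) rcat_scheme \<Rightarrow> bool" where
  "cocomplete U Y \<longleftrightarrow>
     split Y \<and> has_small_colimits U (Total Y) \<and>
     preserves_small_colimits U (Total Y) Y (Total_inclusion Y)"

definition cocontinuous :: "'u itself \<Rightarrow> ('o, 'a, 'z) rcat_scheme \<Rightarrow> ('p, 'b, 'y) rcat_scheme
    \<Rightarrow> ('o, 'a, 'p, 'b) ftor \<Rightarrow> bool" where
  "cocontinuous U Y Z F \<longleftrightarrow>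
     preserves_small_colimits U (Total Y) (Total Z) (Total_ftor Y F)"


section \<open>Hom-categories of the 2-categories \<open>rCAT\<close> and \<open>rCocomp\<close>\<close>

definition rCAT :: "('o, 'a, 'z) rcat_scheme \<Rightarrow> ('p, 'b, 'y) rcat_scheme
    \<Rightarrow> (('o, 'a, 'p, 'b) ftor, 'o \<Rightarrow> 'b) cat" where
  "rCAT X Y =
     \<lparr>Ob = {F. is_restriction_functor X Y F},
      Hom = (\<lambda>F G. {\<alpha>. is_restriction_trans X Y F G \<alpha>}),
      Comp = Comp (functor_category X Y),
      Idt = Idt (functor_category X Y)\<rparr>"

definition rCocomp :: "'u itself \<Rightarrow> ('o, 'a, 'z) rcat_scheme \<Rightarrow> ('p, 'b, 'y) rcat_scheme
    \<Rightarrow> (('o, 'a, 'p, 'b) ftor, 'o \<Rightarrow> 'b) cat" where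
  "rCocomp U Y Z = full_subcategory (rCAT Y Z) {F. cocontinuous U Y Z F}"

text \<open>
  \<open>precomp K X L\<close> is precomposition with a functor \<open>L\<close> with domain \<open>X\<close>, as a functor on a
  category \<open>K\<close> of functors and transformations.
\<close>

definition precomp :: "(('p, 'b, 'q, 'c) ftor, 'p \<Rightarrow> 'c, 'y) cat_scheme \<Rightarrow> ('o, 'a, 'z) cat_scheme
    \<Rightarrow> ('o, 'a, 'p, 'b) ftor
    \<Rightarrow> (('p, 'b, 'q, 'c) ftor, 'p \<Rightarrow> 'c, ('o, 'a, 'q, 'c) ftor, 'o \<Rightarrow> 'c) ftor" where
  "precomp K X L = mk_ftor K (\<lambda>F. comp_ftor X F L) (\<lambda>F G \<alpha>. \<lambda>A\<in>Ob X. \<alpha> (FO L A))"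


section \<open>Splitting restriction idempotents\<close>

definition K_r :: "('o, 'a, 'z) rcat_scheme \<Rightarrow> ('o \<times> 'a, 'a) rcat" where
  "K_r X =
     \<lparr>Ob = {(A, e). A \<in> Ob X \<and> restriction_idempotent X A e},
      Hom = (\<lambda>(A, e) (A', e'). {f \<in> Hom X A A'. Comp X A A' A' e' (Comp X A A A' f e) = f}),
      Comp = (\<lambda>(A, e) (B, d) (D, c) g f. Comp X A B D g f),
      Idt = (\<lambda>(A, e). e),
      Rst = (\<lambda>(A, e) (B, d) f. Rst X A B f)\<rparr>"

definition J_emb :: "('o, 'a, 'z) rcat_scheme \<Rightarrow> ('o, 'a, 'o \<times> 'a, 'a) ftor" where
  "J_emb X = mk_ftor X (\<lambda>A. (A, Idt X A)) (\<lambda>A B f. f)"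


section \<open>\<open>\<M>\<close>-categories and partial maps\<close>

text \<open>\<open>Mon C A B\<close> is the set of chosen monics from \<open>A\<close> to \<open>B\<close>.\<close>

record ('o, 'a) mcat = "('o, 'a) cat" +
  Mon :: "'o \<Rightarrow> 'o \<Rightarrow> 'a set"

definition MTotal :: "('o, 'a, 'z) rcat_scheme \<Rightarrow> ('o, 'a) mcat" where
  "MTotal Y =
     \<lparr>Ob = Ob (Total Y), Hom = Hom (Total Y), Comp = Comp (Total Y), Idt = Idt (Total Y),
      Mon = (\<lambda>A B. {m. restriction_monic Y A B m})\<rparr>"

text \<open>
  A triple \<open>(Z, m, f)\<close> stands for the span \<open>A \<leftarrow> Z \<rightarrow> B\<close> with legs \<open>m\<close> and \<open>f\<close>;
  \<open>span_class C A B (Z, m, f)\<close> is its isomorphism class.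
\<close>

definition span_class :: "('o, 'a, 'z) cat_scheme \<Rightarrow> 'o \<Rightarrow> 'o \<Rightarrow> 'o \<times> 'a \<times> 'a
    \<Rightarrow> ('o \<times> 'a \<times> 'a) set" where
  "span_class C A B = (\<lambda>(Z, m, f).
     {(Z', Comp C Z' Z A m i, Comp C Z' Z B f i) | Z' i. Z' \<in> Ob C \<and> is_iso C Z' Z i})"

text \<open>
  The operations on classes of spans collect the results for all representatives (and, for
  composition, all pullbacks), which again form a single isomorphism class.
\<close>

definition Par :: "('o, 'a, 'z) mcat_scheme \<Rightarrow> ('o, ('o \<times> 'a \<times> 'a) set) rcat" where
  "Par C =
     \<lparr>Ob = Ob C,
      Hom = (\<lambda>A B. {span_class C A B (Z, m, f) | Z m f.
               Z \<in> Ob C \<and> m \<in> Mon C Z A \<and> f \<in> Hom C Z B}),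
      Comp = (\<lambda>A B D \<psi> \<phi>.
         {(W, Comp C W Z A m p, Comp C W Z' D g q) | W p q Z m f Z' n g.
            (Z, m, f) \<in> \<phi> \<and> (Z', n, g) \<in> \<psi> \<and> is_pullback C Z Z' B f n W p q}),
      Idt = (\<lambda>A. span_class C A A (A, Idt C A, Idt C A)),
      Rst = (\<lambda>A B \<phi>. \<Union>(Z, m, f)\<in>\<phi>. span_class C A A (Z, m, m))\<rparr>"

definition Par_ftor :: "('o, 'a, 'z) mcat_scheme \<Rightarrow> ('p, 'b, 'y) mcat_scheme
    \<Rightarrow> ('o, 'a, 'p, 'b) ftor
    \<Rightarrow> ('o, ('o \<times> 'a \<times> 'a) set, 'p, ('p \<times> 'b \<times> 'b) set) ftor" where
  "Par_ftor C D F = mk_ftor (Par C) (FO F)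
     (\<lambda>A B \<phi>. \<Union>(Z, m, f)\<in>\<phi>.
        span_class D (FO F A) (FO F B) (FO F Z, FA F Z A m, FA F Z B f))"

definition Phi :: "('o, 'a, 'z) rcat_scheme \<Rightarrow> ('o, 'a, 'o, ('o \<times> 'a \<times> 'a) set) ftor" where
  "Phi Y = mk_ftor Y (\<lambda>A. A)
     (\<lambda>A B f. \<Union>(Z, m, r)\<in>{(Z, m, r). splits_as Y A (Rst Y A B f) Z m r}.
        span_class (MTotal Y) A B (Z, m, Comp Y Z A B f m))"


section \<open>Small presheaves\<close>

definition SET :: "'u itself \<Rightarrow> ('u set, 'u \<Rightarrow> 'u) cat" where
  "SET U = \<lparr>Ob = {A. small U A}, Hom = (\<lambda>A B. A \<rightarrow>\<^sub>E B),
     Comp = (\<lambda>A B D g f. compose A g f), Idt = (\<lambda>A. \<lambda>x\<in>A. x)\<rparr>"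

type_synonym ('o, 'a, 'u) presheaf = "('o, 'a, 'u set, 'u \<Rightarrow> 'u) ftor"

definition Psh :: "'u itself \<Rightarrow> ('o, 'a, 'z) cat_scheme
    \<Rightarrow> (('o, 'a, 'u) presheaf, 'o \<Rightarrow> 'u \<Rightarrow> 'u) cat" where
  "Psh U C = functor_category (opposite C) (SET U)"

text \<open>
  Since arrows of \<open>C\<close> need not be elements of \<open>'u\<close>, each (small) hom-set is transported along a
  chosen injection into \<open>'u\<close>. Up to this identification \<open>y_ob U C D\<close> is \<open>Hom(-, D)\<close>.
\<close>

definition enc :: "'u itself \<Rightarrow> ('o, 'a, 'z) cat_scheme \<Rightarrow> 'o \<Rightarrow> 'o \<Rightarrow> 'a \<Rightarrow> 'u" where
  "enc U C A B = (SOME h. inj_on h (Hom C A B))"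

definition dec :: "'u itself \<Rightarrow> ('o, 'a, 'z) cat_scheme \<Rightarrow> 'o \<Rightarrow> 'o \<Rightarrow> 'u \<Rightarrow> 'a" where
  "dec U C A B = inv_into (Hom C A B) (enc U C A B)"

definition y_ob :: "'u itself \<Rightarrow> ('o, 'a, 'z) cat_scheme \<Rightarrow> 'o \<Rightarrow> ('o, 'a, 'u) presheaf" where
  "y_ob U C D = mk_ftor (opposite C)
     (\<lambda>A. enc U C A D ` Hom C A D)
     (\<lambda>A B f. \<lambda>x\<in>enc U C A D ` Hom C A D. enc U C B D (Comp C B A D (dec U C A D x) f))"

definition yoneda :: "'u itself \<Rightarrow> ('o, 'a, 'z) cat_scheme
    \<Rightarrow> ('o, 'a, ('o, 'a, 'u) presheaf, 'o \<Rightarrow> 'u \<Rightarrow> 'u) ftor" where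
  "yoneda U C = mk_ftor C (y_ob U C)
     (\<lambda>D E g. \<lambda>A\<in>Ob C. \<lambda>x\<in>enc U C A D ` Hom C A D.
        enc U C A E (Comp C A D E g (dec U C A D x)))"

definition small_presheaf :: "'u itself \<Rightarrow> ('o, 'a, 'z) cat_scheme
    \<Rightarrow> ('o, 'a, 'u) presheaf \<Rightarrow> bool" where
  "small_presheaf U C P \<longleftrightarrow>
     (\<exists>(J :: ('u, 'u) cat) T c. small_category U J \<and> is_functor J C T \<and>
        is_colimit J (Psh U C) (comp_ftor J (yoneda U C) T) P c)"

definition P_small :: "'u itself \<Rightarrow> ('o, 'a, 'z) cat_scheme
    \<Rightarrow> (('o, 'a, 'u) presheaf, 'o \<Rightarrow> 'u \<Rightarrow> 'u) cat" where
  "P_small U C = full_subcategory (Psh U C) {P. small_presheaf U C P}"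

definition P_M :: "'u itself \<Rightarrow> ('o, 'a, 'z) mcat_scheme
    \<Rightarrow> (('o, 'a, 'u) presheaf, 'o \<Rightarrow> 'u \<Rightarrow> 'u) mcat" where
  "P_M U C =
     \<lparr>Ob = Ob (P_small U C), Hom = Hom (P_small U C), Comp = Comp (P_small U C),
      Idt = Idt (P_small U C),
      Mon = (\<lambda>P Q. {\<mu> \<in> Hom (P_small U C) P Q.
        \<forall>D\<in>Ob C. \<forall>\<gamma>\<in>Hom (P_small U C) (FO (yoneda U C) D) Q.
          \<exists>B\<in>Ob C. \<exists>m\<in>Mon C B D. \<exists>\<delta>.
            is_pullback (P_small U C) P (FO (yoneda U C) D) Q \<mu> \<gamma>
              (FO (yoneda U C) B) \<delta> (FA (yoneda U C) B D m)})\<rparr>"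


section \<open>The Cockett--Lack embedding\<close>

definition Lambda :: "'u itself \<Rightarrow> ('o, 'a, 'z) rcat_scheme
    \<Rightarrow> ('o, 'a, ('o \<times> 'a, 'a, 'u) presheaf,
        (('o \<times> 'a, 'a, 'u) presheaf \<times> ('o \<times> 'a \<Rightarrow> 'u \<Rightarrow> 'u) \<times> ('o \<times> 'a \<Rightarrow> 'u \<Rightarrow> 'u)) set) ftor" where
  "Lambda U X =
     (let C = MTotal (K_r X) in
      comp_ftor X (Par_ftor C (P_M U C) (yoneda U C)) (comp_ftor X (Phi (K_r X)) (J_emb X)))"

end

theory Submission
  imports Defs
begin

text \<open>
  Let \<open>K = K_r X\<close>, let \<open>C\<close> be the category of total maps of \<open>K\<close>, and let \<open>Y\<close> be the category of
  partial maps of small presheaves on \<open>C\<close>. The embedding \<open>\<Lambda>\<close> is \<open>J : X \<rightarrow> K\<close> followed by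
  \<open>L : K \<rightarrow> Y\<close>, which sends \<open>D\<close> to the representable \<open>y D\<close>. Since every object of \<open>K\<close> is a retract
  of some \<open>J A\<close> and \<open>E\<close> is split, functors and transformations on \<open>X\<close> extend essentially uniquely
  to \<open>K\<close>. It remains to extend from \<open>K\<close> to \<open>Y\<close>.

  A small presheaf \<open>P\<close> is a small colimit of representables, so a cocontinuous \<open>F\<close> sends it to the
  colimit of \<open>F L\<close> weighted by \<open>P\<close> (\<open>cocontinuous_weighted_colimit\<close>). Its coprojections
  \<open>\<kappa> x : F L D \<rightarrow> F P\<close>, for \<open>x \<in> P D\<close>, are total. Because the inclusion of the total maps into
  \<open>E\<close> preserves colimits, this weighted colimit is universal for families of partial maps of
  \<open>E\<close> as well.

  The arrows of \<open>Y\<close> are partial, and this is controlled by one fact (\<open>arrow_from_y\<close>): every arrow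
  \<open>y D \<rightarrow> Q\<close> of \<open>Y\<close> is \<open>L k\<close>, for a possibly partial \<open>k : D \<rightarrow> B\<close> in \<open>K\<close>, followed by a total arrow
  \<open>y B \<rightarrow> Q\<close>, that is, an element of \<open>Q B\<close>. Indeed the domain of such an arrow is a chosen monic
  into \<open>y D\<close>, and those come from restriction idempotents of \<open>K\<close>. Hence a transformation that is
  natural on \<open>K\<close> induces one that is natural for all arrows of \<open>Y\<close> (\<open>trans_extend_from_L\<close>), and
  it is unique since the \<open>\<kappa> x\<close> are jointly epic (\<open>trans_eqI_on_y\<close>).

  Conversely, a restriction functor \<open>H\<close> on \<open>K\<close> is extended by choosing weighted colimits. An arrow
  \<open>\<phi> : P \<rightarrow> Q\<close> acts by \<open>\<kappa> x \<mapsto> \<kappa> z \<circ> H k\<close>, where \<open>\<phi> x = z \<circ> L k\<close>; the factorization is unique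
  enough for this to be well defined (\<open>factorization_unique\<close>, \<open>khat_eq\<close>), and functoriality and
  preservation of restrictions are then formal. Cocontinuity (\<open>cocontinuous_ext\<close>) reduces to
  colimits of presheaves, tested against the presheaves of total arrows \<open>H D \<rightarrow> Z\<close>. These need
  not be small, so one needs that a colimit of small presheaves is universal among all presheaves
  (\<open>colimit_Total_Y\<close>), for which the colimit in all presheaves is shown to be small.

  To work with \<open>Y\<close> at all, its arrows are identified with graphs: families of single-valued
  relations whose domain is cut out by restriction idempotents (\<open>Hom_Y\<close>, \<open>Comp_Y\<close>). Composites
  exist because subpresheaves cut out by restriction idempotents are again small
  (\<open>small_M_sub\<close>). Smallness is handled through presentations by generating elements and relations
  (\<open>presents\<close>) rather than through colimit cocones.
\<close>

section \<open>Small sets\<close>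

lemma small_lepoll: "\<lbrakk>small U B; A \<lesssim> B\<rbrakk> \<Longrightarrow> small U A"
  by (auto simp: small_def intro: lesspoll_trans1)

lemma small_subset: "\<lbrakk>small U B; A \<subseteq> B\<rbrakk> \<Longrightarrow> small U A"
  by (erule small_lepoll) (rule subset_imp_lepoll)

lemma small_image: "small U A \<Longrightarrow> small U (f ` A)"
  by (rule small_lepoll[OF _ image_lepoll])

lemma small_inj_ex:
  assumes "small (U :: 'u itself) A"
  shows "\<exists>h :: 'x \<Rightarrow> 'u. inj_on h A"
  using assms by (auto simp: small_def lesspoll_def lepoll_def)

lemma small_finite:
  assumes "universe U" "finite A"
  shows "small U A"
  using assms by (auto simp: small_def universe_def intro: finite_lesspoll_infinite)

text \<open>
  Pairs are coded by elements of \<open>'u\<close>, since \<open>'u\<close> is infinite, and regularity of the universe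
  bounds the union of the coded fibres.
\<close>

lemma small_Sigma:
  fixes U :: "'u itself"
  assumes U: "universe U" and I: "small U I" and A: "\<And>i. i \<in> I \<Longrightarrow> small U (A i)"
  shows "small U (Sigma I A)"
proof -
  obtain f :: "_ \<Rightarrow> 'u" where f: "inj_on f I"
    using small_inj_ex[OF I] by blast
  have "\<forall>i\<in>I. \<exists>g :: _ \<Rightarrow> 'u. inj_on g (A i)"
    using small_inj_ex A by blast
  then obtain g :: "_ \<Rightarrow> _ \<Rightarrow> 'u" where g: "\<And>i. i \<in> I \<Longrightarrow> inj_on (g i) (A i)"
    by metis
  have "infinite (UNIV :: 'u set)"
    using U by (simp add: universe_def)
  then have "(UNIV :: 'u set) \<times> (UNIV :: 'u set) \<approx> (UNIV :: 'u set)"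
    unfolding eqpoll_iff_card_of_ordIso by (rule card_of_Times_same_infinite)
  then obtain b :: "'u \<times> 'u \<Rightarrow> 'u" where b: "inj b"
    by (auto simp: eqpoll_def bij_betw_def)
  let ?v = "inv_into I f"
  define B where "B u = (\<lambda>x. b (u, g (?v u) x)) ` A (?v u)" for u
  have "small U (B u)" if "u \<in> f ` I" for u
    unfolding B_def by (rule small_image, rule A) (use that in \<open>simp add: inv_into_into\<close>)
  then have *: "small U (\<Union>u\<in>f ` I. B u)"
    using U small_image[OF I, of f] unfolding universe_def by blast
  let ?h = "\<lambda>(i, x). b (f i, g i x)"
  have "inj_on ?h (Sigma I A)"
    using f g by (auto simp: inj_on_def inj_eq[OF b])
  moreover have "?h ` Sigma I A \<subseteq> (\<Union>u\<in>f ` I. B u)"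
    using f by (auto simp: B_def)
  ultimately have "Sigma I A \<lesssim> (\<Union>u\<in>f ` I. B u)"
    by (auto simp: lepoll_def)
  then show ?thesis
    by (rule small_lepoll[OF *])
qed

lemma small_UN:
  assumes "universe U" "small U I" "\<And>i. i \<in> I \<Longrightarrow> small U (A i)"
  shows "small U (\<Union>i\<in>I. A i)"
proof -
  have "(\<Union>i\<in>I. A i) = snd ` Sigma I A"
    by force
  then show ?thesis
    using small_Sigma[OF assms] by (simp add: small_image)
qed

section \<open>Functors and equivalences of categories\<close>

lemma mk_ftor_sel [simp]:
  "A \<in> Ob C \<Longrightarrow> FO (mk_ftor C F0 F1) A = F0 A"
  "\<lbrakk>A \<in> Ob C; B \<in> Ob C; f \<in> Hom C A B\<rbrakk> \<Longrightarrow> FA (mk_ftor C F0 F1) A B f = F1 A B f"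
  by (simp_all add: mk_ftor_def)

lemma mk_ftor_cong:
  assumes "\<And>A. A \<in> Ob C \<Longrightarrow> F0 A = G0 A"
    and "\<And>A B f. \<lbrakk>A \<in> Ob C; B \<in> Ob C; f \<in> Hom C A B\<rbrakk> \<Longrightarrow> F1 A B f = G1 A B f"
  shows "mk_ftor C F0 F1 = mk_ftor C G0 G1"
  using assms by (auto simp: mk_ftor_def restrict_def fun_eq_iff)

lemma mk_ftor_idem: "mk_ftor C (FO (mk_ftor C F0 F1)) (FA (mk_ftor C F0 F1)) = mk_ftor C F0 F1"
  by (rule mk_ftor_cong) auto

lemma is_functor_mk_ftor:
  assumes "category C"
    and "\<And>A. A \<in> Ob C \<Longrightarrow> F0 A \<in> Ob D"
    and "\<And>A B f. \<lbrakk>A \<in> Ob C; B \<in> Ob C; f \<in> Hom C A B\<rbrakk> \<Longrightarrow> F1 A B f \<in> Hom D (F0 A) (F0 B)"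
    and "\<And>A. A \<in> Ob C \<Longrightarrow> F1 A A (Idt C A) = Idt D (F0 A)"
    and "\<And>A B E f g. \<lbrakk>A \<in> Ob C; B \<in> Ob C; E \<in> Ob C; f \<in> Hom C A B; g \<in> Hom C B E\<rbrakk> \<Longrightarrow>
      F1 A E (Comp C A B E g f) = Comp D (F0 A) (F0 B) (F0 E) (F1 B E g) (F1 A B f)"
  shows "is_functor C D (mk_ftor C F0 F1)"
proof -
  interpret category C by fact
  show ?thesis
    using assms(2-5) by (auto simp: is_functor_def mk_ftor_idem Idt_in Comp_in)
qed

lemma is_functorD:
  assumes "is_functor C D F"
  shows "A \<in> Ob C \<Longrightarrow> FO F A \<in> Ob D"
    and "\<lbrakk>A \<in> Ob C; B \<in> Ob C; f \<in> Hom C A B\<rbrakk> \<Longrightarrow> FA F A B f \<in> Hom D (FO F A) (FO F B)"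
    and "A \<in> Ob C \<Longrightarrow> FA F A A (Idt C A) = Idt D (FO F A)"
    and "\<lbrakk>A \<in> Ob C; B \<in> Ob C; E \<in> Ob C; f \<in> Hom C A B; g \<in> Hom C B E\<rbrakk> \<Longrightarrow>
      FA F A E (Comp C A B E g f)
        = Comp D (FO F A) (FO F B) (FO F E) (FA F B E g) (FA F A B f)"
  using assms unfolding is_functor_def by blast+

lemma is_functor_eq: "is_functor C D F \<Longrightarrow> F = mk_ftor C (FO F) (FA F)"
  unfolding is_functor_def by blast

lemma functor_eqI:
  assumes "is_functor C D F" "is_functor C D' G"
    and "\<And>A. A \<in> Ob C \<Longrightarrow> FO F A = FO G A"
    and "\<And>A B f. \<lbrakk>A \<in> Ob C; B \<in> Ob C; f \<in> Hom C A B\<rbrakk> \<Longrightarrow> FA F A B f = FA G A B f"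
  shows "F = G"
proof -
  have "mk_ftor C (FO F) (FA F) = mk_ftor C (FO G) (FA G)"
    using assms(3,4) by (rule mk_ftor_cong)
  then show ?thesis
    using is_functor_eq[OF assms(1)] is_functor_eq[OF assms(2)] by simp
qed

lemma comp_ftor_sel [simp]:
  "A \<in> Ob C \<Longrightarrow> FO (comp_ftor C G F) A = FO G (FO F A)"
  "\<lbrakk>A \<in> Ob C; B \<in> Ob C; f \<in> Hom C A B\<rbrakk> \<Longrightarrow>
    FA (comp_ftor C G F) A B f = FA G (FO F A) (FO F B) (FA F A B f)"
  by (simp_all add: comp_ftor_def)

lemma id_ftor_sel [simp]:
  "A \<in> Ob C \<Longrightarrow> FO (id_ftor C) A = A"
  "\<lbrakk>A \<in> Ob C; B \<in> Ob C; f \<in> Hom C A B\<rbrakk> \<Longrightarrow> FA (id_ftor C) A B f = f"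
  by (simp_all add: id_ftor_def)

lemma is_functor_comp:
  assumes "category C" "is_functor C D F" "is_functor D E G"
  shows "is_functor C E (comp_ftor C G F)"
  unfolding comp_ftor_def
  by (rule is_functor_mk_ftor[OF assms(1)])
    (simp_all add: is_functorD[OF assms(2)] is_functorD[OF assms(3)])

lemma comp_ftor_assoc:
  assumes "is_functor C D F"
  shows "comp_ftor C (comp_ftor D H G) F = comp_ftor C H (comp_ftor C G F)"
  unfolding comp_ftor_def[of C]
  by (rule mk_ftor_cong) (simp_all add: is_functorD[OF assms])

lemma opposite_sel [simp]:
  "Ob (opposite C) = Ob C" "Hom (opposite C) A B = Hom C B A"
  "Comp (opposite C) A B D g f = Comp C D B A f g" "Idt (opposite C) = Idt C"
  by (simp_all add: opposite_def)

lemma full_subcategory_sel [simp]: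
  "Ob (full_subcategory C S) = Ob C \<inter> S" "Hom (full_subcategory C S) = Hom C"
  "Comp (full_subcategory C S) = Comp C" "Idt (full_subcategory C S) = Idt C"
  by (simp_all add: full_subcategory_def)

lemma functor_category_sel [simp]:
  "F \<in> Ob (functor_category C D) \<longleftrightarrow> is_functor C D F"
  "\<alpha> \<in> Hom (functor_category C D) F G \<longleftrightarrow> is_nat_trans C D F G \<alpha>"
  "Comp (functor_category C D) F G H \<beta> \<alpha>
    = (\<lambda>A\<in>Ob C. Comp D (FO F A) (FO G A) (FO H A) (\<beta> A) (\<alpha> A))"
  "Idt (functor_category C D) F = (\<lambda>A\<in>Ob C. Idt D (FO F A))"
  by (simp_all add: functor_category_def)

context category
begin

lemma opposite_category: "category (opposite C)"
  by unfold_locales (simp_all add: Idt_in Comp_in Idt_left Idt_right Comp_assoc)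

lemma full_subcategory_category: "category (full_subcategory C S)"
  by unfold_locales (auto simp: Idt_in Comp_in Idt_left Idt_right Comp_assoc)

end

text \<open>
  The inverse functor sends an object to a chosen preimage up to isomorphism; on arrows it is
  conjugation by the chosen isomorphisms, lifted along the bijections on hom-sets.
\<close>

lemma is_equivalenceI:
  assumes C: "category C" and D: "category D" and F: "is_functor C D F"
    and full: "\<And>A B g. \<lbrakk>A \<in> Ob C; B \<in> Ob C; g \<in> Hom D (FO F A) (FO F B)\<rbrakk>
        \<Longrightarrow> \<exists>f\<in>Hom C A B. FA F A B f = g"
    and faithful: "\<And>A B f f'. \<lbrakk>A \<in> Ob C; B \<in> Ob C; f \<in> Hom C A B; f' \<in> Hom C A B;
        FA F A B f = FA F A B f'\<rbrakk> \<Longrightarrow> f = f'"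
    and ess_surj: "\<And>Y. Y \<in> Ob D \<Longrightarrow> \<exists>A\<in>Ob C. \<exists>i. is_iso D (FO F A) Y i"
  shows "is_equivalence C D F"
proof -
  interpret C: category C by fact
  interpret D: category D by fact
  note F0 = is_functorD(1)[OF F] and F1 = is_functorD(2)[OF F] and F2 = is_functorD(3)[OF F]
    and F3 = is_functorD(4)[OF F]
  obtain G0 \<epsilon> where G0: "\<And>Y. Y \<in> Ob D \<Longrightarrow> G0 Y \<in> Ob C"
    and iso: "\<And>Y. Y \<in> Ob D \<Longrightarrow> is_iso D (FO F (G0 Y)) Y (\<epsilon> Y)"
    using ess_surj by metis
  have \<epsilon>: "\<epsilon> Y \<in> Hom D (FO F (G0 Y)) Y" if "Y \<in> Ob D" for Y
    using iso[OF that] by (simp add: is_iso_def)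
  obtain \<eta> where \<eta>: "\<And>Y. Y \<in> Ob D \<Longrightarrow> \<eta> Y \<in> Hom D Y (FO F (G0 Y))"
    and \<eta>\<epsilon>: "\<And>Y. Y \<in> Ob D \<Longrightarrow>
      Comp D (FO F (G0 Y)) Y (FO F (G0 Y)) (\<eta> Y) (\<epsilon> Y) = Idt D (FO F (G0 Y))"
    and \<epsilon>\<eta>: "\<And>Y. Y \<in> Ob D \<Longrightarrow> Comp D Y (FO F (G0 Y)) Y (\<epsilon> Y) (\<eta> Y) = Idt D Y"
    using iso unfolding is_iso_def by metis
  define conj where "conj Y Y' f = Comp D (FO F (G0 Y)) Y (FO F (G0 Y')) 
      (Comp D Y Y' (FO F (G0 Y')) (\<eta> Y') f) (\<epsilon> Y)" for Y Y' f
  have conj_in: "conj Y Y' f \<in> Hom D (FO F (G0 Y)) (FO F (G0 Y'))"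
    if "Y \<in> Ob D" "Y' \<in> Ob D" "f \<in> Hom D Y Y'" for Y Y' f
    unfolding conj_def using that by (simp add: D.Comp_in \<epsilon> \<eta> G0 F0)
  define G1 where "G1 Y Y' f = (SOME h. h \<in> Hom C (G0 Y) (G0 Y') \<and>
      FA F (G0 Y) (G0 Y') h = conj Y Y' f)" for Y Y' f
  have G1: "G1 Y Y' f \<in> Hom C (G0 Y) (G0 Y') \<and> FA F (G0 Y) (G0 Y') (G1 Y Y' f) = conj Y Y' f"
    if "Y \<in> Ob D" "Y' \<in> Ob D" "f \<in> Hom D Y Y'" for Y Y' f
    unfolding G1_def by (rule someI_ex) (use full conj_in that G0 in blast)
  note G1i = G1[THEN conjunct1] and FG1 = G1[THEN conjunct2]
  have conj_id: "conj Y Y (Idt D Y) = Idt D (FO F (G0 Y))" if "Y \<in> Ob D" for Y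
    unfolding conj_def using that by (simp add: D.Idt_right[OF _ _ \<eta>] \<eta>\<epsilon> G0 F0)
  have \<epsilon>_conj: "Comp D (FO F (G0 Y)) (FO F (G0 Y')) Y' (\<epsilon> Y') (conj Y Y' f)
      = Comp D (FO F (G0 Y)) Y Y' f (\<epsilon> Y)"
    if "Y \<in> Ob D" "Y' \<in> Ob D" "f \<in> Hom D Y Y'" for Y Y' f
    unfolding conj_def using that
    by (simp add: D.Comp_assoc \<epsilon> \<eta> G0 F0 D.Comp_in D.Idt_left \<epsilon>\<eta>)
  have conj_comp: "conj Y Y'' (Comp D Y Y' Y'' g f)
      = Comp D (FO F (G0 Y)) (FO F (G0 Y')) (FO F (G0 Y'')) (conj Y' Y'' g) (conj Y Y' f)"
    if "Y \<in> Ob D" "Y' \<in> Ob D" "Y'' \<in> Ob D" "f \<in> Hom D Y Y'" "g \<in> Hom D Y' Y''" for Y Y' Y'' f g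
  proof -
    have "Comp D (FO F (G0 Y)) (FO F (G0 Y')) (FO F (G0 Y'')) (conj Y' Y'' g) (conj Y Y' f)
       = Comp D (FO F (G0 Y)) Y' (FO F (G0 Y'')) (Comp D Y' Y'' (FO F (G0 Y'')) (\<eta> Y'') g)
          (Comp D (FO F (G0 Y)) (FO F (G0 Y')) Y' (\<epsilon> Y') (conj Y Y' f))"
      unfolding conj_def[of Y' Y''] using that
      by (intro D.Comp_assoc[symmetric]) (simp_all add: \<epsilon> \<eta> G0 F0 D.Comp_in conj_in)
    also have "\<dots> = conj Y Y'' (Comp D Y Y' Y'' g f)"
      unfolding \<epsilon>_conj[OF that(1,2,4)] unfolding conj_def using that
      by (simp add: D.Comp_assoc \<epsilon> \<eta> G0 F0 D.Comp_in)
    finally show ?thesis ..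
  qed
  define G where "G = mk_ftor D G0 G1"
  have G: "is_functor D C G"
    unfolding G_def
  proof (rule is_functor_mk_ftor[OF D])
    fix A assume A: "A \<in> Ob D"
    show "G1 A A (Idt D A) = Idt C (G0 A)"
      by (rule faithful[of "G0 A" "G0 A"])
        (simp_all add: A G0 G1i FG1 D.Idt_in C.Idt_in F2 conj_id)
  next
    fix A B E f g
    assume *: "A \<in> Ob D" "B \<in> Ob D" "E \<in> Ob D" "f \<in> Hom D A B" "g \<in> Hom D B E"
    show "G1 A E (Comp D A B E g f) = Comp C (G0 A) (G0 B) (G0 E) (G1 B E g) (G1 A B f)"
      by (rule faithful[of "G0 A" "G0 E"])
        (simp_all add: * G0 G1i FG1 D.Comp_in C.Comp_in F3 conj_comp)
  qed (simp_all add: G0 G1i)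
  have GF: "is_functor C C (comp_ftor C G F)" by (rule is_functor_comp[OF C F G])
  have FG: "is_functor D D (comp_ftor D F G)" by (rule is_functor_comp[OF D G F])
  have "naturally_isomorphic D D (comp_ftor D F G) (id_ftor D)"
    unfolding naturally_isomorphic_def
    by (intro exI[of _ "restrict \<epsilon> (Ob D)"])
      (auto simp: is_nat_trans_def G_def \<epsilon> iso FG1 \<epsilon>_conj)
  moreover have "naturally_isomorphic C C (comp_ftor C G F) (id_ftor C)"
  proof -
    have "\<exists>t\<in>Hom C (G0 (FO F A)) A. FA F (G0 (FO F A)) A t = \<epsilon> (FO F A)" if "A \<in> Ob C" for A
      using that by (intro full) (simp_all add: G0 F0 \<epsilon>)
    then obtain t where t: "\<And>A. A \<in> Ob C \<Longrightarrow> t A \<in> Hom C (G0 (FO F A)) A"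
      and Ft: "\<And>A. A \<in> Ob C \<Longrightarrow> FA F (G0 (FO F A)) A (t A) = \<epsilon> (FO F A)"
      by metis
    have "\<exists>s\<in>Hom C A (G0 (FO F A)). FA F A (G0 (FO F A)) s = \<eta> (FO F A)" if "A \<in> Ob C" for A
      using that by (intro full) (simp_all add: G0 F0 \<eta>)
    then obtain s where s: "\<And>A. A \<in> Ob C \<Longrightarrow> s A \<in> Hom C A (G0 (FO F A))"
      and Fs: "\<And>A. A \<in> Ob C \<Longrightarrow> FA F A (G0 (FO F A)) (s A) = \<eta> (FO F A)"
      by metis
    have 1: "is_iso C (G0 (FO F A)) A (t A)" if A: "A \<in> Ob C" for A
      unfolding is_iso_def
    proof (intro conjI bexI[OF _ s[OF A]] t A)
      show "Comp C (G0 (FO F A)) A (G0 (FO F A)) (s A) (t A) = Idt C (G0 (FO F A))"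
        by (rule faithful[of "G0 (FO F A)" "G0 (FO F A)"])
          (simp_all add: A G0 F0 C.Comp_in s t C.Idt_in F3 Fs Ft F2 \<eta>\<epsilon>)
      show "Comp C A (G0 (FO F A)) A (t A) (s A) = Idt C A"
        by (rule faithful[of A A])
          (simp_all add: A G0 F0 C.Comp_in s t C.Idt_in F3 Fs Ft F2 \<epsilon>\<eta>)
    qed
    have 2: "Comp C (G0 (FO F A)) (G0 (FO F B)) B (t B) (G1 (FO F A) (FO F B) (FA F A B f))
        = Comp C (G0 (FO F A)) A B f (t A)"
      if A: "A \<in> Ob C" "B \<in> Ob C" "f \<in> Hom C A B" for A B f
      by (rule faithful[of "G0 (FO F A)" B])
        (simp_all add: A G0 F0 C.Comp_in s t F3 Fs Ft FG1 F1 G1i \<epsilon>_conj)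
    show ?thesis
      unfolding naturally_isomorphic_def
      by (intro exI[of _ "restrict t (Ob C)"])
        (auto simp: is_nat_trans_def G_def F0 F1 t 1 2)
  qed
  ultimately show ?thesis
    unfolding is_equivalence_def using C D F G by blast
qed

context category
begin

declare Idt_in [simp] Comp_in [simp] Idt_left [simp] Idt_right [simp]

end

lemma is_cocone_comp:
  assumes "category J" "category C" "is_functor J C D" "is_cocone J C D V c" "W \<in> Ob C" "h \<in> Hom C V W"
  shows "is_cocone J C D W (\<lambda>i. Comp C (FO D i) V W h (c i))"
proof -
  interpret C: category C by fact
  interpret J: category J by fact
  note D = is_functorD[OF assms(3)]
  show ?thesis
    using assms(4-6) D(1,2) unfolding is_cocone_def by (auto simp: C.Comp_assoc[symmetric])
qed

lemma is_colimit_ex: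
  assumes "is_colimit J C D V c" "is_cocone J C D W d"
  obtains h where "h \<in> Hom C V W" "\<And>i. i \<in> Ob J \<Longrightarrow> Comp C (FO D i) V W h (c i) = d i"
  using assms unfolding is_colimit_def by blast

lemma is_colimit_eqI:
  assumes "is_colimit J C D V c" "category J" "category C" "is_functor J C D"
    and "W \<in> Ob C" "h \<in> Hom C V W" "h' \<in> Hom C V W"
    and "\<And>i. i \<in> Ob J \<Longrightarrow> Comp C (FO D i) V W h (c i) = Comp C (FO D i) V W h' (c i)"
  shows "h = h'"
proof -
  have "is_cocone J C D W (\<lambda>i. Comp C (FO D i) V W h (c i))"
    using assms by (intro is_cocone_comp) (auto simp: is_colimit_def)
  then have "\<exists>!k. k \<in> Hom C V W \<and> (\<forall>i\<in>Ob J. Comp C (FO D i) V W k (c i) = Comp C (FO D i) V W h (c i))"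
    using assms(1) unfolding is_colimit_def by blast
  then show ?thesis
    using assms(6-8) by (metis (no_types, lifting))
qed

lemma is_colimit_cong:
  assumes "is_colimit J C D V c"
    and "\<And>i. i \<in> Ob J \<Longrightarrow> FO D i = FO D' i"
    and "\<And>i j u. \<lbrakk>i \<in> Ob J; j \<in> Ob J; u \<in> Hom J i j\<rbrakk> \<Longrightarrow> FA D i j u = FA D' i j u"
    and "\<And>i. i \<in> Ob J \<Longrightarrow> c i = c' i"
  shows "is_colimit J C D' V c'"
proof -
  have *: "is_cocone J C D W d \<longleftrightarrow> is_cocone J C D' W d" for W d
    using assms(2,3) by (simp add: is_cocone_def)
  have **: "is_cocone J C D' V c \<longleftrightarrow> is_cocone J C D' V c'"
    using assms(4) by (simp add: is_cocone_def)
  show ?thesis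
    using assms(1) * ** unfolding is_colimit_def using assms(2,4) by simp
qed

section \<open>Restriction categories\<close>

lemma Total_sel [simp]:
  "Ob (Total X) = Ob X" "f \<in> Hom (Total X) A B \<longleftrightarrow> is_total X A B f"
  "Comp (Total X) = Comp X" "Idt (Total X) = Idt X"
  by (simp_all add: Total_def)

lemma is_total_Hom: "is_total X A B f \<Longrightarrow> f \<in> Hom X A B"
  by (simp add: is_total_def)

lemma rCAT_sel [simp]:
  "F \<in> Ob (rCAT X Y) \<longleftrightarrow> is_restriction_functor X Y F"
  "\<alpha> \<in> Hom (rCAT X Y) F G \<longleftrightarrow> is_restriction_trans X Y F G \<alpha>"
  "Comp (rCAT X Y) F G H \<beta> \<alpha> = (\<lambda>A\<in>Ob X. Comp Y (FO F A) (FO G A) (FO H A) (\<beta> A) (\<alpha> A))"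
  "Idt (rCAT X Y) F = (\<lambda>A\<in>Ob X. Idt Y (FO F A))"
  by (simp_all add: rCAT_def)

lemma rCocomp_sel [simp]:
  "F \<in> Ob (rCocomp U Y Z) \<longleftrightarrow> is_restriction_functor Y Z F \<and> cocontinuous U Y Z F"
  "Hom (rCocomp U Y Z) = Hom (rCAT Y Z)" "Comp (rCocomp U Y Z) = Comp (rCAT Y Z)"
  "Idt (rCocomp U Y Z) = Idt (rCAT Y Z)"
  by (simp_all add: rCocomp_def)

lemma restriction_functorD:
  assumes "is_restriction_functor X Y F"
  shows "is_functor X Y F"
    and "A \<in> Ob X \<Longrightarrow> FO F A \<in> Ob Y"
    and "\<lbrakk>A \<in> Ob X; B \<in> Ob X; f \<in> Hom X A B\<rbrakk> \<Longrightarrow> FA F A B f \<in> Hom Y (FO F A) (FO F B)"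
    and "A \<in> Ob X \<Longrightarrow> FA F A A (Idt X A) = Idt Y (FO F A)"
    and "\<lbrakk>A \<in> Ob X; B \<in> Ob X; D \<in> Ob X; f \<in> Hom X A B; g \<in> Hom X B D\<rbrakk> \<Longrightarrow>
      FA F A D (Comp X A B D g f) = Comp Y (FO F A) (FO F B) (FO F D) (FA F B D g) (FA F A B f)"
    and "\<lbrakk>A \<in> Ob X; B \<in> Ob X; f \<in> Hom X A B\<rbrakk> \<Longrightarrow>
      FA F A A (Rst X A B f) = Rst Y (FO F A) (FO F B) (FA F A B f)"
  using assms is_functorD[of X Y F] unfolding is_restriction_functor_def by auto

lemma restriction_functor_total:
  assumes "is_restriction_functor X Y F" "A \<in> Ob X" "B \<in> Ob X" "is_total X A B f"
  shows "is_total Y (FO F A) (FO F B) (FA F A B f)"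
  using assms(2-4) restriction_functorD[OF assms(1)]
  by (metis is_total_def)

lemma restriction_transD:
  assumes "is_restriction_trans X Y F G \<alpha>"
  shows "A \<in> Ob X \<Longrightarrow> is_total Y (FO F A) (FO G A) (\<alpha> A)"
    and "A \<in> Ob X \<Longrightarrow> \<alpha> A \<in> Hom Y (FO F A) (FO G A)"
    and "\<lbrakk>A \<in> Ob X; B \<in> Ob X; f \<in> Hom X A B\<rbrakk> \<Longrightarrow>
      Comp Y (FO F A) (FO F B) (FO G B) (\<alpha> B) (FA F A B f)
        = Comp Y (FO F A) (FO G A) (FO G B) (FA G A B f) (\<alpha> A)"
    and "\<alpha> \<in> extensional (Ob X)"
  using assms unfolding is_restriction_trans_def is_nat_trans_def by auto

lemma restriction_transI:
  assumes "\<alpha> \<in> extensional (Ob X)"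
    and "\<And>A. A \<in> Ob X \<Longrightarrow> is_total Y (FO F A) (FO G A) (\<alpha> A)"
    and "\<And>A B f. \<lbrakk>A \<in> Ob X; B \<in> Ob X; f \<in> Hom X A B\<rbrakk> \<Longrightarrow>
      Comp Y (FO F A) (FO F B) (FO G B) (\<alpha> B) (FA F A B f)
        = Comp Y (FO F A) (FO G A) (FO G B) (FA G A B f) (\<alpha> A)"
  shows "is_restriction_trans X Y F G \<alpha>"
  using assms unfolding is_restriction_trans_def is_nat_trans_def by (auto simp: is_total_Hom)

context restriction_category
begin

declare Rst_in [simp] R1 [simp]

lemma Rst_Idt [simp]: "A \<in> Ob X \<Longrightarrow> Rst X A A (Idt X A) = Idt X A"
  by (metis Idt_in Idt_left R1 Rst_in)

lemma total_Idt [simp]: "A \<in> Ob X \<Longrightarrow> is_total X A A (Idt X A)"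
  by (simp add: is_total_def)

lemma Rst_Rst [simp]:
  "\<lbrakk>A \<in> Ob X; B \<in> Ob X; f \<in> Hom X A B\<rbrakk> \<Longrightarrow> Rst X A A (Rst X A B f) = Rst X A B f"
  using R3[of A B A f "Idt X A"] by simp

lemma Rst_idem [simp]:
  "\<lbrakk>A \<in> Ob X; B \<in> Ob X; f \<in> Hom X A B\<rbrakk> \<Longrightarrow>
    Comp X A A A (Rst X A B f) (Rst X A B f) = Rst X A B f"
  using R3[of A B B f f] by simp

lemma restriction_idempotent_Rst [simp]:
  "\<lbrakk>A \<in> Ob X; B \<in> Ob X; f \<in> Hom X A B\<rbrakk> \<Longrightarrow> restriction_idempotent X A (Rst X A B f)"
  by (simp add: restriction_idempotent_def)

lemma Rst_Comp_left:
  assumes "A \<in> Ob X" "B \<in> Ob X" "D \<in> Ob X" "f \<in> Hom X A B" "g \<in> Hom X B D"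
  shows "Rst X A B (Comp X A B B (Rst X B D g) f) = Rst X A D (Comp X A B D g f)"
proof -
  let ?gf = "Comp X A B D g f"
  have "Comp X A A D ?gf (Rst X A B f) = ?gf"
    using assms by (simp add: Comp_assoc[symmetric])
  then have "Comp X A A A (Rst X A D ?gf) (Rst X A B f) = Rst X A D ?gf"
    using R3[of A B D f ?gf] assms by simp
  moreover have "Rst X A B (Comp X A B B (Rst X B D g) f)
      = Comp X A A A (Rst X A B f) (Rst X A D ?gf)"
    using R3[of A D B ?gf f] R4[of A B D f g] assms by simp
  ultimately show ?thesis
    using R2[of A B D f ?gf] assms by simp
qed

lemma Rst_Comp_total:
  assumes "A \<in> Ob X" "B \<in> Ob X" "D \<in> Ob X" "f \<in> Hom X A B" "is_total X B D g"
  shows "Rst X A D (Comp X A B D g f) = Rst X A B f"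
  using Rst_Comp_left[of A B D f g] assms by (simp add: is_total_def)

lemma total_Comp:
  assumes "A \<in> Ob X" "B \<in> Ob X" "D \<in> Ob X" "is_total X A B f" "is_total X B D g"
  shows "is_total X A D (Comp X A B D g f)"
  using Rst_Comp_total[of A B D f g] assms by (simp add: is_total_def)

lemma total_right_factor:
  assumes "A \<in> Ob X" "B \<in> Ob X" "D \<in> Ob X" "f \<in> Hom X A B" "g \<in> Hom X B D"
    and "is_total X A D (Comp X A B D g f)"
  shows "is_total X A B f"
proof -
  have "Comp X A A D (Comp X A B D g f) (Rst X A B f) = Comp X A B D g f"
    using assms by (simp add: Comp_assoc[symmetric])
  then show ?thesis
    using R3[of A B D f "Comp X A B D g f"] assms
    by (simp add: is_total_def)
qed

lemma category_Total: "category (Total X)"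
  by unfold_locales (auto simp: total_Comp is_total_Hom Comp_assoc)

lemma splits_as_total:
  assumes "A \<in> Ob X" "splits_as X A e Z m r"
  shows "is_total X Z A m"
  using assms total_right_factor[of Z A Z m r] by (auto simp: splits_as_def)

lemma splits_as_Rst:
  assumes "A \<in> Ob X" "splits_as X A e Z m r" "restriction_idempotent X A e"
  shows "Rst X A Z r = e"
  using Rst_Comp_total[of A Z A r m] splits_as_total[OF assms(1,2)] assms
  by (auto simp: splits_as_def restriction_idempotent_def)

end

lemma restriction_functor_comp:
  assumes "restriction_category X" "is_restriction_functor X Y F" "is_restriction_functor Y Z G"
  shows "is_restriction_functor X Z (comp_ftor X G F)"
proof -
  interpret restriction_category X by fact
  note F = restriction_functorD[OF assms(2)] and G = restriction_functorD[OF assms(3)]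
  show ?thesis
    using is_functor_comp[OF category_axioms F(1) G(1)]
    unfolding is_restriction_functor_def by (simp add: F(2-) G(2-))
qed

lemma category_rCAT:
  assumes "restriction_category Y"
  shows "category (rCAT X Y)"
proof -
  interpret Y: restriction_category Y by fact
  show ?thesis
  proof (unfold_locales, goal_cases)
    case (1 F)
    then show ?case
      using restriction_functorD[of X Y F] by (auto intro!: restriction_transI)
  next
    case (2 F G H \<alpha> \<beta>)
    then have F: "is_restriction_functor X Y F" "is_restriction_functor X Y G"
      "is_restriction_functor X Y H" and a: "is_restriction_trans X Y F G \<alpha>"
      "is_restriction_trans X Y G H \<beta>" by simp_all
    note F0 = F[THEN restriction_functorD(2)] and F1 = F[THEN restriction_functorD(3)]
    note a0 = a[THEN restriction_transD(1)] and a1 = a[THEN restriction_transD(2)]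
      and a2 = a[THEN restriction_transD(3)]
    show ?case
      unfolding rCAT_sel
    proof (rule restriction_transI)
      fix A B f assume *: "A \<in> Ob X" "B \<in> Ob X" "f \<in> Hom X A B"
      have "Comp Y (FO F A) (FO F B) (FO H B) (Comp Y (FO F B) (FO G B) (FO H B) (\<beta> B) (\<alpha> B)) (FA F A B f)
        = Comp Y (FO F A) (FO G B) (FO H B) (\<beta> B) (Comp Y (FO F A) (FO G A) (FO G B) (FA G A B f) (\<alpha> A))"
        using * by (simp add: F0 F1 a1 a2[symmetric] Y.Comp_assoc)
      also have "\<dots> = Comp Y (FO F A) (FO G A) (FO H B)
          (Comp Y (FO G A) (FO H A) (FO H B) (FA H A B f) (\<beta> A)) (\<alpha> A)"
        using * by (simp add: F0 F1 a1 a2(2)[symmetric] Y.Comp_assoc)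
      also have "\<dots> = Comp Y (FO F A) (FO H A) (FO H B) (FA H A B f)
          (Comp Y (FO F A) (FO G A) (FO H A) (\<beta> A) (\<alpha> A))"
        using * by (simp add: F0 F1 a1 Y.Comp_assoc)
      finally show "Comp Y (FO F A) (FO F B) (FO H B)
          ((\<lambda>A\<in>Ob X. Comp Y (FO F A) (FO G A) (FO H A) (\<beta> A) (\<alpha> A)) B) (FA F A B f)
        = Comp Y (FO F A) (FO H A) (FO H B) (FA H A B f)
          ((\<lambda>A\<in>Ob X. Comp Y (FO F A) (FO G A) (FO H A) (\<beta> A) (\<alpha> A)) A)"
        using * by simp
    qed (simp_all add: a0 F0 Y.total_Comp)
  next
    case (3 F G \<alpha>)
    then show ?case
      using restriction_functorD(2)[of X Y] restriction_transD(2,4)[of X Y F G \<alpha>]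
      by (auto simp: fun_eq_iff extensional_def)
  next
    case (4 F G \<alpha>)
    then show ?case
      using restriction_functorD(2)[of X Y] restriction_transD(2,4)[of X Y F G \<alpha>]
      by (auto simp: fun_eq_iff extensional_def)
  next
    case (5 F G H I \<alpha> \<beta> \<gamma>)
    then show ?case
      using restriction_functorD(2)[of X Y] restriction_transD(2)[of X Y]
      by (auto simp: fun_eq_iff Y.Comp_assoc)
  qed
qed

text \<open>
  Isomorphisms of a restriction category are total, so the inverse components form a restriction
  transformation.
\<close>

lemma rCAT_iso:
  assumes Y: "restriction_category Y"
    and F: "is_restriction_functor X Y F" and G: "is_restriction_functor X Y G"
    and \<alpha>: "is_restriction_trans X Y F G \<alpha>"
    and iso: "\<And>A. A \<in> Ob X \<Longrightarrow> is_iso Y (FO F A) (FO G A) (\<alpha> A)"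
  shows "is_iso (rCAT X Y) F G \<alpha>"
proof -
  interpret Y: restriction_category Y by fact
  note F' = restriction_functorD[OF F] and G' = restriction_functorD[OF G]
    and a = restriction_transD[OF \<alpha>]
  obtain \<beta>0 where b: "\<And>A. A \<in> Ob X \<Longrightarrow> \<beta>0 A \<in> Hom Y (FO G A) (FO F A)"
    and ba: "\<And>A. A \<in> Ob X \<Longrightarrow> Comp Y (FO F A) (FO G A) (FO F A) (\<beta>0 A) (\<alpha> A) = Idt Y (FO F A)"
    and ab: "\<And>A. A \<in> Ob X \<Longrightarrow> Comp Y (FO G A) (FO F A) (FO G A) (\<alpha> A) (\<beta>0 A) = Idt Y (FO G A)"
    using iso unfolding is_iso_def by metis
  have bt: "is_total Y (FO G A) (FO F A) (\<beta>0 A)" if "A \<in> Ob X" for A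
    using Y.total_right_factor[of "FO G A" "FO F A" "FO G A" "\<beta>0 A" "\<alpha> A"] that b ab a F' G' by simp
  let ?b = "restrict \<beta>0 (Ob X)"
  have "is_restriction_trans X Y G F ?b"
  proof (rule restriction_transI)
    fix A B f assume *: "A \<in> Ob X" "B \<in> Ob X" "f \<in> Hom X A B"
    note [simp] = * F'(2,3) G'(2,3) b a(2)
    have "Comp Y (FO G A) (FO G B) (FO F B) (\<beta>0 B) (FA G A B f)
      = Comp Y (FO G A) (FO G B) (FO F B) (\<beta>0 B) (Comp Y (FO G A) (FO F A) (FO G B)
          (Comp Y (FO F A) (FO G A) (FO G B) (FA G A B f) (\<alpha> A)) (\<beta>0 A))"
      by (simp add: Y.Comp_assoc[symmetric] ab)
    also have "\<dots> = Comp Y (FO G A) (FO F A) (FO F B)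
          (Comp Y (FO F A) (FO F B) (FO F B) (Comp Y (FO F B) (FO G B) (FO F B) (\<beta>0 B) (\<alpha> B)) (FA F A B f)) (\<beta>0 A)"
      unfolding a(3)[OF *, symmetric] by (simp add: Y.Comp_assoc)
    finally show "Comp Y (FO G A) (FO G B) (FO F B) (?b B) (FA G A B f)
      = Comp Y (FO G A) (FO F A) (FO F B) (FA F A B f) (?b A)"
      by (simp add: ba)
  qed (use bt in simp_all)
  then show ?thesis
    unfolding is_iso_def using \<alpha> by (auto intro!: bexI[of _ ?b] simp: ba ab fun_eq_iff)
qed

lemma category_rCocomp:
  assumes "restriction_category Z"
  shows "category (rCocomp U Y Z)"
  unfolding rCocomp_def
  using category.full_subcategory_category[OF category_rCAT[OF assms]] .

lemma is_functor_precomp: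
  assumes "restriction_category X" "is_restriction_functor X Y L" "restriction_category Z"
  shows "is_functor (rCocomp U Y Z) (rCAT X Z) (precomp (rCocomp U Y Z) X L)"
proof -
  interpret X: restriction_category X by fact
  note L = restriction_functorD[OF assms(2)]
  show ?thesis
    unfolding precomp_def
  proof (rule is_functor_mk_ftor, goal_cases)
    case 1
    show ?case by (rule category_rCocomp[OF assms(3)])
  next
    case (2 F)
    then show ?case
      by (simp add: restriction_functor_comp[OF assms(1,2)])
  next
    case (3 F G \<alpha>)
    then have a: "is_restriction_trans Y Z F G \<alpha>" by simp
    show ?case
      unfolding rCAT_sel
      by (rule restriction_transI) (simp_all add: restriction_transD[OF a] L)
  qed (auto simp: fun_eq_iff L)
qed

lemma restriction_trans_comp_iff:
  assumes "is_restriction_functor X Y L"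
  shows "is_restriction_trans X Z (comp_ftor X F L) (comp_ftor X G L) \<alpha> \<longleftrightarrow>
     \<alpha> \<in> extensional (Ob X) \<and>
     (\<forall>A\<in>Ob X. is_total Z (FO F (FO L A)) (FO G (FO L A)) (\<alpha> A)) \<and>
     (\<forall>A\<in>Ob X. \<forall>B\<in>Ob X. \<forall>f\<in>Hom X A B.
        Comp Z (FO F (FO L A)) (FO F (FO L B)) (FO G (FO L B)) (\<alpha> B) (FA F (FO L A) (FO L B) (FA L A B f))
          = Comp Z (FO F (FO L A)) (FO G (FO L A)) (FO G (FO L B)) (FA G (FO L A) (FO L B) (FA L A B f)) (\<alpha> A))"
  unfolding is_restriction_trans_def is_nat_trans_def by (auto simp: is_total_def)

section \<open>Splitting the restriction idempotents\<close>

lemma K_r_sel [simp]: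
  "(A, e) \<in> Ob (K_r X) \<longleftrightarrow> A \<in> Ob X \<and> restriction_idempotent X A e"
  "Comp (K_r X) (A, e) (B, d) (D, c) g f = Comp X A B D g f"
  "Idt (K_r X) (A, e) = e"
  "Rst (K_r X) (A, e) (B, d) f = Rst X A B f"
  by (simp_all add: K_r_def)

lemma J_emb_sel [simp]:
  "A \<in> Ob X \<Longrightarrow> FO (J_emb X) A = (A, Idt X A)"
  "\<lbrakk>A \<in> Ob X; B \<in> Ob X; f \<in> Hom X A B\<rbrakk> \<Longrightarrow> FA (J_emb X) A B f = f"
  by (simp_all add: J_emb_def)

context restriction_category
begin

lemma restriction_idempotentD:
  assumes "restriction_idempotent X A e"
  shows "e \<in> Hom X A A" "Rst X A A e = e" "A \<in> Ob X \<Longrightarrow> Comp X A A A e e = e"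
  using assms Rst_idem[of A A e] by (auto simp: restriction_idempotent_def)

lemma K_r_Hom:
  assumes "restriction_idempotent X A e" "restriction_idempotent X B d" "A \<in> Ob X" "B \<in> Ob X"
  shows "f \<in> Hom (K_r X) (A, e) (B, d) \<longleftrightarrow>
    f \<in> Hom X A B \<and> Comp X A A B f e = f \<and> Comp X A B B d f = f"
proof -
  note e = restriction_idempotentD[OF assms(1)] restriction_idempotentD[OF assms(2)]
  have "Comp X A A B f e = f \<and> Comp X A B B d f = f"
    if f: "f \<in> Hom X A B" "Comp X A B B d (Comp X A A B f e) = f"
  proof
    have "Comp X A B B d (Comp X A B B d (Comp X A A B f e)) = Comp X A B B d (Comp X A A B f e)"
      using e assms f(1) by (simp add: Comp_assoc)
    then show "Comp X A B B d f = f"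
      using f by simp
    have "Comp X A A B (Comp X A B B d (Comp X A A B f e)) e = Comp X A B B d (Comp X A A B f e)"
      using e assms f(1) by (simp add: Comp_assoc[symmetric])
    then show "Comp X A A B f e = f"
      using f by simp
  qed
  then show ?thesis
    by (auto simp: K_r_def)
qed

lemma K_r_Hom_full: "\<lbrakk>A \<in> Ob X; B \<in> Ob X\<rbrakk> \<Longrightarrow>
    f \<in> Hom (K_r X) (A, Idt X A) (B, Idt X B) \<longleftrightarrow> f \<in> Hom X A B"
  by (auto simp: K_r_Hom restriction_idempotent_def)

lemma restriction_category_K_r: "restriction_category (K_r X)"
proof (unfold_locales, goal_cases)
  case (1 A)
  then show ?case
    by (cases A) (auto simp: K_r_Hom restriction_idempotentD)
next
  case (2 A B D f g)
  then show ?case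
    by (cases A; cases B; cases D) (auto simp: K_r_Hom restriction_idempotentD Comp_assoc,
      simp add: Comp_assoc[symmetric] restriction_idempotentD)
next
  case (3 A B f)
  then show ?case
    by (cases A; cases B) (auto simp: K_r_Hom)
next
  case (4 A B f)
  then show ?case
    by (cases A; cases B) (auto simp: K_r_Hom)
next
  case (5 A B D E f g h)
  then show ?case
    by (cases A; cases B; cases D; cases E) (auto simp: K_r_Hom Comp_assoc)
next
  case (6 A B f)
  obtain a e b d where [simp]: "A = (a, e)" "B = (b, d)" by fastforce
  from 6 have *: "a \<in> Ob X" "b \<in> Ob X" "restriction_idempotent X a e" "restriction_idempotent X b d"
    "f \<in> Hom X a b" "Comp X a a b f e = f"
    by (auto simp: K_r_Hom)
  have "Comp X a a a (Rst X a b f) e = Rst X a b f"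
    using R3[of a a b e f] * restriction_idempotentD[OF *(3)] by simp
  moreover from this have "Comp X a a a e (Rst X a b f) = Rst X a b f"
    using R2[of a a b e f] * restriction_idempotentD[OF *(3)] by simp
  ultimately show ?case
    using * by (simp add: K_r_Hom)
next
  case (7 A B f)
  then show ?case
    by (cases A; cases B) (auto simp: K_r_Hom)
next
  case (8 A B D f g)
  then show ?case
    by (cases A; cases B; cases D) (auto simp: K_r_Hom intro: R2)
next
  case (9 A B D f g)
  then show ?case
    by (cases A; cases B; cases D) (auto simp: K_r_Hom intro: R3)
next
  case (10 A B D f g)
  then show ?case
    by (cases A; cases B; cases D) (auto simp: K_r_Hom intro: R4)
qed

lemma split_K_r: "split (K_r X)"
  unfolding split_def
proof (intro ballI allI impI)
  fix A d assume A: "A \<in> Ob (K_r X)" "restriction_idempotent (K_r X) A d"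
  obtain a e where [simp]: "A = (a, e)" by fastforce
  from A have *: "a \<in> Ob X" "restriction_idempotent X a e" "restriction_idempotent X a d"
    "Comp X a a a d e = d" "Comp X a a a e d = d"
    by (auto simp: restriction_idempotent_def K_r_Hom)
  then have "splits_as (K_r X) A d (a, d) d d"
    by (simp add: splits_as_def K_r_Hom restriction_idempotentD)
  then show "\<exists>Z m r. splits_as (K_r X) A d Z m r" by blast
qed

lemma locally_small_K_r: "locally_small U X \<Longrightarrow> locally_small U (K_r X)"
  by (auto simp: locally_small_def K_r_def elim!: ballE intro: small_subset)

lemma restriction_functor_J: "is_restriction_functor X (K_r X) (J_emb X)"
  unfolding is_restriction_functor_def
  by (auto simp: J_emb_def K_r_Hom_full restriction_idempotent_def intro!: is_functor_mk_ftor category_axioms)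

end

text \<open>
  Each \<open>(A, e)\<close> is a retract of \<open>J A\<close>, with both legs given by \<open>e\<close> itself; so a transformation
  is determined on \<open>(A, e)\<close> by its component at \<open>J A\<close>.
\<close>

lemma K_r_retract:
  assumes "restriction_category X" "A \<in> Ob X" "restriction_idempotent X A e"
  shows "e \<in> Hom (K_r X) (A, e) (A, Idt X A)" "e \<in> Hom (K_r X) (A, Idt X A) (A, e)"
    "e \<in> Hom (K_r X) (A, Idt X A) (A, Idt X A)"
    "Comp X A A A e e = e" "Rst X A A e = e" "restriction_idempotent X A (Idt X A)"
proof -
  interpret restriction_category X by fact
  note * = restriction_idempotentD[OF assms(3)]
  show 1: "restriction_idempotent X A (Idt X A)" using assms by (simp add: restriction_idempotent_def)
  show "e \<in> Hom (K_r X) (A, e) (A, Idt X A)" "e \<in> Hom (K_r X) (A, Idt X A) (A, e)"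
    "e \<in> Hom (K_r X) (A, Idt X A) (A, Idt X A)"
    "Comp X A A A e e = e" "Rst X A A e = e"
    using assms 1 * by (simp_all add: K_r_Hom)
qed

lemma restriction_trans_K_r_eqI:
  assumes X: "restriction_category X" and Y: "restriction_category Y"
    and F: "is_restriction_functor (K_r X) Y F" and G: "is_restriction_functor (K_r X) Y G"
    and \<alpha>: "is_restriction_trans (K_r X) Y F G \<alpha>" and \<beta>: "is_restriction_trans (K_r X) Y F G \<beta>"
    and eq: "\<And>A. A \<in> Ob X \<Longrightarrow> \<alpha> (A, Idt X A) = \<beta> (A, Idt X A)"
  shows "\<alpha> = \<beta>"
proof (rule extensionalityI[OF restriction_transD(4)[OF \<alpha>] restriction_transD(4)[OF \<beta>]])
  interpret X: restriction_category X by fact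
  interpret Y: restriction_category Y by fact
  note F' = restriction_functorD[OF F] and G' = restriction_functorD[OF G]
  fix D assume "D \<in> Ob (K_r X)"
  then obtain A e where D: "D = (A, e)" and *: "A \<in> Ob X" "restriction_idempotent X A e"
    by (cases D) auto
  note r = K_r_retract[OF X *]
  have "\<gamma> (A, e) = Comp Y (FO F (A, e)) (FO F (A, Idt X A)) (FO G (A, e))
      (Comp Y (FO F (A, Idt X A)) (FO G (A, Idt X A)) (FO G (A, e)) (FA G (A, Idt X A) (A, e) e)
         (\<gamma> (A, Idt X A))) (FA F (A, e) (A, Idt X A) e)"
    if \<gamma>: "is_restriction_trans (K_r X) Y F G \<gamma>" for \<gamma>
  proof -
    have "Comp Y (FO F (A, e)) (FO F (A, Idt X A)) (FO F (A, e))
        (FA F (A, Idt X A) (A, e) e) (FA F (A, e) (A, Idt X A) e) = Idt Y (FO F (A, e))"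
      using F'(5)[of "(A, e)" "(A, Idt X A)" "(A, e)" e e] F'(4)[of "(A, e)"] * r by simp
    then show ?thesis
      using * r F'(2,3) G'(2,3) restriction_transD(2)[OF \<gamma>]
      by (simp add: Y.Comp_assoc[symmetric] restriction_transD(3)[OF \<gamma>, symmetric])
  qed
  from this[OF \<alpha>] this[OF \<beta>] show "\<alpha> D = \<beta> D"
    using eq[OF *(1)] by (simp add: D)
qed

lemma restriction_trans_extend_K_r:
  assumes X: "restriction_category X" and Y: "restriction_category Y"
    and F: "is_restriction_functor (K_r X) Y F" and G: "is_restriction_functor (K_r X) Y G"
    and \<alpha>: "is_restriction_trans X Y (comp_ftor X F (J_emb X)) (comp_ftor X G (J_emb X)) \<alpha>"
  obtains \<beta> where "is_restriction_trans (K_r X) Y F G \<beta>"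
    "\<And>A. A \<in> Ob X \<Longrightarrow> \<beta> (A, Idt X A) = \<alpha> A"
proof -
  interpret X: restriction_category X by fact
  interpret K: restriction_category "K_r X" by (rule X.restriction_category_K_r)
  interpret Y: restriction_category Y by fact
  note F' = restriction_functorD[OF F] and G' = restriction_functorD[OF G]
  note R = X.restriction_idempotentD
  let ?J = "\<lambda>A. (A, Idt X A)"
  have J: "restriction_idempotent X A (Idt X A)" if "A \<in> Ob X" for A
    using that by (simp add: restriction_idempotent_def)
  have a0: "is_total Y (FO F (?J A)) (FO G (?J A)) (\<alpha> A)" if "A \<in> Ob X" for A
    using \<alpha> that unfolding restriction_trans_comp_iff[OF X.restriction_functor_J] by simp
  then have a1: "\<alpha> A \<in> Hom Y (FO F (?J A)) (FO G (?J A))" if "A \<in> Ob X" for A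
    using that by (simp add: is_total_Hom)
  have a2: "Comp Y (FO F (?J A)) (FO F (?J B)) (FO G (?J B)) (\<alpha> B) (FA F (?J A) (?J B) f)
      = Comp Y (FO F (?J A)) (FO G (?J A)) (FO G (?J B)) (FA G (?J A) (?J B) f) (\<alpha> A)"
    if "A \<in> Ob X" "B \<in> Ob X" "f \<in> Hom X A B" for A B f
    using \<alpha> that unfolding restriction_trans_comp_iff[OF X.restriction_functor_J] by simp
  define \<beta>0 where "\<beta>0 = (\<lambda>(A, e).
      Comp Y (FO F (A, e)) (FO G (?J A)) (FO G (A, e)) (FA G (?J A) (A, e) e)
        (Comp Y (FO F (A, e)) (FO F (?J A)) (FO G (?J A)) (\<alpha> A) (FA F (A, e) (?J A) e)))"
  define \<beta> where "\<beta> = restrict \<beta>0 (Ob (K_r X))"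
  show thesis
  proof (rule that[of \<beta>])
    fix A assume A: "A \<in> Ob X"
    then show "\<beta> (A, Idt X A) = \<alpha> A"
      using F'(4)[of "?J A"] G'(4)[of "?J A"] J[OF A] a1[OF A] F'(2)[of "?J A"] G'(2)[of "?J A"]
      by (simp add: \<beta>_def \<beta>0_def)
  next
    show "is_restriction_trans (K_r X) Y F G \<beta>"
    proof (rule restriction_transI)
      show "\<beta> \<in> extensional (Ob (K_r X))" by (simp add: \<beta>_def)
    next
      fix D assume D: "D \<in> Ob (K_r X)"
      then obtain A e where [simp]: "D = (A, e)" and *: "A \<in> Ob X" "restriction_idempotent X A e"
        by (cases D) auto
      note r = K_r_retract[OF X *] and R = R[OF *(2)]
      let ?m = "FA F D (?J A) e" and ?r = "FA G (?J A) D e"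
      have m: "is_total Y (FO F D) (FO F (?J A)) ?m"
        using * r J R by (intro restriction_functor_total[OF F]) (simp_all add: is_total_def)
      then have m': "?m \<in> Hom Y (FO F D) (FO F (?J A))" by (simp add: is_total_Hom)
      let ?am = "Comp Y (FO F D) (FO F (?J A)) (FO G (?J A)) (\<alpha> A) ?m"
      have am: "is_total Y (FO F D) (FO G (?J A)) ?am"
        using m a0 * J F'(2) G'(2) by (intro Y.total_Comp) simp_all
      have "Rst Y (FO G (?J A)) (FO G D) ?r = FA G (?J A) (?J A) e"
        using G'(6)[of "?J A" "(A, e)" e] r * J R by simp
      then have "Comp Y (FO F D) (FO G (?J A)) (FO G (?J A)) (Rst Y (FO G (?J A)) (FO G D) ?r) ?am
         = Comp Y (FO F D) (FO F (?J A)) (FO G (?J A)) 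
            (Comp Y (FO F (?J A)) (FO F (?J A)) (FO G (?J A)) (\<alpha> A) (FA F (?J A) (?J A) e)) ?m"
        using * J r R m' a1 F'(2,3) G'(2,3) by (simp add: Y.Comp_assoc a2)
      also have "\<dots> = Comp Y (FO F D) (FO F (?J A)) (FO G (?J A)) (\<alpha> A)
          (Comp Y (FO F D) (FO F (?J A)) (FO F (?J A)) (FA F (?J A) (?J A) e) ?m)"
        using * J r R m' a1 F'(2,3) G'(2,3) by (simp add: Y.Comp_assoc)
      also have "\<dots> = ?am"
        using F'(5)[of "(A, e)" "?J A" "?J A" e e] * J r R by simp
      finally have "Rst Y (FO F D) (FO G D) (Comp Y (FO F D) (FO G (?J A)) (FO G D) ?r ?am)
        = Rst Y (FO F D) (FO G (?J A)) ?am"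
        using Y.Rst_Comp_left[of "FO F D" "FO G (?J A)" "FO G D" ?am ?r] * J r R F'(2) G'(2,3) am
        by (simp add: is_total_Hom)
      then show "is_total Y (FO F D) (FO G D) (\<beta> D)"
        using am * J r R F'(2) G'(2,3) by (simp add: \<beta>_def \<beta>0_def is_total_def)
    next
      fix D D' f assume D: "D \<in> Ob (K_r X)" "D' \<in> Ob (K_r X)" and f: "f \<in> Hom (K_r X) D D'"
      then obtain A e A' e' where [simp]: "D = (A, e)" "D' = (A', e')"
        and *: "A \<in> Ob X" "restriction_idempotent X A e" "A' \<in> Ob X" "restriction_idempotent X A' e'"
        by (cases D; cases D') auto
      note r = K_r_retract[OF X *(1,2)] K_r_retract[OF X *(3,4)] and R = R[OF *(2)] R[OF *(4)]
      note [simp] = * J F'(2,3) G'(2,3) a1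
      have f': "f \<in> Hom X A A'" "Comp X A A A' f e = f" "Comp X A A' A' e' f = f"
        using f by (simp_all add: X.K_r_Hom)
      have fK: "f \<in> Hom (K_r X) (?J A) (?J A')" "f \<in> Hom (K_r X) D (?J A')" "f \<in> Hom (K_r X) (?J A) D'"
        using f' by (simp_all add: X.K_r_Hom)
      note [simp] = f fK r
      have 1: "Comp Y (FO F D) (FO F D') (FO F (?J A')) (FA F D' (?J A') e') (FA F D D' f)
          = Comp Y (FO F D) (FO F (?J A)) (FO F (?J A')) (FA F (?J A) (?J A') f) (FA F D (?J A) e)"
        using F'(5)[of D D' "?J A'" f e'] F'(5)[of D "?J A" "?J A'" e f] f f' by simp
      have 2: "Comp Y (FO G (?J A)) (FO G (?J A')) (FO G D') (FA G (?J A') D' e') (FA G (?J A) (?J A') f)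
          = Comp Y (FO G (?J A)) (FO G D) (FO G D') (FA G D D' f) (FA G (?J A) D e)"
        using G'(5)[of "?J A" "?J A'" D' f e'] G'(5)[of "?J A" D D' e f] f f' by simp
      have "Comp Y (FO F D) (FO F D') (FO G D') (\<beta> D') (FA F D D' f)
        = Comp Y (FO F D) (FO G (?J A')) (FO G D') (FA G (?J A') D' e')
           (Comp Y (FO F D) (FO F (?J A')) (FO G (?J A')) (\<alpha> A')
             (Comp Y (FO F D) (FO F D') (FO F (?J A')) (FA F D' (?J A') e') (FA F D D' f)))"
        using f by (simp add: \<beta>_def \<beta>0_def Y.Comp_assoc)
      also have "\<dots> = Comp Y (FO F D) (FO G (?J A')) (FO G D') (FA G (?J A') D' e')
           (Comp Y (FO F D) (FO F (?J A)) (FO G (?J A')) 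
             (Comp Y (FO F (?J A)) (FO F (?J A')) (FO G (?J A')) (\<alpha> A') (FA F (?J A) (?J A') f))
               (FA F D (?J A) e))"
        unfolding 1 by (simp add: Y.Comp_assoc)
      also have "\<dots> = Comp Y (FO F D) (FO G (?J A)) (FO G D')
           (Comp Y (FO G (?J A)) (FO G (?J A')) (FO G D') (FA G (?J A') D' e') (FA G (?J A) (?J A') f))
           (Comp Y (FO F D) (FO F (?J A)) (FO G (?J A)) (\<alpha> A) (FA F D (?J A) e))"
        using f'(1) by (simp add: a2 Y.Comp_assoc)
      also have "\<dots> = Comp Y (FO F D) (FO G D) (FO G D') (FA G D D' f) (\<beta> D)"
        unfolding 2 using f by (simp add: Y.Comp_assoc \<beta>_def \<beta>0_def)
      finally show "Comp Y (FO F D) (FO F D') (FO G D') (\<beta> D') (FA F D D' f)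
          = Comp Y (FO F D) (FO G D) (FO G D') (FA G D D' f) (\<beta> D)" .
    qed
  qed
qed

text \<open>
  The value at \<open>(A, e)\<close> is a splitting of \<open>F e\<close>. Identities are split by identities, which makes
  the extension restrict to \<open>F\<close> on the nose.
\<close>

lemma restriction_functor_extend_K_r:
  assumes X: "restriction_category X" and Y: "restriction_category Y" and "split Y"
    and F: "is_restriction_functor X Y F"
  obtains G where "is_restriction_functor (K_r X) Y G" "comp_ftor X G (J_emb X) = F"
proof -
  interpret X: restriction_category X by fact
  interpret K: restriction_category "K_r X" by (rule X.restriction_category_K_r)
  interpret Y: restriction_category Y by fact
  note F' = restriction_functorD[OF F]
  have "\<exists>Z m r. splits_as Y (FO F A) (FA F A A e) Z m r \<and>
      (e = Idt X A \<longrightarrow> Z = FO F A \<and> m = Idt Y (FO F A) \<and> r = Idt Y (FO F A))"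
    if "A \<in> Ob X" "restriction_idempotent X A e" for A e
  proof (cases "e = Idt X A")
    case True
    then show ?thesis
      using that F'(2,4) by (auto simp: splits_as_def)
  next
    case False
    have "restriction_idempotent Y (FO F A) (FA F A A e)"
      using F'(3)[of A A e] F'(6)[of A A e] that by (simp add: restriction_idempotent_def)
    then show ?thesis
      using False \<open>split Y\<close> F'(2)[OF that(1)] unfolding split_def by blast
  qed
  then obtain Z m r where sp: "\<And>A e. \<lbrakk>A \<in> Ob X; restriction_idempotent X A e\<rbrakk> \<Longrightarrow>
      splits_as Y (FO F A) (FA F A A e) (Z (A, e)) (m (A, e)) (r (A, e))"
    and id: "\<And>A. A \<in> Ob X \<Longrightarrow> Z (A, Idt X A) = FO F A \<and> m (A, Idt X A) = Idt Y (FO F A)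
      \<and> r (A, Idt X A) = Idt Y (FO F A)"
  proof -
    assume *: "\<And>Z m r. \<lbrakk>\<And>A e. \<lbrakk>A \<in> Ob X; restriction_idempotent X A e\<rbrakk> \<Longrightarrow>
        splits_as Y (FO F A) (FA F A A e) (Z (A, e)) (m (A, e)) (r (A, e));
        \<And>A. A \<in> Ob X \<Longrightarrow> Z (A, Idt X A) = FO F A \<and> m (A, Idt X A) = Idt Y (FO F A)
      \<and> r (A, Idt X A) = Idt Y (FO F A)\<rbrakk> \<Longrightarrow> thesis"
    assume "\<And>A e. \<lbrakk>A \<in> Ob X; restriction_idempotent X A e\<rbrakk> \<Longrightarrow>
      \<exists>Z m r. splits_as Y (FO F A) (FA F A A e) Z m r \<and>
      (e = Idt X A \<longrightarrow> Z = FO F A \<and> m = Idt Y (FO F A) \<and> r = Idt Y (FO F A))"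
    then have "\<forall>D\<in>Ob (K_r X). \<exists>Z m r. splits_as Y (FO F (fst D)) (FA F (fst D) (fst D) (snd D)) Z m r \<and>
      (snd D = Idt X (fst D) \<longrightarrow> Z = FO F (fst D) \<and> m = Idt Y (FO F (fst D)) \<and> r = Idt Y (FO F (fst D)))"
      by (auto simp: K_r_def)
    then obtain Z m r where zmr: "\<And>D. D \<in> Ob (K_r X) \<Longrightarrow> splits_as Y (FO F (fst D)) (FA F (fst D) (fst D) (snd D)) (Z D) (m D) (r D) \<and>
      (snd D = Idt X (fst D) \<longrightarrow> Z D = FO F (fst D) \<and> m D = Idt Y (FO F (fst D)) \<and> r D = Idt Y (FO F (fst D)))"
      by metis
    show thesis
    proof (rule *[of Z m r])
      fix A e assume "A \<in> Ob X" "restriction_idempotent X A e"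
      then show "splits_as Y (FO F A) (FA F A A e) (Z (A, e)) (m (A, e)) (r (A, e))"
        using zmr[of "(A, e)"] by simp
    next
      fix A assume "A \<in> Ob X"
      then show "Z (A, Idt X A) = FO F A \<and> m (A, Idt X A) = Idt Y (FO F A) \<and> r (A, Idt X A) = Idt Y (FO F A)"
        using zmr[of "(A, Idt X A)"] by (simp add: restriction_idempotent_def)
    qed
  qed
  have Z [simp]: "Z (A, e) \<in> Ob Y" "m (A, e) \<in> Hom Y (Z (A, e)) (FO F A)" "r (A, e) \<in> Hom Y (FO F A) (Z (A, e))"
    and mr: "Comp Y (FO F A) (Z (A, e)) (FO F A) (m (A, e)) (r (A, e)) = FA F A A e"
    and rm: "Comp Y (Z (A, e)) (FO F A) (Z (A, e)) (r (A, e)) (m (A, e)) = Idt Y (Z (A, e))"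
    if "A \<in> Ob X" "restriction_idempotent X A e" for A e
    using sp[OF that] by (simp_all add: splits_as_def)
  note [simp] = F'(2,3)
  define G1 where "G1 = (\<lambda>(A, e) (B, d) f. Comp Y (Z (A, e)) (FO F A) (Z (B, d))
    (Comp Y (FO F A) (FO F B) (Z (B, d)) (r (B, d)) (FA F A B f)) (m (A, e)))"
  have G: "is_functor (K_r X) Y (mk_ftor (K_r X) Z G1)"
  proof (rule is_functor_mk_ftor, goal_cases)
    case 1 show ?case by (rule K.category_axioms)
  next
    case (2 D)
    then show ?case by (cases D) auto
  next
    case (3 D D' f)
    then show ?case by (cases D; cases D') (auto simp: G1_def X.K_r_Hom)
  next
    case (4 D)
    obtain A e where [simp]: "D = (A, e)" by fastforce
    have *: "A \<in> Ob X" "restriction_idempotent X A e" using 4 by simp_all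
    note R = X.restriction_idempotentD[OF *(2)]
    note [simp] = * R
    have "G1 D D (Idt (K_r X) D) = Comp Y (Z (A, e)) (FO F A) (Z (A, e))
       (Comp Y (FO F A) (FO F A) (Z (A, e)) (r (A, e)) (Comp Y (FO F A) (Z (A, e)) (FO F A) (m (A, e)) (r (A, e)))) (m (A, e))"
      by (simp add: G1_def mr)
    also have "\<dots> = Comp Y (Z (A, e)) (FO F A) (Z (A, e)) (Comp Y (FO F A) (Z (A, e)) (Z (A, e))
       (Comp Y (Z (A, e)) (FO F A) (Z (A, e)) (r (A, e)) (m (A, e))) (r (A, e))) (m (A, e))"
      by (simp add: Y.Comp_assoc)
    also have "\<dots> = Idt Y (Z D)"
      by (simp add: rm)
    finally show ?case .
  next
    case (5 D D' D'' f g)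
    obtain A e A' e' A'' e'' where [simp]: "D = (A, e)" "D' = (A', e')" "D'' = (A'', e'')" by (metis surj_pair)
    have *: "A \<in> Ob X" "restriction_idempotent X A e" "A' \<in> Ob X" "restriction_idempotent X A' e'"
      "A'' \<in> Ob X" "restriction_idempotent X A'' e''" using 5 by simp_all
    have f: "f \<in> Hom X A A'" "Comp X A A A' f e = f" "Comp X A A' A' e' f = f"
      "g \<in> Hom X A' A''" "Comp X A' A' A'' g e' = g" "Comp X A' A'' A'' e'' g = g"
      using 5 by (simp_all add: X.K_r_Hom)
    note R = X.restriction_idempotentD(1)[OF *(2)] X.restriction_idempotentD(1)[OF *(4)] X.restriction_idempotentD(1)[OF *(6)]
    note [simp] = * f(1,4) R
    have fe: "Comp Y (FO F A) (FO F A') (FO F A') (FA F A' A' e') (FA F A A' f) = FA F A A' f"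
      using F'(5)[of A A' A' f e'] f by simp
    have "Comp Y (Z D) (Z D') (Z D'') (G1 D' D'' g) (G1 D D' f)
      = Comp Y (Z D) (FO F A) (Z D'') (Comp Y (FO F A) (FO F A') (Z D'')
          (Comp Y (FO F A') (FO F A'') (Z D'') (r D'') (FA F A' A'' g)) 
           (Comp Y (FO F A) (FO F A') (FO F A')
             (Comp Y (FO F A') (Z D') (FO F A') (m D') (r D')) (FA F A A' f))) (m D)"
      unfolding G1_def by (simp add: Y.Comp_assoc)
    also have "\<dots> = G1 D D'' (Comp (K_r X) D D' D'' g f)"
      by (simp add: mr fe G1_def F'(5) Y.Comp_assoc)
    finally show ?case ..
  qed
  show thesis
  proof (rule that[of "mk_ftor (K_r X) Z G1"])
    have "G1 D D (Rst (K_r X) D D' f) = Rst Y (Z D) (Z D') (G1 D D' f)"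
      if D: "D \<in> Ob (K_r X)" "D' \<in> Ob (K_r X)" "f \<in> Hom (K_r X) D D'" for D D' f
    proof -
      obtain A e A' e' where [simp]: "D = (A, e)" "D' = (A', e')" by (metis surj_pair)
      have *: "A \<in> Ob X" "restriction_idempotent X A e" "A' \<in> Ob X" "restriction_idempotent X A' e'"
        using D by simp_all
      have f: "f \<in> Hom X A A'" "Comp X A A A' f e = f" "Comp X A A' A' e' f = f"
        using D by (simp_all add: X.K_r_Hom)
      note R = X.restriction_idempotentD[OF *(2)] X.restriction_idempotentD[OF *(4)]
      note [simp] = * f(1) R(1,2,4,5) X.restriction_idempotent_Rst
      let ?rf = "Comp Y (FO F A) (FO F A') (Z D') (r D') (FA F A A' f)"
      \<comment> \<open>The retraction of \<open>F e'\<close> has restriction \<open>F e'\<close>, which fixes \<open>F f\<close>.\<close>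
      have re: "Rst Y (FO F A') (Z D') (r D') = FA F A' A' e'"
        using Y.splits_as_Rst[OF _ sp[OF *(3,4)]] F'(6)[of A' A' e']
        by (simp add: restriction_idempotent_def)
      have rf: "Rst Y (FO F A) (Z D') ?rf = FA F A A (Rst X A A' f)"
        using Y.Rst_Comp_left[of "FO F A" "FO F A'" "Z D'" "FA F A A' f" "r D'"] re
          F'(5)[of A A' A' f e'] f F'(6)[of A A' f] by simp
      have mf: "Comp Y (Z D) (Z D) (FO F A) (m D) (Rst Y (Z D) (Z D') (G1 D D' f))
          = Comp Y (Z D) (FO F A) (FO F A) (FA F A A (Rst X A A' f)) (m D)"
        using Y.R4[of "Z D" "FO F A" "Z D'" "m D" ?rf] rf by (simp add: G1_def)
      have "Rst Y (Z D) (Z D') (G1 D D' f) = Comp Y (Z D) (FO F A) (Z D) (r D)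
         (Comp Y (Z D) (Z D) (FO F A) (m D) (Rst Y (Z D) (Z D') (G1 D D' f)))"
        by (simp add: Y.Comp_assoc rm G1_def)
      also have "\<dots> = G1 D D (Rst (K_r X) D D' f)"
        unfolding mf by (simp add: G1_def Y.Comp_assoc)
      finally show ?thesis ..
    qed
    then show "is_restriction_functor (K_r X) Y (mk_ftor (K_r X) Z G1)"
      using G by (simp add: is_restriction_functor_def)
    have J: "restriction_idempotent X A (Idt X A)" if "A \<in> Ob X" for A
      using that by (simp add: restriction_idempotent_def)
    show "comp_ftor X (mk_ftor (K_r X) Z G1) (J_emb X) = F"
      by (rule functor_eqI[OF is_functor_comp[OF X.category_axioms restriction_functorD(1)[OF X.restriction_functor_J] G]
          restriction_functorD(1)[OF F]])
        (simp_all add: id J G1_def X.K_r_Hom_full)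
  qed
qed

section \<open>Presheaves on the total maps of a split restriction category\<close>

lemma MTotal_sel [simp]:
  "Ob (MTotal K) = Ob K" "f \<in> Hom (MTotal K) A B \<longleftrightarrow> is_total K A B f"
  "Comp (MTotal K) = Comp K" "Idt (MTotal K) = Idt K"
  "m \<in> Mon (MTotal K) A B \<longleftrightarrow> restriction_monic K A B m"
  by (simp_all add: MTotal_def)

lemma SET_sel [simp]:
  "A \<in> Ob (SET U) \<longleftrightarrow> small U A" "Hom (SET U) A B = A \<rightarrow>\<^sub>E B"
  "Comp (SET U) A B D g f = compose A g f" "Idt (SET U) A = (\<lambda>x\<in>A. x)"
  by (simp_all add: SET_def)

lemma small_category_single: "universe (U :: 'u itself) \<Longrightarrow>
    small_category U \<lparr>Ob = {a :: 'u}, Hom = (\<lambda>_ _. {a}), Comp = (\<lambda>_ _ _ _ _. a), Idt = (\<lambda>_. a)\<rparr>"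
  by (auto simp: small_category_def locally_small_def small_finite intro!: category.intro)

locale split_restriction_category = restriction_category K
  for K :: "('o, 'a) rcat" +
  fixes U :: "'u itself"
  assumes universe: "universe U" and loc_small: "locally_small U K" and split_K: "split K"
begin

abbreviation C :: "('o, 'a) mcat" where "C \<equiv> MTotal K"

abbreviation presheaf :: "('o, 'a, 'u) presheaf \<Rightarrow> bool" where
  "presheaf \<equiv> is_functor (opposite C) (SET U)"

abbreviation natural where "natural \<equiv> is_nat_trans (opposite C) (SET U)"

lemma category_C: "category C"
  by unfold_locales (auto simp: total_Comp is_total_Hom Comp_assoc)

lemma category_op: "category (opposite C)"
  by (rule category.opposite_category[OF category_C])

lemma small_total: "\<lbrakk>A \<in> Ob K; B \<in> Ob K\<rbrakk> \<Longrightarrow> small U (Collect (is_total K A B))"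
  by (rule small_subset[of U "Hom K A B"])
    (use loc_small in \<open>auto simp: locally_small_def dest: is_total_Hom\<close>)

lemma presheafD:
  assumes "presheaf P" "A \<in> Ob K"
  shows "small U (FO P A)"
    and "\<lbrakk>B \<in> Ob K; is_total K B A k\<rbrakk> \<Longrightarrow> FA P A B k \<in> FO P A \<rightarrow>\<^sub>E FO P B"
    and "\<lbrakk>B \<in> Ob K; is_total K B A k; x \<in> FO P A\<rbrakk> \<Longrightarrow> FA P A B k x \<in> FO P B"
    and "x \<in> FO P A \<Longrightarrow> FA P A A (Idt K A) x = x"
    and "\<lbrakk>B \<in> Ob K; D \<in> Ob K; is_total K B A k; is_total K D B l; x \<in> FO P A\<rbrakk> \<Longrightarrow>
      FA P A D (Comp K D B A k l) x = FA P B D l (FA P A B k x)"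
proof -
  show "small U (FO P A)" using is_functorD(1)[OF assms(1), of A] assms(2) by simp
  show 1: "FA P A B k \<in> FO P A \<rightarrow>\<^sub>E FO P B" if "B \<in> Ob K" "is_total K B A k" for B k
    using is_functorD(2)[OF assms(1), of A B k] assms(2) that by simp
  then show "FA P A B k x \<in> FO P B" if "B \<in> Ob K" "is_total K B A k" "x \<in> FO P A"
    using that by blast
  show "FA P A A (Idt K A) x = x" if "x \<in> FO P A"
    using is_functorD(3)[OF assms(1), of A] assms(2) that by (simp add: fun_eq_iff)
  show "FA P A D (Comp K D B A k l) x = FA P B D l (FA P A B k x)"
    if "B \<in> Ob K" "D \<in> Ob K" "is_total K B A k" "is_total K D B l" "x \<in> FO P A"
    using is_functorD(4)[OF assms(1), of A B D k l] assms(2) that by (simp add: compose_def)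
qed

text \<open>
  A presheaf with values in small sets over any type; constructions are carried out in this
  generality and transported to sets over \<open>'u\<close> at the end.
\<close>

definition action :: "('o \<Rightarrow> 'x set) \<Rightarrow> ('o \<Rightarrow> 'o \<Rightarrow> 'a \<Rightarrow> 'x \<Rightarrow> 'x) \<Rightarrow> bool" where
  "action G0 G1 \<longleftrightarrow>
    (\<forall>A\<in>Ob K. small U (G0 A)) \<and>
    (\<forall>A\<in>Ob K. \<forall>B\<in>Ob K. \<forall>k x. is_total K B A k \<longrightarrow> x \<in> G0 A \<longrightarrow> G1 A B k x \<in> G0 B) \<and>
    (\<forall>A\<in>Ob K. \<forall>x\<in>G0 A. G1 A A (Idt K A) x = x) \<and>
    (\<forall>A\<in>Ob K. \<forall>B\<in>Ob K. \<forall>D\<in>Ob K. \<forall>k l x. is_total K B A k \<longrightarrow> is_total K D B l \<longrightarrow> x \<in> G0 A \<longrightarrow>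
      G1 A D (Comp K D B A k l) x = G1 B D l (G1 A B k x))"

lemma actionI:
  assumes "\<And>A. A \<in> Ob K \<Longrightarrow> small U (G0 A)"
    and "\<And>A B k x. \<lbrakk>A \<in> Ob K; B \<in> Ob K; is_total K B A k; x \<in> G0 A\<rbrakk> \<Longrightarrow> G1 A B k x \<in> G0 B"
    and "\<And>A x. \<lbrakk>A \<in> Ob K; x \<in> G0 A\<rbrakk> \<Longrightarrow> G1 A A (Idt K A) x = x"
    and "\<And>A B D k l x. \<lbrakk>A \<in> Ob K; B \<in> Ob K; D \<in> Ob K; is_total K B A k; is_total K D B l; x \<in> G0 A\<rbrakk>
      \<Longrightarrow> G1 A D (Comp K D B A k l) x = G1 B D l (G1 A B k x)"
  shows "action G0 G1"
  unfolding action_def using assms by simp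

lemma actionD:
  assumes "action G0 G1" "A \<in> Ob K"
  shows "small U (G0 A)"
    and "\<lbrakk>B \<in> Ob K; is_total K B A k; x \<in> G0 A\<rbrakk> \<Longrightarrow> G1 A B k x \<in> G0 B"
    and "x \<in> G0 A \<Longrightarrow> G1 A A (Idt K A) x = x"
    and "\<lbrakk>B \<in> Ob K; D \<in> Ob K; is_total K B A k; is_total K D B l; x \<in> G0 A\<rbrakk> \<Longrightarrow>
      G1 A D (Comp K D B A k l) x = G1 B D l (G1 A B k x)"
  using assms unfolding action_def by blast+

lemma action_presheaf: "presheaf P \<Longrightarrow> action (FO P) (FA P)"
  by (rule actionI) (simp_all add: presheafD)

definition mk_presheaf :: "('o \<Rightarrow> 'u set) \<Rightarrow> ('o \<Rightarrow> 'o \<Rightarrow> 'a \<Rightarrow> 'u \<Rightarrow> 'u) \<Rightarrow> ('o, 'a, 'u) presheaf" where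
  "mk_presheaf G0 G1 = mk_ftor (opposite C) G0 (\<lambda>A B k. \<lambda>x\<in>G0 A. G1 A B k x)"

lemma mk_presheaf_sel [simp]:
  "A \<in> Ob K \<Longrightarrow> FO (mk_presheaf G0 G1) A = G0 A"
  "\<lbrakk>A \<in> Ob K; B \<in> Ob K; is_total K B A k; x \<in> G0 A\<rbrakk> \<Longrightarrow> FA (mk_presheaf G0 G1) A B k x = G1 A B k x"
  by (simp_all add: mk_presheaf_def)

lemma presheaf_mk_presheaf:
  assumes "action G0 G1"
  shows "presheaf (mk_presheaf G0 G1)"
  unfolding mk_presheaf_def
  by (rule is_functor_mk_ftor[OF category_op])
    (auto simp: actionD[OF assms] compose_def fun_eq_iff)

lemma naturalD:
  assumes "natural P Q \<alpha>" "A \<in> Ob K"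
  shows "\<alpha> A \<in> FO P A \<rightarrow>\<^sub>E FO Q A"
    and "x \<in> FO P A \<Longrightarrow> \<alpha> A x \<in> FO Q A"
    and "\<lbrakk>presheaf P; B \<in> Ob K; is_total K B A k; x \<in> FO P A\<rbrakk> \<Longrightarrow> \<alpha> B (FA P A B k x) = FA Q A B k (\<alpha> A x)"
proof -
  show 1: "\<alpha> A \<in> FO P A \<rightarrow>\<^sub>E FO Q A" using assms by (simp add: is_nat_trans_def)
  then show "x \<in> FO P A \<Longrightarrow> \<alpha> A x \<in> FO Q A" by blast
  assume *: "presheaf P" "B \<in> Ob K" "is_total K B A k" "x \<in> FO P A"
  then have "compose (FO P A) (\<alpha> B) (FA P A B k) = compose (FO P A) (FA Q A B k) (\<alpha> A)"
    using assms by (simp add: is_nat_trans_def)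
  then show "\<alpha> B (FA P A B k x) = FA Q A B k (\<alpha> A x)"
    using *(4) by (metis compose_eq)
qed

definition mk_nat :: "('o, 'a, 'u) presheaf \<Rightarrow> ('o \<Rightarrow> 'u \<Rightarrow> 'u) \<Rightarrow> 'o \<Rightarrow> 'u \<Rightarrow> 'u" where
  "mk_nat P f = (\<lambda>A\<in>Ob K. \<lambda>x\<in>FO P A. f A x)"

lemma mk_nat_sel [simp]: "\<lbrakk>A \<in> Ob K; x \<in> FO P A\<rbrakk> \<Longrightarrow> mk_nat P f A x = f A x"
  by (simp add: mk_nat_def)

lemma natural_mk_nat:
  assumes "presheaf P" "\<And>A x. \<lbrakk>A \<in> Ob K; x \<in> FO P A\<rbrakk> \<Longrightarrow> f A x \<in> FO Q A"
    and "\<And>A B k x. \<lbrakk>A \<in> Ob K; B \<in> Ob K; is_total K B A k; x \<in> FO P A\<rbrakk> \<Longrightarrow>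
      f B (FA P A B k x) = FA Q A B k (f A x)"
  shows "natural P Q (mk_nat P f)"
  unfolding is_nat_trans_def
  using assms by (auto simp: mk_nat_def compose_def fun_eq_iff presheafD)

lemma natural_eqI:
  assumes "natural P Q \<alpha>" "natural P Q' \<beta>" "\<And>A x. \<lbrakk>A \<in> Ob K; x \<in> FO P A\<rbrakk> \<Longrightarrow> \<alpha> A x = \<beta> A x"
  shows "\<alpha> = \<beta>"
proof (rule extensionalityI[of \<alpha> "Ob K"])
  show "\<alpha> \<in> extensional (Ob K)" "\<beta> \<in> extensional (Ob K)"
    using assms(1,2) by (simp_all add: is_nat_trans_def)
  fix A assume "A \<in> Ob K"
  then show "\<alpha> A = \<beta> A"
    using assms by (intro extensionalityI[of "\<alpha> A" "FO P A"])
      (auto dest!: naturalD(1) simp: PiE_def)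
qed

lemma Psh_sel [simp]:
  "P \<in> Ob (Psh U C) \<longleftrightarrow> presheaf P"
  "\<alpha> \<in> Hom (Psh U C) P Q \<longleftrightarrow> natural P Q \<alpha>"
  "Comp (Psh U C) P Q R \<beta> \<alpha> = (\<lambda>A\<in>Ob K. compose (FO P A) (\<beta> A) (\<alpha> A))"
  "Idt (Psh U C) P = (\<lambda>A\<in>Ob K. \<lambda>x\<in>FO P A. x)"
  by (simp_all add: Psh_def)

lemma Comp_Psh [simp]:
  "\<lbrakk>A \<in> Ob K; x \<in> FO P A\<rbrakk> \<Longrightarrow> Comp (Psh U C) P Q R \<beta> \<alpha> A x = \<beta> A (\<alpha> A x)"
  by (simp add: compose_eq)

lemma Idt_Psh [simp]: "\<lbrakk>A \<in> Ob K; x \<in> FO P A\<rbrakk> \<Longrightarrow> Idt (Psh U C) P A x = x"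
  by simp

declare Psh_sel(3,4) [simp del]

lemma natural_Comp:
  assumes "presheaf P" "presheaf Q" "natural P Q \<alpha>" "natural Q R \<beta>"
  shows "natural P R (Comp (Psh U C) P Q R \<beta> \<alpha>)"
proof -
  have "Comp (Psh U C) P Q R \<beta> \<alpha> = mk_nat P (\<lambda>A x. \<beta> A (\<alpha> A x))"
    by (auto simp: Psh_sel(3) mk_nat_def compose_def)
  moreover have "natural P R \<dots>"
    using assms by (intro natural_mk_nat) (simp_all add: naturalD)
  ultimately show ?thesis by simp
qed

lemma natural_Idt: "presheaf P \<Longrightarrow> natural P P (Idt (Psh U C) P)"
  using natural_mk_nat[of P "\<lambda>_ x. x" P] by (simp add: mk_nat_def Psh_sel(4))

lemma category_Psh: "category (Psh U C)"
proof (unfold_locales, goal_cases)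
  case (3 P Q \<alpha>)
  show ?case
    by (rule natural_eqI[of P Q _ Q]) (use 3 in \<open>simp_all add: natural_Comp natural_Idt naturalD\<close>)
next
  case (4 P Q \<alpha>)
  show ?case
    by (rule natural_eqI[of P Q _ Q]) (use 4 in \<open>simp_all add: natural_Comp natural_Idt naturalD\<close>)
next
  case (5 P Q R S \<alpha> \<beta> \<gamma>)
  show ?case
    by (rule natural_eqI[of P S _ S]) (use 5 in \<open>simp_all add: natural_Comp naturalD\<close>)
qed (simp_all add: natural_Comp natural_Idt)

text \<open>Transport of an action along chosen injections of its (small) values into \<open>'u\<close>.\<close>

definition encoding :: "('o \<Rightarrow> 'x set) \<Rightarrow> 'o \<Rightarrow> 'x \<Rightarrow> 'u" where
  "encoding G0 A = (SOME h. inj_on h (G0 A))"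

definition encode :: "('o \<Rightarrow> 'x set) \<Rightarrow> ('o \<Rightarrow> 'o \<Rightarrow> 'a \<Rightarrow> 'x \<Rightarrow> 'x) \<Rightarrow> ('o, 'a, 'u) presheaf" where
  "encode G0 G1 = mk_presheaf (\<lambda>A. encoding G0 A ` G0 A)
    (\<lambda>A B k y. encoding G0 B (G1 A B k (inv_into (G0 A) (encoding G0 A) y)))"

lemma encoding_inj:
  assumes "action G0 G1" "A \<in> Ob K"
  shows "inj_on (encoding G0 A) (G0 A)"
  unfolding encoding_def by (rule someI_ex[of "\<lambda>h. inj_on h (G0 A)"]) (use actionD(1)[OF assms] small_inj_ex in blast)

lemma encode_sel:
  assumes "action G0 G1" "A \<in> Ob K"
  shows "FO (encode G0 G1) A = encoding G0 A ` G0 A"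
    and "\<lbrakk>B \<in> Ob K; is_total K B A k; x \<in> G0 A\<rbrakk> \<Longrightarrow>
      FA (encode G0 G1) A B k (encoding G0 A x) = encoding G0 B (G1 A B k x)"
  using assms encoding_inj[OF assms] by (simp_all add: encode_def)

lemma presheaf_encode:
  assumes "action G0 G1"
  shows "presheaf (encode G0 G1)"
  unfolding encode_def
proof (rule presheaf_mk_presheaf, rule actionI, goal_cases)
  case (1 A)
  then show ?case by (simp add: small_image actionD(1)[OF assms])
next
  case (2 A B k x)
  then show ?case
    by (elim imageE) (simp add: actionD(2)[OF assms, of A B] encoding_inj[OF assms])
next
  case (3 A x)
  then show ?case
    by (elim imageE) (simp add: actionD(3)[OF assms] encoding_inj[OF assms])
next
  case (4 A B D k l x)
  then show ?case
    by (elim imageE) (simp add: actionD(2,4)[OF assms, of A B] encoding_inj[OF assms])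
qed

section \<open>Representable presheaves\<close>

abbreviation y :: "'o \<Rightarrow> ('o, 'a, 'u) presheaf" where "y \<equiv> y_ob U C"

abbreviation code :: "'o \<Rightarrow> 'o \<Rightarrow> 'a \<Rightarrow> 'u" where "code \<equiv> enc U C"

lemma Hom_C [simp]: "Hom C A B = Collect (is_total K A B)"
  by (auto simp: set_eq_iff)

lemma code_inj: "\<lbrakk>A \<in> Ob K; B \<in> Ob K\<rbrakk> \<Longrightarrow> inj_on (code A B) (Collect (is_total K A B))"
  unfolding enc_def Hom_C
  by (rule someI_ex[of "\<lambda>h. inj_on h (Collect (is_total K A B))"]) (use small_total small_inj_ex in blast)

lemma code_eq_iff [simp]:
  "\<lbrakk>A \<in> Ob K; B \<in> Ob K; is_total K A B k; is_total K A B l\<rbrakk> \<Longrightarrow> code A B k = code A B l \<longleftrightarrow> k = l"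
  using code_inj[of A B] by (auto dest: inj_onD)

lemma dec_code [simp]: "\<lbrakk>A \<in> Ob K; B \<in> Ob K; is_total K A B k\<rbrakk> \<Longrightarrow> dec U C A B (code A B k) = k"
  using code_inj[of A B] by (simp add: dec_def)

lemma presheaf_y [simp]: "D \<in> Ob K \<Longrightarrow> presheaf (y D)"
  unfolding y_ob_def Hom_C mk_presheaf_def[symmetric]
  by (intro presheaf_mk_presheaf actionI)
    (auto simp: total_Comp is_total_Hom Comp_assoc small_image small_total)

lemma y_sel:
  assumes "D \<in> Ob K" "A \<in> Ob K"
  shows "FO (y D) A = code A D ` Collect (is_total K A D)"
    and "\<lbrakk>B \<in> Ob K; is_total K B A k; is_total K A D l\<rbrakk> \<Longrightarrow>
      FA (y D) A B k (code A D l) = code B D (Comp K B A D l k)"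
  using assms by (simp_all add: y_ob_def)

lemma code_in_y [simp]: "\<lbrakk>D \<in> Ob K; A \<in> Ob K; is_total K A D k\<rbrakk> \<Longrightarrow> code A D k \<in> FO (y D) A"
  by (simp add: y_sel)

lemma y_elemE:
  assumes "z \<in> FO (y D) A" "D \<in> Ob K" "A \<in> Ob K"
  obtains k where "is_total K A D k" "z = code A D k"
  using assms by (auto simp: y_sel)

lemma yoneda_sel:
  "D \<in> Ob K \<Longrightarrow> FO (yoneda U C) D = y D"
  "\<lbrakk>D \<in> Ob K; E \<in> Ob K; is_total K D E g; A \<in> Ob K; is_total K A D k\<rbrakk> \<Longrightarrow>
    FA (yoneda U C) D E g A (code A D k) = code A E (Comp K A D E g k)"
  by (simp_all add: yoneda_def)

text \<open>The transformation \<open>y D \<Rightarrow> P\<close> classifying an element of \<open>P D\<close>.\<close>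

definition elt :: "('o, 'a, 'u) presheaf \<Rightarrow> 'o \<Rightarrow> 'u \<Rightarrow> 'o \<Rightarrow> 'u \<Rightarrow> 'u" where
  "elt P D x = mk_nat (y D) (\<lambda>A z. FA P D A (dec U C A D z) x)"

lemma elt_code [simp]:
  "\<lbrakk>D \<in> Ob K; A \<in> Ob K; is_total K A D k\<rbrakk> \<Longrightarrow> elt P D x A (code A D k) = FA P D A k x"
  by (simp add: elt_def)

lemma natural_elt:
  assumes "presheaf P" "D \<in> Ob K" "x \<in> FO P D"
  shows "natural (y D) P (elt P D x)"
  unfolding elt_def
  by (rule natural_mk_nat)
    (use assms in \<open>auto elim!: y_elemE simp: presheafD y_sel(2) total_Comp\<close>)

lemma natural_y_code:
  assumes "presheaf P" "D \<in> Ob K" "natural (y D) P \<alpha>" "A \<in> Ob K" "is_total K A D k"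
  shows "\<alpha> A (code A D k) = FA P D A k (\<alpha> D (code D D (Idt K D)))"
  using naturalD(3)[OF assms(3) assms(2) _ assms(4,5), of "code D D (Idt K D)"] assms
  by (simp add: y_sel(2) is_total_Hom)

lemma natural_y_eqI:
  assumes "presheaf P" "D \<in> Ob K" "natural (y D) P \<alpha>" "natural (y D) P \<beta>"
    and "\<alpha> D (code D D (Idt K D)) = \<beta> D (code D D (Idt K D))"
  shows "\<alpha> = \<beta>"
proof (rule natural_eqI[OF assms(3,4)])
  fix A z assume A: "A \<in> Ob K" "z \<in> FO (y D) A"
  then obtain k where k: "is_total K A D k" "z = code A D k"
    using assms(2) by (blast elim: y_elemE)
  show "\<alpha> A z = \<beta> A z"
    unfolding k(2) natural_y_code[OF assms(1-3) A(1) k(1)] natural_y_code[OF assms(1,2,4) A(1) k(1)]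
    by (simp add: assms(5))
qed

lemma natural_yoneda:
  assumes "D \<in> Ob K" "E \<in> Ob K" "is_total K D E g"
  shows "natural (y D) (y E) (FA (yoneda U C) D E g)"
proof -
  have "FA (yoneda U C) D E g = mk_nat (y D) (\<lambda>A z. code A E (Comp K A D E g (dec U C A D z)))"
    using assms by (auto simp: yoneda_def mk_nat_def y_sel)
  then show ?thesis
    using assms by (auto intro!: natural_mk_nat elim!: y_elemE
        simp: y_sel(2) total_Comp is_total_Hom Comp_assoc)
qed

lemma is_functor_yoneda: "is_functor C (Psh U C) (yoneda U C)"
proof -
  have "yoneda U C = mk_ftor C (FO (yoneda U C)) (FA (yoneda U C))"
    unfolding yoneda_def by (rule mk_ftor_idem[symmetric])
  moreover have "is_functor C (Psh U C) \<dots>"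
  proof (rule is_functor_mk_ftor[OF category_C], goal_cases)
    case (3 D)
    then show ?case
      by (intro natural_y_eqI[of "y D" D])
        (simp_all add: yoneda_sel natural_yoneda natural_Idt)
  next
    case (4 A B D f g)
    then show ?case
      by (intro natural_y_eqI[of "y D" A])
        (simp_all add: yoneda_sel natural_yoneda natural_Comp total_Comp is_total_Hom Comp_assoc)
  qed (simp_all add: yoneda_sel natural_yoneda)
  ultimately show ?thesis by simp
qed

section \<open>Presentations of small presheaves\<close>

definition compatible :: "('u, 'u) cat \<Rightarrow> ('u, 'u, 'o, 'a) ftor \<Rightarrow> ('o \<Rightarrow> 'x set)
    \<Rightarrow> ('o \<Rightarrow> 'o \<Rightarrow> 'a \<Rightarrow> 'x \<Rightarrow> 'x) \<Rightarrow> ('u \<Rightarrow> 'x) \<Rightarrow> bool" where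
  "compatible J T G0 G1 g \<longleftrightarrow> (\<forall>i\<in>Ob J. g i \<in> G0 (FO T i)) \<and>
    (\<forall>i\<in>Ob J. \<forall>j\<in>Ob J. \<forall>u\<in>Hom J i j. G1 (FO T j) (FO T i) (FA T i j u) (g j) = g i)"

text \<open>
  A presentation of \<open>P\<close> as a colimit of representables \<open>y (T i)\<close> in terms of the elements
  \<open>p i\<close> that classify the coprojections: they generate \<open>P\<close>, and the only relations between them
  are those that hold for every compatible family in every presheaf.
\<close>

definition presents :: "('o, 'a, 'u) presheaf \<Rightarrow> ('u, 'u) cat \<Rightarrow> ('u, 'u, 'o, 'a) ftor \<Rightarrow> ('u \<Rightarrow> 'u) \<Rightarrow> bool" where
  "presents P J T p \<longleftrightarrow> small_category U J \<and> is_functor J C T \<and> presheaf P \<and>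
    compatible J T (FO P) (FA P) p \<and>
    (\<forall>D\<in>Ob K. \<forall>x\<in>FO P D. \<exists>i\<in>Ob J. \<exists>k. is_total K D (FO T i) k \<and> x = FA P (FO T i) D k (p i)) \<and>
    (\<forall>G g i j D k k'. presheaf G \<longrightarrow> compatible J T (FO G) (FA G) g \<longrightarrow>
       i \<in> Ob J \<longrightarrow> j \<in> Ob J \<longrightarrow> D \<in> Ob K \<longrightarrow> is_total K D (FO T i) k \<longrightarrow> is_total K D (FO T j) k' \<longrightarrow>
       FA P (FO T i) D k (p i) = FA P (FO T j) D k' (p j) \<longrightarrow>
       FA G (FO T i) D k (g i) = FA G (FO T j) D k' (g j))"

lemma presentsD:
  assumes "presents P J T p"
  shows "small_category U J" "is_functor J C T" "presheaf P"
    and "compatible J T (FO P) (FA P) p"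
    and "i \<in> Ob J \<Longrightarrow> FO T i \<in> Ob K"
    and "i \<in> Ob J \<Longrightarrow> p i \<in> FO P (FO T i)"
    and "\<lbrakk>i \<in> Ob J; j \<in> Ob J; u \<in> Hom J i j\<rbrakk> \<Longrightarrow> is_total K (FO T i) (FO T j) (FA T i j u)"
    and "\<lbrakk>i \<in> Ob J; j \<in> Ob J; u \<in> Hom J i j\<rbrakk> \<Longrightarrow> FA P (FO T j) (FO T i) (FA T i j u) (p j) = p i"
proof -
  show "small_category U J" "is_functor J C T" "presheaf P"
    and 1: "compatible J T (FO P) (FA P) p"
    using assms unfolding presents_def by simp_all
  then show "i \<in> Ob J \<Longrightarrow> FO T i \<in> Ob K"
    "\<lbrakk>i \<in> Ob J; j \<in> Ob J; u \<in> Hom J i j\<rbrakk> \<Longrightarrow> is_total K (FO T i) (FO T j) (FA T i j u)"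
    using is_functorD(1,2)[of J C T] by auto
  show "i \<in> Ob J \<Longrightarrow> p i \<in> FO P (FO T i)"
    "\<lbrakk>i \<in> Ob J; j \<in> Ob J; u \<in> Hom J i j\<rbrakk> \<Longrightarrow> FA P (FO T j) (FO T i) (FA T i j u) (p j) = p i"
    using 1 unfolding compatible_def by blast+
qed

lemma presents_gen:
  assumes "presents P J T p" "D \<in> Ob K" "x \<in> FO P D"
  obtains i k where "i \<in> Ob J" "is_total K D (FO T i) k" "x = FA P (FO T i) D k (p i)"
  using assms unfolding presents_def by blast

text \<open>
  A presentation only constrains families in sets over \<open>'u\<close>; encoding the values carries the
  constraint over to actions on arbitrary types, such as sets of arrows of another category.
\<close>

lemma presents_rel:
  assumes P: "presents P J T p" and G: "action G0 G1" and g: "compatible J T G0 G1 g"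
    and ij: "i \<in> Ob J" "j \<in> Ob J" "D \<in> Ob K" "is_total K D (FO T i) k" "is_total K D (FO T j) k'"
    and eq: "FA P (FO T i) D k (p i) = FA P (FO T j) D k' (p j)"
  shows "G1 (FO T i) D k (g i) = G1 (FO T j) D k' (g j)"
proof -
  note T = presentsD(5,7)[OF P]
  have g0: "\<And>i. i \<in> Ob J \<Longrightarrow> g i \<in> G0 (FO T i)"
    using g unfolding compatible_def by blast
  let ?g = "\<lambda>i. encoding G0 (FO T i) (g i)"
  have "compatible J T (FO (encode G0 G1)) (FA (encode G0 G1)) ?g"
    using g unfolding compatible_def by (simp add: encode_sel[OF G] T)
  then have "FA (encode G0 G1) (FO T i) D k (?g i) = FA (encode G0 G1) (FO T j) D k' (?g j)"
    using P ij eq presheaf_encode[OF G] unfolding presents_def by meson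
  then have "encoding G0 D (G1 (FO T i) D k (g i)) = encoding G0 D (G1 (FO T j) D k' (g j))"
    using ij by (simp add: encode_sel[OF G] T g0)
  then show ?thesis
    using ij by (intro inj_onD[OF encoding_inj[OF G ij(3)]]) (simp_all add: T g0 actionD(2)[OF G])
qed

text \<open>
  By \<open>presents_rel\<close> the value of the mediating transformation at \<open>p i \<cdot> k\<close> does not depend
  on how the element is written.
\<close>

lemma presents_extend:
  assumes P: "presents P J T p" and G: "action G0 G1"
    and comp: "compatible J T G0 G1 g"
  obtains h where "\<And>D x. \<lbrakk>D \<in> Ob K; x \<in> FO P D\<rbrakk> \<Longrightarrow> h D x \<in> G0 D"
    "\<And>A B k x. \<lbrakk>A \<in> Ob K; B \<in> Ob K; is_total K B A k; x \<in> FO P A\<rbrakk> \<Longrightarrow>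
      h B (FA P A B k x) = G1 A B k (h A x)"
    "\<And>i. i \<in> Ob J \<Longrightarrow> h (FO T i) (p i) = g i"
    "\<And>i D k. \<lbrakk>i \<in> Ob J; D \<in> Ob K; is_total K D (FO T i) k\<rbrakk> \<Longrightarrow>
      h D (FA P (FO T i) D k (p i)) = G1 (FO T i) D k (g i)"
proof -
  note D = presentsD[OF P]
  have g: "\<And>i. i \<in> Ob J \<Longrightarrow> g i \<in> G0 (FO T i)"
    using comp unfolding compatible_def by blast
  define h where "h D x = (SOME z. \<exists>i\<in>Ob J. \<exists>k. is_total K D (FO T i) k \<and>
      x = FA P (FO T i) D k (p i) \<and> z = G1 (FO T i) D k (g i))" for D x
  have h: "h D (FA P (FO T i) D k (p i)) = G1 (FO T i) D k (g i)"
    if *: "i \<in> Ob J" "D \<in> Ob K" "is_total K D (FO T i) k" for i D k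
  proof -
    have "\<exists>j\<in>Ob J. \<exists>k'. is_total K D (FO T j) k' \<and> FA P (FO T i) D k (p i) = FA P (FO T j) D k' (p j) \<and>
        h D (FA P (FO T i) D k (p i)) = G1 (FO T j) D k' (g j)"
      unfolding h_def by (rule someI_ex) (use * in blast)
    then show ?thesis
      using presents_rel[OF P G comp] * by metis
  qed
  show thesis
  proof (rule that[of h])
    fix D x assume "D \<in> Ob K" "x \<in> FO P D"
    then show "h D x \<in> G0 D"
      using presents_gen[OF P, of D x] h D g actionD[OF G] by metis
  next
    fix A B k x assume *: "A \<in> Ob K" "B \<in> Ob K" "is_total K B A k" "x \<in> FO P A"
    obtain i l where i: "i \<in> Ob J" "is_total K A (FO T i) l" "x = FA P (FO T i) A l (p i)"
      using presents_gen[OF P *(1,4)] .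
    have "FA P A B k x = FA P (FO T i) B (Comp K B A (FO T i) l k) (p i)"
      using i * D by (simp add: presheafD(5)[of P])
    then show "h B (FA P A B k x) = G1 A B k (h A x)"
      using i * D g by (simp add: h total_Comp actionD(4)[OF G])
  next
    fix i assume "i \<in> Ob J"
    then show "h (FO T i) (p i) = g i"
      using h[of i "FO T i" "Idt K (FO T i)"] D g by (simp add: presheafD(4)[of P] actionD(3)[OF G])
  next
    fix i D k assume "i \<in> Ob J" "D \<in> Ob K" "is_total K D (FO T i) k"
    then show "h D (FA P (FO T i) D k (p i)) = G1 (FO T i) D k (g i)"
      by (rule h)
  qed
qed

lemma cocone_elt:
  assumes T: "is_functor J C T" and G: "presheaf G" and g: "compatible J T (FO G) (FA G) g"
  shows "is_cocone J (Psh U C) (comp_ftor J (yoneda U C) T) G (\<lambda>i. elt G (FO T i) (g i))"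
proof -
  have T0: "FO T i \<in> Ob K" if "i \<in> Ob J" for i
    using is_functorD(1)[OF T that] by simp
  have T1: "is_total K (FO T i) (FO T j) (FA T i j u)" if "i \<in> Ob J" "j \<in> Ob J" "u \<in> Hom J i j" for i j u
    using is_functorD(2)[OF T that] by simp
  have g0: "g i \<in> FO G (FO T i)" if "i \<in> Ob J" for i
    using g that by (simp add: compatible_def)
  have g1: "FA G (FO T j) (FO T i) (FA T i j u) (g j) = g i" if "i \<in> Ob J" "j \<in> Ob J" "u \<in> Hom J i j" for i j u
    using g that by (simp add: compatible_def)
  have "Comp (Psh U C) (y (FO T i)) (y (FO T j)) G (elt G (FO T j) (g j))
      (FA (yoneda U C) (FO T i) (FO T j) (FA T i j u)) = elt G (FO T i) (g i)"
    if *: "i \<in> Ob J" "j \<in> Ob J" "u \<in> Hom J i j" for i j u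
    by (rule natural_y_eqI[OF G T0[OF *(1)]])
      (use * in \<open>simp_all add: natural_Comp natural_elt natural_yoneda G T0 T1 g0 g1 yoneda_sel
        presheafD(4)[OF G] is_total_Hom[OF T1]\<close>)
  then show ?thesis
    unfolding is_cocone_def using G by (simp add: T0 T1 yoneda_sel natural_elt g0)
qed

lemma cocone_compatible:
  assumes T: "is_functor J C T" and c: "is_cocone J (Psh U C) (comp_ftor J (yoneda U C) T) G c"
  shows "compatible J T (FO G) (FA G) (\<lambda>i. c i (FO T i) (code (FO T i) (FO T i) (Idt K (FO T i))))"
proof -
  have T0: "FO T i \<in> Ob K" if "i \<in> Ob J" for i
    using is_functorD(1)[OF T that] by simp
  have T1: "is_total K (FO T i) (FO T j) (FA T i j u)" if "i \<in> Ob J" "j \<in> Ob J" "u \<in> Hom J i j" for i j u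
    using is_functorD(2)[OF T that] by simp
  have G: "presheaf G" using c by (simp add: is_cocone_def)
  have c0: "natural (y (FO T i)) G (c i)" if "i \<in> Ob J" for i
    using c that by (simp add: is_cocone_def yoneda_sel T0)
  have c1: "Comp (Psh U C) (y (FO T i)) (y (FO T j)) G (c j) (FA (yoneda U C) (FO T i) (FO T j) (FA T i j u)) = c i"
    if "i \<in> Ob J" "j \<in> Ob J" "u \<in> Hom J i j" for i j u
    using c that by (simp add: is_cocone_def yoneda_sel T0)
  have "FA G (FO T j) (FO T i) (FA T i j u) (c j (FO T j) (code (FO T j) (FO T j) (Idt K (FO T j))))
      = c i (FO T i) (code (FO T i) (FO T i) (Idt K (FO T i)))"
    if *: "i \<in> Ob J" "j \<in> Ob J" "u \<in> Hom J i j" for i j u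
  proof -
    have "FA G (FO T j) (FO T i) (FA T i j u) (c j (FO T j) (code (FO T j) (FO T j) (Idt K (FO T j))))
        = c j (FO T i) (code (FO T i) (FO T j) (FA T i j u))"
      using * by (intro natural_y_code[symmetric]) (simp_all add: G T0 T1 c0)
    also have "\<dots> = Comp (Psh U C) (y (FO T i)) (y (FO T j)) G (c j)
        (FA (yoneda U C) (FO T i) (FO T j) (FA T i j u)) (FO T i) (code (FO T i) (FO T i) (Idt K (FO T i)))"
      using * by (simp add: T0 T1 yoneda_sel is_total_Hom[OF T1])
    finally show ?thesis using c1[OF *] by simp
  qed
  then show ?thesis
    using naturalD(2)[OF c0] T0 by (simp add: compatible_def)
qed

text \<open>
  The image of a colimiting cocone is a subpresheaf through which the cocone factors; uniqueness
  of mediating arrows makes its inclusion surjective, so the elements \<open>p i\<close> generate.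
\<close>

lemma small_presheaf_presents:
  assumes "small_presheaf U C P"
  obtains J T p where "presents P J T p"
proof -
  obtain J T c where J: "small_category U J" and T: "is_functor J C T"
    and c: "is_colimit J (Psh U C) (comp_ftor J (yoneda U C) T) P c"
    using assms unfolding small_presheaf_def by blast
  let ?D = "comp_ftor J (yoneda U C) T"
  have catJ: "category J" using J by (simp add: small_category_def)
  have cc: "is_cocone J (Psh U C) ?D P c" using c by (simp add: is_colimit_def)
  have D: "is_functor J (Psh U C) ?D" by (rule is_functor_comp[OF catJ T is_functor_yoneda])
  have T0: "FO T i \<in> Ob K" if "i \<in> Ob J" for i
    using is_functorD(1)[OF T that] by simp
  have P: "presheaf P" using cc by (simp add: is_cocone_def)
  have c0: "natural (y (FO T i)) P (c i)" if "i \<in> Ob J" for i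
    using cc that by (simp add: is_cocone_def yoneda_sel T0)
  define p where "p = (\<lambda>i. c i (FO T i) (code (FO T i) (FO T i) (Idt K (FO T i))))"
  have comp: "compatible J T (FO P) (FA P) p"
    unfolding p_def by (rule cocone_compatible[OF T cc])
  have p0: "p i \<in> FO P (FO T i)" if "i \<in> Ob J" for i
    using comp that by (simp add: compatible_def)
  have c_code: "c i A (code A (FO T i) k) = FA P (FO T i) A k (p i)"
    if "i \<in> Ob J" "A \<in> Ob K" "is_total K A (FO T i) k" for i A k
    unfolding p_def using that by (intro natural_y_code) (simp_all add: P T0 c0)
  have c_elt: "c i = elt P (FO T i) (p i)" if "i \<in> Ob J" for i
    by (rule natural_y_eqI[OF P T0[OF that] c0[OF that]])
      (use that in \<open>simp_all add: natural_elt P T0 p0 c_code\<close>)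
  have gen: "\<exists>i\<in>Ob J. \<exists>k. is_total K A (FO T i) k \<and> x = FA P (FO T i) A k (p i)"
    if A: "A \<in> Ob K" "x \<in> FO P A" for A x
  proof -
    define I0 where "I0 A = {x \<in> FO P A. \<exists>i\<in>Ob J. \<exists>k. is_total K A (FO T i) k \<and> x = FA P (FO T i) A k (p i)}" for A
    have "action I0 (FA P)"
    proof (rule actionI)
      fix A B k x assume *: "A \<in> Ob K" "B \<in> Ob K" "is_total K B A k" "x \<in> I0 A"
      then obtain i l where i: "i \<in> Ob J" "is_total K A (FO T i) l" "x = FA P (FO T i) A l (p i)"
        by (auto simp: I0_def)
      then have "FA P A B k x = FA P (FO T i) B (Comp K B A (FO T i) l k) (p i)"
        using * by (simp add: presheafD(5)[OF P] T0 p0)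
      moreover have "is_total K B (FO T i) (Comp K B A (FO T i) l k)"
        using i * by (simp add: T0 total_Comp)
      moreover have "FA P A B k x \<in> FO P B"
        using * by (simp add: I0_def presheafD(3)[OF P])
      ultimately show "FA P A B k x \<in> I0 B"
        using i(1) by (auto simp: I0_def)
    qed (auto simp: I0_def presheafD[OF P] intro: small_subset[OF presheafD(1)[OF P]])
    let ?I = "mk_presheaf I0 (FA P)"
    have I: "presheaf ?I" using presheaf_mk_presheaf \<open>action I0 (FA P)\<close> .
    have p_I: "p i \<in> I0 (FO T i)" if "i \<in> Ob J" for i
    proof -
      have "is_total K (FO T i) (FO T i) (Idt K (FO T i)) \<and>
          p i = FA P (FO T i) (FO T i) (Idt K (FO T i)) (p i)"
        using that by (simp add: T0 p0 presheafD(4)[OF P])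
      then show ?thesis
        using that p0[OF that] unfolding I0_def by blast
    qed
    have FAI: "FA ?I A B k x = FA P A B k x" if "A \<in> Ob K" "B \<in> Ob K" "is_total K B A k" "x \<in> I0 A" for A B k x
      using that by simp
    have "is_total K (FO T i) (FO T j) (FA T i j u)" if "i \<in> Ob J" "j \<in> Ob J" "u \<in> Hom J i j" for i j u
      using is_functorD(2)[OF T that] by simp
    then have "compatible J T (FO ?I) (FA ?I) p"
      using comp p_I T0 by (simp add: compatible_def)
    then have d: "is_cocone J (Psh U C) ?D ?I (\<lambda>i. elt ?I (FO T i) (p i))"
      by (rule cocone_elt[OF T I])
    obtain h where h: "h \<in> Hom (Psh U C) P ?I"
      and hc: "\<And>i. i \<in> Ob J \<Longrightarrow> Comp (Psh U C) (FO ?D i) P ?I h (c i) = elt ?I (FO T i) (p i)"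
      using is_colimit_ex[OF c d] by blast
    let ?inc = "mk_nat ?I (\<lambda>A x. x)"
    have inc: "natural ?I P ?inc"
      by (rule natural_mk_nat[OF I]) (auto simp: I0_def)
    have "Comp (Psh U C) P ?I P ?inc h = Idt (Psh U C) P"
    proof (rule is_colimit_eqI[OF c catJ category_Psh D])
      fix i assume i: "i \<in> Ob J"
      have "FO ?D i = y (FO T i)" using i by (simp add: yoneda_sel T0)
      moreover have "Comp (Psh U C) (y (FO T i)) P P (Comp (Psh U C) P ?I P ?inc h) (c i)
        = Comp (Psh U C) (y (FO T i)) P P (Idt (Psh U C) P) (c i)"
      proof (rule natural_y_eqI[OF P T0[OF i]])
        let ?one = "code (FO T i) (FO T i) (Idt K (FO T i))"
        have "h (FO T i) (p i) = p i"
          using fun_cong[OF fun_cong[OF hc[OF i]], of "FO T i" ?one] i T0 p0[OF i] p_I[OF i]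
          by (simp add: yoneda_sel c_code presheafD(4)[OF P])
        then show "Comp (Psh U C) (y (FO T i)) P P (Comp (Psh U C) P ?I P ?inc h) (c i) (FO T i) ?one
          = Comp (Psh U C) (y (FO T i)) P P (Idt (Psh U C) P) (c i) (FO T i) ?one"
          using i T0 p0[OF i] p_I[OF i] by (simp add: c_code presheafD(4)[OF P])
      qed (use i h inc in \<open>simp_all add: natural_Comp P I T0 c0 natural_Idt\<close>)
      ultimately show "Comp (Psh U C) (FO ?D i) P P (Comp (Psh U C) P ?I P ?inc h) (c i)
        = Comp (Psh U C) (FO ?D i) P P (Idt (Psh U C) P) (c i)" by simp
    qed (use h inc in \<open>simp_all add: natural_Comp P I natural_Idt\<close>)
    from fun_cong[OF fun_cong[OF this], of A x] have "?inc A (h A x) = x"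
      using A by simp
    moreover have "h A x \<in> I0 A"
      using naturalD(2)[of P ?I h A x] h A by simp
    ultimately show ?thesis
      using A by (auto simp: I0_def)
  qed
  have rel: "FA G (FO T i) A k (g i) = FA G (FO T j) A k' (g j)"
    if G: "presheaf G" and g: "compatible J T (FO G) (FA G) g"
      and ij: "i \<in> Ob J" "j \<in> Ob J" "A \<in> Ob K" "is_total K A (FO T i) k" "is_total K A (FO T j) k'"
      and eq: "FA P (FO T i) A k (p i) = FA P (FO T j) A k' (p j)" for G g i j A k k'
  proof -
    obtain h where h: "h \<in> Hom (Psh U C) P G"
      and hc: "\<And>i. i \<in> Ob J \<Longrightarrow> Comp (Psh U C) (FO ?D i) P G h (c i) = elt G (FO T i) (g i)"
      using is_colimit_ex[OF c cocone_elt[OF T G g]] by blast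
    have "h A (FA P (FO T i) A k (p i)) = FA G (FO T i) A k (g i)"
      if "i \<in> Ob J" "is_total K A (FO T i) k" for i k
      using fun_cong[OF fun_cong[OF hc[OF that(1)]], of A "code A (FO T i) k"] that ij(3)
      by (simp add: yoneda_sel T0 c_code)
    then show ?thesis
      using ij eq by metis
  qed
  have "presents P J T p"
    unfolding presents_def using J T P comp gen rel by blast
  then show thesis by (rule that)
qed

lemma presents_small_presheaf:
  assumes p: "presents P J T p"
  shows "small_presheaf U C P"
proof -
  note D = presentsD[OF p]
  have T0: "FO T i \<in> Ob K" if "i \<in> Ob J" for i
    using is_functorD(1)[OF D(2) that] by simp
  have "is_colimit J (Psh U C) (comp_ftor J (yoneda U C) T) P (\<lambda>i. elt P (FO T i) (p i))"
    unfolding is_colimit_def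
  proof (intro conjI allI impI)
    show "is_cocone J (Psh U C) (comp_ftor J (yoneda U C) T) P (\<lambda>i. elt P (FO T i) (p i))"
      by (rule cocone_elt[OF D(2,3,4)])
  next
    fix G d assume d: "is_cocone J (Psh U C) (comp_ftor J (yoneda U C) T) G d"
    have G: "presheaf G" using d by (simp add: is_cocone_def)
    let ?g = "\<lambda>i. d i (FO T i) (code (FO T i) (FO T i) (Idt K (FO T i)))"
    have d0: "natural (y (FO T i)) G (d i)" if "i \<in> Ob J" for i
      using d that by (simp add: is_cocone_def yoneda_sel T0)
    obtain h where h: "\<And>D x. \<lbrakk>D \<in> Ob K; x \<in> FO P D\<rbrakk> \<Longrightarrow> h D x \<in> FO G D"
      "\<And>A B k x. \<lbrakk>A \<in> Ob K; B \<in> Ob K; is_total K B A k; x \<in> FO P A\<rbrakk> \<Longrightarrow>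
        h B (FA P A B k x) = FA G A B k (h A x)"
      "\<And>i. i \<in> Ob J \<Longrightarrow> h (FO T i) (p i) = ?g i"
      using presents_extend[OF p action_presheaf[OF G] cocone_compatible[OF D(2) d]] by metis
    show "\<exists>!h. h \<in> Hom (Psh U C) P G \<and> (\<forall>i\<in>Ob J. Comp (Psh U C) (FO (comp_ftor J (yoneda U C) T) i) P G h
        (elt P (FO T i) (p i)) = d i)"
    proof (rule ex1I[of _ "mk_nat P h"], safe)
      have nh: "natural P G (mk_nat P h)"
        by (rule natural_mk_nat[OF D(3)]) (simp_all add: h)
      then show "mk_nat P h \<in> Hom (Psh U C) P G" by simp
      fix i assume i: "i \<in> Ob J"
      have "Comp (Psh U C) (y (FO T i)) P G (mk_nat P h) (elt P (FO T i) (p i)) = d i"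
        by (rule natural_y_eqI[OF G T0[OF i]])
          (use i in \<open>simp_all add: natural_Comp natural_elt D T0 nh d0 presheafD(4)[OF D(3)] h(3)\<close>)
      then show "Comp (Psh U C) (FO (comp_ftor J (yoneda U C) T) i) P G (mk_nat P h)
        (elt P (FO T i) (p i)) = d i"
        using i by (simp add: yoneda_sel T0)
    next
      fix h' assume h': "h' \<in> Hom (Psh U C) P G" and eq: "\<forall>i\<in>Ob J. Comp (Psh U C) (FO (comp_ftor J (yoneda U C) T) i) P G h'
        (elt P (FO T i) (p i)) = d i"
      have nh: "natural P G (mk_nat P h)"
        by (rule natural_mk_nat[OF D(3)]) (simp_all add: h)
      have 1: "h' (FO T i) (p i) = ?g i" if i: "i \<in> Ob J" for i
      proof -
        have "Comp (Psh U C) (y (FO T i)) P G h' (elt P (FO T i) (p i)) = d i"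
          using eq i by (simp add: yoneda_sel T0)
        from fun_cong[OF fun_cong[OF this], of "FO T i" "code (FO T i) (FO T i) (Idt K (FO T i))"]
        show ?thesis
          using i by (simp add: T0 D presheafD(4)[OF D(3)])
      qed
      show "h' = mk_nat P h"
      proof (rule natural_eqI[OF _ nh])
        show "natural P G h'" using h' by simp
        fix A x assume A: "A \<in> Ob K" "x \<in> FO P A"
        then obtain i k where i: "i \<in> Ob J" "is_total K A (FO T i) k" "x = FA P (FO T i) A k (p i)"
          by (rule presents_gen[OF p])
        show "h' A x = mk_nat P h A x"
          using A i h' D(3,6) by (simp add: T0 naturalD(3)[of P G h'] 1 h)
      qed
    qed
  qed
  then show ?thesis
    unfolding small_presheaf_def using D by blast
qed

lemma small_presheaf_presheaf: "small_presheaf U C P \<Longrightarrow> presheaf P"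
  by (erule small_presheaf_presents) (simp add: presentsD(3))

lemma small_presheaf_y [simp]:
  assumes "D \<in> Ob K"
  shows "small_presheaf U C (y D)"
proof -
  \<comment> \<open>The one-object category; any element of \<open>'u\<close> serves as its object and arrow.\<close>
  let ?a = "undefined :: 'u"
  let ?J = "\<lparr>Ob = {?a}, Hom = (\<lambda>_ _. {?a}), Comp = (\<lambda>_ _ _ _ _. ?a), Idt = (\<lambda>_. ?a)\<rparr>"
  let ?T = "mk_ftor ?J (\<lambda>_. D) (\<lambda>_ _ _. Idt K D)"
  have J: "small_category U ?J" by (rule small_category_single[OF universe])
  have T: "is_functor ?J C ?T"
    using J assms by (intro is_functor_mk_ftor) (simp_all add: small_category_def)
  have T0 [simp]: "FO ?T ?a = D" "FA ?T ?a ?a ?a = Idt K D" by (simp_all add: mk_ftor_def)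
  have "presents (y D) ?J ?T (\<lambda>_. code D D (Idt K D))"
    unfolding presents_def
  proof (intro conjI allI impI ballI J T)
    fix A x assume "A \<in> Ob K" "x \<in> FO (y D) A"
    then obtain k where "is_total K A D k" "x = code A D k"
      using assms by (blast elim: y_elemE)
    then show "\<exists>i\<in>Ob ?J. \<exists>k. is_total K A (FO ?T i) k \<and> x = FA (y D) (FO ?T i) A k (code D D (Idt K D))"
      using assms \<open>A \<in> Ob K\<close> by (auto simp: y_sel(2) is_total_Hom)
  next
    fix G g i j A k k'
    assume "i \<in> Ob ?J" "j \<in> Ob ?J" "A \<in> Ob K" "is_total K A (FO ?T i) k" "is_total K A (FO ?T j) k'"
      "FA (y D) (FO ?T i) A k (code D D (Idt K D)) = FA (y D) (FO ?T j) A k' (code D D (Idt K D))"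
    then show "FA G (FO ?T i) A k (g i) = FA G (FO ?T j) A k' (g j)"
      using assms by (simp add: y_sel(2) is_total_Hom)
  qed (use assms in \<open>simp_all add: compatible_def y_sel(2) is_total_Hom\<close>)
  then show ?thesis by (rule presents_small_presheaf)
qed

section \<open>Subpresheaves cut out by restriction idempotents\<close>

text \<open>
  The chosen splitting of a restriction idempotent \<open>e\<close> on \<open>D\<close> is \<open>e = sm D e \<circ> sr D e\<close>
  through the object \<open>so D e\<close>.
\<close>

definition splitting :: "'o \<Rightarrow> 'a \<Rightarrow> 'o \<times> 'a \<times> 'a" where
  "splitting D e = (SOME (Z, m, r). splits_as K D e Z m r)"

definition so where "so D e = fst (splitting D e)"
definition sm where "sm D e = fst (snd (splitting D e))"
definition sr where "sr D e = snd (snd (splitting D e))"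

lemma splits_as_chosen:
  assumes "D \<in> Ob K" "restriction_idempotent K D e"
  shows "splits_as K D e (so D e) (sm D e) (sr D e)"
proof -
  have "\<exists>s. case s of (Z, m, r) \<Rightarrow> splits_as K D e Z m r"
    using split_K assms unfolding split_def by auto
  then have "case splitting D e of (Z, m, r) \<Rightarrow> splits_as K D e Z m r"
    unfolding splitting_def by (rule someI_ex)
  then show ?thesis by (auto simp: so_def sm_def sr_def split: prod.splits)
qed

lemma chosen:
  assumes "D \<in> Ob K" "restriction_idempotent K D e"
  shows "so D e \<in> Ob K" "is_total K (so D e) D (sm D e)" "sm D e \<in> Hom K (so D e) D"
    "sr D e \<in> Hom K D (so D e)"
    "Comp K D (so D e) D (sm D e) (sr D e) = e"
    "Comp K (so D e) D (so D e) (sr D e) (sm D e) = Idt K (so D e)"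
    "Rst K D (so D e) (sr D e) = e"
    "Comp K (so D e) D D e (sm D e) = sm D e"
    "restriction_monic K (so D e) D (sm D e)"
proof -
  note s = splits_as_chosen[OF assms]
  show so: "so D e \<in> Ob K" and sm: "sm D e \<in> Hom K (so D e) D" and sr: "sr D e \<in> Hom K D (so D e)"
    and e: "Comp K D (so D e) D (sm D e) (sr D e) = e"
    and i: "Comp K (so D e) D (so D e) (sr D e) (sm D e) = Idt K (so D e)"
    using s by (simp_all add: splits_as_def)
  show "is_total K (so D e) D (sm D e)" "Rst K D (so D e) (sr D e) = e"
    using splits_as_total[OF assms(1) s] splits_as_Rst[OF assms(1) s assms(2)] .
  have "Comp K (so D e) D D (Comp K D (so D e) D (sm D e) (sr D e)) (sm D e)
     = Comp K (so D e) (so D e) D (sm D e) (Comp K (so D e) D (so D e) (sr D e) (sm D e))"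
    using so sm sr assms by (simp add: Comp_assoc)
  then show "Comp K (so D e) D D e (sm D e) = sm D e"
    using so sm assms by (simp add: e i)
  show "restriction_monic K (so D e) D (sm D e)"
    unfolding restriction_monic_def using s assms by blast
qed

lemma factor_split:
  assumes "D \<in> Ob K" "restriction_idempotent K D e" "A \<in> Ob K" "k \<in> Hom K A D" "Comp K A D D e k = k"
  shows "Comp K A (so D e) D (sm D e) (Comp K A D (so D e) (sr D e) k) = k"
  using assms chosen[OF assms(1,2)] by (simp add: Comp_assoc)

lemma factor_split_total:
  assumes "D \<in> Ob K" "restriction_idempotent K D e" "A \<in> Ob K" "is_total K A D k" "Comp K A D D e k = k"
  shows "is_total K A (so D e) (Comp K A D (so D e) (sr D e) k)"
  using total_right_factor[of A "so D e" D "Comp K A D (so D e) (sr D e) k" "sm D e"]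
    factor_split[of D e A k] assms chosen[OF assms(1,2)] by (simp add: is_total_Hom)

lemma split_cancel:
  assumes "D \<in> Ob K" "restriction_idempotent K D e" "A \<in> Ob K" "l \<in> Hom K A (so D e)"
  shows "Comp K A D (so D e) (sr D e) (Comp K A (so D e) D (sm D e) l) = l"
  using assms chosen[OF assms(1,2)] by (simp add: Comp_assoc)

lemma split_fix:
  assumes "D \<in> Ob K" "restriction_idempotent K D e" "A \<in> Ob K" "l \<in> Hom K A (so D e)"
  shows "Comp K A D D e (Comp K A (so D e) D (sm D e) l) = Comp K A (so D e) D (sm D e) l"
  using assms chosen[OF assms(1,2)] restriction_idempotentD(1)[OF assms(2)] by (simp add: Comp_assoc)

text \<open>
  Each idempotent fixes the monic part of the splitting of the other, so \<open>e d = d\<close> and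
  \<open>d e = e\<close>; and restriction idempotents commute.
\<close>

lemma restriction_idempotent_eqI:
  assumes D: "D \<in> Ob K" and e: "restriction_idempotent K D e" and d: "restriction_idempotent K D d"
    and fix_iff: "\<And>A k. \<lbrakk>A \<in> Ob K; is_total K A D k\<rbrakk> \<Longrightarrow> Comp K A D D e k = k \<longleftrightarrow> Comp K A D D d k = k"
  shows "e = d"
proof -
  note E = restriction_idempotentD[OF e] and D' = restriction_idempotentD[OF d]
  have *: "Comp K D D D b a = a"
    if a: "restriction_idempotent K D a" and b: "restriction_idempotent K D b"
      and m: "Comp K (so D a) D D b (sm D a) = sm D a" for a b
  proof -
    note ca = chosen[OF D a]
    have "Comp K D D D b (Comp K D (so D a) D (sm D a) (sr D a))
        = Comp K D (so D a) D (Comp K (so D a) D D b (sm D a)) (sr D a)"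
      using D ca(1,3,4) restriction_idempotentD(1)[OF b] by (intro Comp_assoc)
    then show ?thesis by (simp add: m ca(5))
  qed
  have "Comp K D D D d e = e" "Comp K D D D e d = d"
    using *[OF e d] *[OF d e] fix_iff chosen[OF D e] chosen[OF D d] by blast+
  then show ?thesis
    using R2[of D D D d e] D E D' by simp
qed

text \<open>
  \<open>e\<close> is the domain of definition at \<open>x \<in> P D\<close> of the subpresheaf \<open>W\<close>: a total map
  restricts \<open>x\<close> into \<open>W\<close> iff it factors through the splitting of \<open>e\<close>.
\<close>

definition domain_at where
  "domain_at P W D x e \<longleftrightarrow> restriction_idempotent K D e \<and>
    (\<forall>A\<in>Ob K. \<forall>k. is_total K A D k \<longrightarrow> (FA P D A k x \<in> W A \<longleftrightarrow> Comp K A D D e k = k))"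

text \<open>
  The subpresheaves that occur as images of chosen monics (see \<open>Mon_PM_iff\<close>); they are closed
  under the action because \<open>x \<in> W D\<close> forces its domain of definition to be the identity.
\<close>

definition M_sub where
  "M_sub P W \<longleftrightarrow> (\<forall>D\<in>Ob K. W D \<subseteq> FO P D) \<and> (\<forall>D\<in>Ob K. \<forall>x\<in>FO P D. \<exists>e. domain_at P W D x e)"

lemma domain_atD:
  assumes "domain_at P W D x e"
  shows "restriction_idempotent K D e"
    and "\<lbrakk>A \<in> Ob K; is_total K A D k\<rbrakk> \<Longrightarrow> FA P D A k x \<in> W A \<longleftrightarrow> Comp K A D D e k = k"
  using assms by (simp_all add: domain_at_def)

lemma domain_at_unique:
  assumes "D \<in> Ob K" "domain_at P W D x e" "domain_at P W D x d"
  shows "e = d"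
  using assms(2,3) by (intro restriction_idempotent_eqI[OF assms(1)]) (auto simp: domain_at_def)

lemma domain_at_in:
  assumes P: "presheaf P" and D: "D \<in> Ob K" "x \<in> FO P D" and e: "domain_at P W D x e"
  shows "x \<in> W D \<longleftrightarrow> e = Idt K D"
  using domain_atD(2)[OF e D(1), of "Idt K D"] restriction_idempotentD(1)[OF domain_atD(1)[OF e]] D
  by (simp add: presheafD(4)[OF P])

lemma Rst_fix_iff:
  assumes "A \<in> Ob K" "B \<in> Ob K" "D \<in> Ob K" "f \<in> Hom K B D" "is_total K A B k"
  shows "Comp K A B B (Rst K B D f) k = k \<longleftrightarrow> is_total K A D (Comp K A B D f k)"
proof
  assume *: "Comp K A B B (Rst K B D f) k = k"
  have "Rst K A D (Comp K A B D f k) = Rst K A B k"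
    using Rst_Comp_left[of A B D k f] assms * by (simp add: is_total_Hom)
  then show "is_total K A D (Comp K A B D f k)"
    using assms by (simp add: is_total_def)
next
  assume "is_total K A D (Comp K A B D f k)"
  then show "Comp K A B B (Rst K B D f) k = k"
    using R4[of A B D k f] assms by (simp add: is_total_def)
qed

lemma idem_fix_iff:
  assumes "A \<in> Ob K" "B \<in> Ob K" "D \<in> Ob K" "restriction_idempotent K D e" "is_total K A B l" "is_total K B D k"
  shows "Comp K A B B (Rst K B D (Comp K B D D e k)) l = l \<longleftrightarrow>
    Comp K A D D e (Comp K A B D k l) = Comp K A B D k l"
proof -
  note e = restriction_idempotentD[OF assms(4)]
  have kl: "is_total K A D (Comp K A B D k l)" using assms by (simp add: total_Comp)
  have "Comp K A B B (Rst K B D (Comp K B D D e k)) l = l \<longleftrightarrow>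
      is_total K A D (Comp K A B D (Comp K B D D e k) l)"
    using assms e by (intro Rst_fix_iff) (simp_all add: is_total_Hom)
  also have "Comp K A B D (Comp K B D D e k) l = Comp K A D D e (Comp K A B D k l)"
    using assms e by (simp add: Comp_assoc is_total_Hom)
  also have "is_total K A D (Comp K A D D e (Comp K A B D k l)) \<longleftrightarrow>
      Comp K A D D e (Comp K A B D k l) = Comp K A B D k l"
    using Rst_fix_iff[of A D D e "Comp K A B D k l"] assms e kl by simp
  finally show ?thesis .
qed

lemma domain_at_act:
  assumes P: "presheaf P" and D: "D \<in> Ob K" "x \<in> FO P D" and e: "domain_at P W D x e"
    and k: "B \<in> Ob K" "is_total K B D k"
  shows "domain_at P W B (FA P D B k x) (Rst K B D (Comp K B D D e k))"
proof -
  note e' = domain_atD(1)[OF e] and E = restriction_idempotentD[OF domain_atD(1)[OF e]]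
  show ?thesis
    unfolding domain_at_def
  proof (intro conjI ballI allI impI)
    show "restriction_idempotent K B (Rst K B D (Comp K B D D e k))"
      using D k E by (intro restriction_idempotent_Rst) (simp_all add: is_total_Hom)
    fix A l assume A: "A \<in> Ob K" "is_total K A B l"
    have "FA P B A l (FA P D B k x) = FA P D A (Comp K A B D k l) x"
      using A D k by (simp add: presheafD(5)[OF P])
    then show "FA P B A l (FA P D B k x) \<in> W A \<longleftrightarrow>
        Comp K A B B (Rst K B D (Comp K B D D e k)) l = l"
      using domain_atD(2)[OF e A(1), of "Comp K A B D k l"] idem_fix_iff[of A B D e l k] A D k e'
      by (simp add: total_Comp)
  qed
qed

lemma M_sub_closed:
  assumes P: "presheaf P" and W: "M_sub P W" and x: "D \<in> Ob K" "x \<in> W D" "B \<in> Ob K" "is_total K B D k"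
  shows "FA P D B k x \<in> W B"
proof -
  have xP: "x \<in> FO P D" using W x by (auto simp: M_sub_def)
  then obtain e where e: "domain_at P W D x e" using W x unfolding M_sub_def by blast
  then have "e = Idt K D" using domain_at_in[OF P x(1) xP e] x by simp
  then show ?thesis using domain_atD(2)[OF e x(3,4)] x by (simp add: is_total_Hom)
qed

lemma action_M_sub:
  assumes P: "presheaf P" and W: "M_sub P W"
  shows "action W (FA P)"
proof (rule actionI)
  have sub: "W A \<subseteq> FO P A" if "A \<in> Ob K" for A using W that by (auto simp: M_sub_def)
  fix A assume A: "A \<in> Ob K"
  show "small U (W A)" using small_subset[OF presheafD(1)[OF P A] sub[OF A]] .
  show "FA P A A (Idt K A) x = x" if "x \<in> W A" for x
    using that sub[OF A] presheafD(4)[OF P A] by blast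
  show "FA P A B k x \<in> W B" if "B \<in> Ob K" "is_total K B A k" "x \<in> W A" for B k x
    using M_sub_closed[OF P W A that(3,1,2)] .
  show "FA P A D (Comp K D B A k l) x = FA P B D l (FA P A B k x)"
    if "B \<in> Ob K" "D \<in> Ob K" "is_total K B A k" "is_total K D B l" "x \<in> W A" for B D k l x
    using that sub[OF A] presheafD(5)[OF P A] by blast
qed

text \<open>
  The presheaf of partial elements of \<open>G\<close>: at \<open>D\<close>, an element of \<open>G\<close> over the splitting of some
  restriction idempotent on \<open>D\<close>. It classifies the partial maps into \<open>G\<close> whose domain is cut out
  by restriction idempotents.
\<close>

definition partial_elements where
  "partial_elements G D = Sigma {e. restriction_idempotent K D e} (\<lambda>e. FO G (so D e))"

definition partial_act where
  "partial_act G D A k = (\<lambda>(e, v). let d = Rst K A D (Comp K A D D e k) in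
     (d, FA G (so D e) (so A d) (Comp K (so A d) D (so D e) (sr D e) (Comp K (so A d) A D k (sm A d))) v))"

lemma partial_act_total:
  assumes "A \<in> Ob K" "D \<in> Ob K" "restriction_idempotent K D e" "is_total K A D k"
    and "d = Rst K A D (Comp K A D D e k)"
  shows "restriction_idempotent K A d"
    and "Comp K (so A d) D D e (Comp K (so A d) A D k (sm A d)) = Comp K (so A d) A D k (sm A d)"
    and "is_total K (so A d) (so D e) (Comp K (so A d) D (so D e) (sr D e) (Comp K (so A d) A D k (sm A d)))"
proof -
  note e = restriction_idempotentD[OF assms(3)]
  show d: "restriction_idempotent K A d"
    using assms e by (simp add: is_total_Hom)
  show 1: "Comp K (so A d) D D e (Comp K (so A d) A D k (sm A d)) = Comp K (so A d) A D k (sm A d)"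
    using idem_fix_iff[of "so A d" A D e "sm A d" k] assms chosen[OF assms(1) d] by simp
  show "is_total K (so A d) (so D e) (Comp K (so A d) D (so D e) (sr D e) (Comp K (so A d) A D k (sm A d)))"
    using 1 assms chosen[OF assms(1) d] by (intro factor_split_total) (simp_all add: total_Comp)
qed

lemma action_partial_elements:
  assumes G: "presheaf G"
  shows "action (partial_elements G) (partial_act G)"
proof (rule actionI)
  fix D assume D: "D \<in> Ob K"
  have "{e. restriction_idempotent K D e} \<subseteq> Hom K D D"
    by (auto simp: restriction_idempotent_def)
  moreover have "small U (Hom K D D)" using loc_small D by (simp add: locally_small_def)
  ultimately have "small U {e. restriction_idempotent K D e}" using small_subset by blast
  then show "small U (partial_elements G D)"
    unfolding partial_elements_def using D
    by (intro small_Sigma[OF universe]) (auto intro!: presheafD(1)[OF G] chosen)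
  fix x assume "x \<in> partial_elements G D"
  then obtain e v where x: "x = (e, v)" "restriction_idempotent K D e" "v \<in> FO G (so D e)"
    by (auto simp: partial_elements_def)
  note e = restriction_idempotentD[OF x(2)] and ce = chosen[OF D x(2)]
  show "partial_act G D D (Idt K D) x = x"
    using e ce D x by (simp add: partial_act_def Let_def presheafD(4)[OF G])
  fix A k assume A: "A \<in> Ob K" "is_total K A D k"
  define d where "d = Rst K A D (Comp K A D D e k)"
  note d = partial_act_total[OF A(1) D x(2) A(2) d_def]
  note cd = chosen[OF A(1) d(1)] and d' = restriction_idempotentD[OF d(1)]
  define w where "w = FA G (so D e) (so A d) (Comp K (so A d) D (so D e) (sr D e) (Comp K (so A d) A D k (sm A d))) v"
  have 1: "partial_act G D A k x = (d, w)"
    by (simp add: x partial_act_def Let_def d_def w_def)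
  have w: "w \<in> FO G (so A d)"
    unfolding w_def using x ce cd d by (intro presheafD(3)[OF G])
  show "partial_act G D A k x \<in> partial_elements G A"
    using w d by (simp add: 1 partial_elements_def)
  fix B l assume B: "B \<in> Ob K" "is_total K B A l"
  define c where "c = Rst K B A (Comp K B A A d l)"
  note c = partial_act_total[OF B(1) A(1) d(1) B(2) c_def]
  note cc = chosen[OF B(1) c(1)] and c' = restriction_idempotentD[OF c(1)]
  have kl: "is_total K B D (Comp K B A D k l)"
    using A B D by (simp add: total_Comp)
  have c_eq: "c = Rst K B D (Comp K B D D e (Comp K B A D k l))"
  proof -
    have "c = Rst K B D (Comp K B A D (Comp K A D D e k) l)"
      unfolding c_def d_def using A B D e by (intro Rst_Comp_left) (simp_all add: is_total_Hom)
    then show ?thesis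
      using A B D e by (simp add: Comp_assoc is_total_Hom)
  qed
  have *: "Comp K (so B c) (so A d) (so D e)
      (Comp K (so A d) D (so D e) (sr D e) (Comp K (so A d) A D k (sm A d)))
      (Comp K (so B c) A (so A d) (sr A d) (Comp K (so B c) B A l (sm B c)))
    = Comp K (so B c) D (so D e) (sr D e) (Comp K (so B c) B D (Comp K B A D k l) (sm B c))"
  proof -
    have "Comp K (so B c) (so A d) (so D e)
        (Comp K (so A d) D (so D e) (sr D e) (Comp K (so A d) A D k (sm A d)))
        (Comp K (so B c) A (so A d) (sr A d) (Comp K (so B c) B A l (sm B c)))
      = Comp K (so B c) D (so D e) (sr D e) (Comp K (so B c) A D k
          (Comp K (so B c) (so A d) A (sm A d) 
            (Comp K (so B c) A (so A d) (sr A d) (Comp K (so B c) B A l (sm B c)))))"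
      using A B D ce(1-4) cd(1-4) cc(1-4) by (simp add: Comp_assoc is_total_Hom)
    also have "Comp K (so B c) (so A d) A (sm A d) 
            (Comp K (so B c) A (so A d) (sr A d) (Comp K (so B c) B A l (sm B c)))
       = Comp K (so B c) B A l (sm B c)"
      using A B cc c by (intro factor_split d(1)) (simp_all add: is_total_Hom)
    finally show ?thesis
      using A B D ce(1-4) cd(1-4) cc(1-4) by (simp add: Comp_assoc is_total_Hom)
  qed
  have "partial_act G A B l (d, w) = (c, FA G (so A d) (so B c)
      (Comp K (so B c) A (so A d) (sr A d) (Comp K (so B c) B A l (sm B c))) w)"
    by (simp add: partial_act_def Let_def c_def)
  also have "\<dots> = (c, FA G (so D e) (so B c) (Comp K (so B c) D (so D e) (sr D e)
      (Comp K (so B c) B D (Comp K B A D k l) (sm B c))) v)"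
    unfolding w_def *[symmetric]
    using presheafD(5)[OF G ce(1) cd(1) cc(1) d(3) c(3) x(3)] by simp
  also have "\<dots> = partial_act G D B (Comp K B A D k l) x"
    by (simp add: x partial_act_def Let_def c_eq)
  finally show "partial_act G D B (Comp K B A D k l) x = partial_act G A B l (partial_act G D A k x)"
    by (simp add: 1)
qed

text \<open>
  A presentation \<open>(T, p)\<close> of \<open>P\<close> restricts to one of \<open>W\<close>: cut \<open>T i\<close> down to the domain of \<open>p i\<close>.
  Relations persist because a compatible family for the restricted diagram is a compatible family
  of partial elements for the original one.
\<close>

lemma small_M_sub:
  assumes P: "small_presheaf U C P" and W: "M_sub P W"
  shows "small_presheaf U C (mk_presheaf W (FA P))"
proof -
  obtain J T p where pres: "presents P J T p" using small_presheaf_presents[OF P] .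
  note D = presentsD[OF pres]
  note [simp] = D(5,6)
  interpret J: category J using D(1) by (simp add: small_category_def)
  let ?W = "mk_presheaf W (FA P)"
  have aW: "action W (FA P)" by (rule action_M_sub[OF D(3) W])
  have sub: "W A \<subseteq> FO P A" if "A \<in> Ob K" for A using W that by (auto simp: M_sub_def)
  have "\<exists>e. domain_at P W (FO T i) (p i) e" if "i \<in> Ob J" for i
    using W that D by (auto simp: M_sub_def)
  then obtain e where e: "\<And>i. i \<in> Ob J \<Longrightarrow> domain_at P W (FO T i) (p i) (e i)" by metis
  note ei = domain_atD(1)[OF e]
  define B where "B i = so (FO T i) (e i)" for i
  define m where "m i = sm (FO T i) (e i)" for i
  define r where "r i = sr (FO T i) (e i)" for i
  have c [simp]: "B i \<in> Ob K" "is_total K (B i) (FO T i) (m i)" "m i \<in> Hom K (B i) (FO T i)"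
    "r i \<in> Hom K (FO T i) (B i)" "Comp K (B i) (FO T i) (B i) (r i) (m i) = Idt K (B i)"
    "Comp K (B i) (FO T i) (FO T i) (e i) (m i) = m i"
    if "i \<in> Ob J" for i
    using chosen[OF D(5) ei] that by (simp_all add: B_def m_def r_def)
  \<comment> \<open>Arrows of the diagram respect domains of definition, by uniqueness of the latter.\<close>
  have eu: "e i = Rst K (FO T i) (FO T j) (Comp K (FO T i) (FO T j) (FO T j) (e j) (FA T i j u))"
    if "i \<in> Ob J" "j \<in> Ob J" "u \<in> Hom J i j" for i j u
    using domain_at_unique[OF D(5)[OF that(1)] e[OF that(1)]]
      domain_at_act[OF D(3) D(5)[OF that(2)] D(6)[OF that(2)] e[OF that(2)] D(5)[OF that(1)] D(7)[OF that]]
    by (simp add: D(8)[OF that])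
  define S where "S i j u = Comp K (B i) (FO T j) (B j) (r j) (Comp K (B i) (FO T i) (FO T j) (FA T i j u) (m i))" for i j u
  have mS: "Comp K (B i) (B j) (FO T j) (m j) (S i j u) = Comp K (B i) (FO T i) (FO T j) (FA T i j u) (m i)"
    and S: "is_total K (B i) (B j) (S i j u)"
    if *: "i \<in> Ob J" "j \<in> Ob J" "u \<in> Hom J i j" for i j u
  proof -
    have "Comp K (B i) (FO T j) (FO T j) (e j) (Comp K (B i) (FO T i) (FO T j) (FA T i j u) (m i))
      = Comp K (B i) (FO T i) (FO T j) (FA T i j u) (m i)"
      using partial_act_total(2)[OF _ _ ei D(7) eu, of i j u] * by (simp add: B_def m_def)
    then show "Comp K (B i) (B j) (FO T j) (m j) (S i j u) = Comp K (B i) (FO T i) (FO T j) (FA T i j u) (m i)"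
      unfolding S_def m_def[of j] B_def[of j] r_def using * D(7)[OF *]
      by (intro factor_split ei) (simp_all add: is_total_Hom)
    show "is_total K (B i) (B j) (S i j u)"
      using partial_act_total(3)[OF _ _ ei D(7) eu, of i j u] * by (simp add: B_def m_def r_def S_def)
  qed
  have S_eqI: "f = g" if "i \<in> Ob J" "A \<in> Ob K" "f \<in> Hom K A (B i)" "g \<in> Hom K A (B i)"
    "Comp K A (B i) (FO T i) (m i) f = Comp K A (B i) (FO T i) (m i) g" for i A f g
  proof -
    have "Comp K A (FO T i) (B i) (r i) (Comp K A (B i) (FO T i) (m i) h) = h"
      if "h \<in> Hom K A (B i)" for h
      using that \<open>i \<in> Ob J\<close> \<open>A \<in> Ob K\<close> by (simp add: Comp_assoc)
    from this[OF that(3)] this[OF that(4)] show ?thesis unfolding that(5) by simp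
  qed
  let ?S = "mk_ftor J B S"
  have T_Idt: "FA T i i (Idt J i) = Idt K (FO T i)" if "i \<in> Ob J" for i
    using is_functorD(3)[OF D(2) that] by simp
  have T_Comp: "FA T i k (Comp J i j k v u) = Comp K (FO T i) (FO T j) (FO T k) (FA T j k v) (FA T i j u)"
    if "i \<in> Ob J" "j \<in> Ob J" "k \<in> Ob J" "u \<in> Hom J i j" "v \<in> Hom J j k" for i j k u v
    using is_functorD(4)[OF D(2) that] by simp
  have functor_S: "is_functor J C ?S"
  proof (rule is_functor_mk_ftor[OF J.category_axioms], goal_cases)
    case (3 i)
    then show ?case by (simp add: S_def T_Idt)
  next
    case (4 i j k u v)
    have T1: "is_total K (FO T i) (FO T j) (FA T i j u)" "is_total K (FO T j) (FO T k) (FA T j k v)"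
      using 4 D(7) by auto
    have S1: "S i j u \<in> Hom K (B i) (B j)" "S j k v \<in> Hom K (B j) (B k)" "S i k (Comp J i j k v u) \<in> Hom K (B i) (B k)"
      using 4 S by (simp_all add: is_total_Hom)
    have "Comp K (B i) (B k) (FO T k) (m k) (Comp K (B i) (B j) (B k) (S j k v) (S i j u))
        = Comp K (B i) (FO T j) (FO T k) (FA T j k v) (Comp K (B i) (B j) (FO T j) (m j) (S i j u))"
      using 4 S1 T1 mS[of j k v] by (simp add: Comp_assoc is_total_Hom)
    also have "\<dots> = Comp K (B i) (B k) (FO T k) (m k) (S i k (Comp J i j k v u))"
      using 4 T1 by (simp add: mS T_Comp Comp_assoc is_total_Hom)
    finally have eq: "Comp K (B i) (B k) (FO T k) (m k) (S i k (Comp J i j k v u))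
        = Comp K (B i) (B k) (FO T k) (m k) (Comp K (B i) (B j) (B k) (S j k v) (S i j u))" by (rule sym)
    have "Comp K (B i) (B j) (B k) (S j k v) (S i j u) \<in> Hom K (B i) (B k)"
      using 4(1-3) S1 by (intro Comp_in) simp_all
    then show ?case
      using S_eqI[OF 4(3) c(1)[OF 4(1)] S1(3) _ eq] by simp
  qed (simp_all add: S)
  define q where "q i = FA P (FO T i) (B i) (m i) (p i)" for i
  have q: "q i \<in> W (B i)" if "i \<in> Ob J" for i
    unfolding q_def using domain_atD(2)[OF e[OF that] c(1,2)[OF that]] c(6)[OF that] by simp
  have q_act: "FA ?W (B i) A k (q i) = FA P (FO T i) A (Comp K A (B i) (FO T i) (m i) k) (p i)"
    if "i \<in> Ob J" "A \<in> Ob K" "is_total K A (B i) k" for i A k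
    using that q by (simp add: q_def presheafD(5)[OF D(3)])
  have "presents ?W J ?S q"
    unfolding presents_def
  proof (intro conjI allI impI ballI D(1) functor_S presheaf_mk_presheaf[OF aW])
    show "compatible J ?S (FO ?W) (FA ?W) q"
      unfolding compatible_def
    proof (intro conjI ballI)
      fix i j u assume *: "i \<in> Ob J" "j \<in> Ob J" "u \<in> Hom J i j"
      have "FA ?W (B j) (B i) (S i j u) (q j) = FA P (FO T i) (B i) (m i) (FA P (FO T j) (FO T i) (FA T i j u) (p j))"
        using * D(7)[OF *] by (simp add: q_act S mS presheafD(5)[OF D(3)])
      then show "FA ?W (FO ?S j) (FO ?S i) (FA ?S i j u) (q j) = q i"
        using * by (simp add: q_def D(8))
    qed (simp add: q)
  next
    fix A w assume A: "A \<in> Ob K" "w \<in> FO ?W A"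
    then have "w \<in> FO P A" "w \<in> W A" using sub by auto
    then obtain i k where i: "i \<in> Ob J" "is_total K A (FO T i) k" "w = FA P (FO T i) A k (p i)"
      using presents_gen[OF pres A(1)] by blast
    then have ek: "Comp K A (FO T i) (FO T i) (e i) k = k"
      using domain_atD(2)[OF e[OF i(1)] A(1) i(2)] \<open>w \<in> W A\<close> by simp
    then have "is_total K A (B i) (Comp K A (FO T i) (B i) (r i) k)"
      "Comp K A (B i) (FO T i) (m i) (Comp K A (FO T i) (B i) (r i) k) = k"
      using A i by (auto simp: B_def r_def m_def ei is_total_Hom intro!: factor_split factor_split_total)
    then show "\<exists>i\<in>Ob J. \<exists>k. is_total K A (FO ?S i) k \<and> w = FA ?W (FO ?S i) A k (q i)"
      using i A by (intro bexI[of _ i] exI[of _ "Comp K A (FO T i) (B i) (r i) k"]) (simp_all add: q_act)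
  next
    fix G g i j A k k'
    assume G: "presheaf G" and g: "compatible J ?S (FO G) (FA G) g"
      and ij: "i \<in> Ob J" "j \<in> Ob J" "A \<in> Ob K" "is_total K A (FO ?S i) k" "is_total K A (FO ?S j) k'"
      and eq: "FA ?W (FO ?S i) A k (q i) = FA ?W (FO ?S j) A k' (q j)"
    have g0: "g i \<in> FO G (B i)" if "i \<in> Ob J" for i
      using g that by (simp add: compatible_def)
    have g1: "FA G (B j) (B i) (S i j u) (g j) = g i" if "i \<in> Ob J" "j \<in> Ob J" "u \<in> Hom J i j" for i j u
      using g that by (simp add: compatible_def)
    have "compatible J T (partial_elements G) (partial_act G) (\<lambda>i. (e i, g i))"
      unfolding compatible_def
    proof (intro conjI ballI)
      fix i assume "i \<in> Ob J"
      then show "(e i, g i) \<in> partial_elements G (FO T i)"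
        using ei g0 by (simp add: partial_elements_def B_def)
    next
      fix i j u assume *: "i \<in> Ob J" "j \<in> Ob J" "u \<in> Hom J i j"
      show "partial_act G (FO T j) (FO T i) (FA T i j u) (e j, g j) = (e i, g i)"
        using g1[OF *] by (simp add: partial_act_def eu[OF *, symmetric] S_def B_def r_def m_def)
    qed
    moreover have "FA P (FO T i) A (Comp K A (B i) (FO T i) (m i) k) (p i)
        = FA P (FO T j) A (Comp K A (B j) (FO T j) (m j) k') (p j)"
      using eq ij by (simp add: q_act)
    ultimately have eq': "partial_act G (FO T i) A (Comp K A (B i) (FO T i) (m i) k) (e i, g i)
        = partial_act G (FO T j) A (Comp K A (B j) (FO T j) (m j) k') (e j, g j)"
      using ij by (intro presents_rel[OF pres action_partial_elements[OF G]]) (simp_all add: total_Comp)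
    \<comment> \<open>Elements defined everywhere are recovered through the chosen splitting of the identity.\<close>
    let ?s = "so A (Idt K A)" and ?m = "sm A (Idt K A)" and ?r = "sr A (Idt K A)"
    have I: "restriction_idempotent K A (Idt K A)" using ij by (simp add: restriction_idempotent_def)
    note cI = chosen[OF ij(3) I]
    have rI: "is_total K A ?s ?r" using cI ij by (simp add: is_total_def)
    have *: "partial_act G (FO T i) A (Comp K A (B i) (FO T i) (m i) k) (e i, g i)
        = (Idt K A, FA G (B i) ?s (Comp K ?s A (B i) k ?m) (g i))"
      if i: "i \<in> Ob J" and k: "is_total K A (B i) k" for i k
    proof -
      have k': "k \<in> Hom K A (B i)" using k by (simp add: is_total_Hom)
      have 1: "Comp K A (FO T i) (FO T i) (e i) (Comp K A (B i) (FO T i) (m i) k) = Comp K A (B i) (FO T i) (m i) k"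
        unfolding B_def m_def using i k' ij(3) by (intro split_fix ei) (simp_all add: B_def)
      have 2: "Comp K ?s (FO T i) (B i) (r i) (Comp K ?s A (FO T i) (Comp K A (B i) (FO T i) (m i) k) ?m)
        = Comp K ?s A (B i) k ?m"
      proof -
        have "Comp K ?s (FO T i) (B i) (r i) (Comp K ?s A (FO T i) (Comp K A (B i) (FO T i) (m i) k) ?m)
          = Comp K ?s (FO T i) (B i) (r i) (Comp K ?s (B i) (FO T i) (m i) (Comp K ?s A (B i) k ?m))"
          using i k' ij(3) cI by (simp add: Comp_assoc)
        also have "\<dots> = Comp K ?s A (B i) k ?m"
          unfolding B_def m_def r_def
          using i k' ij(3) cI(1-4) chosen(1)[OF D(5)[OF i] ei[OF i]] by (intro split_cancel ei) (simp_all add: B_def)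
        finally show ?thesis .
      qed
      have 3: "Rst K A (FO T i) (Comp K A (B i) (FO T i) (m i) k) = Idt K A"
        using total_Comp[OF ij(3) c(1)[OF i] D(5)[OF i] k c(2)[OF i]] unfolding is_total_def by blast
      show ?thesis
        using 2 by (simp add: partial_act_def Let_def 1 3 B_def[symmetric] r_def[symmetric])
    qed
    have **: "FA G ?s A ?r (FA G (B i) ?s (Comp K ?s A (B i) k ?m) (g i)) = FA G (B i) A k (g i)"
      if i: "i \<in> Ob J" and k: "is_total K A (B i) k" for i k
    proof -
      have "FA G (B i) A (Comp K A ?s (B i) (Comp K ?s A (B i) k ?m) ?r) (g i)
        = FA G ?s A ?r (FA G (B i) ?s (Comp K ?s A (B i) k ?m) (g i))"
        using i k ij(3) cI rI g0 by (intro presheafD(5)[OF G]) (simp_all add: total_Comp)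
      moreover have "Comp K A ?s (B i) (Comp K ?s A (B i) k ?m) ?r = k"
        using i k ij(3) cI is_total_Hom[OF k] by (simp add: Comp_assoc[symmetric])
      ultimately show ?thesis by simp
    qed
    show "FA G (FO ?S i) A k (g i) = FA G (FO ?S j) A k' (g j)"
      using eq' ij *[of i k] *[of j k'] **[of i k] **[of j k'] by simp
  qed
  then show ?thesis by (rule presents_small_presheaf)
qed

section \<open>Partial maps of small presheaves\<close>

abbreviation "PM \<equiv> P_M U C"

lemma P_small_sel [simp]:
  "P \<in> Ob (P_small U C) \<longleftrightarrow> small_presheaf U C P"
  "\<alpha> \<in> Hom (P_small U C) P Q \<longleftrightarrow> natural P Q \<alpha>"
  "Comp (P_small U C) = Comp (Psh U C)" "Idt (P_small U C) = Idt (Psh U C)"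
  by (auto simp: P_small_def small_presheaf_presheaf)

lemma PM_sel [simp]:
  "P \<in> Ob PM \<longleftrightarrow> small_presheaf U C P"
  "\<alpha> \<in> Hom PM P Q \<longleftrightarrow> natural P Q \<alpha>"
  "Comp PM = Comp (Psh U C)" "Idt PM = Idt (Psh U C)"
  by (simp_all add: P_M_def)

lemma Mon_PM:
  "\<mu> \<in> Mon PM P Q \<longleftrightarrow> natural P Q \<mu> \<and>
    (\<forall>D\<in>Ob K. \<forall>\<gamma>. natural (y D) Q \<gamma> \<longrightarrow> (\<exists>B\<in>Ob K. \<exists>m. restriction_monic K B D m \<and>
       (\<exists>\<delta>. is_pullback (P_small U C) P (y D) Q \<mu> \<gamma> (y B) \<delta> (FA (yoneda U C) B D m))))"
  unfolding P_M_def by (auto simp: yoneda_sel Bex_def)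

lemma M_sub_cong: "(\<And>D. D \<in> Ob K \<Longrightarrow> W D = W' D) \<Longrightarrow> M_sub P W \<longleftrightarrow> M_sub P W'"
  unfolding M_sub_def domain_at_def by auto

lemma restriction_monic_total:
  "\<lbrakk>restriction_monic K Z A m; A \<in> Ob K\<rbrakk> \<Longrightarrow> is_total K Z A m"
  unfolding restriction_monic_def using splits_as_total by blast

text \<open>
  Representables are small, so a pullback square of small presheaves can be tested on them, that
  is, elementwise.
\<close>

lemma monic_pullback_elements:
  assumes P: "presheaf P" and Q: "presheaf Q" and \<mu>: "natural P Q \<mu>"
    and D: "D \<in> Ob K" and x: "x \<in> FO Q D" and B: "B \<in> Ob K" and m: "restriction_monic K B D m"
    and pb: "is_pullback (P_small U C) P (y D) Q \<mu> (elt Q D x) (y B) \<delta> (FA (yoneda U C) B D m)"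
  shows "\<And>A l. \<lbrakk>A \<in> Ob K; is_total K A B l\<rbrakk> \<Longrightarrow>
      \<delta> A (code A B l) \<in> FO P A \<and> \<mu> A (\<delta> A (code A B l)) = FA Q D A (Comp K A B D m l) x"
    and "\<And>A k z. \<lbrakk>A \<in> Ob K; is_total K A D k; z \<in> FO P A; \<mu> A z = FA Q D A k x\<rbrakk> \<Longrightarrow>
      \<exists>l. is_total K A B l \<and> Comp K A B D m l = k \<and> \<delta> A (code A B l) = z"
proof -
  have mt: "is_total K B D m" using restriction_monic_total[OF m D] .
  have \<delta>: "natural (y B) P \<delta>"
    and sq: "Comp (Psh U C) (y B) P Q \<mu> \<delta> = Comp (Psh U C) (y B) (y D) Q (elt Q D x) (FA (yoneda U C) B D m)"
    and univ: "\<And>V s t. \<lbrakk>small_presheaf U C V; natural V P s; natural V (y D) t;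
        Comp (Psh U C) V P Q \<mu> s = Comp (Psh U C) V (y D) Q (elt Q D x) t\<rbrakk> \<Longrightarrow>
      \<exists>!h. natural V (y B) h \<and> Comp (Psh U C) V (y B) P \<delta> h = s \<and>
        Comp (Psh U C) V (y B) (y D) (FA (yoneda U C) B D m) h = t"
    using pb unfolding is_pullback_def by auto
  show "\<delta> A (code A B l) \<in> FO P A \<and> \<mu> A (\<delta> A (code A B l)) = FA Q D A (Comp K A B D m l) x"
    if A: "A \<in> Ob K" "is_total K A B l" for A l
    using fun_cong[OF fun_cong[OF sq], of A "code A B l"] A B D mt naturalD(2)[OF \<delta> A(1)]
    by (simp add: yoneda_sel total_Comp)
  show "\<exists>l. is_total K A B l \<and> Comp K A B D m l = k \<and> \<delta> A (code A B l) = z"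
    if A: "A \<in> Ob K" "is_total K A D k" "z \<in> FO P A" "\<mu> A z = FA Q D A k x" for A k z
  proof -
    let ?one = "code A A (Idt K A)"
    have s: "natural (y A) P (elt P A z)" and t: "natural (y A) (y D) (FA (yoneda U C) A D k)"
      using A D P by (simp_all add: natural_elt natural_yoneda)
    have "Comp (Psh U C) (y A) P Q \<mu> (elt P A z) = Comp (Psh U C) (y A) (y D) Q (elt Q D x) (FA (yoneda U C) A D k)"
      by (rule natural_y_eqI[OF Q A(1)])
        (use A D P Q \<mu> s t x in \<open>simp_all add: natural_Comp natural_elt presheafD(4)[OF P] yoneda_sel is_total_Hom\<close>)
    from univ[OF small_presheaf_y[OF A(1)] s t this]
    obtain h where h: "natural (y A) (y B) h" "Comp (Psh U C) (y A) (y B) P \<delta> h = elt P A z"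
      "Comp (Psh U C) (y A) (y B) (y D) (FA (yoneda U C) B D m) h = FA (yoneda U C) A D k"
      by blast
    obtain l where l: "is_total K A B l" "h A ?one = code A B l"
      using y_elemE[OF naturalD(2)[OF h(1) A(1), of ?one] B A(1)] A by auto
    have "code A D (Comp K A B D m l) = code A D k"
      using fun_cong[OF fun_cong[OF h(3)], of A ?one] A B D mt l by (simp add: yoneda_sel is_total_Hom)
    then have "Comp K A B D m l = k"
      using A B D mt l by (simp add: total_Comp)
    moreover have "\<delta> A (code A B l) = z"
      using fun_cong[OF fun_cong[OF h(2)], of A ?one] A l by (simp add: presheafD(4)[OF P])
    ultimately show ?thesis using l by blast
  qed
qed

lemma lift_natural:
  assumes W: "presheaf W" and Z: "presheaf Z" and n: "natural Z Q n"
    and inj: "\<And>D. D \<in> Ob K \<Longrightarrow> inj_on (n D) (FO Z D)" and a: "natural W Q a"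
    and range: "\<And>D w. \<lbrakk>D \<in> Ob K; w \<in> FO W D\<rbrakk> \<Longrightarrow> a D w \<in> n D ` FO Z D"
  obtains h where "natural W Z h" "\<And>D w. \<lbrakk>D \<in> Ob K; w \<in> FO W D\<rbrakk> \<Longrightarrow> n D (h D w) = a D w"
proof -
  let ?h = "mk_nat W (\<lambda>D w. inv_into (FO Z D) (n D) (a D w))"
  have h0: "inv_into (FO Z D) (n D) (a D w) \<in> FO Z D" "n D (inv_into (FO Z D) (n D) (a D w)) = a D w"
    if "D \<in> Ob K" "w \<in> FO W D" for D w
    using range[OF that] by (simp_all add: inv_into_into f_inv_into_f)
  have "natural W Z ?h"
  proof (rule natural_mk_nat[OF W])
    fix A B k w assume A: "A \<in> Ob K" "B \<in> Ob K" "is_total K B A k" "w \<in> FO W A"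
    have w: "FA W A B k w \<in> FO W B" using A W by (simp add: presheafD(3))
    show "inv_into (FO Z B) (n B) (a B (FA W A B k w)) = FA Z A B k (inv_into (FO Z A) (n A) (a A w))"
    proof (rule inj_onD[OF inj[OF A(2)]])
      show "n B (inv_into (FO Z B) (n B) (a B (FA W A B k w))) = n B (FA Z A B k (inv_into (FO Z A) (n A) (a A w)))"
        unfolding h0(2)[OF A(2) w]
        using A h0[OF A(1,4)] by (simp add: naturalD(3)[OF n _ Z] naturalD(3)[OF a _ W])
      show "FA Z A B k (inv_into (FO Z A) (n A) (a A w)) \<in> FO Z B"
        using A h0(1)[OF A(1,4)] by (simp add: presheafD(3)[OF Z])
    qed (rule h0(1)[OF A(2) w])
  qed (rule h0(1))
  then show thesis by (rule that) (simp add: h0)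
qed

text \<open>
  If pullbacks of \<open>\<mu>\<close> along elements of \<open>Q\<close> are restriction monics, then \<open>\<mu>\<close> is injective
  because these are monic, and their idempotents are the domains of definition of the image.
  Conversely, splitting the domain of definition at an element gives the pullback along it.
\<close>

lemma Mon_PM_iff:
  assumes "small_presheaf U C P" "small_presheaf U C Q"
  shows "\<mu> \<in> Mon PM P Q \<longleftrightarrow> natural P Q \<mu> \<and> (\<forall>D\<in>Ob K. inj_on (\<mu> D) (FO P D)) \<and>
    M_sub Q (\<lambda>D. \<mu> D ` FO P D)"
proof
  have P: "presheaf P" and Q: "presheaf Q" using assms small_presheaf_presheaf by blast+
  assume \<mu>: "\<mu> \<in> Mon PM P Q"
  then have n: "natural P Q \<mu>" by (simp add: Mon_PM)
  have pb: "\<exists>B\<in>Ob K. \<exists>m. restriction_monic K B D m \<and>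
     (\<exists>\<delta>. is_pullback (P_small U C) P (y D) Q \<mu> (elt Q D x) (y B) \<delta> (FA (yoneda U C) B D m))"
    if D: "D \<in> Ob K" "x \<in> FO Q D" for D x
    using \<mu> D natural_elt[OF Q D] unfolding Mon_PM by blast
  have "inj_on (\<mu> D) (FO P D)" if D: "D \<in> Ob K" for D
  proof (rule inj_onI)
    fix z z' assume z: "z \<in> FO P D" "z' \<in> FO P D" "\<mu> D z = \<mu> D z'"
    let ?x = "\<mu> D z"
    have x: "?x \<in> FO Q D" using naturalD(2)[OF n D z(1)] .
    obtain B m \<delta> where B: "B \<in> Ob K" and m: "restriction_monic K B D m"
      and pb: "is_pullback (P_small U C) P (y D) Q \<mu> (elt Q D ?x) (y B) \<delta> (FA (yoneda U C) B D m)"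
      using pb[OF D x] by blast
    note el = monic_pullback_elements(2)[OF P Q n D x B m pb D total_Idt[OF D]]
    obtain l where l: "is_total K D B l" "Comp K D B D m l = Idt K D" "\<delta> D (code D B l) = z"
      using el[of z] z x by (auto simp: presheafD(4)[OF Q D])
    obtain l' where l': "is_total K D B l'" "Comp K D B D m l' = Idt K D" "\<delta> D (code D B l') = z'"
      using el[of z'] z x by (auto simp: presheafD(4)[OF Q D])
    obtain r where r: "r \<in> Hom K D B" "Comp K B D B r m = Idt K B"
      using m by (auto simp: restriction_monic_def splits_as_def)
    have *: "j = r" if "is_total K D B j" "Comp K D B D m j = Idt K D" for j
    proof -
      have "Comp K D D B r (Comp K D B D m j) = Comp K D B B (Comp K B D B r m) j"
        using that r B D is_total_Hom[OF restriction_monic_total[OF m D]]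
        by (intro Comp_assoc) (simp_all add: is_total_Hom)
      then show ?thesis using that r B D by (simp add: is_total_Hom)
    qed
    show "z = z'" using l l' *[of l] *[of l'] by simp
  qed
  moreover have "\<exists>e. domain_at Q (\<lambda>D. \<mu> D ` FO P D) D x e" if D: "D \<in> Ob K" "x \<in> FO Q D" for D x
  proof -
    obtain B m \<delta> where B: "B \<in> Ob K" and m: "restriction_monic K B D m"
      and pb: "is_pullback (P_small U C) P (y D) Q \<mu> (elt Q D x) (y B) \<delta> (FA (yoneda U C) B D m)"
      using pb[OF D] by blast
    note el = monic_pullback_elements[OF P Q n D B m pb]
    have mt: "is_total K B D m" by (rule restriction_monic_total[OF m D(1)])
    obtain e r where e: "restriction_idempotent K D e" "r \<in> Hom K D B" "Comp K D B D m r = e"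
      "Comp K B D B r m = Idt K B"
      using m by (auto simp: restriction_monic_def splits_as_def)
    have "domain_at Q (\<lambda>D. \<mu> D ` FO P D) D x e"
      unfolding domain_at_def
    proof (intro conjI ballI allI impI e(1))
      fix A k assume A: "A \<in> Ob K" "is_total K A D k"
      show "FA Q D A k x \<in> \<mu> A ` FO P A \<longleftrightarrow> Comp K A D D e k = k"
      proof
        assume "FA Q D A k x \<in> \<mu> A ` FO P A"
        then obtain z where z: "z \<in> FO P A" "\<mu> A z = FA Q D A k x" by auto
        obtain l where l: "is_total K A B l" "Comp K A B D m l = k"
          using el(2)[OF A z] by blast
        have mh: "m \<in> Hom K B D" "l \<in> Hom K A B" using mt l by (simp_all add: is_total_Hom)
        have "Comp K B D D (Comp K D B D m r) m = Comp K B B D m (Comp K B D B r m)"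
          using Comp_assoc[of B D B D m r m] B D e(2) mh by simp
        then have "Comp K B D D e m = m"
          using e B D mh by simp
        then have "Comp K A D D e (Comp K A B D m l) = Comp K A B D m l"
          using Comp_assoc[of A B D D l m e] A B D mh restriction_idempotentD(1)[OF e(1)] by simp
        then show "Comp K A D D e k = k"
          using l by simp
      next
        assume *: "Comp K A D D e k = k"
        have mr: "Comp K A B D m (Comp K A D B r k) = k"
          using * e(3) A B D e(2) mt by (simp add: Comp_assoc is_total_Hom)
        moreover have "is_total K A B (Comp K A D B r k)"
          using total_right_factor[of A B D "Comp K A D B r k" m] mr A B D e mt by (simp add: is_total_Hom)
        ultimately show "FA Q D A k x \<in> \<mu> A ` FO P A"
          using el(1)[OF A(1), of "Comp K A D B r k"] by (auto intro: image_eqI[of _ _ "\<delta> A (code A B (Comp K A D B r k))"])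
      qed
    qed
    then show ?thesis by blast
  qed
  ultimately show "natural P Q \<mu> \<and> (\<forall>D\<in>Ob K. inj_on (\<mu> D) (FO P D)) \<and> M_sub Q (\<lambda>D. \<mu> D ` FO P D)"
    using n naturalD(2)[OF n] by (auto simp: M_sub_def)
next
  have P: "presheaf P" and Q: "presheaf Q" using assms small_presheaf_presheaf by blast+
  assume "natural P Q \<mu> \<and> (\<forall>D\<in>Ob K. inj_on (\<mu> D) (FO P D)) \<and> M_sub Q (\<lambda>D. \<mu> D ` FO P D)"
  then have n: "natural P Q \<mu>" and inj: "\<And>D. D \<in> Ob K \<Longrightarrow> inj_on (\<mu> D) (FO P D)"
    and M: "\<And>D x. \<lbrakk>D \<in> Ob K; x \<in> FO Q D\<rbrakk> \<Longrightarrow> \<exists>e. domain_at Q (\<lambda>D. \<mu> D ` FO P D) D x e"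
    by (auto simp: M_sub_def)
  show "\<mu> \<in> Mon PM P Q"
    unfolding Mon_PM
  proof (intro conjI ballI allI impI n)
    fix D \<gamma> assume D: "D \<in> Ob K" and \<gamma>: "natural (y D) Q \<gamma>"
    define x0 where "x0 = \<gamma> D (code D D (Idt K D))"
    have x: "x0 \<in> FO Q D" unfolding x0_def using naturalD(2)[OF \<gamma> D] D by simp
    obtain e where e: "domain_at Q (\<lambda>D. \<mu> D ` FO P D) D x0 e" using M[OF D x] by blast
    note e1 = domain_atD(1)[OF e] and e2 = domain_atD(2)[OF e]
    note c = chosen[OF D e1]
    let ?B = "so D e" and ?m = "sm D e" and ?r = "sr D e"
    have \<gamma>_code: "\<gamma> A (code A D k) = FA Q D A k x0" if "A \<in> Ob K" "is_total K A D k" for A k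
      unfolding x0_def by (rule natural_y_code[OF Q D \<gamma> that])
    obtain z where z: "z \<in> FO P ?B" "\<mu> ?B z = FA Q D ?B ?m x0"
      using e2[OF c(1,2)] c(8) by auto
    let ?ym = "FA (yoneda U C) ?B D ?m"
    have ym: "natural (y ?B) (y D) ?ym" using natural_yoneda[OF c(1) D c(2)] .
    have \<delta>: "natural (y ?B) P (elt P ?B z)" by (rule natural_elt[OF P c(1) z(1)])
    have "is_pullback (P_small U C) P (y D) Q \<mu> \<gamma> (y ?B) (elt P ?B z) ?ym"
      unfolding is_pullback_def
    proof (intro conjI ballI impI)
      show "Comp (P_small U C) (y ?B) P Q \<mu> (elt P ?B z) = Comp (P_small U C) (y ?B) (y D) Q \<gamma> ?ym"
        unfolding P_small_sel
        by (rule natural_y_eqI[OF Q c(1)])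
          (use c D n \<delta> \<gamma> ym z P in \<open>simp_all add: natural_Comp presheafD(4)[OF P] yoneda_sel \<gamma>_code\<close>)
    next
      fix V s t assume "V \<in> Ob (P_small U C)" "s \<in> Hom (P_small U C) V P" "t \<in> Hom (P_small U C) V (y D)"
        "Comp (P_small U C) V P Q \<mu> s = Comp (P_small U C) V (y D) Q \<gamma> t"
      then have V: "presheaf V" and s: "natural V P s" and t: "natural V (y D) t"
        and eq: "Comp (Psh U C) V P Q \<mu> s = Comp (Psh U C) V (y D) Q \<gamma> t"
        by (auto intro: small_presheaf_presheaf)
      have code_mem: "code A ?B l \<in> FO (y ?B) A" if "A \<in> Ob K" "is_total K A ?B l" for A l
        using that c by simp
      have inj_ym: "inj_on (?ym A) (FO (y ?B) A)" if A: "A \<in> Ob K" for A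
      proof (rule inj_onI)
        fix a b assume "a \<in> FO (y ?B) A" "b \<in> FO (y ?B) A" and ab: "?ym A a = ?ym A b"
        then obtain k l where k: "is_total K A ?B k" "a = code A ?B k" and l: "is_total K A ?B l" "b = code A ?B l"
          using A c by (metis y_elemE)
        have "Comp K A ?B D ?m k = Comp K A ?B D ?m l"
          using ab k l A D c by (simp add: yoneda_sel total_Comp)
        then have "k = l"
          using split_cancel[OF D e1 A] k l by (metis is_total_Hom)
        then show "a = b" using k l by simp
      qed
      have fix_t: "\<exists>k. is_total K A D k \<and> t A v = code A D k \<and> Comp K A D D e k = k \<and> FA Q D A k x0 = \<mu> A (s A v)"
        if A: "A \<in> Ob K" "v \<in> FO V A" for A v
      proof -
        obtain k where k: "is_total K A D k" "t A v = code A D k"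
          using y_elemE[OF naturalD(2)[OF t A] D A(1)] by blast
        have "FA Q D A k x0 = \<mu> A (s A v)"
          using fun_cong[OF fun_cong[OF eq], of A v] A k by (simp add: \<gamma>_code)
        moreover from this have "FA Q D A k x0 \<in> \<mu> A ` FO P A"
          using naturalD(2)[OF s A] by simp
        then have "Comp K A D D e k = k"
          using e2[OF A(1) k(1)] by simp
        ultimately show ?thesis using k by blast
      qed
      have "t A v \<in> ?ym A ` FO (y ?B) A" if A: "A \<in> Ob K" "v \<in> FO V A" for A v
      proof -
        obtain k where k: "is_total K A D k" "t A v = code A D k" "Comp K A D D e k = k"
          using fix_t[OF A] by blast
        have "?ym A (code A ?B (Comp K A D ?B ?r k)) = t A v"
          using factor_split_total[OF D e1 A(1) k(1,3)] factor_split[OF D e1 A(1) is_total_Hom[OF k(1)] k(3)] A D c k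
          by (simp add: yoneda_sel)
        then show ?thesis
          using code_mem[OF A(1) factor_split_total[OF D e1 A(1) k(1,3)]] by (metis imageI)
      qed
      then obtain h where h: "natural V (y ?B) h" and ymh: "\<And>A v. \<lbrakk>A \<in> Ob K; v \<in> FO V A\<rbrakk> \<Longrightarrow> ?ym A (h A v) = t A v"
        using lift_natural[OF V presheaf_y[OF c(1)] ym inj_ym t] by blast
      have "elt P ?B z A (h A v) = s A v" if A: "A \<in> Ob K" "v \<in> FO V A" for A v
      proof (rule inj_onD[OF inj[OF A(1)]])
        obtain l where l: "is_total K A ?B l" "h A v = code A ?B l"
          using y_elemE[OF naturalD(2)[OF h A] c(1) A(1)] by blast
        obtain k where k: "is_total K A D k" "t A v = code A D k" "FA Q D A k x0 = \<mu> A (s A v)"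
          using fix_t[OF A] by blast
        have "k = Comp K A ?B D ?m l"
          using ymh[OF A] k l A D c by (simp add: yoneda_sel total_Comp)
        then show "\<mu> A (elt P ?B z A (h A v)) = \<mu> A (s A v)"
          using k(3) l A D c z x by (simp add: naturalD(3)[OF n _ P] presheafD(5)[OF Q])
        show "elt P ?B z A (h A v) \<in> FO P A" using naturalD(2)[OF \<delta> A(1)] naturalD(2)[OF h A] by blast
        show "s A v \<in> FO P A" using naturalD(2)[OF s A] .
      qed
      then have 1: "Comp (Psh U C) V (y ?B) P (elt P ?B z) h = s"
        by (intro natural_eqI[of V P _ P]) (simp_all add: natural_Comp[OF V presheaf_y[OF c(1)] h \<delta>] s)
      have 2: "Comp (Psh U C) V (y ?B) (y D) ?ym h = t"
        by (intro natural_eqI[of V "y D" _ "y D"])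
          (simp_all add: natural_Comp[OF V presheaf_y[OF c(1)] h ym] t ymh)
      show "\<exists>!h. h \<in> Hom (P_small U C) V (y ?B) \<and> Comp (P_small U C) V (y ?B) P (elt P ?B z) h = s \<and>
          Comp (P_small U C) V (y ?B) (y D) ?ym h = t"
      proof (rule ex1I[of _ h])
        show "h \<in> Hom (P_small U C) V (y ?B) \<and> Comp (P_small U C) V (y ?B) P (elt P ?B z) h = s \<and>
          Comp (P_small U C) V (y ?B) (y D) ?ym h = t" using h 1 2 by simp
        fix h' assume "h' \<in> Hom (P_small U C) V (y ?B) \<and> Comp (P_small U C) V (y ?B) P (elt P ?B z) h' = s \<and>
          Comp (P_small U C) V (y ?B) (y D) ?ym h' = t"
        then have h': "natural V (y ?B) h'" and eq': "Comp (Psh U C) V (y ?B) (y D) ?ym h' = t" by simp_all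
        show "h' = h"
        proof (rule natural_eqI[OF h' h])
          fix A v assume A: "A \<in> Ob K" "v \<in> FO V A"
          show "h' A v = h A v"
            using fun_cong[OF fun_cong[OF eq'], of A v] A ymh[OF A]
            by (intro inj_onD[OF inj_ym[OF A(1)] _ naturalD(2)[OF h' A] naturalD(2)[OF h A]]) simp
        qed
      qed
    qed (use c \<delta> ym in simp_all)
    then show "\<exists>B\<in>Ob K. \<exists>m. restriction_monic K B D m \<and>
       (\<exists>\<delta>. is_pullback (P_small U C) P (y D) Q \<mu> \<gamma> (y B) \<delta> (FA (yoneda U C) B D m))"
      using c by blast
  qed
qed

section \<open>The category of partial maps in terms of graphs\<close>

definition graph :: "('o, 'a, 'u) presheaf \<times> ('o \<Rightarrow> 'u \<Rightarrow> 'u) \<times> ('o \<Rightarrow> 'u \<Rightarrow> 'u) \<Rightarrow> 'o \<Rightarrow> ('u \<times> 'u) set" where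
  "graph = (\<lambda>(Z, m, f) D. if D \<in> Ob K then (\<lambda>z. (m D z, f D z)) ` FO Z D else {})"

definition mspan where
  "mspan P Q = (\<lambda>(Z, m, f). small_presheaf U C Z \<and> m \<in> Mon PM Z P \<and> natural Z Q f)"

definition spans where
  "spans P Q R = {s. mspan P Q s \<and> graph s = R}"

text \<open>
  Graphs of partial maps. A span is determined up to isomorphism by its graph, and composition of
  spans by pullback becomes composition of relations; reasoning with graphs thus removes all
  choices of representatives and of pullbacks.
\<close>

definition pmap :: "('o, 'a, 'u) presheaf \<Rightarrow> ('o, 'a, 'u) presheaf \<Rightarrow> ('o \<Rightarrow> ('u \<times> 'u) set) \<Rightarrow> bool" where
  "pmap P Q R \<longleftrightarrow> (\<forall>D. D \<notin> Ob K \<longrightarrow> R D = {}) \<and>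
    (\<forall>D\<in>Ob K. R D \<subseteq> FO P D \<times> FO Q D \<and> single_valued (R D)) \<and>
    (\<forall>D\<in>Ob K. \<forall>A\<in>Ob K. \<forall>k x z. is_total K A D k \<longrightarrow> (x, z) \<in> R D \<longrightarrow> (FA P D A k x, FA Q D A k z) \<in> R A) \<and>
    M_sub P (\<lambda>D. Domain (R D))"

lemma pmapD:
  assumes "pmap P Q R"
  shows "D \<notin> Ob K \<Longrightarrow> R D = {}"
    and "\<lbrakk>(x, z) \<in> R D\<rbrakk> \<Longrightarrow> D \<in> Ob K \<and> x \<in> FO P D \<and> z \<in> FO Q D"
    and "\<lbrakk>(x, z) \<in> R D; (x, z') \<in> R D\<rbrakk> \<Longrightarrow> z = z'"
    and "\<lbrakk>(x, z) \<in> R D; A \<in> Ob K; is_total K A D k\<rbrakk> \<Longrightarrow> (FA P D A k x, FA Q D A k z) \<in> R A"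
    and "M_sub P (\<lambda>D. Domain (R D))"
    and "\<lbrakk>D \<in> Ob K; x \<in> FO P D\<rbrakk> \<Longrightarrow> \<exists>e. domain_at P (\<lambda>D. Domain (R D)) D x e"
proof -
  show "D \<notin> Ob K \<Longrightarrow> R D = {}" using assms by (simp add: pmap_def)
  then show 1: "D \<in> Ob K \<and> x \<in> FO P D \<and> z \<in> FO Q D" if "(x, z) \<in> R D"
    using assms that unfolding pmap_def by blast
  show "z = z'" if "(x, z) \<in> R D" "(x, z') \<in> R D"
  proof -
    have "single_valued (R D)" using assms 1[OF that(1)] unfolding pmap_def by blast
    then show ?thesis using that by (simp add: single_valued_def)
  qed
  show "(FA P D A k x, FA Q D A k z) \<in> R A" if "(x, z) \<in> R D" "A \<in> Ob K" "is_total K A D k"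
    using assms 1[OF that(1)] that unfolding pmap_def by blast
  show 2: "M_sub P (\<lambda>D. Domain (R D))" using assms by (simp add: pmap_def)
  show "\<lbrakk>D \<in> Ob K; x \<in> FO P D\<rbrakk> \<Longrightarrow> \<exists>e. domain_at P (\<lambda>D. Domain (R D)) D x e"
    using 2 by (auto simp: M_sub_def)
qed

lemma pmapI:
  assumes "\<And>D x z. (x, z) \<in> R D \<Longrightarrow> D \<in> Ob K \<and> x \<in> FO P D \<and> z \<in> FO Q D"
    and "\<And>D x z z'. \<lbrakk>(x, z) \<in> R D; (x, z') \<in> R D\<rbrakk> \<Longrightarrow> z = z'"
    and "\<And>D A k x z. \<lbrakk>D \<in> Ob K; A \<in> Ob K; is_total K A D k; (x, z) \<in> R D\<rbrakk> \<Longrightarrow> (FA P D A k x, FA Q D A k z) \<in> R A"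
    and "\<And>D x. \<lbrakk>D \<in> Ob K; x \<in> FO P D\<rbrakk> \<Longrightarrow> \<exists>e. domain_at P (\<lambda>D. Domain (R D)) D x e"
  shows "pmap P Q R"
proof -
  have "R D = {}" if "D \<notin> Ob K" for D using assms(1) that by (metis subrelI subset_empty)
  moreover have "R D \<subseteq> FO P D \<times> FO Q D \<and> single_valued (R D)" for D
    using assms(1,2) by (auto simp: single_valued_def)
  moreover have "M_sub P (\<lambda>D. Domain (R D))"
    unfolding M_sub_def using assms(1,4) by (auto dest: assms(1))
  ultimately show ?thesis
    unfolding pmap_def using assms(3) by simp
qed

lemma mspanD:
  assumes "mspan P Q (Z, m, f)" "small_presheaf U C P"
  shows "small_presheaf U C Z" "presheaf Z" "natural Z P m" "natural Z Q f" "m \<in> Mon PM Z P"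
    and "D \<in> Ob K \<Longrightarrow> inj_on (m D) (FO Z D)" "M_sub P (\<lambda>D. m D ` FO Z D)"
  using assms Mon_PM_iff[of Z P m] by (auto simp: mspan_def intro: small_presheaf_presheaf)

lemma graph_iff:
  "(x, w) \<in> graph (Z, m, f) D \<longleftrightarrow> D \<in> Ob K \<and> (\<exists>z\<in>FO Z D. x = m D z \<and> w = f D z)"
  by (auto simp: graph_def)

lemma Domain_graph: "D \<in> Ob K \<Longrightarrow> Domain (graph (Z, m, f) D) = m D ` FO Z D"
  by (auto simp: graph_def)

lemma pmap_graph:
  assumes s: "mspan P Q (Z, m, f)" and P: "small_presheaf U C P"
  shows "pmap P Q (graph (Z, m, f))"
proof -
  note D = mspanD[OF s P]
  show ?thesis
  proof (rule pmapI)
    fix D x z assume "(x, z) \<in> graph (Z, m, f) D"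
    then show "D \<in> Ob K \<and> x \<in> FO P D \<and> z \<in> FO Q D"
      using naturalD(2)[OF D(3)] naturalD(2)[OF D(4)] by (auto simp: graph_iff)
  next
    fix D x z z' assume "(x, z) \<in> graph (Z, m, f) D" "(x, z') \<in> graph (Z, m, f) D"
    then show "z = z'" using D(6) by (auto simp: graph_iff dest: inj_onD)
  next
    fix B A k x z assume *: "B \<in> Ob K" "A \<in> Ob K" "is_total K A B k" "(x, z) \<in> graph (Z, m, f) B"
    then obtain v where v: "v \<in> FO Z B" "x = m B v" "z = f B v" by (auto simp: graph_iff)
    have "FA Z B A k v \<in> FO Z A" using presheafD(3)[OF D(2)] * v by blast
    moreover have "FA P B A k x = m A (FA Z B A k v)" "FA Q B A k z = f A (FA Z B A k v)"
      using * v naturalD(3)[OF D(3) _ D(2)] naturalD(3)[OF D(4) _ D(2)] by simp_all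
    ultimately show "(FA P B A k x, FA Q B A k z) \<in> graph (Z, m, f) A"
      using *(2) by (auto simp: graph_iff)
  next
    have "M_sub P (\<lambda>D. Domain (graph (Z, m, f) D))"
      by (rule iffD2[OF M_sub_cong D(7)]) (rule Domain_graph)
    then show "\<exists>e. domain_at P (\<lambda>D. Domain (graph (Z, m, f) D)) B x e" if "B \<in> Ob K" "x \<in> FO P B" for B x
      using that by (auto simp: M_sub_def)
  qed
qed

lemma graph_functional:
  assumes "mspan P Q (Z, m, f)" "small_presheaf U C P" "D \<in> Ob K" "z \<in> FO Z D" "(m D z, w) \<in> graph (Z, m, f) D"
  shows "w = f D z"
  using assms(5) inj_onD[OF mspanD(6)[OF assms(1,2,3)]] assms(4) by (auto simp: graph_iff)

text \<open>The canonical span with a given graph has the domain of definition as its apex.\<close>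

lemma spans_nonempty:
  assumes R: "pmap P Q R" and P: "small_presheaf U C P"
  obtains Z m f where "(Z, m, f) \<in> spans P Q R"
proof -
  note RD = pmapD[OF R]
  have pP: "presheaf P" using P by (rule small_presheaf_presheaf)
  let ?W = "\<lambda>D. Domain (R D)"
  let ?Z = "mk_presheaf ?W (FA P)" and ?f = "\<lambda>D x. THE z. (x, z) \<in> R D"
  have Z: "small_presheaf U C ?Z" by (rule small_M_sub[OF P RD(5)])
  then have pZ: "presheaf ?Z" by (rule small_presheaf_presheaf)
  have f: "?f D x = z" if "(x, z) \<in> R D" for D x z
    using that RD(3) by blast
  have FAZ: "FA ?Z A B k x = FA P A B k x" if "A \<in> Ob K" "B \<in> Ob K" "is_total K B A k" "x \<in> Domain (R A)" for A B k x
    using that by simp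
  have m: "natural ?Z P (mk_nat ?Z (\<lambda>_ x. x))"
    using RD(2) by (intro natural_mk_nat[OF pZ]) auto
  have nf: "natural ?Z Q (mk_nat ?Z ?f)"
  proof (rule natural_mk_nat[OF pZ])
    fix D x assume "D \<in> Ob K" "x \<in> FO ?Z D"
    then obtain z where "(x, z) \<in> R D" by auto
    then show "?f D x \<in> FO Q D" using f[of x z D] RD(2) by simp
  next
    fix A B k x assume *: "A \<in> Ob K" "B \<in> Ob K" "is_total K B A k" "x \<in> FO ?Z A"
    then obtain z where z: "(x, z) \<in> R A" by auto
    then have "x \<in> Domain (R A)" by blast
    then show "?f B (FA ?Z A B k x) = FA Q A B k (?f A x)"
      using f[OF z] f[OF RD(4)[OF z *(2,3)]] * by (simp only: FAZ)
  qed
  have "mk_nat ?Z (\<lambda>_ x. x) \<in> Mon PM ?Z P"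
    unfolding Mon_PM_iff[OF Z P]
  proof (intro conjI ballI m)
    have "M_sub P (\<lambda>D. mk_nat ?Z (\<lambda>_ x. x) D ` FO ?Z D) \<longleftrightarrow> M_sub P ?W"
      by (rule M_sub_cong) force
    then show "M_sub P (\<lambda>D. mk_nat ?Z (\<lambda>_ x. x) D ` FO ?Z D)" using RD(5) by simp
  qed (auto simp: inj_on_def)
  moreover have "graph (?Z, mk_nat ?Z (\<lambda>_ x. x), mk_nat ?Z ?f) = R"
  proof (intro ext set_eqI)
    fix D and s :: "'u \<times> 'u"
    obtain x w where [simp]: "s = (x, w)" by fastforce
    show "s \<in> graph (?Z, mk_nat ?Z (\<lambda>_ x. x), mk_nat ?Z ?f) D \<longleftrightarrow> s \<in> R D"
    proof
      assume "s \<in> graph (?Z, mk_nat ?Z (\<lambda>_ x. x), mk_nat ?Z ?f) D"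
      then obtain z where "D \<in> Ob K" "z \<in> Domain (R D)" "x = z" "w = ?f D z"
        by (auto simp: graph_iff)
      moreover from this obtain v where "(z, v) \<in> R D" by blast
      ultimately show "s \<in> R D" using f[of z v D] by simp
    next
      assume s: "s \<in> R D"
      then have "D \<in> Ob K" using RD(2)[of x w D] by simp
      moreover have "x \<in> Domain (R D)" using s by auto
      ultimately show "s \<in> graph (?Z, mk_nat ?Z (\<lambda>_ x. x), mk_nat ?Z ?f) D"
        using s f[of x w D] by (auto simp: graph_iff)
    qed
  qed
  ultimately have "(?Z, mk_nat ?Z (\<lambda>_ x. x), mk_nat ?Z ?f) \<in> spans P Q R"
    using Z nf by (simp add: spans_def mspan_def)
  then show thesis by (rule that)
qed

lemma is_iso_bij:
  assumes "presheaf Z" "presheaf Z'" "is_iso PM Z' Z i" "D \<in> Ob K"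
  shows "natural Z' Z i" "bij_betw (i D) (FO Z' D) (FO Z D)"
proof -
  obtain j where i: "natural Z' Z i" and j: "natural Z Z' j"
    and ji: "Comp (Psh U C) Z' Z Z' j i = Idt (Psh U C) Z'" and ij: "Comp (Psh U C) Z Z' Z i j = Idt (Psh U C) Z"
    using assms(3) unfolding is_iso_def by auto
  show "natural Z' Z i" by fact
  show "bij_betw (i D) (FO Z' D) (FO Z D)"
  proof (rule bij_betw_byWitness[where f' = "j D"])
    have "j D (i D a) = a" if "a \<in> FO Z' D" for a
      using fun_cong[OF fun_cong[OF ji], of D a] assms(4) that by simp
    then show "\<forall>a\<in>FO Z' D. j D (i D a) = a" by blast
    have "i D (j D a) = a" if "a \<in> FO Z D" for a
      using fun_cong[OF fun_cong[OF ij], of D a] assms(4) that by simp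
    then show "\<forall>a\<in>FO Z D. i D (j D a) = a" by blast
  qed (use naturalD(2)[OF i assms(4)] naturalD(2)[OF j assms(4)] in auto)
qed

text \<open>
  The left legs are injective with the same image, the domain of definition; hence spans with the
  same graph have isomorphic apexes, compatibly with both legs.
\<close>

lemma span_class_eq:
  assumes s: "mspan P Q (Z, m, f)" and P: "small_presheaf U C P" and Q: "presheaf Q"
  shows "span_class PM P Q (Z, m, f) = spans P Q (graph (Z, m, f))"
proof (intro set_eqI iffI)
  note S = mspanD[OF s P]
  fix t assume "t \<in> span_class PM P Q (Z, m, f)"
  then obtain Z' i where t: "t = (Z', Comp (Psh U C) Z' Z P m i, Comp (Psh U C) Z' Z Q f i)"
    and Z': "small_presheaf U C Z'" and i: "is_iso PM Z' Z i"
    unfolding span_class_def by auto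
  have pZ': "presheaf Z'" using Z' by (rule small_presheaf_presheaf)
  have "natural Z' Z i" using i by (auto simp: is_iso_def)
  note bij = is_iso_bij(2)[OF S(2) pZ' i]
  let ?m = "Comp (Psh U C) Z' Z P m i" and ?f = "Comp (Psh U C) Z' Z Q f i"
  have m: "natural Z' P ?m" and f: "natural Z' Q ?f"
    using natural_Comp[OF pZ' S(2) \<open>natural Z' Z i\<close>] S by blast+
  have g: "graph (Z', ?m, ?f) = graph (Z, m, f)"
  proof
    fix D show "graph (Z', ?m, ?f) D = graph (Z, m, f) D"
    proof (cases "D \<in> Ob K")
      case True
      then have "(\<lambda>z. (?m D z, ?f D z)) ` FO Z' D = (\<lambda>z. (m D z, f D z)) ` i D ` FO Z' D"
        by (auto simp: image_image intro!: image_cong)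
      then show ?thesis using True bij[OF True] by (simp add: graph_def bij_betw_def)
    qed (simp add: graph_def)
  qed
  have "?m \<in> Mon PM Z' P"
    unfolding Mon_PM_iff[OF Z' P]
  proof (intro conjI ballI m)
    fix D assume D: "D \<in> Ob K"
    have "inj_on (m D \<circ> i D) (FO Z' D)"
      using bij[OF D] S(6)[OF D] by (auto simp: bij_betw_def intro: comp_inj_on)
    moreover have "inj_on (?m D) (FO Z' D) \<longleftrightarrow> inj_on (m D \<circ> i D) (FO Z' D)"
      using D by (intro inj_on_cong) simp
    ultimately show "inj_on (?m D) (FO Z' D)" by simp
  next
    have "?m D ` FO Z' D = m D ` FO Z D" if D: "D \<in> Ob K" for D
      using Domain_graph[OF D, of Z' ?m ?f] Domain_graph[OF D, of Z m f] g by simp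
    then show "M_sub P (\<lambda>D. ?m D ` FO Z' D)"
      by (rule iffD2[OF M_sub_cong S(7)])
  qed
  then show "t \<in> spans P Q (graph (Z, m, f))"
    using t Z' f g by (simp add: spans_def mspan_def)
next
  note S = mspanD[OF s P]
  have pP: "presheaf P" using P by (rule small_presheaf_presheaf)
  fix t assume "t \<in> spans P Q (graph (Z, m, f))"
  then obtain Z' m' f' where t: "t = (Z', m', f')" and s': "mspan P Q (Z', m', f')"
    and g: "graph (Z', m', f') = graph (Z, m, f)"
    by (cases t) (auto simp: spans_def)
  note S' = mspanD[OF s' P]
  have img: "m' D ` FO Z' D = m D ` FO Z D" if D: "D \<in> Ob K" for D
    using Domain_graph[OF D, of Z' m' f'] Domain_graph[OF D, of Z m f] g by simp
  obtain i where i: "natural Z' Z i" and mi: "\<And>D z. \<lbrakk>D \<in> Ob K; z \<in> FO Z' D\<rbrakk> \<Longrightarrow> m D (i D z) = m' D z"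
    using lift_natural[OF S'(2) S(2) S(3) S(6) S'(3)] img by blast
  obtain j where j: "natural Z Z' j" and mj: "\<And>D z. \<lbrakk>D \<in> Ob K; z \<in> FO Z D\<rbrakk> \<Longrightarrow> m' D (j D z) = m D z"
    using lift_natural[OF S(2) S'(2) S'(3) S'(6) S(3)] img by blast
  have ji: "j D (i D z) = z" if "D \<in> Ob K" "z \<in> FO Z' D" for D z
    by (rule inj_onD[OF S'(6)[OF that(1)] _ naturalD(2)[OF j that(1) naturalD(2)[OF i that]] that(2)])
      (simp add: mi[OF that] mj[OF that(1) naturalD(2)[OF i that]])
  have ij: "i D (j D z) = z" if "D \<in> Ob K" "z \<in> FO Z D" for D z
    by (rule inj_onD[OF S(6)[OF that(1)] _ naturalD(2)[OF i that(1) naturalD(2)[OF j that]] that(2)])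
      (simp add: mj[OF that] mi[OF that(1) naturalD(2)[OF j that]])
  have "Comp (Psh U C) Z' Z Z' j i = Idt (Psh U C) Z'"
    by (rule natural_eqI[OF natural_Comp[OF S'(2) S(2) i j] natural_Idt[OF S'(2)]]) (simp add: ji)
  moreover have "Comp (Psh U C) Z Z' Z i j = Idt (Psh U C) Z"
    by (rule natural_eqI[OF natural_Comp[OF S(2) S'(2) j i] natural_Idt[OF S(2)]]) (simp add: ij)
  ultimately have "is_iso PM Z' Z i"
    using i j by (auto simp: is_iso_def)
  moreover have "m' = Comp (Psh U C) Z' Z P m i"
    by (rule natural_eqI[OF S'(3) natural_Comp[OF S'(2) S(2) i S(3)]]) (simp add: mi)
  moreover have "f' = Comp (Psh U C) Z' Z Q f i"
  proof (rule natural_eqI[OF S'(4) natural_Comp[OF S'(2) S(2) i S(4)]])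
    fix D z assume D: "D \<in> Ob K" "z \<in> FO Z' D"
    have "(m D (i D z), f' D z) \<in> graph (Z, m, f) D"
      using D by (auto simp: g[symmetric] graph_iff mi)
    then show "f' D z = Comp (Psh U C) Z' Z Q f i D z"
      using graph_functional[OF s P D(1) naturalD(2)[OF i D]] D by simp
  qed
  ultimately show "t \<in> span_class PM P Q (Z, m, f)"
    unfolding span_class_def using t S'(1) by auto
qed

lemma spans_eqI: "\<lbrakk>mspan P Q (Z, m, f); small_presheaf U C P; presheaf Q; graph (Z, m, f) = R\<rbrakk> \<Longrightarrow>
    span_class PM P Q (Z, m, f) = spans P Q R"
  using span_class_eq by blast

lemma spans_graph:
  assumes "(Z, m, f) \<in> spans P Q R"
  shows "mspan P Q (Z, m, f)" "graph (Z, m, f) = R"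
  using assms by (simp_all add: spans_def)

abbreviation "Y \<equiv> Par PM"

lemma Ob_Y [simp]: "P \<in> Ob Y \<longleftrightarrow> small_presheaf U C P"
  by (simp add: Par_def)

lemma Hom_Y:
  assumes "small_presheaf U C P" "small_presheaf U C Q"
  shows "\<phi> \<in> Hom Y P Q \<longleftrightarrow> (\<exists>R. pmap P Q R \<and> \<phi> = spans P Q R)"
proof
  have Q: "presheaf Q" using assms(2) by (rule small_presheaf_presheaf)
  assume "\<phi> \<in> Hom Y P Q"
  then obtain Z m f where "\<phi> = span_class PM P Q (Z, m, f)" "mspan P Q (Z, m, f)"
    by (auto simp: Par_def mspan_def)
  then show "\<exists>R. pmap P Q R \<and> \<phi> = spans P Q R"
    using span_class_eq[OF _ assms(1) Q] pmap_graph[OF _ assms(1)] by blast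
next
  have Q: "presheaf Q" using assms(2) by (rule small_presheaf_presheaf)
  assume "\<exists>R. pmap P Q R \<and> \<phi> = spans P Q R"
  then obtain R where R: "pmap P Q R" "\<phi> = spans P Q R" by blast
  obtain Z m f where s: "(Z, m, f) \<in> spans P Q R" using spans_nonempty[OF R(1) assms(1)] .
  then have "\<phi> = span_class PM P Q (Z, m, f)"
    using R span_class_eq[OF spans_graph(1)[OF s] assms(1) Q] spans_graph(2)[OF s] by simp
  then show "\<phi> \<in> Hom Y P Q"
    using spans_graph(1)[OF s] by (auto simp: Par_def mspan_def)
qed

lemma spans_in_Hom [simp]:
  "\<lbrakk>small_presheaf U C P; small_presheaf U C Q; pmap P Q R\<rbrakk> \<Longrightarrow> spans P Q R \<in> Hom Y P Q"
  by (auto simp: Hom_Y)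

lemma spans_inj:
  assumes "pmap P Q R" "small_presheaf U C P" "spans P Q R = spans P Q R'"
  shows "R = R'"
  using spans_nonempty[OF assms(1,2)] assms(3) spans_graph(2) by metis

definition id_graph where "id_graph P D = (if D \<in> Ob K then Id_on (FO P D) else {})"

lemma Idt_in_Mon:
  assumes "small_presheaf U C P"
  shows "Idt (Psh U C) P \<in> Mon PM P P"
proof -
  have P: "presheaf P" using assms by (rule small_presheaf_presheaf)
  have "M_sub P (FO P)"
  proof -
    have "domain_at P (FO P) D x (Idt K D)" if "D \<in> Ob K" "x \<in> FO P D" for D x
      using that by (simp add: domain_at_def presheafD(3)[OF P] restriction_idempotent_def is_total_Hom)
    then show ?thesis unfolding M_sub_def by blast
  qed
  moreover have "M_sub P (\<lambda>D. Idt (Psh U C) P D ` FO P D) \<longleftrightarrow> M_sub P (FO P)"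
    by (rule M_sub_cong) force
  ultimately show ?thesis
    unfolding Mon_PM_iff[OF assms assms] using natural_Idt[OF P] by (auto simp: inj_on_def)
qed

lemma graph_natural:
  assumes "presheaf P"
  shows "graph (P, Idt (Psh U C) P, f) = (\<lambda>D. if D \<in> Ob K then (\<lambda>x. (x, f D x)) ` FO P D else {})"
  by (auto simp: graph_def fun_eq_iff)

lemma mspan_natural:
  assumes "small_presheaf U C P" "natural P Q f"
  shows "mspan P Q (P, Idt (Psh U C) P, f)"
  using assms Idt_in_Mon by (simp add: mspan_def)

lemma Idt_Y:
  assumes "small_presheaf U C P"
  shows "Idt Y P = spans P P (id_graph P)" "pmap P P (id_graph P)"
proof -
  have P: "presheaf P" using assms by (rule small_presheaf_presheaf)
  have g: "graph (P, Idt (Psh U C) P, Idt (Psh U C) P) = id_graph P"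
    by (auto simp: graph_def id_graph_def fun_eq_iff Id_on_def)
  show "Idt Y P = spans P P (id_graph P)"
    using spans_eqI[OF mspan_natural[OF assms natural_Idt[OF P]] assms P g] by (simp add: Par_def)
  show "pmap P P (id_graph P)"
    using pmap_graph[OF mspan_natural[OF assms natural_Idt[OF P]] assms] by (simp add: g)
qed

lemma Rst_Y:
  assumes P: "small_presheaf U C P" and R: "pmap P Q R"
  shows "Rst Y P Q (spans P Q R) = spans P P (\<lambda>D. Id_on (Domain (R D)))"
    "pmap P P (\<lambda>D. Id_on (Domain (R D)))"
proof -
  have pP: "presheaf P" using P by (rule small_presheaf_presheaf)
  have *: "mspan P P (Z, m, m)" "graph (Z, m, m) = (\<lambda>D. Id_on (Domain (R D)))"
    if s: "(Z, m, f) \<in> spans P Q R" for Z m f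
  proof -
    note S = spans_graph[OF s]
    show "mspan P P (Z, m, m)"
      using S(1) mspanD[OF S(1) P] by (simp add: mspan_def)
    show "graph (Z, m, m) = (\<lambda>D. Id_on (Domain (R D)))"
      unfolding S(2)[symmetric] by (auto simp: graph_def fun_eq_iff Id_on_def)
  qed
  obtain Z m f where s: "(Z, m, f) \<in> spans P Q R" using spans_nonempty[OF R P] .
  have "(case t of (Z, m, f) \<Rightarrow> span_class PM P P (Z, m, m)) = spans P P (\<lambda>D. Id_on (Domain (R D)))"
    if "t \<in> spans P Q R" for t
    using that * P pP by (cases t) (auto simp: spans_eqI)
  then show "Rst Y P Q (spans P Q R) = spans P P (\<lambda>D. Id_on (Domain (R D)))"
    using s by (auto simp: Par_def)
  show "pmap P P (\<lambda>D. Id_on (Domain (R D)))"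
    using pmap_graph[OF *(1)[OF s] P] *(2)[OF s] by simp
qed

text \<open>
  Let \<open>r\<close> be the retraction onto the splitting of \<open>e1\<close>. A total map \<open>k\<close> restricts \<open>x\<close> into the
  domain of the composite iff \<open>e1\<close> fixes \<open>k\<close> and \<open>e2\<close> fixes \<open>r k\<close>, that is, iff \<open>e2 r k\<close> is
  total.
\<close>

lemma domain_at_relcomp:
  assumes P: "presheaf P" and R1: "pmap P Q R1" and Q: "presheaf Q" and R2: "pmap Q S R2"
    and D: "D \<in> Ob K" "x \<in> FO P D" and e1: "domain_at P (\<lambda>D. Domain (R1 D)) D x e1"
    and z: "(FA P D (so D e1) (sm D e1) x, z) \<in> R1 (so D e1)"
    and e2: "domain_at Q (\<lambda>D. Domain (R2 D)) (so D e1) z e2"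
  shows "domain_at P (\<lambda>D. Domain (R1 D O R2 D)) D x (Rst K D (so D e1) (Comp K D (so D e1) (so D e1) e2 (sr D e1)))"
proof -
  note r1 = domain_atD(1)[OF e1] and r2 = domain_atD(1)[OF e2]
  note c = chosen[OF D(1) r1]
  note E2 = restriction_idempotentD[OF r2]
  let ?B = "so D e1" and ?m = "sm D e1" and ?r = "sr D e1"
  let ?er = "Comp K D ?B ?B e2 ?r"
  have er: "?er \<in> Hom K D ?B" using c E2 D by simp
  have zQ: "z \<in> FO Q ?B" using pmapD(2)[OF R1 z] by simp
  show ?thesis
    unfolding domain_at_def
  proof (intro conjI ballI allI impI)
    show "restriction_idempotent K D (Rst K D ?B ?er)" using D c er by simp
    fix A k assume A: "A \<in> Ob K" "is_total K A D k"
    let ?rk = "Comp K A D ?B ?r k"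
    have kh: "k \<in> Hom K A D" using A by (simp add: is_total_Hom)
    have assoc: "Comp K A D ?B ?er k = Comp K A ?B ?B e2 ?rk"
      using Comp_assoc[of A D ?B ?B k ?r e2] A D c kh E2 by simp
    show "FA P D A k x \<in> Domain (R1 A O R2 A) \<longleftrightarrow> Comp K A D D (Rst K D ?B ?er) k = k"
    proof -
      have "Comp K A D D (Rst K D ?B ?er) k = k \<longleftrightarrow> is_total K A ?B (Comp K A ?B ?B e2 ?rk)"
        using Rst_fix_iff[OF A(1) D(1) c(1) er A(2)] assoc by simp
      also have "\<dots> \<longleftrightarrow> Comp K A D D e1 k = k \<and> Comp K A ?B ?B e2 ?rk = ?rk"
      proof
        assume t: "is_total K A ?B (Comp K A ?B ?B e2 ?rk)"
        then have rk: "is_total K A ?B ?rk"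
          using total_right_factor[of A ?B ?B ?rk e2] A c kh D E2 by simp
        then have "Comp K A D D e1 k = k"
          using Rst_fix_iff[OF A(1) D(1) c(1,4) A(2)] c(7) by simp
        moreover have "Comp K A ?B ?B e2 ?rk = ?rk"
          using Rst_fix_iff[OF A(1) c(1) c(1) E2(1) rk] t E2 by simp
        ultimately show "Comp K A D D e1 k = k \<and> Comp K A ?B ?B e2 ?rk = ?rk" by simp
      next
        assume "Comp K A D D e1 k = k \<and> Comp K A ?B ?B e2 ?rk = ?rk"
        then show "is_total K A ?B (Comp K A ?B ?B e2 ?rk)"
          using factor_split_total[OF D(1) r1 A(1,2)] by simp
      qed
      also have "\<dots> \<longleftrightarrow> FA P D A k x \<in> Domain (R1 A O R2 A)"
      proof
        assume *: "Comp K A D D e1 k = k \<and> Comp K A ?B ?B e2 ?rk = ?rk"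
        have rk: "is_total K A ?B ?rk" using * factor_split_total[OF D(1) r1 A(1,2)] by simp
        have mrk: "Comp K A ?B D ?m ?rk = k" using * factor_split[OF D(1) r1 A(1) kh] by simp
        have "(FA P ?B A ?rk (FA P D ?B ?m x), FA Q ?B A ?rk z) \<in> R1 A"
          by (rule pmapD(4)[OF R1 z A(1) rk])
        then have "(FA P D A k x, FA Q ?B A ?rk z) \<in> R1 A"
          using presheafD(5)[OF P D(1) c(1) A(1) c(2) rk D(2)] mrk by simp
        moreover have "FA Q ?B A ?rk z \<in> Domain (R2 A)"
          using domain_atD(2)[OF e2 A(1) rk] * by simp
        ultimately show "FA P D A k x \<in> Domain (R1 A O R2 A)" by blast
      next
        assume "FA P D A k x \<in> Domain (R1 A O R2 A)"
        then obtain w where w: "(FA P D A k x, w) \<in> R1 A" "w \<in> Domain (R2 A)" by blast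
        then have e1k: "Comp K A D D e1 k = k"
          using domain_atD(2)[OF e1 A] by blast
        then have rk: "is_total K A ?B ?rk" and mrk: "Comp K A ?B D ?m ?rk = k"
          using factor_split_total[OF D(1) r1 A(1,2)] factor_split[OF D(1) r1 A(1) kh] by simp_all
        have "(FA P ?B A ?rk (FA P D ?B ?m x), FA Q ?B A ?rk z) \<in> R1 A"
          by (rule pmapD(4)[OF R1 z A(1) rk])
        then have "(FA P D A k x, FA Q ?B A ?rk z) \<in> R1 A"
          using presheafD(5)[OF P D(1) c(1) A(1) c(2) rk D(2)] mrk by simp
        then have "FA Q ?B A ?rk z = w" using pmapD(3)[OF R1] w(1) by blast
        then show "Comp K A D D e1 k = k \<and> Comp K A ?B ?B e2 ?rk = ?rk"
          using domain_atD(2)[OF e2 A(1) rk] w(2) e1k by simp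
      qed
      finally show ?thesis by simp
    qed
  qed
qed

lemma domain_value:
  assumes P: "presheaf P" and R: "pmap P Q R" and D: "D \<in> Ob K" "x \<in> FO P D"
    and e: "domain_at P (\<lambda>D. Domain (R D)) D x e"
  obtains z where "(FA P D (so D e) (sm D e) x, z) \<in> R (so D e)"
  using domain_atD(2)[OF e chosen(1,2)[OF D(1) domain_atD(1)[OF e]]] chosen(8)[OF D(1) domain_atD(1)[OF e]]
  by auto

lemma pmap_relcomp:
  assumes P: "presheaf P" and R1: "pmap P Q R1" and Q: "presheaf Q" and R2: "pmap Q S R2"
  shows "pmap P S (\<lambda>D. R1 D O R2 D)"
proof (rule pmapI)
  fix D x z assume "(x, z) \<in> R1 D O R2 D"
  then show "D \<in> Ob K \<and> x \<in> FO P D \<and> z \<in> FO S D"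
    using pmapD(2)[OF R1] pmapD(2)[OF R2] by blast
next
  fix D x z z' assume "(x, z) \<in> R1 D O R2 D" "(x, z') \<in> R1 D O R2 D"
  then show "z = z'" using pmapD(3)[OF R1] pmapD(3)[OF R2] by blast
next
  fix D A k x z assume "D \<in> Ob K" "A \<in> Ob K" "is_total K A D k" "(x, z) \<in> R1 D O R2 D"
  then show "(FA P D A k x, FA S D A k z) \<in> R1 A O R2 A"
    using pmapD(4)[OF R1] pmapD(4)[OF R2] by blast
next
  fix D x assume D: "D \<in> Ob K" "x \<in> FO P D"
  obtain e1 where e1: "domain_at P (\<lambda>D. Domain (R1 D)) D x e1" using pmapD(6)[OF R1 D] by blast
  obtain z where z: "(FA P D (so D e1) (sm D e1) x, z) \<in> R1 (so D e1)" using domain_value[OF P R1 D e1] .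
  obtain e2 where e2: "domain_at Q (\<lambda>D. Domain (R2 D)) (so D e1) z e2"
    using pmapD(2)[OF R1 z] pmapD(6)[OF R2] by blast
  show "\<exists>e. domain_at P (\<lambda>D. Domain (R1 D O R2 D)) D x e"
    using domain_at_relcomp[OF P R1 Q R2 D e1 z e2] by blast
qed

lemma pullback_PM_elements:
  assumes Z: "presheaf Z" and Z': "presheaf Z'" and Q: "presheaf Q" and f: "natural Z Q f" and n: "natural Z' Q n"
    and pb: "is_pullback PM Z Z' Q f n W p q"
  shows "small_presheaf U C W" "natural W Z p" "natural W Z' q"
    and "\<And>D w. \<lbrakk>D \<in> Ob K; w \<in> FO W D\<rbrakk> \<Longrightarrow> f D (p D w) = n D (q D w)"
    and "\<And>D z z'. \<lbrakk>D \<in> Ob K; z \<in> FO Z D; z' \<in> FO Z' D; f D z = n D z'\<rbrakk> \<Longrightarrow> \<exists>!w. w \<in> FO W D \<and> p D w = z \<and> q D w = z'"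
proof -
  show W: "small_presheaf U C W" and p: "natural W Z p" and q: "natural W Z' q"
    using pb by (simp_all add: is_pullback_def)
  have pW: "presheaf W" using W by (rule small_presheaf_presheaf)
  have sq: "Comp (Psh U C) W Z Q f p = Comp (Psh U C) W Z' Q n q"
    and univ: "\<And>V s t. \<lbrakk>small_presheaf U C V; natural V Z s; natural V Z' t;
        Comp (Psh U C) V Z Q f s = Comp (Psh U C) V Z' Q n t\<rbrakk> \<Longrightarrow>
      \<exists>!h. natural V W h \<and> Comp (Psh U C) V W Z p h = s \<and> Comp (Psh U C) V W Z' q h = t"
    using pb unfolding is_pullback_def by auto
  show "f D (p D w) = n D (q D w)" if "D \<in> Ob K" "w \<in> FO W D" for D w
    using fun_cong[OF fun_cong[OF sq], of D w] that by simp
  show "\<exists>!w. w \<in> FO W D \<and> p D w = z \<and> q D w = z'"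
    if D: "D \<in> Ob K" and z: "z \<in> FO Z D" "z' \<in> FO Z' D" "f D z = n D z'" for D z z'
  proof -
    have s: "natural (y D) Z (elt Z D z)" and t: "natural (y D) Z' (elt Z' D z')"
      using natural_elt D z Z Z' by blast+
    have eq: "Comp (Psh U C) (y D) Z Q f (elt Z D z) = Comp (Psh U C) (y D) Z' Q n (elt Z' D z')"
      by (rule natural_y_eqI[OF Q D])
        (use D z f n s t Z Z' in \<open>simp_all add: natural_Comp presheafD(4)\<close>)
    from univ[OF small_presheaf_y[OF D] s t eq]
    obtain h where h: "natural (y D) W h" "Comp (Psh U C) (y D) W Z p h = elt Z D z"
      "Comp (Psh U C) (y D) W Z' q h = elt Z' D z'"
      and uniq: "\<And>h'. \<lbrakk>natural (y D) W h'; Comp (Psh U C) (y D) W Z p h' = elt Z D z;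
        Comp (Psh U C) (y D) W Z' q h' = elt Z' D z'\<rbrakk> \<Longrightarrow> h' = h" by blast
    let ?one = "code D D (Idt K D)"
    have one: "?one \<in> FO (y D) D" using D by simp
    show ?thesis
    proof (rule ex1I[of _ "h D ?one"])
      show "h D ?one \<in> FO W D \<and> p D (h D ?one) = z \<and> q D (h D ?one) = z'"
        using fun_cong[OF fun_cong[OF h(2)], of D ?one] fun_cong[OF fun_cong[OF h(3)], of D ?one]
          naturalD(2)[OF h(1) D one] D z by (simp add: presheafD(4)[OF Z] presheafD(4)[OF Z'])
      fix w assume w: "w \<in> FO W D \<and> p D w = z \<and> q D w = z'"
      have "elt W D w = h"
      proof (rule uniq)
        show nw: "natural (y D) W (elt W D w)" using natural_elt[OF pW D] w by blast
        show "Comp (Psh U C) (y D) W Z p (elt W D w) = elt Z D z"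
          by (rule natural_y_eqI[OF Z D natural_Comp[OF presheaf_y[OF D] pW nw p] s])
            (use D w z in \<open>simp add: presheafD(4)[OF pW] presheafD(4)[OF Z]\<close>)
        show "Comp (Psh U C) (y D) W Z' q (elt W D w) = elt Z' D z'"
          by (rule natural_y_eqI[OF Z' D natural_Comp[OF presheaf_y[OF D] pW nw q] t])
            (use D w z in \<open>simp add: presheafD(4)[OF pW] presheafD(4)[OF Z']\<close>)
      qed
      then show "w = h D ?one"
        using D w by (auto simp: presheafD(4)[OF pW])
    qed
  qed
qed

text \<open>
  Pullbacks of chosen monics are computed elementwise. Conversely, a span with the composite graph
  is itself a pullback of any representatives: its apex is the domain of the composite.
\<close>

lemma Comp_Y:
  assumes P: "small_presheaf U C P" and Q: "small_presheaf U C Q" and S: "small_presheaf U C S"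
    and R1: "pmap P Q R1" and R2: "pmap Q S R2"
  shows "Comp Y P Q S (spans Q S R2) (spans P Q R1) = spans P S (\<lambda>D. R1 D O R2 D)" (is "?L = ?R")
proof (intro set_eqI iffI)
  have pP: "presheaf P" and pQ: "presheaf Q" and pS: "presheaf S"
    using assms small_presheaf_presheaf by blast+
  note R = pmap_relcomp[OF pP R1 pQ R2]
  fix t assume "t \<in> ?L"
  then obtain W p q Z m f Z' n g where t: "t = (W, Comp (Psh U C) W Z P m p, Comp (Psh U C) W Z' S g q)"
    and s1: "(Z, m, f) \<in> spans P Q R1" and s2: "(Z', n, g) \<in> spans Q S R2"
    and pb: "is_pullback PM Z Z' Q f n W p q"
    by (auto simp: Par_def)
  note S1 = mspanD[OF spans_graph(1)[OF s1] P] and g1 = spans_graph(2)[OF s1]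
  note S2 = mspanD[OF spans_graph(1)[OF s2] Q] and g2 = spans_graph(2)[OF s2]
  note el = pullback_PM_elements[OF S1(2) S2(2) pQ S1(4) S2(3) pb]
  have pW: "presheaf W" using el(1) by (rule small_presheaf_presheaf)
  let ?m = "Comp (Psh U C) W Z P m p" and ?g = "Comp (Psh U C) W Z' S g q"
  have nm: "natural W P ?m" and ng: "natural W S ?g"
    using natural_Comp[OF pW S1(2) el(2) S1(3)] natural_Comp[OF pW S2(2) el(3) S2(4)] .
  have gr: "graph (W, ?m, ?g) = (\<lambda>D. R1 D O R2 D)"
  proof (intro ext set_eqI)
    fix D and s :: "'u \<times> 'u"
    obtain x v where [simp]: "s = (x, v)" by fastforce
    show "s \<in> graph (W, ?m, ?g) D \<longleftrightarrow> s \<in> R1 D O R2 D"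
    proof
      assume "s \<in> graph (W, ?m, ?g) D"
      then obtain w where w: "D \<in> Ob K" "w \<in> FO W D" "x = ?m D w" "v = ?g D w"
        by (auto simp: graph_iff)
      have "(m D (p D w), f D (p D w)) \<in> R1 D" "(n D (q D w), g D (q D w)) \<in> R2 D"
        using w naturalD(2)[OF el(2) w(1,2)] naturalD(2)[OF el(3) w(1,2)]
        by (auto simp: g1[symmetric] g2[symmetric] graph_iff)
      then show "s \<in> R1 D O R2 D"
        using w el(4)[OF w(1,2)] by auto
    next
      assume "s \<in> R1 D O R2 D"
      then obtain u where "(x, u) \<in> graph (Z, m, f) D" "(u, v) \<in> graph (Z', n, g) D"
        using g1 g2 by auto
      then obtain z z' where z: "D \<in> Ob K" "z \<in> FO Z D" "x = m D z" "u = f D z" "z' \<in> FO Z' D" "u = n D z'" "v = g D z'"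
        by (auto simp: graph_iff)
      then obtain w where "w \<in> FO W D" "p D w = z" "q D w = z'"
        using el(5)[of D z z'] by auto
      then show "s \<in> graph (W, ?m, ?g) D" using z by (auto simp: graph_iff intro!: bexI[of _ w])
    qed
  qed
  have "?m \<in> Mon PM W P"
    unfolding Mon_PM_iff[OF el(1) P]
  proof (intro conjI ballI nm)
    fix D assume D: "D \<in> Ob K"
    show "inj_on (?m D) (FO W D)"
    proof (rule inj_onI)
      fix w w' assume w: "w \<in> FO W D" "w' \<in> FO W D" "?m D w = ?m D w'"
      have pw: "p D w \<in> FO Z D" "p D w' \<in> FO Z D" "q D w \<in> FO Z' D" "q D w' \<in> FO Z' D"
        using naturalD(2)[OF el(2) D] naturalD(2)[OF el(3) D] w by auto
      have 1: "p D w = p D w'"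
        by (rule inj_onD[OF S1(6)[OF D]]) (use w pw D in auto)
      have 2: "q D w = q D w'"
        by (rule inj_onD[OF S2(6)[OF D]]) (use el(4)[OF D w(1)] el(4)[OF D w(2)] pw 1 in auto)
      show "w = w'" using el(5)[OF D pw(1,3) el(4)[OF D w(1)]] w 1 2 by metis
    qed
  next
    have "?m D ` FO W D = Domain (R1 D O R2 D)" if "D \<in> Ob K" for D
      using Domain_graph[OF that, of W ?m ?g] gr by simp
    then show "M_sub P (\<lambda>D. ?m D ` FO W D)"
      by (rule iffD2[OF M_sub_cong pmapD(5)[OF R]])
  qed
  then show "t \<in> ?R"
    using el(1) ng gr by (simp add: t spans_def mspan_def)
next
  have pP: "presheaf P" and pQ: "presheaf Q" and pS: "presheaf S"
    using assms small_presheaf_presheaf by blast+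
  fix t assume "t \<in> ?R"
  then obtain W a b where t: "t = (W, a, b)" and s: "(W, a, b) \<in> ?R" by (cases t) auto
  note SW = mspanD[OF spans_graph(1)[OF s] P] and gW = spans_graph(2)[OF s]
  obtain Z m f where s1: "(Z, m, f) \<in> spans P Q R1" using spans_nonempty[OF R1 P] .
  obtain Z' n g where s2: "(Z', n, g) \<in> spans Q S R2" using spans_nonempty[OF R2 Q] .
  note S1 = mspanD[OF spans_graph(1)[OF s1] P] and g1 = spans_graph(2)[OF s1]
  note S2 = mspanD[OF spans_graph(1)[OF s2] Q] and g2 = spans_graph(2)[OF s2]
  have ab: "\<exists>z\<in>FO Z D. \<exists>z'\<in>FO Z' D. a D w = m D z \<and> f D z = n D z' \<and> b D w = g D z'"
    if "D \<in> Ob K" "w \<in> FO W D" for D w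
  proof -
    have "(a D w, b D w) \<in> graph (Z, m, f) D O graph (Z', n, g) D"
      unfolding g1 g2 using fun_cong[OF gW, of D] that by (auto simp: graph_def)
    then obtain u where "(a D w, u) \<in> graph (Z, m, f) D" "(u, b D w) \<in> graph (Z', n, g) D" by blast
    then show ?thesis unfolding graph_iff by metis
  qed
  have "a D w \<in> m D ` FO Z D" if "D \<in> Ob K" "w \<in> FO W D" for D w
    using ab[OF that] by auto
  then obtain p where p: "natural W Z p" and mp: "\<And>D w. \<lbrakk>D \<in> Ob K; w \<in> FO W D\<rbrakk> \<Longrightarrow> m D (p D w) = a D w"
    using lift_natural[OF SW(2) S1(2) S1(3) S1(6) SW(3)] by metis
  have fp: "natural W Q (Comp (Psh U C) W Z Q f p)"
    by (rule natural_Comp[OF SW(2) S1(2) p S1(4)])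
  have p_eq: "p D w = z" if "D \<in> Ob K" "w \<in> FO W D" "z \<in> FO Z D" "a D w = m D z" for D w z
    by (rule inj_onD[OF S1(6)[OF that(1)] _ naturalD(2)[OF p that(1,2)] that(3)])
      (simp add: mp[OF that(1,2)] that(4))
  have fp_range: "\<exists>z'\<in>FO Z' D. f D (p D w) = n D z' \<and> b D w = g D z'" if "D \<in> Ob K" "w \<in> FO W D" for D w
    using ab[OF that] p_eq[OF that] by metis
  then have "Comp (Psh U C) W Z Q f p D w \<in> n D ` FO Z' D" if "D \<in> Ob K" "w \<in> FO W D" for D w
    using that by fastforce
  then obtain q where q: "natural W Z' q"
    and nq': "\<And>D w. \<lbrakk>D \<in> Ob K; w \<in> FO W D\<rbrakk> \<Longrightarrow> n D (q D w) = Comp (Psh U C) W Z Q f p D w"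
    using lift_natural[OF SW(2) S2(2) S2(3) S2(6) fp] by metis
  have nq: "n D (q D w) = f D (p D w)" if "D \<in> Ob K" "w \<in> FO W D" for D w
    using nq'[OF that] that by simp
  have gq: "g D (q D w) = b D w" if D: "D \<in> Ob K" "w \<in> FO W D" for D w
  proof -
    obtain z' where z': "z' \<in> FO Z' D" "f D (p D w) = n D z'" "b D w = g D z'" using fp_range[OF D] by blast
    have "q D w = z'" by (rule inj_onD[OF S2(6)[OF D(1)]]) (use nq[OF D] z' naturalD(2)[OF q D] in auto)
    then show ?thesis using z' by simp
  qed
  have "is_pullback PM Z Z' Q f n W p q"
    unfolding is_pullback_def PM_sel
  proof (intro conjI ballI impI SW(1) p q)
    show "Comp (Psh U C) W Z Q f p = Comp (Psh U C) W Z' Q n q"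
      by (rule natural_eqI[OF fp natural_Comp[OF SW(2) S2(2) q S2(3)]]) (simp add: nq)
    fix V s' t' assume "V \<in> Ob PM" "s' \<in> Hom PM V Z" "t' \<in> Hom PM V Z'"
      "Comp (Psh U C) V Z Q f s' = Comp (Psh U C) V Z' Q n t'"
    then have V: "presheaf V" and s': "natural V Z s'" and t': "natural V Z' t'"
      and eq: "Comp (Psh U C) V Z Q f s' = Comp (Psh U C) V Z' Q n t'"
      using small_presheaf_presheaf by auto
    have ms: "natural V P (Comp (Psh U C) V Z P m s')" by (rule natural_Comp[OF V S1(2) s' S1(3)])
    have "Comp (Psh U C) V Z P m s' D v \<in> a D ` FO W D" if D: "D \<in> Ob K" "v \<in> FO V D" for D v
    proof -
      have "f D (s' D v) = n D (t' D v)"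
        using fun_cong[OF fun_cong[OF eq], of D v] D by simp
      moreover have "(m D (s' D v), f D (s' D v)) \<in> graph (Z, m, f) D" "(n D (t' D v), g D (t' D v)) \<in> graph (Z', n, g) D"
        using D naturalD(2)[OF s' D] naturalD(2)[OF t' D] by (auto simp: graph_iff)
      ultimately have "(m D (s' D v), g D (t' D v)) \<in> R1 D O R2 D" using g1 g2 by auto
      then have "(m D (s' D v), g D (t' D v)) \<in> graph (W, a, b) D" using gW by simp
      then show ?thesis using D by (auto simp: graph_iff)
    qed
    then obtain h where h: "natural V W h" and ah': "\<And>D v. \<lbrakk>D \<in> Ob K; v \<in> FO V D\<rbrakk> \<Longrightarrow>
        a D (h D v) = Comp (Psh U C) V Z P m s' D v"
      using lift_natural[OF V SW(2) SW(3) SW(6) ms] by metis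
    have ah: "a D (h D v) = m D (s' D v)" if "D \<in> Ob K" "v \<in> FO V D" for D v
      using ah'[OF that] that by simp
    have ph: "p D (h D v) = s' D v" if D: "D \<in> Ob K" "v \<in> FO V D" for D v
      by (rule p_eq) (use D ah[OF D] naturalD(2)[OF h D] naturalD(2)[OF s' D] in auto)
    have qh: "q D (h D v) = t' D v" if D: "D \<in> Ob K" "v \<in> FO V D" for D v
    proof (rule inj_onD[OF S2(6)[OF D(1)]])
      show "n D (q D (h D v)) = n D (t' D v)"
        using nq[OF D(1) naturalD(2)[OF h D]] ph[OF D] fun_cong[OF fun_cong[OF eq], of D v] D by simp
    qed (use naturalD(2)[OF h D] naturalD(2)[OF q D(1)] naturalD(2)[OF t' D] in auto)
    have "\<exists>!h. natural V W h \<and> Comp (Psh U C) V W Z p h = s' \<and> Comp (Psh U C) V W Z' q h = t'"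
    proof (rule ex1I[of _ h], intro conjI h)
      show "Comp (Psh U C) V W Z p h = s'"
        by (rule natural_eqI[OF natural_Comp[OF V SW(2) h p] s']) (simp add: ph)
      show "Comp (Psh U C) V W Z' q h = t'"
        by (rule natural_eqI[OF natural_Comp[OF V SW(2) h q] t']) (simp add: qh)
      fix h' assume *: "natural V W h' \<and> Comp (Psh U C) V W Z p h' = s' \<and> Comp (Psh U C) V W Z' q h' = t'"
      show "h' = h"
      proof (rule natural_eqI[OF conjunct1[OF *] h])
        fix D v assume D: "D \<in> Ob K" "v \<in> FO V D"
        have h'v: "h' D v \<in> FO W D" using naturalD(2)[OF conjunct1[OF *] D] .
        have "p D (h' D v) = s' D v" using * D by auto
        then have "a D (h' D v) = a D (h D v)" using mp[OF D(1) h'v] ah[OF D] by simp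
        then show "h' D v = h D v"
          by (rule inj_onD[OF SW(6)[OF D(1)] _ h'v naturalD(2)[OF h D]])
      qed
    qed
    then show "\<exists>!h. natural V W h \<and> Comp (Psh U C) V W Z p h = s' \<and> Comp (Psh U C) V W Z' q h = t'" .
  qed
  moreover have "a = Comp (Psh U C) W Z P m p"
    by (rule natural_eqI[OF SW(3) natural_Comp[OF SW(2) S1(2) p S1(3)]]) (simp add: mp)
  moreover have "b = Comp (Psh U C) W Z' S g q"
    by (rule natural_eqI[OF SW(4) natural_Comp[OF SW(2) S2(2) q S2(4)]]) (simp add: gq)
  ultimately show "t \<in> ?L"
    using s1 s2 unfolding t Par_def by (simp, blast)
qed

lemma Hom_YE:
  assumes "\<phi> \<in> Hom Y P Q" "small_presheaf U C P" "small_presheaf U C Q"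
  obtains R where "pmap P Q R" "\<phi> = spans P Q R"
  using assms Hom_Y by blast

lemma restriction_category_Y: "restriction_category Y"
proof -
  note [simp] = Idt_Y Rst_Y Comp_Y pmap_relcomp small_presheaf_presheaf
  have idl: "(\<lambda>D. id_graph P D O R D) = R" if "pmap P Q R" for P Q R
    using pmapD(2)[OF that] by (fastforce simp: id_graph_def fun_eq_iff)
  have idr: "(\<lambda>D. R D O id_graph Q D) = R" if "pmap P Q R" for P Q R
    using pmapD(2)[OF that] by (fastforce simp: id_graph_def fun_eq_iff)
  show ?thesis
  proof (unfold_locales, goal_cases)
    case (1 A)
    then show ?case by simp
  next
    case (2 A B D f g)
    then show ?case by (auto elim!: Hom_YE)
  next
    case (3 A B f)
    then show ?case by (auto elim!: Hom_YE simp: idr)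
  next
    case (4 A B f)
    then show ?case by (auto elim!: Hom_YE simp: idl)
  next
    case (5 A B D E f g h)
    then show ?case by (auto elim!: Hom_YE simp: O_assoc)
  next
    case (6 A B f)
    then show ?case by (auto elim!: Hom_YE)
  next
    case (7 A B f)
    then obtain R where R: "pmap A B R" "f = spans A B R" by (auto elim: Hom_YE)
    have "(\<lambda>D. Id_on (Domain (R D)) O R D) = R" by (auto simp: fun_eq_iff)
    then show ?case using 7 R by simp
  next
    case (8 A B D f g)
    then obtain R S where R: "pmap A B R" "f = spans A B R" "pmap A D S" "g = spans A D S"
      by (auto elim!: Hom_YE)
    have "(\<lambda>B. Id_on (Domain (R B)) O Id_on (Domain (S B))) = (\<lambda>B. Id_on (Domain (S B)) O Id_on (Domain (R B)))"
      by (auto simp: fun_eq_iff)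
    then show ?case using 8 R by simp
  next
    case (9 A B D f g)
    then obtain R S where R: "pmap A B R" "f = spans A B R" "pmap A D S" "g = spans A D S"
      by (auto elim!: Hom_YE)
    have "(\<lambda>B. Id_on (Domain (Id_on (Domain (R B)) O S B))) = (\<lambda>B. Id_on (Domain (R B)) O Id_on (Domain (S B)))"
      by (auto simp: fun_eq_iff)
    moreover have "pmap A D (\<lambda>B. Id_on (Domain (R B)) O S B)"
      using 9 R by (intro pmap_relcomp[OF _ Rst_Y(2)]) simp_all
    ultimately show ?case using 9 R by simp
  next
    case (10 A B D f g)
    then obtain R S where R: "pmap A B R" "f = spans A B R" "pmap B D S" "g = spans B D S"
      by (auto elim!: Hom_YE)
    have "(\<lambda>B. R B O Id_on (Domain (S B))) = (\<lambda>B. Id_on (Domain (R B O S B)) O R B)"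
    proof (intro ext equalityI subrelI)
      fix B a b assume "(a, b) \<in> R B O Id_on (Domain (S B))"
      then show "(a, b) \<in> Id_on (Domain (R B O S B)) O R B" by blast
    next
      fix B a b assume "(a, b) \<in> Id_on (Domain (R B O S B)) O R B"
      then obtain u where "(a, b) \<in> R B" "(a, u) \<in> R B" "u \<in> Domain (S B)" by blast
      moreover from this have "b = u" using pmapD(3)[OF R(1)] by blast
      ultimately show "(a, b) \<in> R B O Id_on (Domain (S B))" by blast
    qed
    moreover have "pmap A D (\<lambda>B. R B O S B)"
      using 10 by (intro pmap_relcomp[OF _ R(1) _ R(3)]) simp_all
    moreover from this have "pmap A A (\<lambda>B. Id_on (Domain (R B O S B)))"
      using 10 by (intro Rst_Y(2)) simp_all
    ultimately show ?case using 10 R by simp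
  qed
qed

text \<open>
  A total arrow is defined everywhere, so its graph is that of a natural transformation.
\<close>

definition fgraph where
  "fgraph P \<alpha> = (\<lambda>D. if D \<in> Ob K then (\<lambda>x. (x, \<alpha> D x)) ` FO P D else {})"

definition tarr where "tarr P Q \<alpha> = spans P Q (fgraph P \<alpha>)"

lemma fgraph_iff: "(x, z) \<in> fgraph P \<alpha> D \<longleftrightarrow> D \<in> Ob K \<and> x \<in> FO P D \<and> z = \<alpha> D x"
  by (auto simp: fgraph_def)

lemma pmap_fgraph:
  assumes "small_presheaf U C P" "natural P Q \<alpha>"
  shows "pmap P Q (fgraph P \<alpha>)"
  using pmap_graph[OF mspan_natural[OF assms] assms(1)] graph_natural[of P \<alpha>] small_presheaf_presheaf[OF assms(1)]
  by (simp add: fgraph_def)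

lemma tarr_total:
  assumes "small_presheaf U C P" "small_presheaf U C Q" "natural P Q \<alpha>"
  shows "is_total Y P Q (tarr P Q \<alpha>)"
proof -
  have "(\<lambda>D. Id_on (Domain (fgraph P \<alpha> D))) = id_graph P"
    by (auto simp: fgraph_iff id_graph_def fun_eq_iff fgraph_def)
  then show ?thesis
    using assms pmap_fgraph[OF assms(1,3)] by (simp add: is_total_def tarr_def Idt_Y Rst_Y)
qed

lemma total_YE:
  assumes \<phi>: "is_total Y P Q \<phi>" and P: "small_presheaf U C P" and Q: "small_presheaf U C Q"
  obtains \<alpha> where "natural P Q \<alpha>" "\<phi> = tarr P Q \<alpha>"
proof -
  have pP: "presheaf P" using P by (rule small_presheaf_presheaf)
  obtain R where R: "pmap P Q R" "\<phi> = spans P Q R"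
    using \<phi> P Q by (auto simp: is_total_def elim: Hom_YE)
  note RD = pmapD[OF R(1)]
  have "spans P P (\<lambda>D. Id_on (Domain (R D))) = spans P P (id_graph P)"
    using \<phi> P Q R by (simp add: is_total_def Rst_Y Idt_Y)
  then have *: "(\<lambda>D. Id_on (Domain (R D))) = id_graph P"
    using spans_inj[OF Rst_Y(2)[OF P R(1)] P] by blast
  have dom: "\<exists>z. (x, z) \<in> R D" if "D \<in> Ob K" "x \<in> FO P D" for D x
  proof -
    have "(x, x) \<in> id_graph P D" using that by (simp add: id_graph_def Id_onI)
    then have "(x, x) \<in> Id_on (Domain (R D))" by (simp add: *[symmetric])
    then show ?thesis by blast
  qed
  let ?f = "\<lambda>D x. THE z. (x, z) \<in> R D"
  have f: "?f D x = z" if "(x, z) \<in> R D" for D x z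
    using that RD(3) by blast
  have Rf: "(x, ?f D x) \<in> R D" if "D \<in> Ob K" "x \<in> FO P D" for D x
    using dom[OF that] f by metis
  have n: "natural P Q (mk_nat P ?f)"
  proof (rule natural_mk_nat[OF pP])
    show "?f D x \<in> FO Q D" if "D \<in> Ob K" "x \<in> FO P D" for D x
      using RD(2)[OF Rf[OF that]] by simp
    show "?f B (FA P A B k x) = FA Q A B k (?f A x)"
      if "A \<in> Ob K" "B \<in> Ob K" "is_total K B A k" "x \<in> FO P A" for A B k x
      by (rule f[OF RD(4)[OF Rf[OF that(1,4)] that(2,3)]])
  qed
  have "R = fgraph P (mk_nat P ?f)"
  proof (intro ext set_eqI)
    fix D and s :: "'u \<times> 'u"
    obtain x z where [simp]: "s = (x, z)" by fastforce
    show "s \<in> R D \<longleftrightarrow> s \<in> fgraph P (mk_nat P ?f) D"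
    proof
      assume "s \<in> R D"
      then have s: "(x, z) \<in> R D" by simp
      show "s \<in> fgraph P (mk_nat P ?f) D"
        using RD(2)[OF s] f[OF s] by (simp add: fgraph_iff)
    next
      assume "s \<in> fgraph P (mk_nat P ?f) D"
      then have "D \<in> Ob K" "x \<in> FO P D" "z = ?f D x" by (simp_all add: fgraph_iff)
      then show "s \<in> R D" using Rf[of D x] by (simp only: \<open>s = (x, z)\<close>)
    qed
  qed
  then show thesis using that[OF n] R(2) by (simp add: tarr_def)
qed

lemma tarr_inj:
  assumes "small_presheaf U C P" "natural P Q \<alpha>" "natural P Q \<beta>" "tarr P Q \<alpha> = tarr P Q \<beta>"
  shows "\<alpha> = \<beta>"
proof (rule natural_eqI[OF assms(2,3)])
  have eq: "fgraph P \<alpha> = fgraph P \<beta>"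
    using spans_inj[OF pmap_fgraph[OF assms(1,2)] assms(1)] assms(4) by (simp add: tarr_def)
  fix D x assume "D \<in> Ob K" "x \<in> FO P D"
  then have "(x, \<alpha> D x) \<in> fgraph P \<beta> D" by (simp add: eq[symmetric] fgraph_iff)
  then show "\<alpha> D x = \<beta> D x" by (simp add: fgraph_iff)
qed

lemma tarr_Comp:
  assumes P: "small_presheaf U C P" and Q: "small_presheaf U C Q" and S: "small_presheaf U C S"
    and a: "natural P Q \<alpha>" and b: "natural Q S \<beta>"
  shows "Comp Y P Q S (tarr Q S \<beta>) (tarr P Q \<alpha>) = tarr P S (Comp (Psh U C) P Q S \<beta> \<alpha>)"
proof -
  have "(\<lambda>D. fgraph P \<alpha> D O fgraph Q \<beta> D) = fgraph P (Comp (Psh U C) P Q S \<beta> \<alpha>)"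
    using naturalD(2)[OF a] by (auto simp: fun_eq_iff fgraph_def)
  then show ?thesis
    using assms by (simp add: tarr_def Comp_Y pmap_fgraph)
qed

lemma tarr_Idt: "small_presheaf U C P \<Longrightarrow> tarr P P (Idt (Psh U C) P) = Idt Y P"
proof -
  assume P: "small_presheaf U C P"
  have "id_graph P = fgraph P (Idt (Psh U C) P)"
    by (auto simp: id_graph_def fgraph_def fun_eq_iff Id_on_def)
  then show ?thesis using P by (simp add: Idt_Y tarr_def)
qed

section \<open>The embedding of a split restriction category\<close>

definition L where
  "L = comp_ftor K (Par_ftor C PM (yoneda U C)) (Phi K)"

definition Lgraph where
  "Lgraph D E f A = {(code A D k, code A E (Comp K A D E f k)) |k.
     A \<in> Ob K \<and> is_total K A D k \<and> is_total K A E (Comp K A D E f k)}"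

lemma Lgraph_iff:
  assumes "D \<in> Ob K" "E \<in> Ob K" "A \<in> Ob K" "is_total K A D k" "is_total K A E l"
  shows "(code A D k, code A E l) \<in> Lgraph D E f A \<longleftrightarrow> Comp K A D E f k = l"
  using assms by (auto simp: Lgraph_def)

lemma LgraphE:
  assumes "(x, z) \<in> Lgraph D E f A"
  obtains k where "A \<in> Ob K" "is_total K A D k" "is_total K A E (Comp K A D E f k)"
    "x = code A D k" "z = code A E (Comp K A D E f k)"
  using assms by (auto simp: Lgraph_def)

text \<open>
  Whatever representative \<open>(Z, m, f m)\<close> of \<open>\<Phi> f\<close> is chosen, a total map \<open>k\<close> factors through \<open>m\<close>
  iff \<open>f k\<close> is total; so the graph of the span under \<open>y\<close> does not depend on the choice.
\<close>

lemma mspan_Phi: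
  assumes D: "D \<in> Ob K" and E: "E \<in> Ob K" and f: "f \<in> Hom K D E"
    and s: "splits_as K D (Rst K D E f) Z0 m0 r0" and Z: "Z \<in> Ob K" and i: "is_iso C Z Z0 i"
    and m_def: "m = Comp K Z Z0 D m0 i" and h_def: "h = Comp K Z Z0 E (Comp K Z0 D E f m0) i"
  shows "mspan (y D) (y E) (y Z, FA (yoneda U C) Z D m, FA (yoneda U C) Z E h)"
    and "graph (y Z, FA (yoneda U C) Z D m, FA (yoneda U C) Z E h) = Lgraph D E f"
proof -
  have Z0: "Z0 \<in> Ob K" and m0: "m0 \<in> Hom K Z0 D" and r0: "r0 \<in> Hom K D Z0"
    and mr0: "Comp K D Z0 D m0 r0 = Rst K D E f" and rm0: "Comp K Z0 D Z0 r0 m0 = Idt K Z0"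
    using s by (simp_all add: splits_as_def)
  have m0t: "is_total K Z0 D m0" by (rule splits_as_total[OF D s])
  obtain j where it: "is_total K Z Z0 i" and jt: "is_total K Z0 Z j"
    and ji: "Comp K Z Z0 Z j i = Idt K Z" and ij: "Comp K Z0 Z Z0 i j = Idt K Z0"
    using i by (auto simp: is_iso_def)
  note [simp] = D E f Z0 m0 r0 Z is_total_Hom[OF it] is_total_Hom[OF jt]
  have mt: "is_total K Z D m" unfolding m_def using m0t it by (simp add: total_Comp)
  have fix_m0: "Comp K Z0 D D (Rst K D E f) m0 = m0"
  proof -
    have "Comp K Z0 D D (Comp K D Z0 D m0 r0) m0 = Comp K Z0 Z0 D m0 (Comp K Z0 D Z0 r0 m0)"
      by (simp add: Comp_assoc)
    then show ?thesis by (simp add: mr0 rm0)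
  qed
  have fm0: "is_total K Z0 E (Comp K Z0 D E f m0)"
    using Rst_fix_iff[of Z0 D E f m0] m0t fix_m0 by simp
  have hm: "h = Comp K Z D E f m"
    unfolding h_def m_def by (simp add: Comp_assoc)
  have ht: "is_total K Z E h" unfolding h_def using fm0 it by (simp add: total_Comp)
  have fac: "\<exists>l. is_total K A Z l \<and> Comp K A Z D m l = k"
    if A: "A \<in> Ob K" "is_total K A D k" "is_total K A E (Comp K A D E f k)" for A k
  proof -
    have kh: "k \<in> Hom K A D" using A by (simp add: is_total_Hom)
    have fk: "Comp K A D D (Rst K D E f) k = k"
      using Rst_fix_iff[of A D E f k] A by simp
    let ?l = "Comp K A Z0 Z j (Comp K A D Z0 r0 k)"
    have "Comp K A Z0 Z0 (Comp K Z0 Z Z0 i j) (Comp K A D Z0 r0 k) = Comp K A Z Z0 i ?l"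
      using A kh by (intro Comp_assoc[symmetric]) simp_all
    then have il: "Comp K A Z Z0 i ?l = Comp K A D Z0 r0 k"
      using A kh by (simp add: ij)
    have ml: "Comp K A Z D m ?l = k"
    proof -
      have "Comp K A Z D m ?l = Comp K A Z0 D m0 (Comp K A Z Z0 i ?l)"
        unfolding m_def using A kh by (intro Comp_assoc[symmetric]) simp_all
      also have "\<dots> = Comp K A D D (Comp K D Z0 D m0 r0) k"
        unfolding il using A kh by (intro Comp_assoc) simp_all
      finally show ?thesis by (simp add: mr0 fk)
    qed
    moreover have "is_total K A Z ?l"
      using total_right_factor[of A Z D ?l m] ml A kh mt by (simp add: is_total_Hom)
    ultimately show ?thesis by blast
  qed
  have canc: "l = l'" if A: "A \<in> Ob K" "is_total K A Z l" "is_total K A Z l'" "Comp K A Z D m l = Comp K A Z D m l'" for A l l'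
  proof -
    define q where "q = Comp K D Z0 Z j r0"
    have q: "q \<in> Hom K D Z" by (simp add: q_def)
    have "Comp K Z D Z q m = Comp K Z Z0 Z j (Comp K Z Z0 Z0 (Comp K Z0 D Z0 r0 m0) i)"
      unfolding q_def m_def by (simp add: Comp_assoc)
    then have qm: "Comp K Z D Z q m = Idt K Z" by (simp add: rm0 ji)
    have "Comp K A D Z q (Comp K A Z D m k) = k" if "is_total K A Z k" for k
      using that A q mt qm by (simp add: Comp_assoc is_total_Hom)
    then show ?thesis using A by metis
  qed
  let ?m = "FA (yoneda U C) Z D m" and ?h = "FA (yoneda U C) Z E h"
  have nm: "natural (y Z) (y D) ?m" and nh: "natural (y Z) (y E) ?h"
    using natural_yoneda mt ht by simp_all
  have img: "?m A ` FO (y Z) A = {code A D k |k. is_total K A D k \<and> is_total K A E (Comp K A D E f k)}"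
    if A: "A \<in> Ob K" for A
  proof (intro set_eqI iffI)
    fix v assume "v \<in> ?m A ` FO (y Z) A"
    then obtain l where l: "is_total K A Z l" "v = ?m A (code A Z l)" using A by (auto simp: y_sel)
    have "Comp K A D E f (Comp K A Z D m l) = Comp K A Z E h l"
      unfolding hm using A l mt by (intro Comp_assoc) (simp_all add: is_total_Hom)
    then show "v \<in> {code A D k |k. is_total K A D k \<and> is_total K A E (Comp K A D E f k)}"
      using l A mt ht by (auto simp: yoneda_sel total_Comp)
  next
    fix v assume "v \<in> {code A D k |k. is_total K A D k \<and> is_total K A E (Comp K A D E f k)}"
    then obtain k where k: "is_total K A D k" "is_total K A E (Comp K A D E f k)" "v = code A D k" by blast
    obtain l where l: "is_total K A Z l" "Comp K A Z D m l = k" using fac[OF A k(1,2)] by blast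
    then have "v = ?m A (code A Z l)" using k A mt by (simp add: yoneda_sel)
    then show "v \<in> ?m A ` FO (y Z) A" using l A by simp
  qed
  have "?m \<in> Mon PM (y Z) (y D)"
    unfolding Mon_PM_iff[OF small_presheaf_y[OF Z] small_presheaf_y[OF D]]
  proof (intro conjI ballI nm)
    fix A assume A: "A \<in> Ob K"
    show "inj_on (?m A) (FO (y Z) A)"
    proof (rule inj_onI)
      fix a b assume "a \<in> FO (y Z) A" "b \<in> FO (y Z) A" and ab: "?m A a = ?m A b"
      then obtain l l' where l: "is_total K A Z l" "a = code A Z l" "is_total K A Z l'" "b = code A Z l'"
        using A by (auto simp: y_sel)
      then show "a = b" using canc[OF A l(1,3)] ab A mt by (simp add: yoneda_sel total_Comp)
    qed
  next
    show "M_sub (y D) (\<lambda>A. ?m A ` FO (y Z) A)"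
      unfolding M_sub_def
    proof (intro conjI ballI)
      show "?m A ` FO (y Z) A \<subseteq> FO (y D) A" if "A \<in> Ob K" for A
        using naturalD(2)[OF nm that] by blast
      fix B x assume B: "B \<in> Ob K" "x \<in> FO (y D) B"
      then obtain k where k: "is_total K B D k" "x = code B D k" by (auto simp: y_sel)
      have fk: "Comp K B D E f k \<in> Hom K B E" using B k by (simp add: is_total_Hom)
      have "domain_at (y D) (\<lambda>A. ?m A ` FO (y Z) A) B x (Rst K B E (Comp K B D E f k))"
        unfolding domain_at_def
      proof (intro conjI ballI allI impI)
        show "restriction_idempotent K B (Rst K B E (Comp K B D E f k))" using B fk by simp
        fix A l assume A: "A \<in> Ob K" "is_total K A B l"
        have "Comp K A D E f (Comp K A B D k l) = Comp K A B E (Comp K B D E f k) l"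
          using A B k by (intro Comp_assoc) (simp_all add: is_total_Hom)
        then show "FA (y D) B A l x \<in> ?m A ` FO (y Z) A \<longleftrightarrow> Comp K A B B (Rst K B E (Comp K B D E f k)) l = l"
          using A B k Rst_fix_iff[OF A(1) B(1) E fk A(2)] img[OF A(1)]
          by (auto simp: y_sel(2) total_Comp)
      qed
      then show "\<exists>e. domain_at (y D) (\<lambda>A. ?m A ` FO (y Z) A) B x e" by blast
    qed
  qed
  then show "mspan (y D) (y E) (y Z, ?m, ?h)"
    using nh by (simp add: mspan_def)
  show "graph (y Z, ?m, ?h) = Lgraph D E f"
  proof (intro ext set_eqI)
    fix A and v :: "'u \<times> 'u"
    obtain a b where [simp]: "v = (a, b)" by fastforce
    show "v \<in> graph (y Z, ?m, ?h) A \<longleftrightarrow> v \<in> Lgraph D E f A"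
    proof
      assume "v \<in> graph (y Z, ?m, ?h) A"
      then obtain l where A: "A \<in> Ob K" and l: "is_total K A Z l" "a = ?m A (code A Z l)" "b = ?h A (code A Z l)"
        by (auto simp: graph_iff y_sel)
      have "Comp K A D E f (Comp K A Z D m l) = Comp K A Z E h l"
        unfolding hm using A l mt by (intro Comp_assoc) (simp_all add: is_total_Hom)
      then show "v \<in> Lgraph D E f A"
        using A l mt ht by (auto simp: Lgraph_def yoneda_sel total_Comp intro!: exI[of _ "Comp K A Z D m l"])
    next
      assume "v \<in> Lgraph D E f A"
      then obtain k where A: "A \<in> Ob K" and k: "is_total K A D k" "is_total K A E (Comp K A D E f k)"
        "a = code A D k" "b = code A E (Comp K A D E f k)" by (auto elim: LgraphE)
      obtain l where l: "is_total K A Z l" "Comp K A Z D m l = k" using fac[OF A k(1,2)] by blast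
      have "Comp K A D E f k = Comp K A Z E h l"
        unfolding hm l(2)[symmetric] using A l mt by (intro Comp_assoc) (simp_all add: is_total_Hom)
      then have "a = ?m A (code A Z l)" "b = ?h A (code A Z l)"
        using k A l mt ht by (simp_all add: yoneda_sel)
      then show "v \<in> graph (y Z, ?m, ?h) A" using A l by (auto simp: graph_iff)
    qed
  qed
qed

lemma Phi_elim:
  assumes "D \<in> Ob K" "E \<in> Ob K" "f \<in> Hom K D E" "(Z, m, h) \<in> FA (Phi K) D E f"
  shows "mspan (y D) (y E) (y Z, FA (yoneda U C) Z D m, FA (yoneda U C) Z E h)"
    and "graph (y Z, FA (yoneda U C) Z D m, FA (yoneda U C) Z E h) = Lgraph D E f" and "Z \<in> Ob K"
proof -
  obtain Z0 m0 r0 i where *: "splits_as K D (Rst K D E f) Z0 m0 r0" "Z \<in> Ob K" "is_iso C Z Z0 i"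
    "m = Comp K Z Z0 D m0 i" "h = Comp K Z Z0 E (Comp K Z0 D E f m0) i"
    using assms by (auto simp: Phi_def span_class_def)
  show "mspan (y D) (y E) (y Z, FA (yoneda U C) Z D m, FA (yoneda U C) Z E h)"
    "graph (y Z, FA (yoneda U C) Z D m, FA (yoneda U C) Z E h) = Lgraph D E f" "Z \<in> Ob K"
    using mspan_Phi[OF assms(1-3) *] *(2) by blast+
qed

lemma Phi_nonempty:
  assumes "D \<in> Ob K" "E \<in> Ob K" "f \<in> Hom K D E"
  obtains Z m h where "(Z, m, h) \<in> FA (Phi K) D E f"
proof -
  have "restriction_idempotent K D (Rst K D E f)" using assms by simp
  note s = splits_as_chosen[OF assms(1) this] and c = chosen[OF assms(1) this]
  have "is_iso C (so D (Rst K D E f)) (so D (Rst K D E f)) (Idt K (so D (Rst K D E f)))"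
    using c(1) by (auto simp: is_iso_def intro!: exI[of _ "Idt K (so D (Rst K D E f))"])
  then show thesis
    using that s c(1) assms by (fastforce simp: Phi_def span_class_def)
qed

text \<open>
  Any two splittings of an idempotent are isomorphic, so the union over all of them is a single
  class of spans.
\<close>

lemma Phi_in_Par:
  assumes "D \<in> Ob K" "E \<in> Ob K" "f \<in> Hom K D E"
  shows "FA (Phi K) D E f \<in> Hom (Par C) D E"
proof -
  have r: "restriction_idempotent K D (Rst K D E f)" using assms by simp
  let ?S = "{(Z, m, r). splits_as K D (Rst K D E f) Z m r}"
  define cl where "cl = (\<lambda>(Z, m, r :: 'a). span_class C D E (Z, m, Comp K Z D E f m))"
  have iso: "cl (Z, m, r) \<subseteq> cl (Z', m', r')"
    if s: "splits_as K D (Rst K D E f) Z m r" and s': "splits_as K D (Rst K D E f) Z' m' r'" for Z m r Z' m' r'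
  proof -
    have Z: "Z \<in> Ob K" "m \<in> Hom K Z D" "r \<in> Hom K D Z" "Comp K D Z D m r = Rst K D E f" "Comp K Z D Z r m = Idt K Z"
      and Z': "Z' \<in> Ob K" "m' \<in> Hom K Z' D" "r' \<in> Hom K D Z'" "Comp K D Z' D m' r' = Rst K D E f" "Comp K Z' D Z' r' m' = Idt K Z'"
      using s s' by (simp_all add: splits_as_def)
    note [simp] = assms Z(1-3) Z'(1-3)
    define j where "j = Comp K Z D Z' r' m"
    define j' where "j' = Comp K Z' D Z r m'"
    have j: "j \<in> Hom K Z Z'" "j' \<in> Hom K Z' Z" by (simp_all add: j_def j'_def)
    have mm: "Comp K Z Z' D m' j = m" 
    proof -
      have "Comp K Z Z' D m' j = Comp K Z D D (Comp K D Z' D m' r') m"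
        unfolding j_def by (rule Comp_assoc) simp_all
      also have "\<dots> = Comp K Z Z D m (Comp K Z D Z r m)"
        unfolding Z'(4) Z(4)[symmetric] by (rule Comp_assoc[symmetric]) simp_all
      finally show ?thesis by (simp add: Z(5))
    qed
    have mm': "Comp K Z' Z D m j' = m'"
    proof -
      have "Comp K Z' Z D m j' = Comp K Z' D D (Comp K D Z D m r) m'"
        unfolding j'_def by (rule Comp_assoc) simp_all
      also have "\<dots> = Comp K Z' Z' D m' (Comp K Z' D Z' r' m')"
        unfolding Z(4) Z'(4)[symmetric] by (rule Comp_assoc[symmetric]) simp_all
      finally show ?thesis by (simp add: Z'(5))
    qed
    have jj: "Comp K Z Z' Z j' j = Idt K Z"
    proof -
      have "Comp K Z Z' Z j' j = Comp K Z D Z r (Comp K Z Z' D m' j)"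
        unfolding j'_def using j by (intro Comp_assoc[symmetric]) simp_all
      then show ?thesis by (simp add: mm Z(5))
    qed
    have jj': "Comp K Z' Z Z' j j' = Idt K Z'"
    proof -
      have "Comp K Z' Z Z' j j' = Comp K Z' D Z' r' (Comp K Z' Z D m j')"
        unfolding j_def using j by (intro Comp_assoc[symmetric]) simp_all
      then show ?thesis by (simp add: mm' Z'(5))
    qed
    have jt: "is_total K Z Z' j" "is_total K Z' Z j'"
      using total_right_factor[of Z Z' Z j j'] total_right_factor[of Z' Z Z' j' j] jj jj' j by simp_all
    show ?thesis
    proof
      fix t assume "t \<in> cl (Z, m, r)"
      then obtain W i where t: "t = (W, Comp K W Z D m i, Comp K W Z E (Comp K Z D E f m) i)" "W \<in> Ob K" "is_iso C W Z i"
        by (auto simp: cl_def span_class_def)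
      then obtain i' where i: "is_total K W Z i" "is_total K Z W i'" "Comp K W Z W i' i = Idt K W" "Comp K Z W Z i i' = Idt K Z"
        by (auto simp: is_iso_def)
      have ih: "i \<in> Hom K W Z" "i' \<in> Hom K Z W" using i by (simp_all add: is_total_Hom)
      let ?i = "Comp K W Z Z' j i" and ?i' = "Comp K Z' Z W i' j'"
      have "Comp K W Z' W ?i' ?i = Comp K W Z W i' (Comp K W Z Z (Comp K Z Z' Z j' j) i)"
        using j ih t by (simp add: Comp_assoc)
      then have 1: "Comp K W Z' W ?i' ?i = Idt K W" using ih t i by (simp add: jj)
      have "Comp K Z' W Z' ?i ?i' = Comp K Z' Z Z' j (Comp K Z' Z Z (Comp K Z W Z i i') j')"
        using j ih t by (simp add: Comp_assoc)
      then have 2: "Comp K Z' W Z' ?i ?i' = Idt K Z'" using j t i by (simp add: jj')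
      have 3: "is_iso C W Z' ?i"
        using 1 2 i jt t by (auto simp: is_iso_def total_Comp intro!: exI[of _ ?i'])
      have 4: "Comp K W Z' D m' ?i = Comp K W Z D m i"
        using ih j t mm Comp_assoc[of W Z Z' D i j m'] by simp
      have "Comp K W Z' E (Comp K Z' D E f m') ?i = Comp K W D E f (Comp K W Z' D m' ?i)"
        using ih j t by (intro Comp_assoc[symmetric]) simp_all
      also have "\<dots> = Comp K W Z E (Comp K Z D E f m) i"
        unfolding 4 using ih t by (intro Comp_assoc) simp_all
      finally show "t \<in> cl (Z', m', r')"
        using t 3 4 unfolding cl_def span_class_def by force
    qed
  qed
  note s = splits_as_chosen[OF assms(1) r] and c = chosen[OF assms(1) r]
  let ?e = "Rst K D E f"
  have "FA (Phi K) D E f = (\<Union>s\<in>?S. cl s)"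
    using assms by (simp add: Phi_def cl_def case_prod_unfold)
  also have "\<dots> = cl (so D ?e, sm D ?e, sr D ?e)"
  proof (rule UN_constant_eq)
    show "(so D ?e, sm D ?e, sr D ?e) \<in> ?S" using s by simp
    have "cl (Z, m, r) = cl (so D ?e, sm D ?e, sr D ?e)" if "splits_as K D ?e Z m r" for Z m r
      by (intro equalityI iso that s)
    then show "\<forall>t\<in>?S. cl t = cl (so D ?e, sm D ?e, sr D ?e)" by auto
  qed
  finally have eq: "FA (Phi K) D E f = span_class C D E (so D ?e, sm D ?e, Comp K (so D ?e) D E f (sm D ?e))"
    by (simp add: cl_def)
  have "is_total K (so D ?e) E (Comp K (so D ?e) D E f (sm D ?e))"
    using Rst_fix_iff[of "so D ?e" D E f "sm D ?e"] c(1,2,8) assms by simp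
  then have "\<exists>Z m h. FA (Phi K) D E f = span_class C D E (Z, m, h) \<and> Z \<in> Ob C \<and> m \<in> Mon C Z D \<and> h \<in> Hom C Z E"
    using c(1,9) eq unfolding MTotal_sel by blast
  then show ?thesis
    unfolding Par_def by simp
qed

lemma L_FO [simp]: "D \<in> Ob K \<Longrightarrow> FO L D = y D"
  by (simp add: L_def Par_ftor_def Phi_def Par_def yoneda_sel)

lemma L_FA:
  assumes "D \<in> Ob K" "E \<in> Ob K" "f \<in> Hom K D E"
  shows "FA L D E f = spans (y D) (y E) (Lgraph D E f)" "pmap (y D) (y E) (Lgraph D E f)"
proof -
  obtain Z m h where ne: "(Z, m, h) \<in> FA (Phi K) D E f" using Phi_nonempty[OF assms] .
  have "(case s of (Z, m, h) \<Rightarrow> span_class PM (y D) (y E) (FO (yoneda U C) Z, FA (yoneda U C) Z D m, FA (yoneda U C) Z E h))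
      = spans (y D) (y E) (Lgraph D E f)" if "s \<in> FA (Phi K) D E f" for s
  proof -
    obtain Z m h where s: "s = (Z, m, h)" by (metis surj_pair)
    then have "(Z, m, h) \<in> FA (Phi K) D E f" using that by simp
    note p = Phi_elim[OF assms this]
    show ?thesis using spans_eqI[OF p(1) _ _ p(2)] assms p(3) by (simp add: s yoneda_sel)
  qed
  moreover have "FA L D E f = (\<Union>s\<in>FA (Phi K) D E f. case s of (Z, m, h) \<Rightarrow>
      span_class PM (y D) (y E) (FO (yoneda U C) Z, FA (yoneda U C) Z D m, FA (yoneda U C) Z E h))"
  proof -
    have [simp]: "FO (Phi K) D = D" "FO (Phi K) E = E" using assms by (simp_all add: Phi_def)
    show ?thesis
      using assms Phi_in_Par[OF assms] by (simp add: L_def Par_ftor_def yoneda_sel mk_ftor_def[of "Par C"]) (simp add: Par_def yoneda_sel)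
  qed
  ultimately show "FA L D E f = spans (y D) (y E) (Lgraph D E f)"
    using ne by auto
  show "pmap (y D) (y E) (Lgraph D E f)"
    using pmap_graph[OF Phi_elim(1)[OF assms ne]] Phi_elim(2)[OF assms ne] assms by simp
qed

lemma restriction_functor_L: "is_restriction_functor K Y L"
proof -
  have "is_functor K Y (mk_ftor K (FO L) (FA L))"
  proof (rule is_functor_mk_ftor[OF category_axioms], goal_cases)
    case (3 D)
    have "Lgraph D D (Idt K D) = id_graph (y D)"
      using 3 by (auto simp: Lgraph_def id_graph_def fun_eq_iff y_sel is_total_Hom)
    then show ?case using 3 by (simp add: L_FA Idt_Y)
  next
    case (4 D E F f g)
    have "Lgraph D F (Comp K D E F g f) = (\<lambda>A. Lgraph D E f A O Lgraph E F g A)"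
    proof (intro ext set_eqI)
      fix A and v :: "'u \<times> 'u"
      obtain a b where [simp]: "v = (a, b)" by fastforce
      have assoc: "Comp K A D F (Comp K D E F g f) k = Comp K A E F g (Comp K A D E f k)"
        if "A \<in> Ob K" "is_total K A D k" for k
        using that 4 by (simp add: Comp_assoc is_total_Hom)
      show "v \<in> Lgraph D F (Comp K D E F g f) A \<longleftrightarrow> v \<in> Lgraph D E f A O Lgraph E F g A"
      proof
        assume "v \<in> Lgraph D F (Comp K D E F g f) A"
        then obtain k where k: "A \<in> Ob K" "is_total K A D k" "is_total K A F (Comp K A D F (Comp K D E F g f) k)"
          "a = code A D k" "b = code A F (Comp K A D F (Comp K D E F g f) k)" by (auto elim: LgraphE)
        have fk: "is_total K A E (Comp K A D E f k)"
          using total_right_factor[of A E F "Comp K A D E f k" g] k 4 assoc by (simp add: is_total_Hom)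
        have "(a, code A E (Comp K A D E f k)) \<in> Lgraph D E f A"
          using k fk by (auto simp: Lgraph_def)
        moreover have "(code A E (Comp K A D E f k), b) \<in> Lgraph E F g A"
          using k fk assoc by (auto simp: Lgraph_def)
        ultimately show "v \<in> Lgraph D E f A O Lgraph E F g A" by auto
      next
        assume "v \<in> Lgraph D E f A O Lgraph E F g A"
        then obtain k l where k: "A \<in> Ob K" "is_total K A D k" "is_total K A E (Comp K A D E f k)" "a = code A D k"
          and l: "is_total K A E l" "is_total K A F (Comp K A E F g l)" "b = code A F (Comp K A E F g l)"
          and kl: "code A E (Comp K A D E f k) = code A E l"
          by (auto elim!: LgraphE)
        have "l = Comp K A D E f k" using kl k l 4 by simp
        then show "v \<in> Lgraph D F (Comp K D E F g f) A"
          using k l assoc[OF k(1,2)] by (auto simp: Lgraph_def intro!: exI[of _ k])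
      qed
    qed
    then show ?case using 4 by (simp add: L_FA Comp_Y)
  qed (simp_all add: L_FA)
  moreover have "L = mk_ftor K (FO L) (FA L)"
    unfolding L_def comp_ftor_def by (rule mk_ftor_idem[symmetric])
  ultimately have F: "is_functor K Y L" by simp
  have "FA L D D (Rst K D E f) = Rst Y (FO L D) (FO L E) (FA L D E f)"
    if *: "D \<in> Ob K" "E \<in> Ob K" "f \<in> Hom K D E" for D E f
  proof -
    have tot: "is_total K A D (Comp K A D D (Rst K D E f) k) \<longleftrightarrow> is_total K A E (Comp K A D E f k)"
      "is_total K A E (Comp K A D E f k) \<Longrightarrow> Comp K A D D (Rst K D E f) k = k"
      if "A \<in> Ob K" "is_total K A D k" for A k
      using that * Rst_Comp_left[of A D E k f] Rst_fix_iff[of A D E f k] by (auto simp: is_total_def)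
    have "Lgraph D D (Rst K D E f) = (\<lambda>A. Id_on (Domain (Lgraph D E f A)))"
      using tot by (fastforce simp: Lgraph_def fun_eq_iff Id_on_def Domain_unfold)
    then show ?thesis using * by (simp add: L_FA Rst_Y)
  qed
  then show ?thesis using F by (simp add: is_restriction_functor_def)
qed

text \<open>The arrow \<open>y D \<rightarrow> P\<close> named by \<open>x \<in> P D\<close>.\<close>

definition point where "point P D x = tarr (y D) P (elt P D x)"

lemma point_total:
  assumes "small_presheaf U C P" "D \<in> Ob K" "x \<in> FO P D"
  shows "is_total Y (y D) P (point P D x)"
  unfolding point_def using assms by (intro tarr_total natural_elt) (simp_all add: small_presheaf_presheaf)

lemma L_total_tarr:
  assumes "D \<in> Ob K" "E \<in> Ob K" "is_total K D E k"
  shows "FA L D E k = tarr (y D) (y E) (FA (yoneda U C) D E k)"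
proof -
  have "Lgraph D E k = fgraph (y D) (FA (yoneda U C) D E k)"
  proof (intro ext set_eqI)
    fix A and v :: "'u \<times> 'u"
    obtain a b where [simp]: "v = (a, b)" by fastforce
    show "v \<in> Lgraph D E k A \<longleftrightarrow> v \<in> fgraph (y D) (FA (yoneda U C) D E k) A"
    proof
      assume "v \<in> Lgraph D E k A"
      then show "v \<in> fgraph (y D) (FA (yoneda U C) D E k) A"
        using assms by (auto simp: fgraph_iff yoneda_sel elim!: LgraphE)
    next
      assume "v \<in> fgraph (y D) (FA (yoneda U C) D E k) A"
      then obtain l where "A \<in> Ob K" "is_total K A D l" "a = code A D l" "b = code A E (Comp K A D E k l)"
        using assms by (auto simp: fgraph_iff y_sel yoneda_sel)
      moreover from this have "is_total K A E (Comp K A D E k l)" using assms by (simp add: total_Comp)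
      ultimately show "v \<in> Lgraph D E k A"
        unfolding Lgraph_def by auto
    qed
  qed
  then show ?thesis using assms by (simp add: L_FA tarr_def is_total_Hom)
qed

lemma point_act:
  assumes "small_presheaf U C P" "D \<in> Ob K" "x \<in> FO P D" "A \<in> Ob K" "is_total K A D k"
  shows "Comp Y (y A) (y D) P (point P D x) (FA L A D k) = point P A (FA P D A k x)"
proof -
  have P: "presheaf P" using assms(1) by (rule small_presheaf_presheaf)
  have n: "natural (y A) (y D) (FA (yoneda U C) A D k)" "natural (y D) P (elt P D x)"
    using assms P by (simp_all add: natural_yoneda natural_elt)
  have "Comp (Psh U C) (y A) (y D) P (elt P D x) (FA (yoneda U C) A D k) = elt P A (FA P D A k x)"
    by (rule natural_y_eqI[OF P assms(4) natural_Comp[OF _ _ n] natural_elt[OF P assms(4)]])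
      (use assms P in \<open>simp_all add: yoneda_sel presheafD(3,4) is_total_Hom\<close>)
  then show ?thesis
    using assms n by (simp add: L_total_tarr point_def tarr_Comp)
qed

text \<open>
  The domain of \<open>\<phi> x\<close> is cut out by an idempotent \<open>e\<close> of \<open>K\<close>; on the splitting of \<open>e\<close>, the
  arrow \<open>\<phi> x\<close> is total, hence named by an element \<open>z\<close> of \<open>Q\<close>.
\<close>

lemma Comp_point:
  assumes P: "small_presheaf U C P" and Q: "small_presheaf U C Q" and R: "pmap P Q R"
    and D: "D \<in> Ob K" "x \<in> FO P D" and e: "domain_at P (\<lambda>D. Domain (R D)) D x e"
    and z: "(FA P D (so D e) (sm D e) x, z) \<in> R (so D e)"
  shows "Comp Y (y D) P Q (spans P Q R) (point P D x)
    = Comp Y (y D) (y (so D e)) Q (point Q (so D e) z) (FA L D (so D e) (sr D e))"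
proof -
  have pP: "presheaf P" and pQ: "presheaf Q" using P Q small_presheaf_presheaf by blast+
  note r = domain_atD(1)[OF e]
  note c = chosen[OF D(1) r]
  let ?B = "so D e"
  have zQ: "z \<in> FO Q ?B" using pmapD(2)[OF R z] by simp
  have n: "natural (y D) P (elt P D x)" "natural (y ?B) Q (elt Q ?B z)"
    using natural_elt pP pQ D c zQ by blast+
  have "(\<lambda>A. fgraph (y D) (elt P D x) A O R A) = (\<lambda>A. Lgraph D ?B (sr D e) A O fgraph (y ?B) (elt Q ?B z) A)"
  proof (intro ext set_eqI)
    fix A and v :: "'u \<times> 'u"
    obtain a b where [simp]: "v = (a, b)" by fastforce
    have val: "(FA P D A k x, FA Q ?B A (Comp K A D ?B (sr D e) k) z) \<in> R A"
      if A: "A \<in> Ob K" "is_total K A D k" and ek: "Comp K A D D e k = k" for k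
    proof -
      note f = factor_split[OF D(1) r A(1) is_total_Hom[OF A(2)] ek] factor_split_total[OF D(1) r A ek]
      show ?thesis
        using pmapD(4)[OF R z A(1) f(2)] presheafD(5)[OF pP D(1) c(1) A(1) c(2) f(2) D(2)] f(1) by simp
    qed
    show "v \<in> fgraph (y D) (elt P D x) A O R A \<longleftrightarrow> v \<in> Lgraph D ?B (sr D e) A O fgraph (y ?B) (elt Q ?B z) A"
    proof
      assume "v \<in> fgraph (y D) (elt P D x) A O R A"
      then obtain k where A: "A \<in> Ob K" and k: "is_total K A D k" "a = code A D k" "(FA P D A k x, b) \<in> R A"
        using D by (auto simp: fgraph_iff y_sel)
      have ek: "Comp K A D D e k = k" using domain_atD(2)[OF e A k(1)] k(3) by blast
      note rk = factor_split_total[OF D(1) r A k(1) ek]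
      have b: "b = FA Q ?B A (Comp K A D ?B (sr D e) k) z" using pmapD(3)[OF R k(3) val[OF A k(1) ek]] .
      have "(a, code A ?B (Comp K A D ?B (sr D e) k)) \<in> Lgraph D ?B (sr D e) A"
        using A k rk by (auto simp: Lgraph_def)
      moreover have "(code A ?B (Comp K A D ?B (sr D e) k), b) \<in> fgraph (y ?B) (elt Q ?B z) A"
        using A rk c b by (simp add: fgraph_iff)
      ultimately show "v \<in> Lgraph D ?B (sr D e) A O fgraph (y ?B) (elt Q ?B z) A" by auto
    next
      assume "v \<in> Lgraph D ?B (sr D e) A O fgraph (y ?B) (elt Q ?B z) A"
      then obtain k where A: "A \<in> Ob K" and k: "is_total K A D k" "is_total K A ?B (Comp K A D ?B (sr D e) k)" "a = code A D k"
        and b: "b = FA Q ?B A (Comp K A D ?B (sr D e) k) z"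
        using c by (auto simp: fgraph_iff elim!: LgraphE)
      have "Comp K A D D e k = k" using Rst_fix_iff[OF A D(1) c(1,4) k(1)] k(2) c(7) by simp
      then have "(FA P D A k x, b) \<in> R A" using val[OF A k(1)] b by simp
      moreover have "(a, FA P D A k x) \<in> fgraph (y D) (elt P D x) A"
        using A D k by (simp add: fgraph_iff)
      ultimately show "v \<in> fgraph (y D) (elt P D x) A O R A" by auto
    qed
  qed
  then show ?thesis
    using P Q R D c n L_FA[OF D(1) c(1,4)] unfolding point_def tarr_def by (simp add: Comp_Y pmap_fgraph)
qed

section \<open>Small colimits of small presheaves\<close>

definition nat_cocone where
  "nat_cocone J P \<tau> W d \<longleftrightarrow> presheaf W \<and> (\<forall>i\<in>Ob J. natural (P i) W (d i)) \<and>
    (\<forall>i\<in>Ob J. \<forall>j\<in>Ob J. \<forall>u\<in>Hom J i j. \<forall>A\<in>Ob K. \<forall>t\<in>FO (P i) A. d j A (\<tau> i j u A t) = d i A t)"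

lemma nat_coconeD:
  assumes "nat_cocone J P \<tau> W d"
  shows "presheaf W" "i \<in> Ob J \<Longrightarrow> natural (P i) W (d i)"
    "\<lbrakk>i \<in> Ob J; j \<in> Ob J; u \<in> Hom J i j; A \<in> Ob K; t \<in> FO (P i) A\<rbrakk> \<Longrightarrow> d j A (\<tau> i j u A t) = d i A t"
  using assms by (simp_all add: nat_cocone_def)

text \<open>
  The colimit is the image of the diagram in the product of the vertices of all cocones; the image
  is small although the product need not be.
\<close>

lemma presheaf_colimit:
  fixes J :: "('u, 'u) cat"
  assumes J: "small U (Ob J)" and P: "\<And>i. i \<in> Ob J \<Longrightarrow> presheaf (P i)"
    and \<tau>: "\<And>i j u. \<lbrakk>i \<in> Ob J; j \<in> Ob J; u \<in> Hom J i j\<rbrakk> \<Longrightarrow> natural (P i) (P j) (\<tau> i j u)"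
  obtains V \<gamma> where "nat_cocone J P \<tau> V \<gamma>"
    "\<And>A v. \<lbrakk>A \<in> Ob K; v \<in> FO V A\<rbrakk> \<Longrightarrow> \<exists>i\<in>Ob J. \<exists>t\<in>FO (P i) A. v = \<gamma> i A t"
    "\<And>W d. nat_cocone J P \<tau> W d \<Longrightarrow>
       \<exists>h. natural V W h \<and> (\<forall>i\<in>Ob J. \<forall>A\<in>Ob K. \<forall>t\<in>FO (P i) A. h A (\<gamma> i A t) = d i A t)"
proof -
  \<comment> \<open>The tuple of images of \<open>t\<close> under all cocones \<open>(W, d)\<close>; it is constant at other pairs.\<close>
  define \<kappa> where "\<kappa> A i t = (\<lambda>(W, d). if nat_cocone J P \<tau> W d then d i A t else undefined)"
    for A i t and W :: "('o, 'a, 'u) presheaf" and d :: "'u \<Rightarrow> 'o \<Rightarrow> 'u \<Rightarrow> 'u"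
  define V0 where "V0 A = (\<lambda>(i, t). \<kappa> A i t) ` Sigma (Ob J) (\<lambda>i. FO (P i) A)" for A
  define V1 where "V1 A B k \<phi> = (\<lambda>(W, d). if nat_cocone J P \<tau> W d then FA W A B k (\<phi> (W, d)) else undefined)"
    for A B k and \<phi> :: "('o, 'a, 'u) presheaf \<times> ('u \<Rightarrow> 'o \<Rightarrow> 'u \<Rightarrow> 'u) \<Rightarrow> 'u"
  have \<kappa>_in: "\<kappa> A i t \<in> V0 A" if "i \<in> Ob J" "t \<in> FO (P i) A" for A i t
    using that by (auto simp: V0_def)
  have V0E: "\<exists>i\<in>Ob J. \<exists>t\<in>FO (P i) A. x = \<kappa> A i t" if "x \<in> V0 A" for A x
    using that by (auto simp: V0_def)
  have d_act: "d i B (FA (P i) A B k t) = FA W A B k (d i A t)"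
    if "nat_cocone J P \<tau> W d" "i \<in> Ob J" "A \<in> Ob K" "B \<in> Ob K" "is_total K B A k" "t \<in> FO (P i) A" for W d i A B k t
    using naturalD(3)[OF nat_coconeD(2)[OF that(1,2)] that(3) P[OF that(2)] that(4-6)] .
  have V1_\<kappa>: "V1 A B k (\<kappa> A i t) = \<kappa> B i (FA (P i) A B k t)"
    if "A \<in> Ob K" "B \<in> Ob K" "is_total K B A k" "i \<in> Ob J" "t \<in> FO (P i) A" for A B k i t
    using that by (simp add: V1_def \<kappa>_def fun_eq_iff d_act)
  have V: "action V0 V1"
  proof (rule actionI)
    fix A assume A: "A \<in> Ob K"
    show "small U (V0 A)"
      unfolding V0_def using A by (intro small_image small_Sigma[OF universe J] presheafD(1)[OF P])
    fix x assume "x \<in> V0 A"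
    then obtain i t where x: "i \<in> Ob J" "t \<in> FO (P i) A" "x = \<kappa> A i t" using V0E by blast
    show "V1 A A (Idt K A) x = x"
      using A x by (simp add: V1_\<kappa> presheafD(4)[OF P])
    fix B k assume B: "B \<in> Ob K" "is_total K B A k"
    have t: "FA (P i) A B k t \<in> FO (P i) B" using A B x by (simp add: presheafD(3)[OF P])
    then show "V1 A B k x \<in> V0 B" using A B x by (simp add: V1_\<kappa> \<kappa>_in)
    fix D l assume "D \<in> Ob K" "is_total K D B l"
    then show "V1 A D (Comp K D B A k l) x = V1 B D l (V1 A B k x)"
      using A B x t by (simp add: V1_\<kappa> total_Comp presheafD(5)[OF P])
  qed
  let ?V = "encode V0 V1"
  have pV: "presheaf ?V" by (rule presheaf_encode[OF V])
  define \<gamma> where "\<gamma> i = mk_nat (P i) (\<lambda>A t. encoding V0 A (\<kappa> A i t))" for i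
  have \<gamma>: "natural (P i) ?V (\<gamma> i)" if i: "i \<in> Ob J" for i
    unfolding \<gamma>_def
    by (rule natural_mk_nat[OF P[OF i]])
      (use i in \<open>simp_all add: encode_sel[OF V] \<kappa>_in V1_\<kappa>\<close>)
  have cover: "\<exists>i\<in>Ob J. \<exists>t\<in>FO (P i) A. v = \<gamma> i A t" if A: "A \<in> Ob K" "v \<in> FO ?V A" for A v
  proof -
    obtain x where x: "x \<in> V0 A" "v = encoding V0 A x"
      using A by (auto simp: encode_sel(1)[OF V A(1)])
    obtain i t where "i \<in> Ob J" "t \<in> FO (P i) A" "x = \<kappa> A i t" using V0E[OF x(1)] by blast
    then show ?thesis using x(2) A(1) by (auto simp: \<gamma>_def)
  qed
  have coc: "nat_cocone J P \<tau> ?V \<gamma>"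
    unfolding nat_cocone_def
  proof (intro conjI ballI pV \<gamma>)
    fix i j u A t assume *: "i \<in> Ob J" "j \<in> Ob J" "u \<in> Hom J i j" "A \<in> Ob K" "t \<in> FO (P i) A"
    have "\<kappa> A j (\<tau> i j u A t) = \<kappa> A i t"
      using * by (auto simp: \<kappa>_def fun_eq_iff nat_coconeD(3))
    then show "\<gamma> j A (\<tau> i j u A t) = \<gamma> i A t"
      using * naturalD(2)[OF \<tau>] by (simp add: \<gamma>_def)
  qed
  have univ: "\<exists>h. natural ?V W h \<and> (\<forall>i\<in>Ob J. \<forall>A\<in>Ob K. \<forall>t\<in>FO (P i) A. h A (\<gamma> i A t) = d i A t)"
    if d: "nat_cocone J P \<tau> W d" for W d
  proof -
    define h where "h A v = inv_into (V0 A) (encoding V0 A) v (W, d)" for A v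
    have h: "h A (\<gamma> i A t) = d i A t" if "i \<in> Ob J" "A \<in> Ob K" "t \<in> FO (P i) A" for i A t
      using that d encoding_inj[OF V that(2)] by (simp add: h_def \<gamma>_def \<kappa>_in) (simp add: \<kappa>_def)
    have "natural ?V W (mk_nat ?V h)"
    proof (rule natural_mk_nat[OF pV])
      fix A v assume A: "A \<in> Ob K" "v \<in> FO ?V A"
      obtain i t where v: "i \<in> Ob J" "t \<in> FO (P i) A" "v = \<gamma> i A t" using cover[OF A] by blast
      show "h A v \<in> FO W A"
        using v A by (simp add: h naturalD(2)[OF nat_coconeD(2)[OF d]])
      fix B k assume B: "B \<in> Ob K" "is_total K B A k"
      have "FA ?V A B k v = \<gamma> i B (FA (P i) A B k t)"
        using v A B by (simp add: naturalD(3)[OF \<gamma> _ P])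
      then show "h B (FA ?V A B k v) = FA W A B k (h A v)"
        using v A B by (simp add: h presheafD(3)[OF P] d_act[OF d])
    qed
    moreover have "\<gamma> i A t \<in> FO ?V A" if "i \<in> Ob J" "A \<in> Ob K" "t \<in> FO (P i) A" for i A t
      using that by (rule naturalD(2)[OF \<gamma>])
    ultimately show ?thesis using h by (intro exI[of _ "mk_nat ?V h"]) simp
  qed
  show thesis by (rule that[OF coc cover univ])
qed

text \<open>
  Smallness of \<open>P\<close> amounts to a small set \<open>S\<close> of objects that generates \<open>P\<close> and on which
  transformations out of \<open>P\<close> may be defined. Unlike a presentation, this condition is visibly
  stable under enlarging \<open>S\<close> and under small colimits.
\<close>

definition generated where
  "generated S P \<longleftrightarrow> (\<forall>A\<in>Ob K. \<forall>x\<in>FO P A. \<exists>B\<in>S. \<exists>z\<in>FO P B. \<exists>k. is_total K A B k \<and> x = FA P B A k z)"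

definition natural_on where
  "natural_on S P G \<tau> \<longleftrightarrow> (\<forall>B\<in>S. \<forall>z\<in>FO P B. \<tau> B z \<in> FO G B) \<and>
    (\<forall>B\<in>S. \<forall>A\<in>S. \<forall>k z. is_total K A B k \<longrightarrow> z \<in> FO P B \<longrightarrow> \<tau> A (FA P B A k z) = FA G B A k (\<tau> B z))"

definition extends where
  "extends S P \<longleftrightarrow> (\<forall>G \<tau>. presheaf G \<longrightarrow> natural_on S P G \<tau> \<longrightarrow>
     (\<exists>\<sigma>. natural P G \<sigma> \<and> (\<forall>B\<in>S. \<forall>z\<in>FO P B. \<sigma> B z = \<tau> B z)))"

lemma presents_determined:
  assumes p: "presents P J T p" and S: "S \<subseteq> Ob K" "\<And>i. i \<in> Ob J \<Longrightarrow> FO T i \<in> S"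
  shows "generated S P" "extends S P"
proof -
  note D = presentsD[OF p]
  show "generated S P"
    unfolding generated_def
  proof (intro ballI)
    fix A x assume "A \<in> Ob K" "x \<in> FO P A"
    then obtain i k where "i \<in> Ob J" "is_total K A (FO T i) k" "x = FA P (FO T i) A k (p i)"
      by (rule presents_gen[OF p])
    then show "\<exists>B\<in>S. \<exists>z\<in>FO P B. \<exists>k. is_total K A B k \<and> x = FA P B A k z"
      using S(2) D(6) by blast
  qed
  show "extends S P"
    unfolding extends_def
  proof (intro allI impI)
    fix G \<tau> assume G: "presheaf G" and \<tau>: "natural_on S P G \<tau>"
    have \<tau>0: "\<tau> B z \<in> FO G B" if "B \<in> S" "z \<in> FO P B" for B z
      using \<tau> that unfolding natural_on_def by blast
    have \<tau>1: "\<tau> A (FA P B A k z) = FA G B A k (\<tau> B z)" if "B \<in> S" "A \<in> S" "is_total K A B k" "z \<in> FO P B" for A B k z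
      using \<tau> that unfolding natural_on_def by blast
    have "compatible J T (FO G) (FA G) (\<lambda>i. \<tau> (FO T i) (p i))"
      unfolding compatible_def
    proof (intro conjI ballI)
      fix i j u assume *: "i \<in> Ob J" "j \<in> Ob J" "u \<in> Hom J i j"
      show "FA G (FO T j) (FO T i) (FA T i j u) (\<tau> (FO T j) (p j)) = \<tau> (FO T i) (p i)"
        using * \<tau>1[OF S(2) S(2) D(7)[OF *] D(6)] D(8)[OF *] by simp
    qed (use \<tau>0 S D in blast)
    note comp = this
    obtain h where h: "\<And>D x. \<lbrakk>D \<in> Ob K; x \<in> FO P D\<rbrakk> \<Longrightarrow> h D x \<in> FO G D"
      "\<And>A B k x. \<lbrakk>A \<in> Ob K; B \<in> Ob K; is_total K B A k; x \<in> FO P A\<rbrakk> \<Longrightarrow> h B (FA P A B k x) = FA G A B k (h A x)"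
      "\<And>i. i \<in> Ob J \<Longrightarrow> h (FO T i) (p i) = \<tau> (FO T i) (p i)"
      "\<And>i D k. \<lbrakk>i \<in> Ob J; D \<in> Ob K; is_total K D (FO T i) k\<rbrakk> \<Longrightarrow>
        h D (FA P (FO T i) D k (p i)) = FA G (FO T i) D k (\<tau> (FO T i) (p i))"
      by (rule presents_extend[OF p action_presheaf[OF G] comp]) (rule that)
    have "natural P G (mk_nat P h)" by (rule natural_mk_nat[OF D(3)]) (simp_all add: h)
    moreover have "mk_nat P h B z = \<tau> B z" if B: "B \<in> S" "z \<in> FO P B" for B z
    proof -
      have BK: "B \<in> Ob K" using B S by blast
      obtain i k where "i \<in> Ob J" "is_total K B (FO T i) k" "z = FA P (FO T i) B k (p i)"
        using presents_gen[OF p BK B(2)] .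
      then show ?thesis using B BK h(4) \<tau>1[OF S(2) B(1) _ D(6)] by simp
    qed
    ultimately show "\<exists>\<sigma>. natural P G \<sigma> \<and> (\<forall>B\<in>S. \<forall>z\<in>FO P B. \<sigma> B z = \<tau> B z)" by blast
  qed
qed

text \<open>
  The diagram is the category of elements of \<open>P\<close> over \<open>S\<close>; it is small, and its objects and
  arrows are coded in \<open>'u\<close>.
\<close>

lemma determined_small_presheaf:
  assumes P: "presheaf P" and S: "S \<subseteq> Ob K" "small U S" and gen: "generated S P" and ext: "extends S P"
  shows "small_presheaf U C P"
proof -
  have "small U (Sigma S (FO P))"
    using S by (intro small_Sigma[OF universe]) (auto intro!: presheafD(1)[OF P])
  from small_inj_ex[OF this] obtain f :: "'o \<times> 'u \<Rightarrow> 'u" where f: "inj_on f (Sigma S (FO P))" by blast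
  define g where "g = inv_into (Sigma S (FO P)) f"
  define b where "b i = fst (g i)" for i
  define z where "z i = snd (g i)" for i
  define obs where "obs = f ` Sigma S (FO P)"
  define H where "H i j = code (b i) (b j) ` {k. is_total K (b i) (b j) k \<and> FA P (b j) (b i) k (z j) = z i}" for i j
  let ?d = "\<lambda>i j. dec U C (b i) (b j)"
  define J where "J = \<lparr>Ob = obs, Hom = H, Comp = (\<lambda>i j l v u. code (b i) (b l) (Comp K (b i) (b j) (b l) (?d j l v) (?d i j u))),
      Idt = (\<lambda>i. code (b i) (b i) (Idt K (b i)))\<rparr>"
  have J_sel [simp]: "Ob J = obs" "Hom J = H"
    "Comp J i j l v u = code (b i) (b l) (Comp K (b i) (b j) (b l) (?d j l v) (?d i j u))"
    "Idt J i = code (b i) (b i) (Idt K (b i))" for i j l v u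
    by (simp_all add: J_def)
  have bz: "b i \<in> S" "z i \<in> FO P (b i)" if "i \<in> obs" for i
    using inv_into_into[of i f "Sigma S (FO P)"] that by (auto simp: obs_def b_def z_def g_def)
  have bK [simp]: "b i \<in> Ob K" if "i \<in> obs" for i using bz S that by blast
  have f_in: "f (B, v) \<in> obs" "b (f (B, v)) = B" "z (f (B, v)) = v" if "B \<in> S" "v \<in> FO P B" for B v
    using that f by (auto simp: obs_def b_def z_def g_def)
  have HE: "\<exists>k. u = code (b i) (b j) k \<and> is_total K (b i) (b j) k \<and> FA P (b j) (b i) k (z j) = z i \<and> ?d i j u = k"
    if "u \<in> H i j" "i \<in> obs" "j \<in> obs" for i j u
    using that by (auto simp: H_def)
  have cat: "category J"
  proof (unfold_locales, goal_cases)
    case (1 i)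
    then show ?case by (auto simp: H_def presheafD(4)[OF P] bz)
  next
    case (2 i j l u v)
    then have obs: "i \<in> obs" "j \<in> obs" "l \<in> obs" by simp_all
    obtain k where k: "is_total K (b i) (b j) k" "FA P (b j) (b i) k (z j) = z i" "?d i j u = k"
      using HE[of u i j] 2 by auto
    obtain k' where k': "is_total K (b j) (b l) k'" "FA P (b l) (b j) k' (z l) = z j" "?d j l v = k'"
      using HE[of v j l] 2 by auto
    have "FA P (b l) (b i) (Comp K (b i) (b j) (b l) k' k) (z l) = z i"
      using k k' obs by (simp add: presheafD(5)[OF P] bz)
    then show ?case using k k' obs by (auto simp: H_def total_Comp)
  next
    case (3 i j u)
    then obtain k where "u = code (b i) (b j) k" "is_total K (b i) (b j) k" "?d i j u = k"
      using HE[of u i j] by auto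
    then show ?case using 3 by (simp add: is_total_Hom)
  next
    case (4 i j u)
    then obtain k where "u = code (b i) (b j) k" "is_total K (b i) (b j) k" "?d i j u = k"
      using HE[of u i j] by auto
    then show ?case using 4 by (simp add: is_total_Hom)
  next
    case (5 i j l n u v w)
    then have obs: "i \<in> obs" "j \<in> obs" "l \<in> obs" "n \<in> obs" by simp_all
    obtain k where k: "is_total K (b i) (b j) k" "?d i j u = k" using HE[of u i j] 5 by auto
    obtain k' where k': "is_total K (b j) (b l) k'" "?d j l v = k'" using HE[of v j l] 5 by auto
    obtain k'' where k'': "is_total K (b l) (b n) k''" "?d l n w = k''" using HE[of w l n] 5 by auto
    show ?case using obs k k' k'' by (simp add: total_Comp Comp_assoc is_total_Hom)
  qed
  have smallO: "small U obs"
    unfolding obs_def by (rule small_image) fact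
  have smallH: "small U (H i j)" if "i \<in> obs" "j \<in> obs" for i j
    unfolding H_def using that by (intro small_image small_subset[OF small_total[of "b i" "b j"]]) auto
  have smJ: "small_category U J"
    using cat smallO smallH by (simp add: small_category_def locally_small_def)
  define T where "T = mk_ftor J b ?d"
  have T: "is_functor J C T"
    unfolding T_def
  proof (rule is_functor_mk_ftor[OF cat], goal_cases)
    case (2 i j u)
    then show ?case using HE[of u i j] by auto
  next
    case (4 i j l u v)
    then have obs: "i \<in> obs" "j \<in> obs" "l \<in> obs" by simp_all
    obtain k where k: "is_total K (b i) (b j) k" "?d i j u = k" using HE[of u i j] 4 by auto
    obtain k' where k': "is_total K (b j) (b l) k'" "?d j l v = k'" using HE[of v j l] 4 by auto
    show ?case using obs k k' by (simp add: total_Comp)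
  qed simp_all
  have T_sel [simp]: "FO T i = b i" if "i \<in> obs" for i using that by (simp add: T_def)
  have T_code: "FA T i j u = ?d i j u" if "i \<in> obs" "j \<in> obs" "u \<in> H i j" for i j u
    using that by (simp add: T_def)
  have "presents P J T z"
    unfolding presents_def
  proof (intro conjI allI impI ballI smJ T P)
    show "compatible J T (FO P) (FA P) z"
      unfolding compatible_def
    proof (intro conjI ballI)
      fix i j u assume *: "i \<in> Ob J" "j \<in> Ob J" "u \<in> Hom J i j"
      then show "FA P (FO T j) (FO T i) (FA T i j u) (z j) = z i"
        using HE[of u i j] by (auto simp: T_code)
    qed (simp add: bz)
  next
    fix D x assume D: "D \<in> Ob K" "x \<in> FO P D"
    then obtain B v k where "B \<in> S" "v \<in> FO P B" "is_total K D B k" "x = FA P B D k v"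
      using gen unfolding generated_def by blast
    then show "\<exists>i\<in>Ob J. \<exists>k. is_total K D (FO T i) k \<and> x = FA P (FO T i) D k (z i)"
      using f_in[of B v] by (intro bexI[of _ "f (B, v)"] exI[of _ k]) simp_all
  next
    fix G h i j D k k'
    assume G: "presheaf G" and h: "compatible J T (FO G) (FA G) h"
      and ij: "i \<in> Ob J" "j \<in> Ob J" "D \<in> Ob K" "is_total K D (FO T i) k" "is_total K D (FO T j) k'"
      and eq: "FA P (FO T i) D k (z i) = FA P (FO T j) D k' (z j)"
    have h0: "h i \<in> FO G (b i)" if "i \<in> obs" for i
      using h that by (simp add: compatible_def)
    have h1: "FA G (b j) (b i) (?d i j u) (h j) = h i" if "i \<in> obs" "j \<in> obs" "u \<in> H i j" for i j u
    proof -
      have "FA G (b j) (b i) (FA T i j u) (h j) = h i"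
        using h that by (simp add: compatible_def)
      then show ?thesis by (simp add: T_code[OF that])
    qed
    have "natural_on S P G (\<lambda>B v. h (f (B, v)))"
      unfolding natural_on_def
    proof (intro conjI ballI allI impI)
      fix B v assume B: "B \<in> S" "v \<in> FO P B"
      then show "h (f (B, v)) \<in> FO G B" using h0[of "f (B, v)"] f_in by simp
    next
      fix B A k v assume *: "B \<in> S" "A \<in> S" "is_total K A B k" "v \<in> FO P B"
      have AB: "A \<in> Ob K" "B \<in> Ob K" using * S by blast+
      have v': "FA P B A k v \<in> FO P A" using * AB by (simp add: presheafD(3)[OF P])
      let ?i = "f (A, FA P B A k v)" and ?j = "f (B, v)"
      have "code A B k \<in> H ?i ?j" using * v' f_in by (auto simp: H_def)
      then show "h ?i = FA G B A k (h ?j)"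
        using h1[of ?i ?j "code A B k"] * v' f_in AB by simp
    qed
    then obtain \<sigma> where \<sigma>: "natural P G \<sigma>" "\<And>B v. \<lbrakk>B \<in> S; v \<in> FO P B\<rbrakk> \<Longrightarrow> \<sigma> B v = h (f (B, v))"
      using ext G unfolding extends_def by blast
    have \<sigma>z: "\<sigma> D (FA P (b i) D k (z i)) = FA G (b i) D k (h i)" if "i \<in> obs" "is_total K D (b i) k" for i k
    proof -
      have "f (b i, z i) = i"
        using that f_inv_into_f[of i f "Sigma S (FO P)"] by (simp add: obs_def b_def z_def g_def)
      then show ?thesis
        using that ij(3) bz[OF that(1)] \<sigma>(2)[of "b i" "z i"] by (simp add: naturalD(3)[OF \<sigma>(1) _ P])
    qed
    show "FA G (FO T i) D k (h i) = FA G (FO T j) D k' (h j)"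
      using \<sigma>z[of i k] \<sigma>z[of j k'] ij eq by simp
  qed
  then show ?thesis by (rule presents_small_presheaf)
qed

lemma natural_generated_eqI:
  assumes "presheaf P" "natural P G \<sigma>" "natural P G \<sigma>'" "generated S P" "S \<subseteq> Ob K"
    and "\<And>B z. \<lbrakk>B \<in> S; z \<in> FO P B\<rbrakk> \<Longrightarrow> \<sigma> B z = \<sigma>' B z"
  shows "\<sigma> = \<sigma>'"
proof (rule natural_eqI[OF assms(2,3)])
  fix A x assume A: "A \<in> Ob K" "x \<in> FO P A"
  then obtain B z k where *: "B \<in> S" "z \<in> FO P B" "is_total K A B k" "x = FA P B A k z"
    using assms(4) unfolding generated_def by blast
  moreover have "B \<in> Ob K" using * assms(5) by blast
  ultimately show "\<sigma> A x = \<sigma>' A x"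
    using A assms(1,6) by (simp add: naturalD(3)[OF assms(2)] naturalD(3)[OF assms(3)])
qed

text \<open>
  The generating sets of the \<open>P i\<close> are joined into one set \<open>S\<close>. A transformation given on the
  restriction of the colimit to \<open>S\<close> extends along each leg, and the extensions agree with the
  transition maps because \<open>S\<close> generates.
\<close>

lemma small_presheaf_colimit:
  fixes J :: "('u, 'u) cat"
  assumes J: "small U (Ob J)" and P: "\<And>i. i \<in> Ob J \<Longrightarrow> small_presheaf U C (P i)"
    and \<tau>: "\<And>i j u. \<lbrakk>i \<in> Ob J; j \<in> Ob J; u \<in> Hom J i j\<rbrakk> \<Longrightarrow> natural (P i) (P j) (\<tau> i j u)"
    and coc: "nat_cocone J P \<tau> V \<gamma>"
    and cover: "\<And>A v. \<lbrakk>A \<in> Ob K; v \<in> FO V A\<rbrakk> \<Longrightarrow> \<exists>i\<in>Ob J. \<exists>t\<in>FO (P i) A. v = \<gamma> i A t"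
    and univ: "\<And>W d. nat_cocone J P \<tau> W d \<Longrightarrow>
       \<exists>h. natural V W h \<and> (\<forall>i\<in>Ob J. \<forall>A\<in>Ob K. \<forall>t\<in>FO (P i) A. h A (\<gamma> i A t) = d i A t)"
  shows "small_presheaf U C V"
proof -
  have pP: "presheaf (P i)" if "i \<in> Ob J" for i using P[OF that] by (rule small_presheaf_presheaf)
  note V = nat_coconeD[OF coc]
  have "\<exists>S. S \<subseteq> Ob K \<and> small U S \<and> (\<forall>S'. S \<subseteq> S' \<longrightarrow> S' \<subseteq> Ob K \<longrightarrow> generated S' (P i) \<and> extends S' (P i))"
    if i: "i \<in> Ob J" for i
  proof -
    obtain J' T p where p: "presents (P i) J' T p" using small_presheaf_presents[OF P[OF i]] .
    note D = presentsD[OF p]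
    have "small U (FO T ` Ob J')" using D(1) by (auto simp: small_category_def intro: small_image)
    moreover have "FO T ` Ob J' \<subseteq> Ob K" using D(5) by auto
    moreover have "generated S' (P i) \<and> extends S' (P i)" if "FO T ` Ob J' \<subseteq> S'" "S' \<subseteq> Ob K" for S'
      using presents_determined[OF p that(2)] that(1) by blast
    ultimately show ?thesis by blast
  qed
  then obtain S where S: "\<And>i. i \<in> Ob J \<Longrightarrow> S i \<subseteq> Ob K \<and> small U (S i) \<and>
      (\<forall>S'. S i \<subseteq> S' \<longrightarrow> S' \<subseteq> Ob K \<longrightarrow> generated S' (P i) \<and> extends S' (P i))" by metis
  define S' where "S' = (\<Union>i\<in>Ob J. S i)"
  have S': "S' \<subseteq> Ob K" "small U S'"
    using S by (auto simp: S'_def intro!: small_UN[OF universe J])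
  have gen: "generated S' (P i)" and ext: "extends S' (P i)" if "i \<in> Ob J" for i
    using S[OF that] S'(1) that unfolding S'_def by blast+
  have "generated S' V"
    unfolding generated_def
  proof (intro ballI)
    fix A v assume A: "A \<in> Ob K" "v \<in> FO V A"
    obtain i t where i: "i \<in> Ob J" "t \<in> FO (P i) A" "v = \<gamma> i A t" using cover[OF A] by blast
    obtain B z k where B: "B \<in> S'" "z \<in> FO (P i) B" "is_total K A B k" "t = FA (P i) B A k z"
      using gen[OF i(1)] A(1) i(2) unfolding generated_def by blast
    have BK: "B \<in> Ob K" using B S' by blast
    have "v = FA V B A k (\<gamma> i B z)"
      using naturalD(3)[OF V(2)[OF i(1)] BK pP[OF i(1)] A(1) B(3,2)] i B by simp
    moreover have "\<gamma> i B z \<in> FO V B" using naturalD(2)[OF V(2)[OF i(1)] BK B(2)] .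
    ultimately show "\<exists>B\<in>S'. \<exists>z\<in>FO V B. \<exists>k. is_total K A B k \<and> v = FA V B A k z"
      using B by blast
  qed
  moreover have "extends S' V"
    unfolding extends_def
  proof (intro allI impI)
    fix G \<rho> assume G: "presheaf G" and \<rho>: "natural_on S' V G \<rho>"
    have \<rho>0: "\<rho> B z \<in> FO G B" if "B \<in> S'" "z \<in> FO V B" for B z
      using \<rho> that unfolding natural_on_def by blast
    have \<rho>1: "\<rho> A (FA V B A k z) = FA G B A k (\<rho> B z)"
      if "B \<in> S'" "A \<in> S'" "is_total K A B k" "z \<in> FO V B" for A B k z
      using \<rho> that unfolding natural_on_def by blast
    have "\<exists>\<sigma>. natural (P i) G \<sigma> \<and> (\<forall>B\<in>S'. \<forall>z\<in>FO (P i) B. \<sigma> B z = \<rho> B (\<gamma> i B z))" if i: "i \<in> Ob J" for i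
    proof -
      have "natural_on S' (P i) G (\<lambda>B z. \<rho> B (\<gamma> i B z))"
        unfolding natural_on_def
      proof (intro conjI ballI allI impI)
        fix B z assume "B \<in> S'" "z \<in> FO (P i) B"
        then show "\<rho> B (\<gamma> i B z) \<in> FO G B" using \<rho>0 naturalD(2)[OF V(2)[OF i]] S' by blast
      next
        fix B A k z assume *: "B \<in> S'" "A \<in> S'" "is_total K A B k" "z \<in> FO (P i) B"
        have AB: "A \<in> Ob K" "B \<in> Ob K" using * S' by blast+
        show "\<rho> A (\<gamma> i A (FA (P i) B A k z)) = FA G B A k (\<rho> B (\<gamma> i B z))"
          using naturalD(3)[OF V(2)[OF i] AB(2) pP[OF i] AB(1) *(3,4)]
            \<rho>1[OF *(1,2,3) naturalD(2)[OF V(2)[OF i] AB(2) *(4)]] by simp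
      qed
      then show ?thesis using ext[OF i] G unfolding extends_def by blast
    qed
    then obtain \<sigma> where \<sigma>: "\<And>i. i \<in> Ob J \<Longrightarrow> natural (P i) G (\<sigma> i)"
      and \<sigma>S: "\<And>i B z. \<lbrakk>i \<in> Ob J; B \<in> S'; z \<in> FO (P i) B\<rbrakk> \<Longrightarrow> \<sigma> i B z = \<rho> B (\<gamma> i B z)" by metis
    have "nat_cocone J P \<tau> G \<sigma>"
      unfolding nat_cocone_def
    proof (intro conjI ballI G \<sigma>)
      fix i j u A t assume *: "i \<in> Ob J" "j \<in> Ob J" "u \<in> Hom J i j" "A \<in> Ob K" "t \<in> FO (P i) A"
      have n: "natural (P i) G (Comp (Psh U C) (P i) (P j) G (\<sigma> j) (\<tau> i j u))"
        using * by (intro natural_Comp \<tau> \<sigma> pP)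
      have "Comp (Psh U C) (P i) (P j) G (\<sigma> j) (\<tau> i j u) = \<sigma> i"
      proof (rule natural_generated_eqI[OF pP[OF *(1)] n \<sigma>[OF *(1)] gen[OF *(1)] S'(1)])
        fix B z assume B: "B \<in> S'" "z \<in> FO (P i) B"
        have BK: "B \<in> Ob K" using B S' by blast
        show "Comp (Psh U C) (P i) (P j) G (\<sigma> j) (\<tau> i j u) B z = \<sigma> i B z"
          using B BK * \<sigma>S[OF *(2) B(1) naturalD(2)[OF \<tau>[OF *(1-3)] BK B(2)]] \<sigma>S[OF *(1) B] V(3)[OF *(1-3) BK B(2)]
          by simp
      qed
      from fun_cong[OF fun_cong[OF this], of A t] show "\<sigma> j A (\<tau> i j u A t) = \<sigma> i A t" using * by simp
    qed
    then obtain h where h: "natural V G h" "\<And>i A t. \<lbrakk>i \<in> Ob J; A \<in> Ob K; t \<in> FO (P i) A\<rbrakk> \<Longrightarrow> h A (\<gamma> i A t) = \<sigma> i A t"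
      using univ by blast
    have "h B z = \<rho> B z" if B: "B \<in> S'" "z \<in> FO V B" for B z
    proof -
      have BK: "B \<in> Ob K" using B S' by blast
      obtain i t where "i \<in> Ob J" "t \<in> FO (P i) B" "z = \<gamma> i B t" using cover[OF BK B(2)] by blast
      then show ?thesis using h(2) \<sigma>S B BK by simp
    qed
    then show "\<exists>\<sigma>. natural V G \<sigma> \<and> (\<forall>B\<in>S'. \<forall>z\<in>FO V B. \<sigma> B z = \<rho> B z)" using h(1) by blast
  qed
  ultimately show ?thesis by (rule determined_small_presheaf[OF V(1) S'])
qed

text \<open>
  Colimits in \<open>Total Y\<close> only test against small presheaves; comparison with the colimit among all
  presheaves, which is small, extends the universal property to all of them.
\<close>

lemma colimit_Total_Y:
  assumes J: "small_category U J" and T: "is_functor J (Total Y) T" and c: "is_colimit J (Total Y) T V c"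
  obtains \<tau> \<gamma> where
    "\<And>i j u. \<lbrakk>i \<in> Ob J; j \<in> Ob J; u \<in> Hom J i j\<rbrakk> \<Longrightarrow>
      natural (FO T i) (FO T j) (\<tau> i j u) \<and> FA T i j u = tarr (FO T i) (FO T j) (\<tau> i j u)"
    "\<And>i. i \<in> Ob J \<Longrightarrow> natural (FO T i) V (\<gamma> i) \<and> c i = tarr (FO T i) V (\<gamma> i)"
    "\<And>A v. \<lbrakk>A \<in> Ob K; v \<in> FO V A\<rbrakk> \<Longrightarrow> \<exists>i\<in>Ob J. \<exists>t\<in>FO (FO T i) A. v = \<gamma> i A t"
    "\<And>W d. nat_cocone J (FO T) \<tau> W d \<Longrightarrow>
       \<exists>h. natural V W h \<and> (\<forall>i\<in>Ob J. \<forall>A\<in>Ob K. \<forall>t\<in>FO (FO T i) A. h A (\<gamma> i A t) = d i A t)"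
proof -
  have T0: "small_presheaf U C (FO T i)" if "i \<in> Ob J" for i
    using is_functorD(1)[OF T that] by simp
  have cc: "is_cocone J (Total Y) T V c" using c by (simp add: is_colimit_def)
  have V: "small_presheaf U C V" using cc by (simp add: is_cocone_def)
  have pT: "presheaf (FO T i)" if "i \<in> Ob J" for i using T0[OF that] by (rule small_presheaf_presheaf)
  have pV: "presheaf V" using V by (rule small_presheaf_presheaf)
  have "\<exists>\<alpha>. natural (FO T i) (FO T j) \<alpha> \<and> FA T i j u = tarr (FO T i) (FO T j) \<alpha>"
    if "i \<in> Ob J" "j \<in> Ob J" "u \<in> Hom J i j" for i j u
  proof -
    have "is_total Y (FO T i) (FO T j) (FA T i j u)" using is_functorD(2)[OF T that] by simp
    then show ?thesis by (rule total_YE[OF _ T0[OF that(1)] T0[OF that(2)]]) blast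
  qed
  then obtain \<tau> where \<tau>: "\<And>i j u. \<lbrakk>i \<in> Ob J; j \<in> Ob J; u \<in> Hom J i j\<rbrakk> \<Longrightarrow>
      natural (FO T i) (FO T j) (\<tau> i j u) \<and> FA T i j u = tarr (FO T i) (FO T j) (\<tau> i j u)" by metis
  have "\<exists>\<alpha>. natural (FO T i) V \<alpha> \<and> c i = tarr (FO T i) V \<alpha>" if "i \<in> Ob J" for i
  proof -
    have "is_total Y (FO T i) V (c i)" using cc that by (simp add: is_cocone_def)
    then show ?thesis by (rule total_YE[OF _ T0[OF that] V]) blast
  qed
  then obtain \<gamma> where \<gamma>: "\<And>i. i \<in> Ob J \<Longrightarrow> natural (FO T i) V (\<gamma> i) \<and> c i = tarr (FO T i) V (\<gamma> i)" by metis
  have smJ: "small U (Ob J)" and catJ: "category J" using J by (simp_all add: small_category_def)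
  have \<tau>n: "natural (FO T i) (FO T j) (\<tau> i j u)" if "i \<in> Ob J" "j \<in> Ob J" "u \<in> Hom J i j" for i j u
    using \<tau>[OF that] by blast
  obtain V' \<gamma>' where coc: "nat_cocone J (FO T) \<tau> V' \<gamma>'"
    and cover: "\<And>A v. \<lbrakk>A \<in> Ob K; v \<in> FO V' A\<rbrakk> \<Longrightarrow> \<exists>i\<in>Ob J. \<exists>t\<in>FO (FO T i) A. v = \<gamma>' i A t"
    and univ: "\<And>W d. nat_cocone J (FO T) \<tau> W d \<Longrightarrow>
       \<exists>h. natural V' W h \<and> (\<forall>i\<in>Ob J. \<forall>A\<in>Ob K. \<forall>t\<in>FO (FO T i) A. h A (\<gamma>' i A t) = d i A t)"
    using presheaf_colimit[of J "FO T" \<tau>, OF smJ pT \<tau>n] by blast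
  note V' = nat_coconeD[OF coc]
  have sV': "small_presheaf U C V'"
    by (rule small_presheaf_colimit[OF smJ T0 \<tau>n coc cover univ])
  have cocV: "nat_cocone J (FO T) \<tau> V \<gamma>"
    unfolding nat_cocone_def
  proof (intro conjI ballI pV)
    show "natural (FO T i) V (\<gamma> i)" if "i \<in> Ob J" for i using \<gamma>[OF that] by blast
    fix i j u A t assume *: "i \<in> Ob J" "j \<in> Ob J" "u \<in> Hom J i j" "A \<in> Ob K" "t \<in> FO (FO T i) A"
    have "Comp Y (FO T i) (FO T j) V (c j) (FA T i j u) = c i"
      using cc * by (simp add: is_cocone_def)
    then have "tarr (FO T i) V (Comp (Psh U C) (FO T i) (FO T j) V (\<gamma> j) (\<tau> i j u)) = tarr (FO T i) V (\<gamma> i)"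
      using * \<gamma> \<tau> T0 V by (simp add: tarr_Comp)
    then have "Comp (Psh U C) (FO T i) (FO T j) V (\<gamma> j) (\<tau> i j u) = \<gamma> i"
      using * \<gamma> \<tau> T0 pT by (intro tarr_inj[of "FO T i" V]) (auto intro: natural_Comp)
    from fun_cong[OF fun_cong[OF this], of A t] show "\<gamma> j A (\<tau> i j u A t) = \<gamma> i A t" using * by simp
  qed
  obtain g where g: "natural V' V g" and g\<gamma>: "\<And>i A t. \<lbrakk>i \<in> Ob J; A \<in> Ob K; t \<in> FO (FO T i) A\<rbrakk> \<Longrightarrow> g A (\<gamma>' i A t) = \<gamma> i A t"
    using univ[OF cocV] by blast
  have "is_cocone J (Total Y) T V' (\<lambda>i. tarr (FO T i) V' (\<gamma>' i))"
    unfolding is_cocone_def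
  proof (intro conjI ballI)
    show "V' \<in> Ob (Total Y)" using sV' by simp
    show "tarr (FO T i) V' (\<gamma>' i) \<in> Hom (Total Y) (FO T i) V'" if "i \<in> Ob J" for i
      using that tarr_total[OF T0 sV' V'(2)] by simp
    fix i j u assume *: "i \<in> Ob J" "j \<in> Ob J" "u \<in> Hom J i j"
    have "Comp (Psh U C) (FO T i) (FO T j) V' (\<gamma>' j) (\<tau> i j u) = \<gamma>' i"
      by (rule natural_eqI[OF natural_Comp[OF pT pT \<tau>n V'(2)] V'(2)]) (use * V'(3) in simp_all)
    then show "Comp (Total Y) (FO T i) (FO T j) V' (tarr (FO T j) V' (\<gamma>' j)) (FA T i j u) = tarr (FO T i) V' (\<gamma>' i)"
      using * \<tau> T0 sV' V'(2) by (simp add: tarr_Comp)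
  qed
  note coc' = this
  obtain h0 where h0: "h0 \<in> Hom (Total Y) V V'"
    and h0c: "\<And>i. i \<in> Ob J \<Longrightarrow> Comp (Total Y) (FO T i) V V' h0 (c i) = tarr (FO T i) V' (\<gamma>' i)"
    by (rule is_colimit_ex[OF c coc']) (rule that)
  have h0t: "is_total Y V V' h0" using h0 by simp
  obtain h where h: "natural V V' h" "h0 = tarr V V' h"
    by (rule total_YE[OF h0t V sV']) (rule that)
  have h\<gamma>: "h A (\<gamma> i A t) = \<gamma>' i A t" if *: "i \<in> Ob J" "A \<in> Ob K" "t \<in> FO (FO T i) A" for i A t
  proof -
    have "tarr (FO T i) V' (Comp (Psh U C) (FO T i) V V' h (\<gamma> i)) = tarr (FO T i) V' (\<gamma>' i)"
      using h0c[OF *(1)] h \<gamma>[OF *(1)] T0[OF *(1)] V sV' by (simp add: tarr_Comp)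
    then have "Comp (Psh U C) (FO T i) V V' h (\<gamma> i) = \<gamma>' i"
      using * \<gamma>[OF *(1)] h pT[OF *(1)] pV V'(2) T0 by (intro tarr_inj[of "FO T i" V']) (auto intro: natural_Comp)
    from fun_cong[OF fun_cong[OF this], of A t] show ?thesis using * by simp
  qed
  interpret Y: restriction_category Y by (rule restriction_category_Y)
  have "Comp Y V V' V (tarr V' V g) h0 = Idt Y V"
  proof (rule is_colimit_eqI[OF c catJ Y.category_Total T])
    show "V \<in> Ob (Total Y)" using V by simp
    show "Comp Y V V' V (tarr V' V g) h0 \<in> Hom (Total Y) V V"
      using Y.total_Comp[of V V' V h0 "tarr V' V g"] V sV' h0 tarr_total[OF sV' V g] by simp
    show "Idt Y V \<in> Hom (Total Y) V V" using V by simp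
    fix i assume i: "i \<in> Ob J"
    have ci: "c i \<in> Hom Y (FO T i) V" using cc i by (simp add: is_cocone_def is_total_Hom)
    have "Comp Y (FO T i) V V (Comp Y V V' V (tarr V' V g) h0) (c i)
      = Comp Y (FO T i) V' V (tarr V' V g) (Comp Y (FO T i) V V' h0 (c i))"
      using i T0 V sV' ci h0 tarr_total[OF sV' V g] by (intro Y.Comp_assoc[symmetric]) (simp_all add: is_total_Hom)
    also have "\<dots> = tarr (FO T i) V (Comp (Psh U C) (FO T i) V' V g (\<gamma>' i))"
      using h0c[OF i] T0[OF i] V sV' g V'(2)[OF i] by (simp add: tarr_Comp)
    also have "Comp (Psh U C) (FO T i) V' V g (\<gamma>' i) = \<gamma> i"
      by (rule natural_eqI[OF natural_Comp[OF pT[OF i] V'(1) V'(2)[OF i] g] conjunct1[OF \<gamma>[OF i]]])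
        (simp add: g\<gamma> i)
    finally show "Comp (Total Y) (FO T i) V V (Comp Y V V' V (tarr V' V g) h0) (c i)
      = Comp (Total Y) (FO T i) V V (Idt Y V) (c i)"
      using \<gamma>[OF i] i T0 V ci by simp
  qed
  then have "tarr V V (Comp (Psh U C) V V' V g h) = tarr V V (Idt (Psh U C) V)"
    using h g V sV' by (simp add: tarr_Comp tarr_Idt)
  then have "Comp (Psh U C) V V' V g h = Idt (Psh U C) V"
    using V by (intro tarr_inj[of V V] natural_Comp[OF pV V'(1) h(1) g] natural_Idt[OF pV])
  then have gh: "g A (h A v) = v" if "A \<in> Ob K" "v \<in> FO V A" for A v
    using fun_cong[OF fun_cong, of _ _ A v] that by (metis Comp_Psh Idt_Psh)
  have coverV: "\<exists>i\<in>Ob J. \<exists>t\<in>FO (FO T i) A. v = \<gamma> i A t" if A: "A \<in> Ob K" "v \<in> FO V A" for A v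
  proof -
    obtain i t where i: "i \<in> Ob J" "t \<in> FO (FO T i) A" "h A v = \<gamma>' i A t"
      using cover[OF A(1) naturalD(2)[OF h(1) A]] by blast
    then have "v = \<gamma> i A t" using gh[OF A] g\<gamma>[OF i(1) A(1) i(2)] by simp
    then show ?thesis using i by blast
  qed
  have univV: "\<exists>h. natural V W h \<and> (\<forall>i\<in>Ob J. \<forall>A\<in>Ob K. \<forall>t\<in>FO (FO T i) A. h A (\<gamma> i A t) = d i A t)"
    if d: "nat_cocone J (FO T) \<tau> W d" for W d
  proof -
    obtain k where k: "natural V' W k" "\<And>i A t. \<lbrakk>i \<in> Ob J; A \<in> Ob K; t \<in> FO (FO T i) A\<rbrakk> \<Longrightarrow> k A (\<gamma>' i A t) = d i A t"
      using univ[OF d] by blast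
    have "natural V W (Comp (Psh U C) V V' W k h)"
      by (rule natural_Comp[OF pV V'(1) h(1) k(1)])
    moreover have "Comp (Psh U C) V V' W k h A (\<gamma> i A t) = d i A t"
      if *: "i \<in> Ob J" "A \<in> Ob K" "t \<in> FO (FO T i) A" for i A t
      using * h\<gamma>[OF *] k(2)[OF *] naturalD(2)[OF conjunct1[OF \<gamma>[OF *(1)]] *(2,3)] by simp
    ultimately show ?thesis by blast
  qed
  show thesis by (rule that[OF \<tau> \<gamma> coverV univV])
qed

lemma tarr_point:
  assumes P: "small_presheaf U C P" and Q: "small_presheaf U C Q" and a: "natural P Q \<alpha>"
    and D: "D \<in> Ob K" "x \<in> FO P D"
  shows "Comp Y (y D) P Q (tarr P Q \<alpha>) (point P D x) = point Q D (\<alpha> D x)"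
proof -
  have pP: "presheaf P" and pQ: "presheaf Q" using P Q small_presheaf_presheaf by blast+
  have ax: "\<alpha> D x \<in> FO Q D" using naturalD(2)[OF a D] .
  note n = natural_elt[OF pP D] natural_elt[OF pQ D(1) ax]
  have "Comp (Psh U C) (y D) P Q \<alpha> (elt P D x) = elt Q D (\<alpha> D x)"
    by (rule natural_y_eqI[OF pQ D(1) natural_Comp[OF presheaf_y[OF D(1)] pP n(1) a] n(2)])
      (use D ax pP pQ in \<open>simp add: presheafD(4)\<close>)
  then show ?thesis using assms n by (simp add: point_def tarr_Comp)
qed

lemma point_inj:
  assumes "small_presheaf U C P" "D \<in> Ob K" "x \<in> FO P D" "x' \<in> FO P D" "point P D x = point P D x'"
  shows "x = x'"
proof -
  have P: "presheaf P" using assms(1) by (rule small_presheaf_presheaf)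
  have "elt P D x = elt P D x'"
    using assms natural_elt[OF P assms(2)] by (intro tarr_inj[of "y D" P]) (simp_all add: point_def)
  from fun_cong[OF fun_cong[OF this], of D "code D D (Idt K D)"] show ?thesis
    using assms by (simp add: presheafD(4)[OF P])
qed

lemma point_code:
  assumes "D \<in> Ob K" "A \<in> Ob K" "is_total K A D k"
  shows "point (y D) A (code A D k) = FA L A D k"
proof -
  have "elt (y D) A (code A D k) = FA (yoneda U C) A D k"
    by (rule natural_y_eqI[of "y D" A])
      (use assms in \<open>simp_all add: natural_elt natural_yoneda yoneda_sel y_sel(2) is_total_Hom\<close>)
  then show ?thesis using assms by (simp add: point_def L_total_tarr)
qed

lemma point_code_Idt: "D \<in> Ob K \<Longrightarrow> point (y D) D (code D D (Idt K D)) = Idt Y (y D)"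
  using restriction_functorD(4)[OF restriction_functor_L, of D] by (simp add: point_code)

lemma L_in_Hom: "\<lbrakk>D \<in> Ob K; E \<in> Ob K; f \<in> Hom K D E\<rbrakk> \<Longrightarrow> FA L D E f \<in> Hom Y (y D) (y E)"
  using restriction_functorD(3)[OF restriction_functor_L, of D E f] by simp

lemma L_Comp: "\<lbrakk>D \<in> Ob K; E \<in> Ob K; F \<in> Ob K; f \<in> Hom K D E; g \<in> Hom K E F\<rbrakk> \<Longrightarrow>
    FA L D F (Comp K D E F g f) = Comp Y (y D) (y E) (y F) (FA L E F g) (FA L D E f)"
  using restriction_functorD(5)[OF restriction_functor_L, of D E F f g] by simp

lemma L_Rst: "\<lbrakk>D \<in> Ob K; E \<in> Ob K; f \<in> Hom K D E\<rbrakk> \<Longrightarrow>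
    FA L D D (Rst K D E f) = Rst Y (y D) (y E) (FA L D E f)"
  using restriction_functorD(6)[OF restriction_functor_L, of D E f] by simp

lemma point_in_Hom: "\<lbrakk>small_presheaf U C P; D \<in> Ob K; x \<in> FO P D\<rbrakk> \<Longrightarrow> point P D x \<in> Hom Y (y D) P"
  by (rule is_total_Hom[OF point_total])

text \<open>
  Apply \<open>Comp_point\<close> to the identity, regarded as an element of \<open>y D\<close>.
\<close>

lemma arrow_from_y:
  assumes \<psi>: "\<psi> \<in> Hom Y (y D) Q" and D: "D \<in> Ob K" and Q: "small_presheaf U C Q"
  obtains B z k where "B \<in> Ob K" "z \<in> FO Q B" "k \<in> Hom K D B"
    "\<psi> = Comp Y (y D) (y B) Q (point Q B z) (FA L D B k)"
proof -
  interpret Y: restriction_category Y by (rule restriction_category_Y)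
  have sD: "small_presheaf U C (y D)" using D by simp
  obtain R where R: "pmap (y D) Q R" "\<psi> = spans (y D) Q R"
    using Hom_YE[OF \<psi> sD Q] .
  let ?x = "code D D (Idt K D)"
  have x: "?x \<in> FO (y D) D" using D by simp
  obtain e where e: "domain_at (y D) (\<lambda>A. Domain (R A)) D ?x e" using pmapD(6)[OF R(1) D x] by blast
  obtain z where z: "(FA (y D) D (so D e) (sm D e) ?x, z) \<in> R (so D e)"
    using domain_value[OF presheaf_y[OF D] R(1) D x e] .
  note c = chosen[OF D domain_atD(1)[OF e]]
  have "\<psi> = Comp Y (y D) (y D) Q \<psi> (point (y D) D ?x)"
    using D Q \<psi> by (simp add: point_code_Idt)
  also have "\<dots> = Comp Y (y D) (y (so D e)) Q (point Q (so D e) z) (FA L D (so D e) (sr D e))"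
    unfolding R(2) by (rule Comp_point[OF sD Q R(1) D x e z])
  finally show thesis
    using that c pmapD(2)[OF R(1) z] by blast
qed

text \<open>
  Both idempotents fix the same total maps, as the graphs of their images under \<open>L\<close> show.
\<close>

lemma Rst_from_L:
  assumes "D \<in> Ob K" "B \<in> Ob K" "B' \<in> Ob K" "k \<in> Hom K D B" "k' \<in> Hom K D B'"
    and "Rst Y (y D) (y B) (FA L D B k) = Rst Y (y D) (y B') (FA L D B' k')"
  shows "Rst K D B k = Rst K D B' k'"
proof (rule restriction_idempotent_eqI[OF assms(1)])
  show "restriction_idempotent K D (Rst K D B k)" "restriction_idempotent K D (Rst K D B' k')"
    using assms by simp_all
  have eq: "FA L D D (Rst K D B k) = FA L D D (Rst K D B' k')"
    using assms by (simp add: L_Rst)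
  have "Lgraph D D (Rst K D B k) = Lgraph D D (Rst K D B' k')"
    using spans_inj[OF L_FA(2) small_presheaf_y, of D D "Rst K D B k"] eq assms by (simp add: L_FA(1))
  then have *: "(code A D l, code A D l) \<in> Lgraph D D (Rst K D B k) A \<longleftrightarrow>
      (code A D l, code A D l) \<in> Lgraph D D (Rst K D B' k') A" for A l by simp
  show "Comp K A D D (Rst K D B k) l = l \<longleftrightarrow> Comp K A D D (Rst K D B' k') l = l"
    if "A \<in> Ob K" "is_total K A D l" for A l
    using *[of A l] unfolding Lgraph_iff[OF assms(1,1) that(1,2,2)] .
qed

text \<open>
  The two composites have the same restriction, hence so do \<open>k\<close> and \<open>k'\<close>; on the splitting of
  that common domain both composites are points of \<open>Q\<close>, and a point determines its element.
\<close>

lemma factorization_unique: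
  assumes D: "D \<in> Ob K" and Q: "small_presheaf U C Q"
    and B: "B \<in> Ob K" "z \<in> FO Q B" "k \<in> Hom K D B" and B': "B' \<in> Ob K" "z' \<in> FO Q B'" "k' \<in> Hom K D B'"
    and eq: "Comp Y (y D) (y B) Q (point Q B z) (FA L D B k) = Comp Y (y D) (y B') Q (point Q B' z') (FA L D B' k')"
  defines "e \<equiv> Rst K D B k"
  shows "restriction_idempotent K D e" "Rst K D B' k' = e"
    "is_total K (so D e) B (Comp K (so D e) D B k (sm D e))" "is_total K (so D e) B' (Comp K (so D e) D B' k' (sm D e))"
    "FA Q B (so D e) (Comp K (so D e) D B k (sm D e)) z = FA Q B' (so D e) (Comp K (so D e) D B' k' (sm D e)) z'"
proof -
  interpret Y: restriction_category Y by (rule restriction_category_Y)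
  have pQ: "presheaf Q" using Q by (rule small_presheaf_presheaf)
  show e: "restriction_idempotent K D e" unfolding e_def using D B by simp
  note c = chosen[OF D e]
  have "Rst Y (y D) (y B) (FA L D B k) = Rst Y (y D) (y B') (FA L D B' k')"
    using Y.Rst_Comp_total[of "y D" "y B" Q "FA L D B k" "point Q B z"]
      Y.Rst_Comp_total[of "y D" "y B'" Q "FA L D B' k'" "point Q B' z'"]
      eq D Q B B' point_total[OF Q] L_in_Hom by simp
  then show e': "Rst K D B' k' = e"
    using Rst_from_L[OF D B(1) B'(1) B(3) B'(3)] by (simp add: e_def)
  show km: "is_total K (so D e) B (Comp K (so D e) D B k (sm D e))"
    using Rst_fix_iff[OF c(1) D B(1,3) c(2)] c(8) by (simp add: e_def)
  show km': "is_total K (so D e) B' (Comp K (so D e) D B' k' (sm D e))"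
    using Rst_fix_iff[OF c(1) D B'(1,3) c(2)] c(8) by (simp add: e')
  have pt: "point Q (so D e) (FA Q B (so D e) (Comp K (so D e) D B k (sm D e)) z)
      = Comp Y (y (so D e)) (y D) Q (Comp Y (y D) (y B) Q (point Q B z) (FA L D B k)) (FA L (so D e) D (sm D e))"
    if B: "B \<in> Ob K" "z \<in> FO Q B" "k \<in> Hom K D B" and t: "is_total K (so D e) B (Comp K (so D e) D B k (sm D e))" for B z k
    using B t D c(1,3) Q
    by (simp add: point_act[symmetric] L_Comp Y.Comp_assoc point_in_Hom L_in_Hom)
  show "FA Q B (so D e) (Comp K (so D e) D B k (sm D e)) z = FA Q B' (so D e) (Comp K (so D e) D B' k' (sm D e)) z'"
    by (rule point_inj[OF Q c(1)])
      (use pt[OF B km] pt[OF B' km'] eq B B' km km' c(1) in \<open>simp_all add: presheafD(3)[OF pQ]\<close>)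
qed

end

section \<open>Weighted colimits in a cocomplete restriction category\<close>

locale cocompletion = split_restriction_category K U + E: restriction_category E
  for K :: "('o, 'a) rcat" and U :: "'u itself" and E :: "('p, 'b) rcat" +
  assumes loc_small_E: "locally_small U E" and cocomplete_E: "cocomplete U E"
begin

text \<open>
  Natural transformations from \<open>P\<close> to the presheaf of all arrows \<open>H D \<rightarrow> W\<close>.
\<close>

definition family where
  "family H P W d \<longleftrightarrow> (\<forall>D\<in>Ob K. \<forall>x\<in>FO P D. d D x \<in> Hom E (FO H D) W) \<and>
    (\<forall>D\<in>Ob K. \<forall>A\<in>Ob K. \<forall>k. \<forall>x\<in>FO P D. is_total K A D k \<longrightarrow>
       d A (FA P D A k x) = Comp E (FO H A) (FO H D) W (d D x) (FA H A D k))"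

text \<open>
  \<open>V\<close> is the colimit of \<open>H\<close> weighted by \<open>P\<close>, with total coprojections \<open>\<kappa> D x\<close>, and with respect
  to families of arbitrary arrows of \<open>E\<close>.
\<close>

definition weighted_colimit where
  "weighted_colimit H P V \<kappa> \<longleftrightarrow> V \<in> Ob E \<and> family H P V \<kappa> \<and>
    (\<forall>D\<in>Ob K. \<forall>x\<in>FO P D. is_total E (FO H D) V (\<kappa> D x)) \<and>
    (\<forall>W d. W \<in> Ob E \<longrightarrow> family H P W d \<longrightarrow>
      (\<exists>!h. h \<in> Hom E V W \<and> (\<forall>D\<in>Ob K. \<forall>x\<in>FO P D. Comp E (FO H D) V W h (\<kappa> D x) = d D x)))"

lemma familyI:
  assumes "\<And>D x. \<lbrakk>D \<in> Ob K; x \<in> FO P D\<rbrakk> \<Longrightarrow> d D x \<in> Hom E (FO H D) W"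
    and "\<And>D A k x. \<lbrakk>D \<in> Ob K; A \<in> Ob K; x \<in> FO P D; is_total K A D k\<rbrakk> \<Longrightarrow>
       d A (FA P D A k x) = Comp E (FO H A) (FO H D) W (d D x) (FA H A D k)"
  shows "family H P W d"
  using assms unfolding family_def by blast

lemma familyD:
  assumes "family H P W d" "D \<in> Ob K" "x \<in> FO P D"
  shows "d D x \<in> Hom E (FO H D) W"
    and "\<lbrakk>A \<in> Ob K; is_total K A D k\<rbrakk> \<Longrightarrow>
       d A (FA P D A k x) = Comp E (FO H A) (FO H D) W (d D x) (FA H A D k)"
  using assms unfolding family_def by blast+

lemma weighted_colimitD:
  assumes "weighted_colimit H P V \<kappa>"
  shows "V \<in> Ob E" "family H P V \<kappa>"
    and "\<lbrakk>D \<in> Ob K; x \<in> FO P D\<rbrakk> \<Longrightarrow> is_total E (FO H D) V (\<kappa> D x)"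
    and "\<lbrakk>D \<in> Ob K; x \<in> FO P D\<rbrakk> \<Longrightarrow> \<kappa> D x \<in> Hom E (FO H D) V"
    and "\<lbrakk>D \<in> Ob K; x \<in> FO P D; A \<in> Ob K; is_total K A D k\<rbrakk> \<Longrightarrow>
       \<kappa> A (FA P D A k x) = Comp E (FO H A) (FO H D) V (\<kappa> D x) (FA H A D k)"
  using assms familyD[of H P V \<kappa>] unfolding weighted_colimit_def by auto

lemma weighted_colimit_ex:
  assumes "weighted_colimit H P V \<kappa>" "W \<in> Ob E" "family H P W d"
  obtains h where "h \<in> Hom E V W" "\<And>D x. \<lbrakk>D \<in> Ob K; x \<in> FO P D\<rbrakk> \<Longrightarrow> Comp E (FO H D) V W h (\<kappa> D x) = d D x"
proof -
  have "\<exists>!h. h \<in> Hom E V W \<and> (\<forall>D\<in>Ob K. \<forall>x\<in>FO P D. Comp E (FO H D) V W h (\<kappa> D x) = d D x)"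
    using assms unfolding weighted_colimit_def by blast
  then show thesis using that by blast
qed

lemma family_Comp:
  assumes H: "is_restriction_functor K E H" and P: "presheaf P" and d: "family H P V d"
    and V: "V \<in> Ob E" "W \<in> Ob E" "h \<in> Hom E V W"
  shows "family H P W (\<lambda>D x. Comp E (FO H D) V W h (d D x))"
  using restriction_functorD[OF H] V familyD[OF d]
  by (intro familyI) (simp_all add: E.Comp_assoc is_total_Hom)

lemma weighted_colimit_eqI:
  assumes wc: "weighted_colimit H P V \<kappa>" and H: "is_restriction_functor K E H" and P: "presheaf P"
    and W: "W \<in> Ob E" "h \<in> Hom E V W" "h' \<in> Hom E V W"
    and eq: "\<And>D x. \<lbrakk>D \<in> Ob K; x \<in> FO P D\<rbrakk> \<Longrightarrow>
      Comp E (FO H D) V W h (\<kappa> D x) = Comp E (FO H D) V W h' (\<kappa> D x)"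
  shows "h = h'"
proof -
  note D = weighted_colimitD[OF wc]
  have "family H P W (\<lambda>D x. Comp E (FO H D) V W h (\<kappa> D x))"
    by (rule family_Comp[OF H P D(2,1) W(1,2)])
  then have "\<exists>!k. k \<in> Hom E V W \<and> (\<forall>D\<in>Ob K. \<forall>x\<in>FO P D. Comp E (FO H D) V W k (\<kappa> D x) = Comp E (FO H D) V W h (\<kappa> D x))"
    using wc W(1) unfolding weighted_colimit_def by blast
  then show ?thesis using W eq by (metis (no_types, lifting))
qed

text \<open>Joint epicness of the coprojections forces a mediating arrow to be total if its family is.\<close>

lemma weighted_colimit_total:
  assumes wc: "weighted_colimit H P V \<kappa>" and H: "is_restriction_functor K E H" and P: "presheaf P"
    and W: "W \<in> Ob E" "h \<in> Hom E V W"
    and tot: "\<And>D x. \<lbrakk>D \<in> Ob K; x \<in> FO P D\<rbrakk> \<Longrightarrow> is_total E (FO H D) W (Comp E (FO H D) V W h (\<kappa> D x))"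
  shows "is_total E V W h"
proof -
  note D = weighted_colimitD[OF wc] and H' = restriction_functorD[OF H]
  have "Rst E V W h = Idt E V"
  proof (rule weighted_colimit_eqI[OF wc H P])
    fix A x assume *: "A \<in> Ob K" "x \<in> FO P A"
    show "Comp E (FO H A) V V (Rst E V W h) (\<kappa> A x) = Comp E (FO H A) V V (Idt E V) (\<kappa> A x)"
      using * E.R4[of "FO H A" V W "\<kappa> A x" h] tot[OF *] D H' W by (simp add: is_total_def)
  qed (use D W in simp_all)
  then show ?thesis using W by (simp add: is_total_def)
qed

lemma weighted_colimit_cong:
  assumes wc: "weighted_colimit H P V \<kappa>" and P: "presheaf P"
    and eq: "\<And>D x. \<lbrakk>D \<in> Ob K; x \<in> FO P D\<rbrakk> \<Longrightarrow> \<kappa> D x = \<kappa>' D x"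
  shows "weighted_colimit H P V \<kappa>'"
proof -
  have "family H P V \<kappa>'"
    using weighted_colimitD(4,5)[OF wc] eq by (intro familyI) (simp_all add: presheafD(3)[OF P])
  then show ?thesis
    using wc eq unfolding weighted_colimit_def by simp
qed

text \<open>
  Local smallness of \<open>E\<close> makes the total arrows into \<open>V\<close> a presheaf of small sets.
\<close>

lemma action_total:
  assumes H: "is_restriction_functor K E H" and V: "V \<in> Ob E"
  shows "action (\<lambda>A. Collect (is_total E (FO H A) V)) (\<lambda>A B k g. Comp E (FO H B) (FO H A) V g (FA H B A k))"
proof (rule actionI)
  note H' = restriction_functorD[OF H]
  fix A assume A: "A \<in> Ob K"
  show "small U (Collect (is_total E (FO H A) V))"
    by (rule small_subset[of U "Hom E (FO H A) V"])
      (use loc_small_E A H' V in \<open>auto simp: locally_small_def dest: is_total_Hom\<close>)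
  fix g assume g: "g \<in> Collect (is_total E (FO H A) V)"
  then have g': "g \<in> Hom E (FO H A) V" by (simp add: is_total_Hom)
  show "Comp E (FO H A) (FO H A) V g (FA H A A (Idt K A)) = g" using A H' V g' by simp
  fix B k assume B: "B \<in> Ob K" "is_total K B A k"
  show "Comp E (FO H B) (FO H A) V g (FA H B A k) \<in> Collect (is_total E (FO H B) V)"
    using A B g H'(2) V restriction_functor_total[OF H B(1) A B(2)]
    by (simp add: E.total_Comp)
  fix D l assume D: "D \<in> Ob K" "is_total K D B l"
  show "Comp E (FO H D) (FO H A) V g (FA H D A (Comp K D B A k l))
    = Comp E (FO H D) (FO H B) V (Comp E (FO H B) (FO H A) V g (FA H B A k)) (FA H D B l)"
    using A B D g' H' V by (simp add: E.Comp_assoc is_total_Hom)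
qed

text \<open>
  The coprojections are the mediating transformation from \<open>P\<close> into the presheaf of total arrows
  into \<open>V\<close>. A family on all of \<open>P\<close> is the same as a cocone on the presenting diagram.
\<close>

lemma weighted_colimit_presents:
  assumes H: "is_restriction_functor K E H" and p: "presents P J T p"
    and c: "is_colimit J E D V c" and D0: "\<And>i. i \<in> Ob J \<Longrightarrow> FO D i = FO H (FO T i)"
    and D1: "\<And>i j u. \<lbrakk>i \<in> Ob J; j \<in> Ob J; u \<in> Hom J i j\<rbrakk> \<Longrightarrow> FA D i j u = FA H (FO T i) (FO T j) (FA T i j u)"
    and ct: "\<And>i. i \<in> Ob J \<Longrightarrow> is_total E (FO H (FO T i)) V (c i)"
  obtains \<kappa> where "weighted_colimit H P V \<kappa>" "\<And>i. i \<in> Ob J \<Longrightarrow> \<kappa> (FO T i) (p i) = c i"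
proof -
  note PD = presentsD[OF p] and H' = restriction_functorD[OF H]
  have cc: "is_cocone J E D V c" using c by (simp add: is_colimit_def)
  have V: "V \<in> Ob E" using cc by (simp add: is_cocone_def)
  have catJ: "category J" using PD(1) by (simp add: small_category_def)
  define G0 where "G0 A = Collect (is_total E (FO H A) V)" for A
  define G1 where "G1 A B k g = Comp E (FO H B) (FO H A) V g (FA H B A k)" for A B k g
  have G: "action G0 G1"
    unfolding G0_def G1_def by (rule action_total[OF H V])
  have c1: "Comp E (FO H (FO T i)) (FO H (FO T j)) V (c j) (FA H (FO T i) (FO T j) (FA T i j u)) = c i"
    if "i \<in> Ob J" "j \<in> Ob J" "u \<in> Hom J i j" for i j u
    using cc that by (simp add: is_cocone_def D0 D1)
  have comp: "compatible J T G0 G1 c"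
    using ct c1 by (simp add: compatible_def G0_def G1_def)
  obtain \<kappa> where \<kappa>0: "\<And>D x. \<lbrakk>D \<in> Ob K; x \<in> FO P D\<rbrakk> \<Longrightarrow> \<kappa> D x \<in> G0 D"
    and \<kappa>1: "\<And>A B k x. \<lbrakk>A \<in> Ob K; B \<in> Ob K; is_total K B A k; x \<in> FO P A\<rbrakk> \<Longrightarrow>
      \<kappa> B (FA P A B k x) = G1 A B k (\<kappa> A x)"
    and \<kappa>p: "\<And>i. i \<in> Ob J \<Longrightarrow> \<kappa> (FO T i) (p i) = c i"
    and \<kappa>pk: "\<And>i D k. \<lbrakk>i \<in> Ob J; D \<in> Ob K; is_total K D (FO T i) k\<rbrakk> \<Longrightarrow>
      \<kappa> D (FA P (FO T i) D k (p i)) = G1 (FO T i) D k (c i)"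
    by (rule presents_extend[OF p G comp]) (rule that)
  have fam: "family H P V \<kappa>"
    using \<kappa>0 \<kappa>1 by (intro familyI) (simp_all add: G0_def G1_def is_total_Hom)
  have "weighted_colimit H P V \<kappa>"
    unfolding weighted_colimit_def
  proof (intro conjI ballI allI impI V fam)
    fix A x assume "A \<in> Ob K" "x \<in> FO P A"
    then show "is_total E (FO H A) V (\<kappa> A x)" using \<kappa>0 by (simp add: G0_def)
  next
    fix W d assume W: "W \<in> Ob E" and d: "family H P W d"
    have "is_cocone J E D W (\<lambda>i. d (FO T i) (p i))"
      unfolding is_cocone_def
    proof (intro conjI ballI W)
      fix i assume "i \<in> Ob J"
      then show "d (FO T i) (p i) \<in> Hom E (FO D i) W" using familyD(1)[OF d] PD by (simp add: D0)
      fix j u assume *: "i \<in> Ob J" "j \<in> Ob J" "u \<in> Hom J i j"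
      show "Comp E (FO D i) (FO D j) W (d (FO T j) (p j)) (FA D i j u) = d (FO T i) (p i)"
        using familyD(2)[OF d PD(5)[OF *(2)] PD(6)[OF *(2)] PD(5)[OF *(1)] PD(7)[OF *]] * PD(8)[OF *]
        by (simp add: D0 D1)
    qed
    then have "\<exists>!h. h \<in> Hom E V W \<and> (\<forall>i\<in>Ob J. Comp E (FO D i) V W h (c i) = d (FO T i) (p i))"
      using c unfolding is_colimit_def by blast
    moreover have "(\<forall>i\<in>Ob J. Comp E (FO D i) V W h (c i) = d (FO T i) (p i)) \<longleftrightarrow>
        (\<forall>A\<in>Ob K. \<forall>x\<in>FO P A. Comp E (FO H A) V W h (\<kappa> A x) = d A x)" if h: "h \<in> Hom E V W" for h
    proof
      assume *: "\<forall>i\<in>Ob J. Comp E (FO D i) V W h (c i) = d (FO T i) (p i)"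
      show "\<forall>A\<in>Ob K. \<forall>x\<in>FO P A. Comp E (FO H A) V W h (\<kappa> A x) = d A x"
      proof (intro ballI)
        fix A x assume A: "A \<in> Ob K" "x \<in> FO P A"
        obtain i k where i: "i \<in> Ob J" "is_total K A (FO T i) k" "x = FA P (FO T i) A k (p i)"
          using presents_gen[OF p A] .
        have Hk: "FA H A (FO T i) k \<in> Hom E (FO H A) (FO H (FO T i))"
          using A i PD H' by (simp add: is_total_Hom)
        have "Comp E (FO H A) V W h (\<kappa> A x)
            = Comp E (FO H A) (FO H (FO T i)) W (Comp E (FO H (FO T i)) V W h (c i)) (FA H A (FO T i) k)"
          using A i h Hk W V PD H' is_total_Hom[OF ct] by (simp add: \<kappa>pk G1_def E.Comp_assoc)
        also have "\<dots> = d A x"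
          using * i A familyD(2)[OF d PD(5)[OF i(1)] PD(6)[OF i(1)] A(1) i(2)] by (simp add: D0)
        finally show "Comp E (FO H A) V W h (\<kappa> A x) = d A x" .
      qed
    next
      assume "\<forall>A\<in>Ob K. \<forall>x\<in>FO P A. Comp E (FO H A) V W h (\<kappa> A x) = d A x"
      then show "\<forall>i\<in>Ob J. Comp E (FO D i) V W h (c i) = d (FO T i) (p i)"
        using PD by (auto simp: D0 \<kappa>p[symmetric])
    qed
    ultimately show "\<exists>!h. h \<in> Hom E V W \<and> (\<forall>A\<in>Ob K. \<forall>x\<in>FO P A. Comp E (FO H A) V W h (\<kappa> A x) = d A x)"
      by (metis (no_types, lifting))
  qed
  then show thesis using that \<kappa>p by blast
qed

text \<open>
  This is where cocompleteness gives more than colimits of total maps: mediating arrows exist,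
  uniquely, for cocones of partial maps too.
\<close>

lemma Total_inclusion_colimit:
  assumes J: "small_category U J" and D: "is_functor J (Total E) D" and c: "is_colimit J (Total E) D V c"
  shows "is_colimit J E D V c"
proof -
  have "is_colimit J E (comp_ftor J (Total_inclusion E) D) (FO (Total_inclusion E) V)
      (\<lambda>i. FA (Total_inclusion E) (FO D i) V (c i))"
    using cocomplete_E J D c unfolding cocomplete_def preserves_small_colimits_def by blast
  moreover have cc: "is_cocone J (Total E) D V c" using c by (simp add: is_colimit_def)
  then have "FO (Total_inclusion E) V = V" by (simp add: is_cocone_def Total_inclusion_def)
  ultimately show ?thesis
    using cc is_functorD(1,2)[OF D]
    by (auto simp: is_cocone_def Total_inclusion_def elim!: is_colimit_cong)
qed

lemma weighted_colimit_exists: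
  assumes H: "is_restriction_functor K E H" and P: "small_presheaf U C P"
  obtains V \<kappa> where "weighted_colimit H P V \<kappa>"
proof -
  obtain J T p where p: "presents P J T p" using small_presheaf_presents[OF P] .
  note PD = presentsD[OF p] and H' = restriction_functorD[OF H]
  have catJ: "category J" using PD(1) by (simp add: small_category_def)
  let ?D = "mk_ftor J (\<lambda>i. FO H (FO T i)) (\<lambda>i j u. FA H (FO T i) (FO T j) (FA T i j u))"
  have D: "is_functor J (Total E) ?D"
  proof (rule is_functor_mk_ftor[OF catJ], goal_cases)
    case (2 i j u)
    then show ?case using restriction_functor_total[OF H] PD by simp
  next
    case (3 i)
    then show ?case using is_functorD(3)[OF PD(2)] PD H' by simp
  next
    case (4 i j l u v)
    then show ?case using is_functorD(4)[OF PD(2)] PD H' by (simp add: is_total_Hom)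
  qed (use PD H' in simp)
  then obtain V c where c: "is_colimit J (Total E) ?D V c"
    using cocomplete_E PD(1) unfolding cocomplete_def has_small_colimits_def by blast
  have ct: "is_total E (FO H (FO T i)) V (c i)" if "i \<in> Ob J" for i
    using c that by (simp add: is_colimit_def is_cocone_def)
  show thesis
    using weighted_colimit_presents[OF H p Total_inclusion_colimit[OF PD(1) D c] _ _ ct] that by auto
qed

section \<open>Cocontinuous functors are determined on representables\<close>

lemma restriction_functor_FL:
  assumes "is_restriction_functor Y E F"
  shows "is_restriction_functor K E (comp_ftor K F L)"
  by (rule restriction_functor_comp[OF restriction_category_axioms restriction_functor_L assms])

text \<open>
  A cocone of total arrows on representables is a compatible family of elements.
\<close>

lemma presents_colimit_Total_Y:
  assumes p: "presents P J T p" and D_def: "D = mk_ftor J (\<lambda>i. y (FO T i)) (\<lambda>i j u. FA L (FO T i) (FO T j) (FA T i j u))"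
  shows "is_functor J (Total Y) D" "is_colimit J (Total Y) D P (\<lambda>i. point P (FO T i) (p i))"
proof -
  note PD = presentsD[OF p]
  have P: "small_presheaf U C P" by (rule presents_small_presheaf[OF p])
  have catJ: "category J" using PD(1) by (simp add: small_category_def)
  interpret Y: restriction_category Y by (rule restriction_category_Y)
  have LT: "is_total Y (y (FO T i)) (y (FO T j)) (FA L (FO T i) (FO T j) (FA T i j u))"
    if "i \<in> Ob J" "j \<in> Ob J" "u \<in> Hom J i j" for i j u
    using restriction_functor_total[OF restriction_functor_L _ _ PD(7)[OF that]] PD that by simp
  show D: "is_functor J (Total Y) D"
    unfolding D_def
  proof (rule is_functor_mk_ftor[OF catJ], goal_cases)
    case (3 i)
    then show ?case
      using is_functorD(3)[OF PD(2)] PD restriction_functorD(4)[OF restriction_functor_L, of "FO T i"] by simp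
  next
    case (4 i j l u v)
    then show ?case using is_functorD(4)[OF PD(2)] PD by (simp add: is_total_Hom L_Comp)
  qed (use PD LT in simp_all)
  have D0: "FO D i = y (FO T i)" if "i \<in> Ob J" for i using that by (simp add: D_def)
  have D1: "FA D i j u = FA L (FO T i) (FO T j) (FA T i j u)" if "i \<in> Ob J" "j \<in> Ob J" "u \<in> Hom J i j" for i j u
    using that by (simp add: D_def)
  show "is_colimit J (Total Y) D P (\<lambda>i. point P (FO T i) (p i))"
    unfolding is_colimit_def
  proof (intro conjI allI impI)
    show "is_cocone J (Total Y) D P (\<lambda>i. point P (FO T i) (p i))"
      unfolding is_cocone_def
      using P PD by (auto simp: D0 D1 point_total point_act)
  next
    fix W d assume d: "is_cocone J (Total Y) D W d"
    have W: "small_presheaf U C W" using d by (simp add: is_cocone_def)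
    have pW: "presheaf W" using W by (rule small_presheaf_presheaf)
    have dt: "is_total Y (y (FO T i)) W (d i)" if "i \<in> Ob J" for i
      using d that by (simp add: is_cocone_def D0)
    have "\<exists>w\<in>FO W (FO T i). d i = point W (FO T i) w" if i: "i \<in> Ob J" for i
    proof -
      obtain \<alpha> where a: "natural (y (FO T i)) W \<alpha>" "d i = tarr (y (FO T i)) W \<alpha>"
        by (rule total_YE[OF dt[OF i] small_presheaf_y[OF PD(5)[OF i]] W])
      let ?w = "\<alpha> (FO T i) (code (FO T i) (FO T i) (Idt K (FO T i)))"
      have w: "?w \<in> FO W (FO T i)" using naturalD(2)[OF a(1) PD(5)[OF i]] PD(5)[OF i] by simp
      have "\<alpha> = elt W (FO T i) ?w"
        by (rule natural_y_eqI[OF pW PD(5)[OF i] a(1) natural_elt[OF pW PD(5)[OF i] w]])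
          (use PD(5)[OF i] w pW in \<open>simp add: presheafD(4)\<close>)
      then show ?thesis using w a(2) unfolding point_def by metis
    qed
    then obtain w where w: "\<And>i. i \<in> Ob J \<Longrightarrow> w i \<in> FO W (FO T i)"
      and dw: "\<And>i. i \<in> Ob J \<Longrightarrow> d i = point W (FO T i) (w i)" by metis
    have comp: "compatible J T (FO W) (FA W) w"
      unfolding compatible_def
    proof (intro conjI ballI w)
      fix i j u assume *: "i \<in> Ob J" "j \<in> Ob J" "u \<in> Hom J i j"
      have "Comp Y (y (FO T i)) (y (FO T j)) W (d j) (FA D i j u) = d i"
        using d * by (simp add: is_cocone_def D0)
      then have "point W (FO T i) (FA W (FO T j) (FO T i) (FA T i j u) (w j)) = point W (FO T i) (w i)"
        using * W PD by (simp add: dw D1 point_act w)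
      then show "FA W (FO T j) (FO T i) (FA T i j u) (w j) = w i"
        using * PD w by (intro point_inj[OF W PD(5)[OF *(1)]]) (simp_all add: presheafD(3)[OF pW])
    qed
    obtain h where h0: "\<And>D x. \<lbrakk>D \<in> Ob K; x \<in> FO P D\<rbrakk> \<Longrightarrow> h D x \<in> FO W D"
      and h1: "\<And>A B k x. \<lbrakk>A \<in> Ob K; B \<in> Ob K; is_total K B A k; x \<in> FO P A\<rbrakk> \<Longrightarrow>
        h B (FA P A B k x) = FA W A B k (h A x)"
      and hp: "\<And>i. i \<in> Ob J \<Longrightarrow> h (FO T i) (p i) = w i"
      and hpk: "\<And>i D k. \<lbrakk>i \<in> Ob J; D \<in> Ob K; is_total K D (FO T i) k\<rbrakk> \<Longrightarrow>
        h D (FA P (FO T i) D k (p i)) = FA W (FO T i) D k (w i)"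
      by (rule presents_extend[OF p action_presheaf[OF pW] comp]) (rule that)
    have nh: "natural P W (mk_nat P h)"
      by (rule natural_mk_nat[OF PD(3)]) (simp_all add: h0 h1)
    show "\<exists>!h. h \<in> Hom (Total Y) P W \<and> (\<forall>i\<in>Ob J. Comp (Total Y) (FO D i) P W h (point P (FO T i) (p i)) = d i)"
    proof (rule ex1I[of _ "tarr P W (mk_nat P h)"], intro conjI ballI)
      show "tarr P W (mk_nat P h) \<in> Hom (Total Y) P W" using tarr_total[OF P W nh] by simp
      show "Comp (Total Y) (FO D i) P W (tarr P W (mk_nat P h)) (point P (FO T i) (p i)) = d i" if i: "i \<in> Ob J" for i
        using i tarr_point[OF P W nh PD(5)[OF i] PD(6)[OF i]] PD by (simp add: D0 hp dw)
      fix h' assume h': "h' \<in> Hom (Total Y) P W \<and> (\<forall>i\<in>Ob J. Comp (Total Y) (FO D i) P W h' (point P (FO T i) (p i)) = d i)"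
      then have h't: "is_total Y P W h'" by simp
      obtain \<alpha> where a: "natural P W \<alpha>" "h' = tarr P W \<alpha>" by (rule total_YE[OF h't P W])
      have \<alpha>p: "\<alpha> (FO T i) (p i) = w i" if i: "i \<in> Ob J" for i
      proof -
        have "point W (FO T i) (\<alpha> (FO T i) (p i)) = point W (FO T i) (w i)"
          using h' i tarr_point[OF P W a(1) PD(5)[OF i] PD(6)[OF i]] by (simp add: D0 dw a(2))
        then show ?thesis
          using naturalD(2)[OF a(1) PD(5)[OF i] PD(6)[OF i]] w[OF i] by (intro point_inj[OF W PD(5)[OF i]])
      qed
      have "\<alpha> = mk_nat P h"
      proof (rule natural_eqI[OF a(1) nh])
        fix A x assume A: "A \<in> Ob K" "x \<in> FO P A"
        obtain i k where i: "i \<in> Ob J" "is_total K A (FO T i) k" "x = FA P (FO T i) A k (p i)"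
          using presents_gen[OF p A] .
        show "\<alpha> A x = mk_nat P h A x"
          using A i PD(5,6) naturalD(3)[OF a(1) PD(5)[OF i(1)] PD(3) A(1) i(2) PD(6)[OF i(1)]]
          by (simp add: \<alpha>p hpk)
      qed
      then show "h' = tarr P W (mk_nat P h)" using a(2) by simp
    qed
  qed
qed

text \<open>
  A cocontinuous \<open>F\<close> preserves the presentation of \<open>P\<close> as a colimit of representables in
  \<open>Total Y\<close>, and \<open>E\<close> preserves the resulting colimit of total maps.
\<close>

lemma cocontinuous_weighted_colimit:
  assumes F: "is_restriction_functor Y E F" and coc: "cocontinuous U Y E F" and P: "small_presheaf U C P"
  shows "weighted_colimit (comp_ftor K F L) P (FO F P) (\<lambda>D x. FA F (y D) P (point P D x))"
proof -
  obtain J T p where p: "presents P J T p" using small_presheaf_presents[OF P] .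
  note PD = presentsD[OF p] and F' = restriction_functorD[OF F] and FL = restriction_functor_FL[OF F]
  have catJ: "category J" using PD(1) by (simp add: small_category_def)
  define D where "D = mk_ftor J (\<lambda>i. y (FO T i)) (\<lambda>i j u. FA L (FO T i) (FO T j) (FA T i j u))"
  note pc = presents_colimit_Total_Y[OF p D_def]
  have Ft: "is_total E (FO F A) (FO F B) (FA F A B f)"
    if "small_presheaf U C A" "small_presheaf U C B" "is_total Y A B f" for A B f
    using restriction_functor_total[OF F _ _ that(3)] that by simp
  have LT: "is_total Y (y (FO T i)) (y (FO T j)) (FA L (FO T i) (FO T j) (FA T i j u))"
    if "i \<in> Ob J" "j \<in> Ob J" "u \<in> Hom J i j" for i j u
    using restriction_functor_total[OF restriction_functor_L _ _ PD(7)[OF that]] PD that by simp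
  let ?D = "comp_ftor J (Total_ftor Y F) D" and ?c = "\<lambda>i. FA (Total_ftor Y F) (FO D i) P (point P (FO T i) (p i))"
  have "is_colimit J (Total E) ?D (FO (Total_ftor Y F) P) ?c"
    using coc PD(1) pc unfolding cocontinuous_def preserves_small_colimits_def by blast
  then have c: "is_colimit J (Total E) ?D (FO F P) ?c"
    using P by (simp add: Total_ftor_def)
  have func: "is_functor J (Total E) ?D"
  proof (rule is_functor_comp[OF catJ pc(1)])
    interpret Y: restriction_category Y by (rule restriction_category_Y)
    show "is_functor (Total Y) (Total E) (Total_ftor Y F)"
      unfolding Total_ftor_def
      by (rule is_functor_mk_ftor[OF Y.category_Total]) (use F' Ft in \<open>simp_all add: is_total_Hom\<close>)
  qed
  obtain \<kappa> where \<kappa>: "weighted_colimit (comp_ftor K F L) P (FO F P) \<kappa>"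
    and \<kappa>p: "\<And>i. i \<in> Ob J \<Longrightarrow> \<kappa> (FO T i) (p i) = ?c i"
  proof (rule weighted_colimit_presents[OF FL p Total_inclusion_colimit[OF PD(1) func c]])
    show "FO ?D i = FO (comp_ftor K F L) (FO T i)" if "i \<in> Ob J" for i
      using that PD by (simp add: D_def Total_ftor_def)
    show "FA ?D i j u = FA (comp_ftor K F L) (FO T i) (FO T j) (FA T i j u)"
      if "i \<in> Ob J" "j \<in> Ob J" "u \<in> Hom J i j" for i j u
      using that PD LT by (simp add: D_def Total_ftor_def is_total_Hom)
    show "is_total E (FO (comp_ftor K F L) (FO T i)) (FO F P) (?c i)" if "i \<in> Ob J" for i
      using that PD P Ft[of "y (FO T i)" P] point_total[OF P] by (simp add: D_def Total_ftor_def)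
  qed (use that in blast)
  show ?thesis
  proof (rule weighted_colimit_cong[OF \<kappa> PD(3)])
    fix A x assume A: "A \<in> Ob K" "x \<in> FO P A"
    obtain i k where i: "i \<in> Ob J" "is_total K A (FO T i) k" "x = FA P (FO T i) A k (p i)"
      using presents_gen[OF p A] .
    have "\<kappa> A x = Comp E (FO F (y A)) (FO F (y (FO T i))) (FO F P) (FA F (y (FO T i)) P (point P (FO T i) (p i)))
        (FA F (y A) (y (FO T i)) (FA L A (FO T i) k))"
      using i A PD P weighted_colimitD(5)[OF \<kappa> PD(5)[OF i(1)] PD(6)[OF i(1)] A(1) i(2)] \<kappa>p[OF i(1)]
        point_total[OF P PD(5)[OF i(1)] PD(6)[OF i(1)]]
      by (simp add: D_def Total_ftor_def is_total_Hom)
    also have "\<dots> = FA F (y A) P (Comp Y (y A) (y (FO T i)) P (point P (FO T i) (p i)) (FA L A (FO T i) k))"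
      using i A PD P by (intro F'(5)[symmetric]) (simp_all add: point_in_Hom L_in_Hom is_total_Hom)
    also have "\<dots> = FA F (y A) P (point P A x)"
      using i A PD P by (simp add: point_act)
    finally show "\<kappa> A x = FA F (y A) P (point P A x)" .
  qed
qed

lemma trans_eqI_on_y:
  assumes F: "is_restriction_functor Y E F" and cF: "cocontinuous U Y E F" and G: "is_restriction_functor Y E G"
    and \<beta>: "is_restriction_trans Y E F G \<beta>" and \<beta>': "is_restriction_trans Y E F G \<beta>'"
    and eq: "\<And>D. D \<in> Ob K \<Longrightarrow> \<beta> (y D) = \<beta>' (y D)"
  shows "\<beta> = \<beta>'"
proof (rule extensionalityI[OF restriction_transD(4)[OF \<beta>] restriction_transD(4)[OF \<beta>']])
  note F' = restriction_functorD[OF F] and G' = restriction_functorD[OF G]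
  fix P assume "P \<in> Ob Y"
  then have P: "small_presheaf U C P" by simp
  show "\<beta> P = \<beta>' P"
  proof (rule weighted_colimit_eqI[OF cocontinuous_weighted_colimit[OF F cF P] restriction_functor_FL[OF F] small_presheaf_presheaf[OF P]])
    fix D x assume D: "D \<in> Ob K" "x \<in> FO P D"
    show "Comp E (FO (comp_ftor K F L) D) (FO F P) (FO G P) (\<beta> P) (FA F (y D) P (point P D x))
      = Comp E (FO (comp_ftor K F L) D) (FO F P) (FO G P) (\<beta>' P) (FA F (y D) P (point P D x))"
      using D P eq[OF D(1)] restriction_transD(3)[OF \<beta>, of "y D" P "point P D x"]
        restriction_transD(3)[OF \<beta>', of "y D" P "point P D x"] by (simp add: point_in_Hom)
  qed (use P G' restriction_transD(2)[OF \<beta>] restriction_transD(2)[OF \<beta>'] in simp_all)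
qed

text \<open>
  The component at \<open>P\<close> is induced by \<open>\<alpha>\<close> on the weighted colimit \<open>F P\<close>. Naturality with respect
  to a partial map \<open>\<phi>\<close> is checked on points \<open>x\<close> of the domain, where \<open>\<phi> x\<close> factors as an arrow of
  \<open>K\<close>, for which \<open>\<alpha>\<close> is natural, followed by a point of the codomain.
\<close>

lemma trans_extend_from_L:
  assumes F: "is_restriction_functor Y E F" and cF: "cocontinuous U Y E F" and G: "is_restriction_functor Y E G"
    and \<alpha>: "is_restriction_trans K E (comp_ftor K F L) (comp_ftor K G L) \<alpha>"
  obtains \<beta> where "is_restriction_trans Y E F G \<beta>" "\<And>D. D \<in> Ob K \<Longrightarrow> \<beta> (y D) = \<alpha> D"
proof -
  note F' = restriction_functorD[OF F] and G' = restriction_functorD[OF G]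
  note wc = cocontinuous_weighted_colimit[OF F cF] and FL = restriction_functor_FL[OF F]
  interpret Y: restriction_category Y by (rule restriction_category_Y)
  have at: "is_total E (FO F (y D)) (FO G (y D)) (\<alpha> D)" if "D \<in> Ob K" for D
    using restriction_transD(1)[OF \<alpha> that] that by simp
  then have ah: "\<alpha> D \<in> Hom E (FO F (y D)) (FO G (y D))" if "D \<in> Ob K" for D
    using that by (simp add: is_total_Hom)
  have an: "Comp E (FO F (y D)) (FO F (y B)) (FO G (y B)) (\<alpha> B) (FA F (y D) (y B) (FA L D B k))
      = Comp E (FO F (y D)) (FO G (y D)) (FO G (y B)) (FA G (y D) (y B) (FA L D B k)) (\<alpha> D)"
    if "D \<in> Ob K" "B \<in> Ob K" "k \<in> Hom K D B" for D B k
    using restriction_transD(3)[OF \<alpha> that] that by simp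
  let ?d = "\<lambda>P D x. Comp E (FO F (y D)) (FO G (y D)) (FO G P) (FA G (y D) P (point P D x)) (\<alpha> D)"
  have fam: "family (comp_ftor K F L) P (FO G P) (?d P)" if P: "small_presheaf U C P" for P
  proof (rule familyI)
    show "?d P D x \<in> Hom E (FO (comp_ftor K F L) D) (FO G P)" if "D \<in> Ob K" "x \<in> FO P D" for D x
      using that P F' G' ah by (simp add: point_in_Hom)
    fix D A k x assume *: "D \<in> Ob K" "A \<in> Ob K" "x \<in> FO P D" "is_total K A D k"
    note kh = is_total_Hom[OF *(4)]
    have "?d P A (FA P D A k x) = Comp E (FO F (y A)) (FO G (y A)) (FO G P)
        (Comp E (FO G (y A)) (FO G (y D)) (FO G P) (FA G (y D) P (point P D x)) (FA G (y A) (y D) (FA L A D k))) (\<alpha> A)"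
      using * P kh G'(5)[of "y A" "y D" P "FA L A D k" "point P D x"]
      by (simp add: point_act point_in_Hom L_in_Hom)
    also have "\<dots> = Comp E (FO F (y A)) (FO G (y D)) (FO G P) (FA G (y D) P (point P D x))
        (Comp E (FO F (y A)) (FO G (y A)) (FO G (y D)) (FA G (y A) (y D) (FA L A D k)) (\<alpha> A))"
      using * P kh F' G' ah by (simp add: E.Comp_assoc point_in_Hom L_in_Hom)
    also have "\<dots> = Comp E (FO F (y A)) (FO F (y D)) (FO G P) (?d P D x) (FA F (y A) (y D) (FA L A D k))"
      using * P kh F' G' ah by (simp add: an[symmetric] E.Comp_assoc point_in_Hom L_in_Hom)
    finally show "?d P A (FA P D A k x) = Comp E (FO (comp_ftor K F L) A) (FO (comp_ftor K F L) D) (FO G P) (?d P D x)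
        (FA (comp_ftor K F L) A D k)"
      using * kh by simp
  qed
  have "\<exists>h. h \<in> Hom E (FO F P) (FO G P) \<and> (\<forall>D\<in>Ob K. \<forall>x\<in>FO P D.
      Comp E (FO F (y D)) (FO F P) (FO G P) h (FA F (y D) P (point P D x)) = ?d P D x)" if P: "small_presheaf U C P" for P
  proof -
    have GP: "FO G P \<in> Ob E" using P G' by simp
    show ?thesis
      by (rule weighted_colimit_ex[OF wc[OF P] GP fam[OF P]]) auto
  qed
  then obtain \<beta>0 where b: "\<And>P. small_presheaf U C P \<Longrightarrow> \<beta>0 P \<in> Hom E (FO F P) (FO G P)"
    and b\<kappa>: "\<And>P D x. \<lbrakk>small_presheaf U C P; D \<in> Ob K; x \<in> FO P D\<rbrakk> \<Longrightarrow>
      Comp E (FO F (y D)) (FO F P) (FO G P) (\<beta>0 P) (FA F (y D) P (point P D x)) = ?d P D x" by metis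
  have bt: "is_total E (FO F P) (FO G P) (\<beta>0 P)" if P: "small_presheaf U C P" for P
  proof (rule weighted_colimit_total[OF wc[OF P] FL small_presheaf_presheaf[OF P]])
    fix D x assume D: "D \<in> Ob K" "x \<in> FO P D"
    have "is_total E (FO G (y D)) (FO G P) (FA G (y D) P (point P D x))"
      using D P by (intro restriction_functor_total[OF G] point_total) simp_all
    then have "is_total E (FO F (y D)) (FO G P) (?d P D x)"
      using D P F' G' at by (intro E.total_Comp) simp_all
    then show "is_total E (FO (comp_ftor K F L) D) (FO G P)
      (Comp E (FO (comp_ftor K F L) D) (FO F P) (FO G P) (\<beta>0 P) (FA F (y D) P (point P D x)))"
      using D P by (simp add: b\<kappa>)
  qed (use P b F' G' in simp_all)
  let ?b = "restrict \<beta>0 (Ob Y)"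
  show thesis
  proof (rule that[of ?b])
    show "is_restriction_trans Y E F G ?b"
    proof (rule restriction_transI)
      fix P Q \<phi> assume "P \<in> Ob Y" "Q \<in> Ob Y" and \<phi>: "\<phi> \<in> Hom Y P Q"
      then have P: "small_presheaf U C P" and Q: "small_presheaf U C Q" by simp_all
      have "Comp E (FO F P) (FO F Q) (FO G Q) (\<beta>0 Q) (FA F P Q \<phi>) = Comp E (FO F P) (FO G P) (FO G Q) (FA G P Q \<phi>) (\<beta>0 P)"
      proof (rule weighted_colimit_eqI[OF wc[OF P] FL small_presheaf_presheaf[OF P]])
        fix D x assume D: "D \<in> Ob K" "x \<in> FO P D"
        have pt: "point P D x \<in> Hom Y (y D) P" by (rule point_in_Hom[OF P D])
        have \<phi>x: "Comp Y (y D) P Q \<phi> (point P D x) \<in> Hom Y (y D) Q"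
          using D P Q \<phi> pt by (intro Y.Comp_in) simp_all
        obtain B z k where B: "B \<in> Ob K" "z \<in> FO Q B" "k \<in> Hom K D B"
          and fac: "Comp Y (y D) P Q \<phi> (point P D x) = Comp Y (y D) (y B) Q (point Q B z) (FA L D B k)"
          by (rule arrow_from_y[OF \<phi>x D(1) Q])
        have zt: "point Q B z \<in> Hom Y (y B) Q" by (rule point_in_Hom[OF Q B(1,2)])
        have Lk: "FA L D B k \<in> Hom Y (y D) (y B)" by (rule L_in_Hom[OF D(1) B(1,3)])
        have S [simp]: "small_presheaf U C (y D)" "small_presheaf U C (y B)" using D B by simp_all
        note [simp] = P Q D(1) B(1)
        have Hs [simp]: "FO F P \<in> Ob E" "FO F Q \<in> Ob E" "FO G P \<in> Ob E" "FO G Q \<in> Ob E"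
          "FO F (y D) \<in> Ob E" "FO F (y B) \<in> Ob E" "FO G (y D) \<in> Ob E" "FO G (y B) \<in> Ob E"
          using F'(2) G'(2) by simp_all
        have Hm [simp]: "FA F P Q \<phi> \<in> Hom E (FO F P) (FO F Q)" "FA G P Q \<phi> \<in> Hom E (FO G P) (FO G Q)"
          "FA F (y D) P (point P D x) \<in> Hom E (FO F (y D)) (FO F P)" "FA G (y D) P (point P D x) \<in> Hom E (FO G (y D)) (FO G P)"
          "FA F (y B) Q (point Q B z) \<in> Hom E (FO F (y B)) (FO F Q)" "FA G (y B) Q (point Q B z) \<in> Hom E (FO G (y B)) (FO G Q)"
          "FA F (y D) (y B) (FA L D B k) \<in> Hom E (FO F (y D)) (FO F (y B))" "FA G (y D) (y B) (FA L D B k) \<in> Hom E (FO G (y D)) (FO G (y B))"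
          "\<alpha> D \<in> Hom E (FO F (y D)) (FO G (y D))" "\<alpha> B \<in> Hom E (FO F (y B)) (FO G (y B))"
          "\<beta>0 P \<in> Hom E (FO F P) (FO G P)" "\<beta>0 Q \<in> Hom E (FO F Q) (FO G Q)"
          using F'(3) G'(3) \<phi> pt zt Lk ah b by simp_all
        have facF: "Comp E (FO F (y D)) (FO F P) (FO F Q) (FA F P Q \<phi>) (FA F (y D) P (point P D x))
          = Comp E (FO F (y D)) (FO F (y B)) (FO F Q) (FA F (y B) Q (point Q B z)) (FA F (y D) (y B) (FA L D B k))"
          using F'(5)[of "y D" P Q "point P D x" \<phi>] F'(5)[of "y D" "y B" Q "FA L D B k" "point Q B z"] fac \<phi> pt zt Lk by simp
        have facG: "Comp E (FO G (y D)) (FO G P) (FO G Q) (FA G P Q \<phi>) (FA G (y D) P (point P D x))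
          = Comp E (FO G (y D)) (FO G (y B)) (FO G Q) (FA G (y B) Q (point Q B z)) (FA G (y D) (y B) (FA L D B k))"
          using G'(5)[of "y D" P Q "point P D x" \<phi>] G'(5)[of "y D" "y B" Q "FA L D B k" "point Q B z"] fac \<phi> pt zt Lk by simp
        have "Comp E (FO F (y D)) (FO F P) (FO G Q) (Comp E (FO F P) (FO F Q) (FO G Q) (\<beta>0 Q) (FA F P Q \<phi>)) (FA F (y D) P (point P D x))
          = Comp E (FO F (y D)) (FO F Q) (FO G Q) (\<beta>0 Q)
              (Comp E (FO F (y D)) (FO F P) (FO F Q) (FA F P Q \<phi>) (FA F (y D) P (point P D x)))"
          by (rule E.Comp_assoc[symmetric]) simp_all
        also have "\<dots> = Comp E (FO F (y D)) (FO F (y B)) (FO G Q)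
              (Comp E (FO F (y B)) (FO F Q) (FO G Q) (\<beta>0 Q) (FA F (y B) Q (point Q B z))) (FA F (y D) (y B) (FA L D B k))"
          unfolding facF by (rule E.Comp_assoc) simp_all
        also have "\<dots> = Comp E (FO F (y D)) (FO G (y B)) (FO G Q) (FA G (y B) Q (point Q B z))
              (Comp E (FO F (y D)) (FO F (y B)) (FO G (y B)) (\<alpha> B) (FA F (y D) (y B) (FA L D B k)))"
          unfolding b\<kappa>[OF Q B(1,2)] by (rule E.Comp_assoc[symmetric]) simp_all
        also have "\<dots> = Comp E (FO F (y D)) (FO G (y D)) (FO G Q)
              (Comp E (FO G (y D)) (FO G (y B)) (FO G Q) (FA G (y B) Q (point Q B z)) (FA G (y D) (y B) (FA L D B k))) (\<alpha> D)"
          unfolding an[OF D(1) B(1,3)] by (rule E.Comp_assoc) simp_all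
        also have "\<dots> = Comp E (FO F (y D)) (FO G P) (FO G Q) (FA G P Q \<phi>) (?d P D x)"
          unfolding facG[symmetric] by (rule E.Comp_assoc[symmetric]) simp_all
        also have "\<dots> = Comp E (FO F (y D)) (FO F P) (FO G Q) (Comp E (FO F P) (FO G P) (FO G Q) (FA G P Q \<phi>) (\<beta>0 P)) (FA F (y D) P (point P D x))"
          unfolding b\<kappa>[OF P D, symmetric] by (rule E.Comp_assoc) simp_all
        finally show "Comp E (FO (comp_ftor K F L) D) (FO F P) (FO G Q) (Comp E (FO F P) (FO F Q) (FO G Q) (\<beta>0 Q) (FA F P Q \<phi>)) (FA F (y D) P (point P D x))
          = Comp E (FO (comp_ftor K F L) D) (FO F P) (FO G Q) (Comp E (FO F P) (FO G P) (FO G Q) (FA G P Q \<phi>) (\<beta>0 P)) (FA F (y D) P (point P D x))"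
          by simp
      qed (use P Q F' G' b \<phi> in simp_all)
      then show "Comp E (FO F P) (FO F Q) (FO G Q) (?b Q) (FA F P Q \<phi>) = Comp E (FO F P) (FO G P) (FO G Q) (FA G P Q \<phi>) (?b P)"
        using P Q by simp
    qed (simp_all add: bt)
    fix D assume D: "D \<in> Ob K"
    have "\<beta>0 (y D) = \<alpha> D"
      using b\<kappa>[of "y D" D "code D D (Idt K D)"] D F' G' b ah by (simp add: point_code_Idt)
    then show "?b (y D) = \<alpha> D" using D by simp
  qed
qed

section \<open>Extending functors along the embedding\<close>

text \<open>
  The coprojections \<open>\<kappa>\<close> of a weighted colimit extend to all arrows \<open>\<psi> : y D \<rightarrow> Q\<close> of \<open>Y\<close>, not
  only the total ones, by factoring \<open>\<psi>\<close> as an arrow of \<open>K\<close> followed by a point.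
\<close>

definition khat where
  "khat H Q V \<kappa> D \<psi> = (SOME w. \<exists>B\<in>Ob K. \<exists>z\<in>FO Q B. \<exists>k\<in>Hom K D B.
     \<psi> = Comp Y (y D) (y B) Q (point Q B z) (FA L D B k) \<and>
     w = Comp E (FO H D) (FO H B) V (\<kappa> B z) (FA H D B k))"

text \<open>
  Independence of the factorization: by \<open>factorization_unique\<close> both sides are \<open>\<kappa>\<close> at one and
  the same element over the splitting of the restriction of \<open>k\<close>, precomposed with its
  retraction.
\<close>

lemma khat_eq:
  assumes H: "is_restriction_functor K E H" and Q: "small_presheaf U C Q" and wc: "weighted_colimit H Q V \<kappa>"
    and D: "D \<in> Ob K" and B: "B \<in> Ob K" "z \<in> FO Q B" "k \<in> Hom K D B"
  shows "khat H Q V \<kappa> D (Comp Y (y D) (y B) Q (point Q B z) (FA L D B k))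
    = Comp E (FO H D) (FO H B) V (\<kappa> B z) (FA H D B k)"
proof -
  note H' = restriction_functorD[OF H] and w = weighted_colimitD[OF wc]
  let ?\<psi> = "Comp Y (y D) (y B) Q (point Q B z) (FA L D B k)"
  have "\<exists>B'\<in>Ob K. \<exists>z'\<in>FO Q B'. \<exists>k'\<in>Hom K D B'.
     ?\<psi> = Comp Y (y D) (y B') Q (point Q B' z') (FA L D B' k') \<and>
     khat H Q V \<kappa> D ?\<psi> = Comp E (FO H D) (FO H B') V (\<kappa> B' z') (FA H D B' k')"
    unfolding khat_def by (rule someI_ex) (use B in blast)
  then obtain B' z' k' where B': "B' \<in> Ob K" "z' \<in> FO Q B'" "k' \<in> Hom K D B'"
    and eq: "?\<psi> = Comp Y (y D) (y B') Q (point Q B' z') (FA L D B' k')"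
    and kh: "khat H Q V \<kappa> D ?\<psi> = Comp E (FO H D) (FO H B') V (\<kappa> B' z') (FA H D B' k')" by blast
  define e where "e = Rst K D B k"
  note u = factorization_unique[OF D Q B B' eq, folded e_def]
  note c = chosen[OF D u(1)]
  have *: "Comp E (FO H D) (FO H B) V (\<kappa> B z) (FA H D B k)
      = Comp E (FO H D) (FO H (so D e)) V (\<kappa> (so D e) (FA Q B (so D e) (Comp K (so D e) D B k (sm D e)) z)) (FA H D (so D e) (sr D e))"
    if B: "B \<in> Ob K" "z \<in> FO Q B" "k \<in> Hom K D B" and e: "Rst K D B k = e"
      and t: "is_total K (so D e) B (Comp K (so D e) D B k (sm D e))" for B z k
  proof -
    have "k = Comp K D D B k (Comp K D (so D e) D (sm D e) (sr D e))"
      using R1[OF D B(1,3)] unfolding c(5) e by (rule sym)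
    also have "\<dots> = Comp K D (so D e) B (Comp K (so D e) D B k (sm D e)) (sr D e)"
      using B D c(1-4) by (intro Comp_assoc)
    finally have Hk: "FA H D B k = Comp E (FO H D) (FO H (so D e)) (FO H B) (FA H (so D e) B (Comp K (so D e) D B k (sm D e))) (FA H D (so D e) (sr D e))"
      using H'(5)[OF D c(1) B(1) c(4) is_total_Hom[OF t]] by simp
    show ?thesis
      unfolding w(5)[OF B(1,2) c(1) t] Hk
      using H'(2)[OF D] H'(2)[OF c(1)] H'(2)[OF B(1)] w(1) H'(3)[OF D c(1,4)] H'(3)[OF c(1) B(1) is_total_Hom[OF t]] w(4)[OF B(1,2)]
      by (intro E.Comp_assoc)
  qed
  show ?thesis
    unfolding kh *[OF B' u(2,4)] *[OF B e_def[symmetric] u(3)] u(5) ..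
qed

lemma khat_in:
  assumes H: "is_restriction_functor K E H" and Q: "small_presheaf U C Q" and wc: "weighted_colimit H Q V \<kappa>"
    and D: "D \<in> Ob K" and \<psi>: "\<psi> \<in> Hom Y (y D) Q"
  shows "khat H Q V \<kappa> D \<psi> \<in> Hom E (FO H D) V"
proof -
  obtain B z k where B: "B \<in> Ob K" "z \<in> FO Q B" "k \<in> Hom K D B"
    "\<psi> = Comp Y (y D) (y B) Q (point Q B z) (FA L D B k)" by (rule arrow_from_y[OF \<psi> D Q])
  show ?thesis
    unfolding B(4) khat_eq[OF H Q wc D B(1-3)]
    using B D restriction_functorD[OF H] weighted_colimitD[OF wc] by simp
qed

lemma khat_Comp_L:
  assumes H: "is_restriction_functor K E H" and Q: "small_presheaf U C Q" and wc: "weighted_colimit H Q V \<kappa>"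
    and D: "D \<in> Ob K" and \<psi>: "\<psi> \<in> Hom Y (y D) Q" and A: "A \<in> Ob K" "f \<in> Hom K A D"
  shows "khat H Q V \<kappa> A (Comp Y (y A) (y D) Q \<psi> (FA L A D f)) = Comp E (FO H A) (FO H D) V (khat H Q V \<kappa> D \<psi>) (FA H A D f)"
proof -
  note H' = restriction_functorD[OF H] and w = weighted_colimitD[OF wc]
  interpret Y: restriction_category Y by (rule restriction_category_Y)
  obtain B z k where B: "B \<in> Ob K" "z \<in> FO Q B" "k \<in> Hom K D B"
    and \<psi>_eq: "\<psi> = Comp Y (y D) (y B) Q (point Q B z) (FA L D B k)" by (rule arrow_from_y[OF \<psi> D Q])
  have kf: "Comp K A D B k f \<in> Hom K A B" using A B D by simp
  have "Comp Y (y A) (y D) Q \<psi> (FA L A D f) = Comp Y (y A) (y B) Q (point Q B z) (FA L A B (Comp K A D B k f))"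
    unfolding \<psi>_eq using A B D Q by (simp add: L_Comp Y.Comp_assoc point_in_Hom L_in_Hom)
  then show ?thesis
    unfolding \<psi>_eq using khat_eq[OF H Q wc D B] khat_eq[OF H Q wc A(1) B(1,2) kf] A B D H' w
    by (simp add: E.Comp_assoc)
qed

lemma khat_point:
  assumes H: "is_restriction_functor K E H" and Q: "small_presheaf U C Q" and wc: "weighted_colimit H Q V \<kappa>"
    and D: "D \<in> Ob K" "x \<in> FO Q D"
  shows "khat H Q V \<kappa> D (point Q D x) = \<kappa> D x"
proof -
  note H' = restriction_functorD[OF H] and w = weighted_colimitD[OF wc]
  interpret Y: restriction_category Y by (rule restriction_category_Y)
  have "Comp Y (y D) (y D) Q (point Q D x) (FA L D D (Idt K D)) = point Q D x"
    using D Q restriction_functorD(4)[OF restriction_functor_L D(1)] by (simp add: point_in_Hom)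
  then show ?thesis
    using khat_eq[OF H Q wc D(1) D Idt_in[OF D(1)]] D H' w by simp
qed

end

text \<open>
  A functor \<open>H\<close> on \<open>K\<close> together with a choice of its weighted colimits; the extension of \<open>H\<close> to
  \<open>Y\<close> has these as values on objects.
\<close>

locale extension = cocompletion K U E for K :: "('o, 'a) rcat" and U :: "'u itself" and E :: "('p, 'b) rcat" +
  fixes H V \<kappa>
  assumes H: "is_restriction_functor K E H"
    and wc: "\<And>P. small_presheaf U C P \<Longrightarrow> weighted_colimit H P (V P) (\<kappa> P)"
begin

sublocale Y: restriction_category Y
  by (rule restriction_category_Y)

abbreviation "kh P \<equiv> khat H P (V P) (\<kappa> P)"

lemmas H_simps = restriction_functorD[OF H]
lemmas kh_in = khat_in[OF H _ wc]
lemmas kh_eq = khat_eq[OF H _ wc]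
lemmas kh_L = khat_Comp_L[OF H _ wc]
lemmas kh_point = khat_point[OF H _ wc]
lemmas wcD = weighted_colimitD[OF wc]

lemma ext_eqI:
  assumes "small_presheaf U C P" "W \<in> Ob E" "h \<in> Hom E (V P) W" "h' \<in> Hom E (V P) W"
    and "\<And>D x. \<lbrakk>D \<in> Ob K; x \<in> FO P D\<rbrakk> \<Longrightarrow>
      Comp E (FO H D) (V P) W h (\<kappa> P D x) = Comp E (FO H D) (V P) W h' (\<kappa> P D x)"
  shows "h = h'"
  using weighted_colimit_eqI[OF wc[OF assms(1)] H small_presheaf_presheaf[OF assms(1)] assms(2-5)] .

lemma ext_family:
  assumes P: "small_presheaf U C P" and Q: "small_presheaf U C Q" and \<phi>: "\<phi> \<in> Hom Y P Q"
  shows "family H P (V Q) (\<lambda>D x. kh Q D (Comp Y (y D) P Q \<phi> (point P D x)))"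
proof (rule familyI)
  fix D x assume D: "D \<in> Ob K" "x \<in> FO P D"
  have pt: "point P D x \<in> Hom Y (y D) P" by (rule point_in_Hom[OF P D])
  then have \<phi>x: "Comp Y (y D) P Q \<phi> (point P D x) \<in> Hom Y (y D) Q" using P Q D \<phi> by simp
  show "kh Q D (Comp Y (y D) P Q \<phi> (point P D x)) \<in> Hom E (FO H D) (V Q)"
    by (rule kh_in[OF Q Q D(1) \<phi>x])
  fix A k assume A: "A \<in> Ob K" "is_total K A D k"
  have "Comp Y (y A) P Q \<phi> (point P A (FA P D A k x)) = Comp Y (y A) (y D) Q (Comp Y (y D) P Q \<phi> (point P D x)) (FA L A D k)"
    using A D P Q \<phi> pt by (simp add: point_act[symmetric] Y.Comp_assoc L_in_Hom is_total_Hom)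
  then show "kh Q A (Comp Y (y A) P Q \<phi> (point P A (FA P D A k x)))
     = Comp E (FO H A) (FO H D) (V Q) (kh Q D (Comp Y (y D) P Q \<phi> (point P D x))) (FA H A D k)"
    using kh_L[OF Q Q D(1) \<phi>x A(1) is_total_Hom[OF A(2)]] by simp
qed

definition ext_arr where
  "ext_arr P Q \<phi> = (SOME h. h \<in> Hom E (V P) (V Q) \<and> (\<forall>D\<in>Ob K. \<forall>x\<in>FO P D.
     Comp E (FO H D) (V P) (V Q) h (\<kappa> P D x) = kh Q D (Comp Y (y D) P Q \<phi> (point P D x))))"

lemma ext_arr:
  assumes P: "small_presheaf U C P" and Q: "small_presheaf U C Q" and \<phi>: "\<phi> \<in> Hom Y P Q"
  shows "ext_arr P Q \<phi> \<in> Hom E (V P) (V Q)"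
    and "\<lbrakk>D \<in> Ob K; x \<in> FO P D\<rbrakk> \<Longrightarrow>
      Comp E (FO H D) (V P) (V Q) (ext_arr P Q \<phi>) (\<kappa> P D x) = kh Q D (Comp Y (y D) P Q \<phi> (point P D x))"
proof -
  obtain h where "h \<in> Hom E (V P) (V Q)" "\<And>D x. \<lbrakk>D \<in> Ob K; x \<in> FO P D\<rbrakk> \<Longrightarrow>
      Comp E (FO H D) (V P) (V Q) h (\<kappa> P D x) = kh Q D (Comp Y (y D) P Q \<phi> (point P D x))"
    by (rule weighted_colimit_ex[OF wc[OF P] wcD(1)[OF Q] ext_family[OF P Q \<phi>]]) (rule that)
  then have "\<exists>h. h \<in> Hom E (V P) (V Q) \<and> (\<forall>D\<in>Ob K. \<forall>x\<in>FO P D.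
     Comp E (FO H D) (V P) (V Q) h (\<kappa> P D x) = kh Q D (Comp Y (y D) P Q \<phi> (point P D x)))" by blast
  then have *: "ext_arr P Q \<phi> \<in> Hom E (V P) (V Q) \<and> (\<forall>D\<in>Ob K. \<forall>x\<in>FO P D.
     Comp E (FO H D) (V P) (V Q) (ext_arr P Q \<phi>) (\<kappa> P D x) = kh Q D (Comp Y (y D) P Q \<phi> (point P D x)))"
    unfolding ext_arr_def by (rule someI_ex)
  then show "ext_arr P Q \<phi> \<in> Hom E (V P) (V Q)" by blast
  show "\<lbrakk>D \<in> Ob K; x \<in> FO P D\<rbrakk> \<Longrightarrow>
      Comp E (FO H D) (V P) (V Q) (ext_arr P Q \<phi>) (\<kappa> P D x) = kh Q D (Comp Y (y D) P Q \<phi> (point P D x))"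
    using * by blast
qed

lemma ext_arr_khat:
  assumes P: "small_presheaf U C P" and Q: "small_presheaf U C Q" and \<phi>: "\<phi> \<in> Hom Y P Q"
    and D: "D \<in> Ob K" and \<psi>: "\<psi> \<in> Hom Y (y D) P"
  shows "Comp E (FO H D) (V P) (V Q) (ext_arr P Q \<phi>) (kh P D \<psi>) = kh Q D (Comp Y (y D) P Q \<phi> \<psi>)"
proof -
  obtain B z k where B: "B \<in> Ob K" "z \<in> FO P B" "k \<in> Hom K D B"
    and \<psi>_eq: "\<psi> = Comp Y (y D) (y B) P (point P B z) (FA L D B k)" by (rule arrow_from_y[OF \<psi> D P])
  have zt: "point P B z \<in> Hom Y (y B) P" and Lk: "FA L D B k \<in> Hom Y (y D) (y B)"
    using point_in_Hom[OF P B(1,2)] L_in_Hom[OF D B(1,3)] .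
  have \<phi>z: "Comp Y (y B) P Q \<phi> (point P B z) \<in> Hom Y (y B) Q" using P Q B \<phi> zt by simp
  have "Comp E (FO H D) (V P) (V Q) (ext_arr P Q \<phi>) (kh P D \<psi>)
      = Comp E (FO H D) (V P) (V Q) (ext_arr P Q \<phi>) (Comp E (FO H D) (FO H B) (V P) (\<kappa> P B z) (FA H D B k))"
    unfolding \<psi>_eq kh_eq[OF P P D B] ..
  also have "\<dots> = Comp E (FO H D) (FO H B) (V Q) (Comp E (FO H B) (V P) (V Q) (ext_arr P Q \<phi>) (\<kappa> P B z)) (FA H D B k)"
    using H_simps(2,3) wcD(1)[OF P] wcD(1)[OF Q] wcD(4)[OF P B(1,2)] ext_arr(1)[OF P Q \<phi>] D B by (intro E.Comp_assoc) simp_all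
  also have "\<dots> = kh Q D (Comp Y (y D) (y B) Q (Comp Y (y B) P Q \<phi> (point P B z)) (FA L D B k))"
    unfolding ext_arr(2)[OF P Q \<phi> B(1,2)] kh_L[OF Q Q B(1) \<phi>z D B(3)] ..
  also have "Comp Y (y D) (y B) Q (Comp Y (y B) P Q \<phi> (point P B z)) (FA L D B k) = Comp Y (y D) P Q \<phi> \<psi>"
    unfolding \<psi>_eq using P Q B D \<phi> zt Lk by (intro Y.Comp_assoc[symmetric]) simp_all
  finally show ?thesis .
qed

definition ext where "ext = mk_ftor Y V ext_arr"

lemma ext_sel [simp]:
  "small_presheaf U C P \<Longrightarrow> FO ext P = V P"
  "\<lbrakk>small_presheaf U C P; small_presheaf U C Q; \<phi> \<in> Hom Y P Q\<rbrakk> \<Longrightarrow> FA ext P Q \<phi> = ext_arr P Q \<phi>"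
  by (simp_all add: ext_def)

lemma functor_ext: "is_functor Y E ext"
  unfolding ext_def
proof (rule is_functor_mk_ftor[OF Y.category_axioms], goal_cases)
  case (1 P)
  then show ?case using wcD(1) by simp
next
  case (2 P Q \<phi>)
  then show ?case by (simp add: ext_arr)
next
  case (3 P)
  then have P: "small_presheaf U C P" by simp
  show ?case
  proof (rule ext_eqI[OF P])
    fix D x assume D: "D \<in> Ob K" "x \<in> FO P D"
    show "Comp E (FO H D) (V P) (V P) (ext_arr P P (Idt Y P)) (\<kappa> P D x)
      = Comp E (FO H D) (V P) (V P) (Idt E (V P)) (\<kappa> P D x)"
      using D P wcD(1)[OF P] wcD(4)[OF P D] H_simps(2) by (simp add: ext_arr(2) kh_point point_in_Hom)
  qed (use P wcD(1) in \<open>simp_all add: ext_arr(1)\<close>)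
next
  case (4 P Q S \<phi> \<psi>)
  then have P: "small_presheaf U C P" and Q: "small_presheaf U C Q" and S: "small_presheaf U C S" by simp_all
  note VO = wcD(1)[OF P] wcD(1)[OF Q] wcD(1)[OF S]
  note e1 = ext_arr(1)[OF P Q 4(4)] ext_arr(1)[OF Q S 4(5)]
  have c: "Comp Y P Q S \<psi> \<phi> \<in> Hom Y P S" using 4 by simp
  show ?case
  proof (rule ext_eqI[OF P VO(3) ext_arr(1)[OF P S c]])
    show "Comp E (V P) (V Q) (V S) (ext_arr Q S \<psi>) (ext_arr P Q \<phi>) \<in> Hom E (V P) (V S)" using VO e1 by simp
    fix D x assume D: "D \<in> Ob K" "x \<in> FO P D"
    have pt: "point P D x \<in> Hom Y (y D) P" by (rule point_in_Hom[OF P D])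
    have px: "Comp Y (y D) P Q \<phi> (point P D x) \<in> Hom Y (y D) Q" using P Q D 4 pt by simp
    have "Comp E (FO H D) (V P) (V S) (Comp E (V P) (V Q) (V S) (ext_arr Q S \<psi>) (ext_arr P Q \<phi>)) (\<kappa> P D x)
      = Comp E (FO H D) (V Q) (V S) (ext_arr Q S \<psi>) (Comp E (FO H D) (V P) (V Q) (ext_arr P Q \<phi>) (\<kappa> P D x))"
      using VO e1 wcD(4)[OF P D] H_simps(2) D by (intro E.Comp_assoc[symmetric]) simp_all
    also have "\<dots> = kh S D (Comp Y (y D) Q S \<psi> (Comp Y (y D) P Q \<phi> (point P D x)))"
      unfolding ext_arr(2)[OF P Q 4(4) D] by (rule ext_arr_khat[OF Q S 4(5) D(1) px])
    also have "Comp Y (y D) Q S \<psi> (Comp Y (y D) P Q \<phi> (point P D x)) = Comp Y (y D) P S (Comp Y P Q S \<psi> \<phi>) (point P D x)"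
      using P Q S D 4 pt by (intro Y.Comp_assoc) simp_all
    finally show "Comp E (FO H D) (V P) (V S) (ext_arr P S (Comp Y P Q S \<psi> \<phi>)) (\<kappa> P D x)
      = Comp E (FO H D) (V P) (V S) (Comp E (V P) (V Q) (V S) (ext_arr Q S \<psi>) (ext_arr P Q \<phi>)) (\<kappa> P D x)"
      unfolding ext_arr(2)[OF P S c D] by simp
  qed
qed

text \<open>
  Restrictions are compared on each \<open>\<kappa> x\<close>: with \<open>\<phi> x = z k\<close>, where \<open>z\<close> is total, both sides become
  \<open>\<kappa> x\<close> precomposed with the restriction of \<open>k\<close>.
\<close>

lemma restriction_functor_ext: "is_restriction_functor Y E ext"
proof -
  have "ext_arr P P (Rst Y P Q \<phi>) = Rst E (V P) (V Q) (ext_arr P Q \<phi>)"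
    if P: "small_presheaf U C P" and Q: "small_presheaf U C Q" and \<phi>: "\<phi> \<in> Hom Y P Q" for P Q \<phi>
  proof -
    note VO = wcD(1)[OF P] wcD(1)[OF Q] and e1 = ext_arr(1)[OF P Q \<phi>]
    have r: "Rst Y P Q \<phi> \<in> Hom Y P P" using P Q \<phi> by simp
    show ?thesis
    proof (rule ext_eqI[OF P VO(1) ext_arr(1)[OF P P r]])
      show "Rst E (V P) (V Q) (ext_arr P Q \<phi>) \<in> Hom E (V P) (V P)" using VO e1 by simp
      fix D x assume D: "D \<in> Ob K" "x \<in> FO P D"
      have pt: "point P D x \<in> Hom Y (y D) P" by (rule point_in_Hom[OF P D])
      have px: "Comp Y (y D) P Q \<phi> (point P D x) \<in> Hom Y (y D) Q" using P Q D \<phi> pt by simp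
      obtain B z k where B: "B \<in> Ob K" "z \<in> FO Q B" "k \<in> Hom K D B"
        and fac: "Comp Y (y D) P Q \<phi> (point P D x) = Comp Y (y D) (y B) Q (point Q B z) (FA L D B k)"
        by (rule arrow_from_y[OF px D(1) Q])
      have Lk: "FA L D B k \<in> Hom Y (y D) (y B)" by (rule L_in_Hom[OF D(1) B(1,3)])
      have rk: "Rst K D B k \<in> Hom K D D" using D B by simp
      have "Comp Y (y D) P P (Rst Y P Q \<phi>) (point P D x)
          = Comp Y (y D) (y D) P (point P D x) (Rst Y (y D) Q (Comp Y (y D) P Q \<phi> (point P D x)))"
        using D P Q \<phi> pt by (intro Y.R4) simp_all
      also have "Rst Y (y D) Q (Comp Y (y D) P Q \<phi> (point P D x)) = FA L D D (Rst K D B k)"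
        unfolding fac using Y.Rst_Comp_total[of "y D" "y B" Q "FA L D B k" "point Q B z"] D B Q Lk point_total[OF Q B(1,2)]
        by (simp add: L_Rst)
      finally have "Comp E (FO H D) (V P) (V P) (ext_arr P P (Rst Y P Q \<phi>)) (\<kappa> P D x)
          = Comp E (FO H D) (FO H D) (V P) (\<kappa> P D x) (FA H D D (Rst K D B k))"
        unfolding ext_arr(2)[OF P P r D] using kh_eq[OF P P D(1) D rk] by simp
      also have "FA H D D (Rst K D B k) = Rst E (FO H D) (V Q) (Comp E (FO H D) (V P) (V Q) (ext_arr P Q \<phi>) (\<kappa> P D x))"
        unfolding ext_arr(2)[OF P Q \<phi> D] fac kh_eq[OF Q Q D(1) B]
        using E.Rst_Comp_total[of "FO H D" "FO H B" "V Q" "FA H D B k" "\<kappa> Q B z"] H_simps D B VO wcD(3)[OF Q B(1,2)] by simp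
      also have "Comp E (FO H D) (FO H D) (V P) (\<kappa> P D x) \<dots>
          = Comp E (FO H D) (V P) (V P) (Rst E (V P) (V Q) (ext_arr P Q \<phi>)) (\<kappa> P D x)"
        using VO e1 H_simps(2) D wcD(4)[OF P D] by (intro E.R4[symmetric]) simp_all
      finally show "Comp E (FO H D) (V P) (V P) (ext_arr P P (Rst Y P Q \<phi>)) (\<kappa> P D x)
        = Comp E (FO H D) (V P) (V P) (Rst E (V P) (V Q) (ext_arr P Q \<phi>)) (\<kappa> P D x)" .
    qed
  qed
  then show ?thesis
    unfolding is_restriction_functor_def using functor_ext by simp
qed

lemma ext_tarr:
  assumes P: "small_presheaf U C P" and Q: "small_presheaf U C Q" and a: "natural P Q \<alpha>"
    and D: "D \<in> Ob K" "x \<in> FO P D"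
  shows "Comp E (FO H D) (V P) (V Q) (ext_arr P Q (tarr P Q \<alpha>)) (\<kappa> P D x) = \<kappa> Q D (\<alpha> D x)"
  using ext_arr(2)[OF P Q is_total_Hom[OF tarr_total[OF P Q a]] D] tarr_point[OF P Q a D]
    kh_point[OF Q Q D(1) naturalD(2)[OF a D]] by simp

text \<open>
  Total arrows from the weighted colimit at \<open>W\<close> to \<open>Z\<close> are transformations from \<open>W\<close> to the presheaf of
  total arrows \<open>H D \<rightarrow> Z\<close>. This presheaf need not be small, so the universal property of the
  colimit \<open>W\<close> against all presheaves is used.
\<close>

lemma cocontinuous_ext: "cocontinuous U Y E ext"
  unfolding cocontinuous_def preserves_small_colimits_def
proof (intro allI impI, elim conjE)
  fix J :: "('u, 'u) cat" and T W c
  assume J: "small_category U J" and T: "is_functor J (Total Y) T" and c: "is_colimit J (Total Y) T W c"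
  obtain \<tau> \<gamma> where \<tau>: "\<And>i j u. \<lbrakk>i \<in> Ob J; j \<in> Ob J; u \<in> Hom J i j\<rbrakk> \<Longrightarrow>
      natural (FO T i) (FO T j) (\<tau> i j u) \<and> FA T i j u = tarr (FO T i) (FO T j) (\<tau> i j u)"
    and \<gamma>: "\<And>i. i \<in> Ob J \<Longrightarrow> natural (FO T i) W (\<gamma> i) \<and> c i = tarr (FO T i) W (\<gamma> i)"
    and cover: "\<And>A v. \<lbrakk>A \<in> Ob K; v \<in> FO W A\<rbrakk> \<Longrightarrow> \<exists>i\<in>Ob J. \<exists>t\<in>FO (FO T i) A. v = \<gamma> i A t"
    and univ: "\<And>G d. nat_cocone J (FO T) \<tau> G d \<Longrightarrow>
       \<exists>h. natural W G h \<and> (\<forall>i\<in>Ob J. \<forall>A\<in>Ob K. \<forall>t\<in>FO (FO T i) A. h A (\<gamma> i A t) = d i A t)"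
    by (rule colimit_Total_Y[OF J T c]) (rule that)
  have catJ: "category J" using J by (simp add: small_category_def)
  have cc: "is_cocone J (Total Y) T W c" using c by (simp add: is_colimit_def)
  have sT [simp]: "small_presheaf U C (FO T i)" if "i \<in> Ob J" for i using is_functorD(1)[OF T that] by simp
  have sW [simp]: "small_presheaf U C W" using cc by (simp add: is_cocone_def)
  have pT: "presheaf (FO T i)" if "i \<in> Ob J" for i using sT[OF that] by (rule small_presheaf_presheaf)
  have pW: "presheaf W" using sW by (rule small_presheaf_presheaf)
  have Tt: "is_total Y (FO T i) (FO T j) (FA T i j u)" if "i \<in> Ob J" "j \<in> Ob J" "u \<in> Hom J i j" for i j u
    using is_functorD(2)[OF T that] by simp
  have ct: "is_total Y (FO T i) W (c i)" if "i \<in> Ob J" for i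
    using cc that by (simp add: is_cocone_def)
  have ext_tot: "is_total E (V P) (V Q) (ext_arr P Q \<phi>)" if "small_presheaf U C P" "small_presheaf U C Q" "is_total Y P Q \<phi>" for P Q \<phi>
    using restriction_functor_total[OF restriction_functor_ext _ _ that(3)] that by (simp add: is_total_Hom)
  note VO [simp] = wcD(1)[OF sW] wcD(1)[OF sT]
  let ?D = "comp_ftor J (Total_ftor Y ext) T"
  let ?c = "\<lambda>i. FA (Total_ftor Y ext) (FO T i) W (c i)"
  have D0: "FO ?D i = V (FO T i)" if "i \<in> Ob J" for i
    using that by (simp add: Total_ftor_def)
  have D1: "FA ?D i j u = ext_arr (FO T i) (FO T j) (FA T i j u)" if "i \<in> Ob J" "j \<in> Ob J" "u \<in> Hom J i j" for i j u
    using that Tt[OF that] by (simp add: Total_ftor_def is_total_Hom)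
  have c0: "?c i = ext_arr (FO T i) W (c i)" if "i \<in> Ob J" for i
    using that ct[OF that] by (simp add: Total_ftor_def is_total_Hom)
  have W0: "FO (Total_ftor Y ext) W = V W" by (simp add: Total_ftor_def)
  have c\<kappa>: "Comp E (FO H A) (V (FO T i)) (V W) (ext_arr (FO T i) W (c i)) (\<kappa> (FO T i) A t) = \<kappa> W A (\<gamma> i A t)"
    if "i \<in> Ob J" "A \<in> Ob K" "t \<in> FO (FO T i) A" for i A t
    using ext_tarr[OF sT sW _ that(2,3)] that \<gamma>[OF that(1)] by simp
  have D\<kappa>: "Comp E (FO H A) (V (FO T i)) (V (FO T j)) (ext_arr (FO T i) (FO T j) (FA T i j u)) (\<kappa> (FO T i) A t) = \<kappa> (FO T j) A (\<tau> i j u A t)"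
    if "i \<in> Ob J" "j \<in> Ob J" "u \<in> Hom J i j" "A \<in> Ob K" "t \<in> FO (FO T i) A" for i j u A t
    using ext_tarr[OF sT sT _ that(4,5)] that \<tau>[OF that(1-3)] by simp
  have coc\<gamma>: "\<gamma> j A (\<tau> i j u A t) = \<gamma> i A t"
    if *: "i \<in> Ob J" "j \<in> Ob J" "u \<in> Hom J i j" "A \<in> Ob K" "t \<in> FO (FO T i) A" for i j u A t
  proof -
    have "Comp Y (FO T i) (FO T j) W (c j) (FA T i j u) = c i"
      using cc * by (simp add: is_cocone_def)
    then have "tarr (FO T i) W (Comp (Psh U C) (FO T i) (FO T j) W (\<gamma> j) (\<tau> i j u)) = tarr (FO T i) W (\<gamma> i)"
      using * \<gamma> \<tau> by (simp add: tarr_Comp)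
    then have "Comp (Psh U C) (FO T i) (FO T j) W (\<gamma> j) (\<tau> i j u) = \<gamma> i"
      using * \<gamma> \<tau> pT by (intro tarr_inj[of "FO T i" W]) (auto intro: natural_Comp)
    from fun_cong[OF fun_cong[OF this], of A t] show ?thesis using * by simp
  qed
  have "is_colimit J (Total E) ?D (V W) ?c"
    unfolding is_colimit_def
  proof (intro conjI allI impI)
    show "is_cocone J (Total E) ?D (V W) ?c"
      unfolding is_cocone_def
    proof (intro conjI ballI)
      fix i j u assume *: "i \<in> Ob J" "j \<in> Ob J" "u \<in> Hom J i j"
      have "ext_arr (FO T i) W (Comp Y (FO T i) (FO T j) W (c j) (FA T i j u))
        = Comp E (V (FO T i)) (V (FO T j)) (V W) (ext_arr (FO T j) W (c j)) (ext_arr (FO T i) (FO T j) (FA T i j u))"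
        using is_functorD(4)[OF functor_ext, of "FO T i" "FO T j" W "FA T i j u" "c j"] * Tt[OF *] ct
        by (simp add: is_total_Hom)
      moreover have "Comp Y (FO T i) (FO T j) W (c j) (FA T i j u) = c i"
        using cc * by (simp add: is_cocone_def)
      ultimately show "Comp (Total E) (FO ?D i) (FO ?D j) (V W) (?c j) (FA ?D i j u) = ?c i"
        using * by (simp only: D0 D1 c0 Total_sel)
    next
      fix i assume "i \<in> Ob J"
      then show "?c i \<in> Hom (Total E) (FO ?D i) (V W)"
        using ext_tot[OF sT sW ct] by (simp only: D0 c0 Total_sel)
    qed simp
  next
    fix Z d assume d: "is_cocone J (Total E) ?D Z d"
    have Z: "Z \<in> Ob E" using d by (simp add: is_cocone_def)
    have dt: "is_total E (V (FO T i)) Z (d i)" if "i \<in> Ob J" for i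
      using d that unfolding is_cocone_def by (metis D0 Total_sel(2))
    have d1: "Comp E (V (FO T i)) (V (FO T j)) Z (d j) (ext_arr (FO T i) (FO T j) (FA T i j u)) = d i"
      if "i \<in> Ob J" "j \<in> Ob J" "u \<in> Hom J i j" for i j u
      using d that unfolding is_cocone_def by (metis D0 D1 Total_sel(3))
    \<comment> \<open>The presheaf of total arrows into \<open>Z\<close>, which turns the cocone into one of presheaves.\<close>
    define G0 where "G0 A = Collect (is_total E (FO H A) Z)" for A
    define G1 where "G1 A B k g = Comp E (FO H B) (FO H A) Z g (FA H B A k)" for A B k g
    have G: "action G0 G1"
      unfolding G0_def G1_def by (rule action_total[OF H Z])
    define \<delta> where "\<delta> i A t = Comp E (FO H A) (V (FO T i)) Z (d i) (\<kappa> (FO T i) A t)" for i A t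
    have \<delta>0: "\<delta> i A t \<in> G0 A" if "i \<in> Ob J" "A \<in> Ob K" "t \<in> FO (FO T i) A" for i A t
      using that dt wcD(3)[OF sT] H_simps(2) Z by (simp add: G0_def \<delta>_def E.total_Comp)
    have \<delta>1: "\<delta> i B (FA (FO T i) A B k t) = G1 A B k (\<delta> i A t)"
      if "i \<in> Ob J" "A \<in> Ob K" "B \<in> Ob K" "is_total K B A k" "t \<in> FO (FO T i) A" for i A B k t
      using that wcD(4,5)[OF sT] H_simps(2,3) Z is_total_Hom[OF dt]
      by (simp add: G1_def \<delta>_def E.Comp_assoc is_total_Hom)
    have \<delta>2: "\<delta> j A (\<tau> i j u A t) = \<delta> i A t"
      if *: "i \<in> Ob J" "j \<in> Ob J" "u \<in> Hom J i j" "A \<in> Ob K" "t \<in> FO (FO T i) A" for i j u A t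
    proof -
      have et: "ext_arr (FO T i) (FO T j) (FA T i j u) \<in> Hom E (V (FO T i)) (V (FO T j))"
        using * Tt[OF *(1-3)] by (intro ext_arr(1)) (simp_all add: is_total_Hom)
      have "\<delta> i A t = Comp E (FO H A) (V (FO T i)) Z (Comp E (V (FO T i)) (V (FO T j)) Z (d j)
          (ext_arr (FO T i) (FO T j) (FA T i j u))) (\<kappa> (FO T i) A t)"
        using * by (simp add: \<delta>_def d1)
      also have "\<dots> = Comp E (FO H A) (V (FO T j)) Z (d j) (Comp E (FO H A) (V (FO T i)) (V (FO T j))
          (ext_arr (FO T i) (FO T j) (FA T i j u)) (\<kappa> (FO T i) A t))"
        using * et Z is_total_Hom[OF dt] wcD(4)[OF sT] H_simps(2) by (intro E.Comp_assoc[symmetric]) simp_all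
      finally show ?thesis using * by (simp add: D\<kappa> \<delta>_def)
    qed
    let ?G = "encode G0 G1"
    let ?\<delta> = "\<lambda>i. mk_nat (FO T i) (\<lambda>A t. encoding G0 A (\<delta> i A t))"
    have "nat_cocone J (FO T) \<tau> ?G ?\<delta>"
      unfolding nat_cocone_def
    proof (intro conjI ballI presheaf_encode[OF G])
      show "natural (FO T i) ?G (?\<delta> i)" if "i \<in> Ob J" for i
        by (rule natural_mk_nat[OF pT[OF that]]) (use that in \<open>simp_all add: encode_sel[OF G] \<delta>0 \<delta>1\<close>)
      fix i j u A t assume *: "i \<in> Ob J" "j \<in> Ob J" "u \<in> Hom J i j" "A \<in> Ob K" "t \<in> FO (FO T i) A"
      have "\<tau> i j u A t \<in> FO (FO T j) A" using * \<tau>[OF *(1-3)] naturalD(2) by blast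
      then show "?\<delta> j A (\<tau> i j u A t) = ?\<delta> i A t" using * by (simp add: \<delta>2)
    qed
    from univ[OF this] obtain \<sigma>' where \<sigma>': "natural W ?G \<sigma>'"
      and \<sigma>'\<gamma>: "\<And>i A t. \<lbrakk>i \<in> Ob J; A \<in> Ob K; t \<in> FO (FO T i) A\<rbrakk> \<Longrightarrow> \<sigma>' A (\<gamma> i A t) = ?\<delta> i A t" by blast
    define \<sigma> where "\<sigma> A v = inv_into (G0 A) (encoding G0 A) (\<sigma>' A v)" for A v
    have \<sigma>\<gamma>: "\<sigma> A (\<gamma> i A t) = \<delta> i A t" if "i \<in> Ob J" "A \<in> Ob K" "t \<in> FO (FO T i) A" for i A t
      using that encoding_inj[OF G that(2)] by (simp add: \<sigma>_def \<sigma>'\<gamma> \<delta>0)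
    have fam: "family H W Z \<sigma>"
    proof (rule familyI)
      fix A v assume A: "A \<in> Ob K" "v \<in> FO W A"
      obtain i t where i: "i \<in> Ob J" "t \<in> FO (FO T i) A" "v = \<gamma> i A t" using cover[OF A] by blast
      show "\<sigma> A v \<in> Hom E (FO H A) Z" using \<delta>0[OF i(1) A(1) i(2)] i A \<sigma>\<gamma> by (simp add: G0_def is_total_Hom)
      fix B k assume B: "B \<in> Ob K" "is_total K B A k"
      have "FA W A B k v = \<gamma> i B (FA (FO T i) A B k t)"
        using i A B naturalD(3)[OF conjunct1[OF \<gamma>[OF i(1)]] A(1) pT[OF i(1)] B i(2)] by simp
      then show "\<sigma> B (FA W A B k v) = Comp E (FO H B) (FO H A) Z (\<sigma> A v) (FA H B A k)"
        using i A B presheafD(3)[OF pT[OF i(1)] A(1) B i(2)] by (simp add: \<sigma>\<gamma> \<delta>1 G1_def)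
    qed
    obtain h where h: "h \<in> Hom E (V W) Z"
      and h\<kappa>: "\<And>A v. \<lbrakk>A \<in> Ob K; v \<in> FO W A\<rbrakk> \<Longrightarrow> Comp E (FO H A) (V W) Z h (\<kappa> W A v) = \<sigma> A v"
      by (rule weighted_colimit_ex[OF wc[OF sW] Z fam]) (rule that)
    have \<gamma>0: "\<gamma> i A t \<in> FO W A" if "i \<in> Ob J" "A \<in> Ob K" "t \<in> FO (FO T i) A" for i A t
      using naturalD(2)[OF conjunct1[OF \<gamma>[OF that(1)]] that(2,3)] .
    have c1: "ext_arr (FO T i) W (c i) \<in> Hom E (V (FO T i)) (V W)" if "i \<in> Ob J" for i
      using ext_tot[OF sT sW ct] that by (simp add: is_total_Hom)
    have assoc: "Comp E (FO H A) (V (FO T i)) Z (Comp E (V (FO T i)) (V W) Z g (ext_arr (FO T i) W (c i))) (\<kappa> (FO T i) A t)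
        = Comp E (FO H A) (V W) Z g (\<kappa> W A (\<gamma> i A t))"
      if "g \<in> Hom E (V W) Z" "i \<in> Ob J" "A \<in> Ob K" "t \<in> FO (FO T i) A" for g i A t
      using that c1 Z wcD(4)[OF sT] H_simps(2) by (simp add: E.Comp_assoc[symmetric] c\<kappa>)
    have ht: "is_total E (V W) Z h"
    proof (rule weighted_colimit_total[OF wc[OF sW] H pW Z h])
      fix A v assume A: "A \<in> Ob K" "v \<in> FO W A"
      obtain i t where i: "i \<in> Ob J" "t \<in> FO (FO T i) A" "v = \<gamma> i A t" using cover[OF A] by blast
      then show "is_total E (FO H A) Z (Comp E (FO H A) (V W) Z h (\<kappa> W A v))"
        using A \<delta>0[OF i(1) A(1) i(2)] h\<kappa>[OF A] \<sigma>\<gamma> by (simp add: G0_def)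
    qed
    have hc: "Comp E (V (FO T i)) (V W) Z h (ext_arr (FO T i) W (c i)) = d i" if i: "i \<in> Ob J" for i
    proof (rule ext_eqI[OF sT[OF i] Z])
      fix A t assume A: "A \<in> Ob K" "t \<in> FO (FO T i) A"
      show "Comp E (FO H A) (V (FO T i)) Z (Comp E (V (FO T i)) (V W) Z h (ext_arr (FO T i) W (c i))) (\<kappa> (FO T i) A t)
        = Comp E (FO H A) (V (FO T i)) Z (d i) (\<kappa> (FO T i) A t)"
        using assoc[OF h i A] h\<kappa>[OF A(1) \<gamma>0[OF i A]] \<sigma>\<gamma>[OF i A] by (simp add: \<delta>_def)
    qed (use i Z h c1 is_total_Hom[OF dt] in simp_all)
    have uniq: "g = h" if g: "is_total E (V W) Z g"
      and gc: "\<And>i. i \<in> Ob J \<Longrightarrow> Comp E (V (FO T i)) (V W) Z g (ext_arr (FO T i) W (c i)) = d i" for g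
    proof (rule ext_eqI[OF sW Z is_total_Hom[OF g] h])
      fix A v assume A: "A \<in> Ob K" "v \<in> FO W A"
      obtain i t where i: "i \<in> Ob J" "t \<in> FO (FO T i) A" "v = \<gamma> i A t" using cover[OF A] by blast
      show "Comp E (FO H A) (V W) Z g (\<kappa> W A v) = Comp E (FO H A) (V W) Z h (\<kappa> W A v)"
        using assoc[OF is_total_Hom[OF g] i(1) A(1) i(2)] assoc[OF h i(1) A(1) i(2)] gc[OF i(1)] hc[OF i(1)] i(3) by simp
    qed
    show "\<exists>!h. h \<in> Hom (Total E) (V W) Z \<and> (\<forall>i\<in>Ob J. Comp (Total E) (FO ?D i) (V W) Z h (?c i) = d i)"
    proof (rule ex1I[of _ h])
      show "h \<in> Hom (Total E) (V W) Z \<and> (\<forall>i\<in>Ob J. Comp (Total E) (FO ?D i) (V W) Z h (?c i) = d i)"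
      proof (intro conjI ballI)
        show "h \<in> Hom (Total E) (V W) Z" using ht by simp
        show "Comp (Total E) (FO ?D i) (V W) Z h (?c i) = d i" if "i \<in> Ob J" for i
          using hc[OF that] that by (simp only: D0 c0 Total_sel)
      qed
      fix g assume g: "g \<in> Hom (Total E) (V W) Z \<and> (\<forall>i\<in>Ob J. Comp (Total E) (FO ?D i) (V W) Z g (?c i) = d i)"
      have "Comp E (V (FO T i)) (V W) Z g (ext_arr (FO T i) W (c i)) = d i" if "i \<in> Ob J" for i
        using g that by (metis D0 c0 Total_sel(3))
      then show "g = h" using g by (intro uniq) simp_all
    qed
  qed
  then show "is_colimit J (Total E) ?D (FO (Total_ftor Y ext) W) ?c"
    by (simp only: W0)
qed

text \<open>
  By the Yoneda lemma \<open>H D\<close> is itself a weighted colimit of \<open>H\<close> by \<open>y D\<close>, with coprojections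
  \<open>H k\<close>; the inverse of the comparison is the coprojection at the identity.
\<close>

lemma ext_iso_H:
  obtains \<theta> where "is_restriction_trans K E (comp_ftor K ext L) H \<theta>"
    "\<And>D. D \<in> Ob K \<Longrightarrow> is_iso E (V (y D)) (FO H D) (\<theta> D)"
proof -
  note [simp] = H_simps(2,3) wcD(1)[OF small_presheaf_y]
  let ?one = "\<lambda>D. code D D (Idt K D)"
  have "\<exists>h. h \<in> Hom E (V (y D)) (FO H D) \<and> (\<forall>A\<in>Ob K. \<forall>k. is_total K A D k \<longrightarrow>
      Comp E (FO H A) (V (y D)) (FO H D) h (\<kappa> (y D) A (code A D k)) = FA H A D k)" if D: "D \<in> Ob K" for D
  proof -
    let ?d = "\<lambda>A v. FA H A D (dec U C A D v)"
    have "family H (y D) (FO H D) ?d"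
    proof (rule familyI)
      fix A v assume A: "A \<in> Ob K" "v \<in> FO (y D) A"
      obtain k where k: "is_total K A D k" "v = code A D k" by (rule y_elemE[OF A(2) D A(1)])
      then show "?d A v \<in> Hom E (FO H A) (FO H D)" using A D by (simp add: is_total_Hom)
      fix B l assume B: "B \<in> Ob K" "is_total K B A l"
      then show "?d B (FA (y D) A B l v) = Comp E (FO H B) (FO H A) (FO H D) (?d A v) (FA H B A l)"
        using A D k by (simp add: y_sel(2) total_Comp is_total_Hom H_simps(5))
    qed
    from weighted_colimit_ex[OF wc[OF small_presheaf_y[OF D]] H_simps(2)[OF D] this]
    obtain h where h: "h \<in> Hom E (V (y D)) (FO H D)" and h\<kappa>: "\<And>A v. \<lbrakk>A \<in> Ob K; v \<in> FO (y D) A\<rbrakk> \<Longrightarrow>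
      Comp E (FO H A) (V (y D)) (FO H D) h (\<kappa> (y D) A v) = ?d A v" by metis
    have "Comp E (FO H A) (V (y D)) (FO H D) h (\<kappa> (y D) A (code A D k)) = FA H A D k"
      if "A \<in> Ob K" "is_total K A D k" for A k
      using that D h\<kappa>[of A "code A D k"] by simp
    then show ?thesis using h by blast
  qed
  then obtain \<theta>0 where t: "\<And>D. D \<in> Ob K \<Longrightarrow> \<theta>0 D \<in> Hom E (V (y D)) (FO H D)"
    and t\<kappa>: "\<And>D A k. \<lbrakk>D \<in> Ob K; A \<in> Ob K; is_total K A D k\<rbrakk> \<Longrightarrow>
      Comp E (FO H A) (V (y D)) (FO H D) (\<theta>0 D) (\<kappa> (y D) A (code A D k)) = FA H A D k" by metis
  have k1: "\<kappa> (y D) A (code A D k) \<in> Hom E (FO H A) (V (y D))" if "D \<in> Ob K" "A \<in> Ob K" "is_total K A D k" for D A k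
    using that wcD(4)[OF small_presheaf_y[OF that(1)] that(2)] by simp
  have \<kappa>_one: "Comp E (FO H A) (FO H D) (V (y D)) (\<kappa> (y D) D (?one D)) (FA H A D k) = \<kappa> (y D) A (code A D k)"
    if "D \<in> Ob K" "A \<in> Ob K" "is_total K A D k" for D A k
    using wcD(5)[OF small_presheaf_y[OF that(1)] that(1) _ that(2,3), of "?one D"] that by (simp add: y_sel(2) is_total_Hom)
  have inv: "Comp E (V (y D)) (FO H D) (V (y D)) (\<kappa> (y D) D (?one D)) (\<theta>0 D) = Idt E (V (y D))" if D: "D \<in> Ob K" for D
  proof (rule ext_eqI[OF small_presheaf_y[OF D]])
    fix A v assume A: "A \<in> Ob K" "v \<in> FO (y D) A"
    obtain k where k: "is_total K A D k" "v = code A D k" by (rule y_elemE[OF A(2) D A(1)])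
    show "Comp E (FO H A) (V (y D)) (V (y D)) (Comp E (V (y D)) (FO H D) (V (y D)) (\<kappa> (y D) D (?one D)) (\<theta>0 D)) (\<kappa> (y D) A v)
      = Comp E (FO H A) (V (y D)) (V (y D)) (Idt E (V (y D))) (\<kappa> (y D) A v)"
      using A D k t k1 by (simp add: E.Comp_assoc[symmetric] t\<kappa> \<kappa>_one)
  qed (use D t k1 in simp_all)
  have tt: "is_total E (V (y D)) (FO H D) (\<theta>0 D)" if D: "D \<in> Ob K" for D
    using E.total_right_factor[of "V (y D)" "FO H D" "V (y D)" "\<theta>0 D" "\<kappa> (y D) D (?one D)"] inv[OF D] D t k1 by simp
  have iso: "is_iso E (V (y D)) (FO H D) (\<theta>0 D)" if D: "D \<in> Ob K" for D
    unfolding is_iso_def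
    using D t k1 inv[OF D] t\<kappa>[OF D D total_Idt[OF D]] H_simps(4)[OF D] by (auto intro!: bexI[of _ "\<kappa> (y D) D (?one D)"])
  have nat: "Comp E (V (y D)) (V (y B)) (FO H B) (\<theta>0 B) (ext_arr (y D) (y B) (FA L D B f))
      = Comp E (V (y D)) (FO H D) (FO H B) (FA H D B f) (\<theta>0 D)"
    if D: "D \<in> Ob K" and B: "B \<in> Ob K" and f: "f \<in> Hom K D B" for D B f
  proof (rule ext_eqI[OF small_presheaf_y[OF D]])
    note sD = small_presheaf_y[OF D] and sB = small_presheaf_y[OF B] and Lf = L_in_Hom[OF D B f]
    note e1 = ext_arr(1)[OF sD sB Lf]
    fix A v assume A: "A \<in> Ob K" "v \<in> FO (y D) A"
    obtain k where k: "is_total K A D k" "v = code A D k" by (rule y_elemE[OF A(2) D A(1)])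
    note kh' = is_total_Hom[OF k(1)]
    have fk: "Comp K A D B f k \<in> Hom K A B" using A B D f kh' by simp
    have "Comp Y (y A) (y D) (y B) (FA L D B f) (point (y D) A v) = Comp Y (y A) (y B) (y B) (point (y B) B (?one B)) (FA L A B (Comp K A D B f k))"
      using A B D f kh' k fk restriction_functorD(4)[OF restriction_functor_L B]
      by (simp add: point_code L_Comp L_in_Hom)
    then have "Comp E (FO H A) (V (y D)) (V (y B)) (ext_arr (y D) (y B) (FA L D B f)) (\<kappa> (y D) A v)
        = Comp E (FO H A) (FO H B) (V (y B)) (\<kappa> (y B) B (?one B)) (FA H A B (Comp K A D B f k))"
      using ext_arr(2)[OF sD sB Lf A] kh_eq[OF sB sB A(1) B _ fk, of "?one B"] B by simp
    then have "Comp E (FO H A) (V (y D)) (FO H B) (Comp E (V (y D)) (V (y B)) (FO H B) (\<theta>0 B) (ext_arr (y D) (y B) (FA L D B f))) (\<kappa> (y D) A v)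
        = Comp E (FO H A) (V (y B)) (FO H B) (\<theta>0 B) (Comp E (FO H A) (FO H B) (V (y B)) (\<kappa> (y B) B (?one B)) (FA H A B (Comp K A D B f k)))"
      using A B D k t k1 e1 by (simp add: E.Comp_assoc[symmetric])
    also have "\<dots> = Comp E (FO H A) (FO H B) (FO H B) (Comp E (FO H B) (V (y B)) (FO H B) (\<theta>0 B) (\<kappa> (y B) B (?one B))) (FA H A B (Comp K A D B f k))"
      using A B D t k1 fk by (intro E.Comp_assoc) simp_all
    also have "\<dots> = FA H A B (Comp K A D B f k)"
      using A B fk t\<kappa>[OF B B total_Idt[OF B]] H_simps(4)[OF B] by simp
    also have "\<dots> = Comp E (FO H A) (FO H D) (FO H B) (FA H D B f) (Comp E (FO H A) (V (y D)) (FO H D) (\<theta>0 D) (\<kappa> (y D) A v))"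
      using A B D f k kh' by (simp add: t\<kappa> H_simps(5))
    also have "\<dots> = Comp E (FO H A) (V (y D)) (FO H B) (Comp E (V (y D)) (FO H D) (FO H B) (FA H D B f) (\<theta>0 D)) (\<kappa> (y D) A v)"
      using A B D f k t k1 by (intro E.Comp_assoc) simp_all
    finally show "Comp E (FO H A) (V (y D)) (FO H B) (Comp E (V (y D)) (V (y B)) (FO H B) (\<theta>0 B) (ext_arr (y D) (y B) (FA L D B f))) (\<kappa> (y D) A v)
      = Comp E (FO H A) (V (y D)) (FO H B) (Comp E (V (y D)) (FO H D) (FO H B) (FA H D B f) (\<theta>0 D)) (\<kappa> (y D) A v)" .
  qed (use D B f t ext_arr(1)[OF small_presheaf_y[OF D] small_presheaf_y[OF B] L_in_Hom[OF D B f]] in simp_all)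
  show thesis
  proof (rule that[of "restrict \<theta>0 (Ob K)"])
    show "is_restriction_trans K E (comp_ftor K ext L) H (restrict \<theta>0 (Ob K))"
      by (rule restriction_transI) (simp_all add: tt nat L_in_Hom)
  qed (simp add: iso)
qed

end

section \<open>The free cocompletion\<close>

lemma (in cocompletion) extension_exists:
  assumes H: "is_restriction_functor K E H"
  obtains F \<theta> where "is_restriction_functor Y E F" "cocontinuous U Y E F"
    "is_restriction_trans K E (comp_ftor K F L) H \<theta>"
    "\<And>D. D \<in> Ob K \<Longrightarrow> is_iso E (FO (comp_ftor K F L) D) (FO H D) (\<theta> D)"
proof -
  have "\<exists>V \<kappa>. weighted_colimit H P V \<kappa>" if "small_presheaf U C P" for P
    by (rule weighted_colimit_exists[OF H that]) blast
  then obtain V \<kappa> where wc: "\<And>P. small_presheaf U C P \<Longrightarrow> weighted_colimit H P (V P) (\<kappa> P)" by metis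
  interpret extension K U E H V \<kappa>
    by unfold_locales (use H wc in auto)
  obtain \<theta> where "is_restriction_trans K E (comp_ftor K ext L) H \<theta>"
    "\<And>D. D \<in> Ob K \<Longrightarrow> is_iso E (V (y D)) (FO H D) (\<theta> D)"
    by (rule ext_iso_H) (rule that)
  then show thesis
    using that[OF restriction_functor_ext cocontinuous_ext] by simp
qed

text \<open>
  Transformations and functors are moved first along \<open>J\<close>, then along \<open>L\<close>: \<open>\<Lambda> = L \<circ> J\<close>.
\<close>

theorem corollary45:
  fixes U :: "'u itself"
    and X :: "('o, 'a) rcat"
    and E :: "('p, 'b) rcat"
  assumes "universe U"
    and "restriction_category X" and "locally_small U X"
    and "restriction_category E" and "locally_small U E" and "cocomplete U E"
  shows "is_equivalence
    (rCocomp U (Par (P_M U (MTotal (K_r X)))) E)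
    (rCAT X E)
    (precomp (rCocomp U (Par (P_M U (MTotal (K_r X)))) E) X (Lambda U X))"
proof -
  interpret X: restriction_category X by fact
  interpret K: restriction_category "K_r X" by (rule X.restriction_category_K_r)
  interpret E: restriction_category E by fact
  have splitE: "split E" using assms(6) by (simp add: cocomplete_def)
  interpret cocompletion "K_r X" U E
    by unfold_locales (use assms X.split_K_r X.locally_small_K_r in auto)
  let ?J = "J_emb X" and ?K = "K_r X" and ?\<Lambda> = "Lambda U X"
  note J = X.restriction_functor_J
  note J' = restriction_functorD[OF J]
  have Lam: "?\<Lambda> = comp_ftor X L ?J"
    unfolding Lambda_def Let_def L_def by (rule comp_ftor_assoc[OF J'(1), symmetric])
  have \<Lambda>: "is_restriction_functor X Y ?\<Lambda>"
    unfolding Lam by (rule restriction_functor_comp[OF assms(2) J restriction_functor_L])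
  have \<Lambda>J: "comp_ftor X F ?\<Lambda> = comp_ftor X (comp_ftor ?K F L) ?J" for F :: "(_, _, 'p, 'b) ftor"
    unfolding Lam by (rule comp_ftor_assoc[OF J'(1), symmetric])
  let ?A = "rCocomp U Y E"
  have JK: "(A, Idt X A) \<in> Ob ?K" if "A \<in> Ob X" for A
    using J'(2)[OF that] that by simp
  have \<Lambda>0: "FO ?\<Lambda> A = y (A, Idt X A)" if "A \<in> Ob X" for A
    using that JK[OF that] unfolding Lam by simp
  have whisker: "is_restriction_trans ?K E (comp_ftor ?K F L) (comp_ftor ?K G L) (\<lambda>D\<in>Ob ?K. \<beta> (y D))"
    if F: "is_restriction_functor Y E F" and G: "is_restriction_functor Y E G"
      and \<beta>: "is_restriction_trans Y E F G \<beta>" for F G :: "(_, _, 'p, 'b) ftor" and \<beta>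
    by (rule restriction_transI)
      (use restriction_transD[OF \<beta>] restriction_functorD[OF restriction_functor_L] in simp_all)
  show ?thesis
  proof (rule is_equivalenceI)
    show "category ?A" "category (rCAT X E)"
      using category_rCocomp[OF assms(4)] category_rCAT[OF assms(4)] .
    show "is_functor ?A (rCAT X E) (precomp ?A X ?\<Lambda>)"
      by (rule is_functor_precomp[OF assms(2) \<Lambda> assms(4)])
  next
    fix F G \<alpha> assume "F \<in> Ob ?A" "G \<in> Ob ?A"
      and "\<alpha> \<in> Hom (rCAT X E) (FO (precomp ?A X ?\<Lambda>) F) (FO (precomp ?A X ?\<Lambda>) G)"
    then have F: "is_restriction_functor Y E F" "cocontinuous U Y E F"
      and G: "is_restriction_functor Y E G" "cocontinuous U Y E G"
      and \<alpha>: "is_restriction_trans X E (comp_ftor X (comp_ftor ?K F L) ?J) (comp_ftor X (comp_ftor ?K G L) ?J) \<alpha>"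
      by (simp_all add: precomp_def \<Lambda>J)
    obtain \<beta> where \<beta>: "is_restriction_trans ?K E (comp_ftor ?K F L) (comp_ftor ?K G L) \<beta>"
      and \<beta>\<alpha>: "\<And>A. A \<in> Ob X \<Longrightarrow> \<beta> (A, Idt X A) = \<alpha> A"
      by (rule restriction_trans_extend_K_r[OF assms(2,4) restriction_functor_FL[OF F(1)] restriction_functor_FL[OF G(1)] \<alpha>]) (rule that)
    obtain \<gamma> where \<gamma>: "is_restriction_trans Y E F G \<gamma>" and \<gamma>\<beta>: "\<And>D. D \<in> Ob ?K \<Longrightarrow> \<gamma> (y D) = \<beta> D"
      by (rule trans_extend_from_L[OF F G(1) \<beta>]) (rule that)
    have "(\<lambda>A\<in>Ob X. \<gamma> (FO ?\<Lambda> A)) = \<alpha>"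
      using \<gamma>\<beta>[OF JK] \<beta>\<alpha> restriction_transD(4)[OF \<alpha>] by (auto simp: fun_eq_iff \<Lambda>0 extensional_def)
    then show "\<exists>\<gamma>\<in>Hom ?A F G. FA (precomp ?A X ?\<Lambda>) F G \<gamma> = \<alpha>"
      using \<gamma> F G by (intro bexI[of _ \<gamma>]) (simp_all add: precomp_def)
  next
    fix F G \<beta> \<beta>' assume "F \<in> Ob ?A" "G \<in> Ob ?A" "\<beta> \<in> Hom ?A F G" "\<beta>' \<in> Hom ?A F G"
      and eq: "FA (precomp ?A X ?\<Lambda>) F G \<beta> = FA (precomp ?A X ?\<Lambda>) F G \<beta>'"
    then have F: "is_restriction_functor Y E F" "cocontinuous U Y E F"
      and G: "is_restriction_functor Y E G" "cocontinuous U Y E G"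
      and \<beta>: "is_restriction_trans Y E F G \<beta>" and \<beta>': "is_restriction_trans Y E F G \<beta>'"
      by simp_all
    have eq\<Lambda>: "(\<lambda>A\<in>Ob X. \<beta> (FO ?\<Lambda> A)) = (\<lambda>A\<in>Ob X. \<beta>' (FO ?\<Lambda> A))"
      using eq F G \<beta> \<beta>' by (simp add: precomp_def)
    have eqX: "\<beta> (y (A, Idt X A)) = \<beta>' (y (A, Idt X A))" if "A \<in> Ob X" for A
      using fun_cong[OF eq\<Lambda>, of A] that by (simp add: \<Lambda>0)
    have eqK: "(\<lambda>D\<in>Ob ?K. \<beta> (y D)) = (\<lambda>D\<in>Ob ?K. \<beta>' (y D))"
      by (rule restriction_trans_K_r_eqI[OF assms(2,4) restriction_functor_FL[OF F(1)] restriction_functor_FL[OF G(1)]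
            whisker[OF F(1) G(1) \<beta>] whisker[OF F(1) G(1) \<beta>']])
        (use eqX JK in simp)
    have "\<beta> (y D) = \<beta>' (y D)" if "D \<in> Ob ?K" for D
      using fun_cong[OF eqK, of D] that by simp
    then show "\<beta> = \<beta>'"
      by (rule trans_eqI_on_y[OF F G(1) \<beta> \<beta>'])
  next
    fix H0 assume "H0 \<in> Ob (rCAT X E)"
    then have H0: "is_restriction_functor X E H0" by simp
    obtain H where H: "is_restriction_functor ?K E H" and HJ: "comp_ftor X H ?J = H0"
      by (rule restriction_functor_extend_K_r[OF assms(2,4) splitE H0]) (rule that)
    obtain F \<theta> where F: "is_restriction_functor Y E F" "cocontinuous U Y E F"
      and \<theta>: "is_restriction_trans ?K E (comp_ftor ?K F L) H \<theta>"
      and iso: "\<And>D. D \<in> Ob ?K \<Longrightarrow> is_iso E (FO (comp_ftor ?K F L) D) (FO H D) (\<theta> D)"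
      by (rule extension_exists[OF H]) (rule that)
    note t = restriction_transD[OF \<theta>]
    have FJ: "is_restriction_functor X E (comp_ftor X (comp_ftor ?K F L) ?J)"
      by (rule restriction_functor_comp[OF assms(2) J restriction_functor_FL[OF F(1)]])
    let ?\<theta> = "\<lambda>A\<in>Ob X. \<theta> (A, Idt X A)"
    have "is_restriction_trans X E (comp_ftor X (comp_ftor ?K F L) ?J) (comp_ftor X H ?J) ?\<theta>"
    proof (rule restriction_transI)
      fix A assume A: "A \<in> Ob X"
      show "is_total E (FO (comp_ftor X (comp_ftor ?K F L) ?J) A) (FO (comp_ftor X H ?J) A) (?\<theta> A)"
        using t(1)[OF JK[OF A]] A by simp
      fix B f assume B: "B \<in> Ob X" "f \<in> Hom X A B"
      have "f \<in> Hom ?K (A, Idt X A) (B, Idt X B)" using J'(3)[OF A B] A B by simp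
      from t(3)[OF JK[OF A] JK[OF B(1)] this] A B
      show "Comp E (FO (comp_ftor X (comp_ftor ?K F L) ?J) A) (FO (comp_ftor X (comp_ftor ?K F L) ?J) B) (FO (comp_ftor X H ?J) B)
          (?\<theta> B) (FA (comp_ftor X (comp_ftor ?K F L) ?J) A B f)
        = Comp E (FO (comp_ftor X (comp_ftor ?K F L) ?J) A) (FO (comp_ftor X H ?J) A) (FO (comp_ftor X H ?J) B)
          (FA (comp_ftor X H ?J) A B f) (?\<theta> A)"
        by simp
    qed simp
    then have "is_iso (rCAT X E) (comp_ftor X (comp_ftor ?K F L) ?J) H0 ?\<theta>"
      unfolding HJ using iso JK by (intro rCAT_iso[OF assms(4) FJ H0]) (auto simp: HJ[symmetric])
    then show "\<exists>F\<in>Ob ?A. \<exists>i. is_iso (rCAT X E) (FO (precomp ?A X ?\<Lambda>) F) H0 i"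
      using F by (intro bexI[of _ F] exI[of _ ?\<theta>]) (simp_all add: precomp_def \<Lambda>J)
  qed
qed

end
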